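(* Let $k$ be a commutative ring with $\frac12\in k$ and let $(A,1,\mu+\mu_{\mathrm{su}})$ be an $A_\infty$-algebra with split unit, where $\mu\in CC^\bullet(\overline A,A)_{-1}$. The reduced Hochschild cochains $(CC^\bullet(\overline A,A),[\mu+\mu_{\mathrm{su}},-])$ control the infinitesimal strictly unital deformation functor of $(A,1,\mu+\mu_{\mathrm{su}})$; precisely, the natural transformation of functors on $\mathrm{finComAlg}^{\mathrm{aug}}_k$ $$\mathrm{MC}_{(CC^\bullet(\overline A,A),[\mu+\mu_{\mathrm{su}},-])}\to\mathrm{infDef}^{\,\mathrm{su}}_{(A,1,\mu+\mu_{\mathrm{su}})},\qquad\widetilde\mu\mapsto\theta_l(\widetilde\mu+\mu\otimes1+\mu_{\mathrm{su}}\otimes1)$$ (for $\widetilde\mu$ in the value at $(l,\epsilon)$) is an isomorphism of functors.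
   Context: Conventions: modules, maps, tensor products are over $k$ unless indicated; graded means $\mathbb Z$-graded. $\mathrm{Hom}(M,N)_n=\prod_i\mathrm{Hom}(M_i,N_{i+n})$. $(\Pi M)_n=M_{n-1}$, $s:M\to\Pi M$ is the degree $1$ identity map, $[x]=s(x)$, $[x_1|\dots|x_n]=[x_1]\otimes\dots\otimes[x_n]$. Koszul sign rule: $(f\otimes g)(x\otimes y)=(-1)^{|g||x|}f(x)\otimes g(y)$. $CC^n(A,B)=\mathrm{Hom}((\Pi A)^{\otimes n},\Pi B)$, $CC^\bullet(A,B)=\prod_{n\ge1}CC^n(A,B)$, $f=(f^n)$; $CC^\bullet(A,B)_i$ is the degree $i$ part. For a commutative $k$-algebra $l$, $CC_l^\bullet$ denotes the same construction over $l$. Gerstenhaber product: $(g\circ f)^n=\sum_{i=1}^n\sum_{j=0}^{i-1}g^i(1^{\otimes j}\otimes f^{n-i+1}\otimes1^{\otimes i-j-1})$; bracket $[f,g]=f\circ g-(-1)^{|f||g|}g\circ f$. An $A_\infty$-structure on $A$ is $\nu\in CC^\bullet(A,A)_{-1}$ with $\nu\circ\nu=0$. A graded module with split element is $(A,1)$, where $1\in A_0$ generates a free rank one submodule, together with a fixed graded splitting $A\to k$ of $k\to A$, $1\mapsto 1$; $\overline A=A/(k\cdot1)\subseteq A$. $CC^\bullet(\overline A,A)\subseteq CC^\bullet(A,A)$ via $A\to\overline A$ (extension by zero to tensors with an entry $[1]$). $\mu_{\mathrm{su}}\in CC^\bullet(A,A)_{-1}$ has $\mu_{\mathrm{su}}^n=0$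 for $n\ne2$, $\mu_{\mathrm{su}}^2[1|a]=[a]$, $\mu_{\mathrm{su}}^2[a|1]=(-1)^{|a|}[a]$ for $a\in A$, and $\mu_{\mathrm{su}}^2=0$ on $\Pi\overline A\otimes\Pi\overline A$. $\nu\in CC^\bullet(A,A)_{-1}$ is strictly unital if $\nu^2[1|a]=[a]=(-1)^{|a|}\nu^2[a|1]$ and $\nu^n$, $n\ne2$, vanishes whenever an entry is $1$; these are exactly the elements $\mu+\mu_{\mathrm{su}}$ with $\mu\in CC^\bullet(\overline A,A)_{-1}$. An $A_\infty$-algebra with split unit $(A,1,\nu)$ is a module with split element with a strictly unital $A_\infty$-structure $\nu$. The reduced Hochschild cochains of $(A,1,\mu+\mu_{\mathrm{su}})$ is the dg-Lie algebra $(CC^\bullet(\overline A,A),[\mu+\mu_{\mathrm{su}},-])$ (the subalgebra is preserved by this derivation). $\mathrm{finComAlg}^{\mathrm{aug}}_k$ is the category of pairs $(l,\epsilon)$, with $l$ a commutative $k$-algebra that is a finitely generated projective $k$-module and $\epsilon:l\to k$ a $k$-algebra map with $(\ker\epsilon)^N=0$ for some $N\ge1$; morphisms are $k$-algebra maps commuting with augmentations. For a dg-Lie algebra $(L,\delta)$, the functor $\mathrm{MC}_{(L,\delta)}:\mathrm{finComAlg}^{\mathrm{aug}}_k\to\mathrm{Set}$ sends $(l,\epsilon)$ to $\{v\in(L\otimes\overline l)_{-1}:(\delta\otimes1)(v)+\frac12[v,v]=0\}$, where $\overline l=\ker\epsilon$ and $[v\otimes x,v'\otimes x']=[v,v']\otimes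 xx'$. A functor $F:\mathrm{finComAlg}^{\mathrm{aug}}_k\to\mathrm{Set}$ is controlled by $(L,\delta)$ if there is an isomorphism of functors $\mathrm{MC}_{(L,\delta)}\cong F$. $\mathrm{infDef}^{\,\mathrm{su}}_{(A,1,\nu)}(l,\epsilon)$ is the set of strictly unital $(l,\epsilon)$-deformations of $(A,1,\nu)$: $l$-linear $A_\infty$-structures $\boldsymbol\nu\in CC^\bullet_l(A\otimes l,A\otimes l)_{-1}$ on $A\otimes l$, strictly unital with respect to $1\otimes1$ (with the induced splitting $A\otimes l\to l$), whose base change along $\epsilon$ is $\nu$ (that is, under $CC^\bullet_l(A\otimes l,A\otimes l)\cong CC^\bullet(A,A\otimes l)$, composing with $1\otimes\epsilon:A\otimes l\to A$ gives $\nu$). It is a functor via base change. The map $\theta_l:CC^\bullet(A,A)\otimes l\to CC^\bullet_l(A\otimes l,A\otimes l)$ sends $(\nu^n)\otimes y$ to the family $[a_1\otimes x_1|\dots|a_n\otimes x_n]\mapsto\nu^n[a_1|\dots|a_n]\otimes yx_1\cdots x_n$. *)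

theory Defs
  imports "HOL-Algebra.Module" "HOL-Algebra.Ideal_Product"
begin

section \<open>Modules over a commutative ring\<close>

text \<open>
  All modules use the record type of HOL-Algebra.  Its fields for a ring multiplication and a unit
  play no role for a module and are left undefined.  Linear maps are extensional functions, so that
  equality of maps is equality of functions.
\<close>

definition mod_hom ::
  "('r,'z) ring_scheme \<Rightarrow> ('r,'m) module \<Rightarrow> ('r,'n) module \<Rightarrow> ('m \<Rightarrow> 'n) set" where
  "mod_hom R M N = {h \<in> carrier M \<rightarrow>\<^sub>E carrier N.
     (\<forall>x\<in>carrier M. \<forall>y\<in>carrier M. h (x \<oplus>\<^bsub>M\<^esub> y) = h x \<oplus>\<^bsub>N\<^esub> h y) \<and>
     (\<forall>r\<in>carrier R. \<forall>x\<in>carrier M. h (r \<odot>\<^bsub>M\<^esub> x) = r \<odot>\<^bsub>N\<^esub> h x)}"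

definition hom_module ::
  "('r,'z) ring_scheme \<Rightarrow> ('r,'m) module \<Rightarrow> ('r,'n) module \<Rightarrow> ('r, 'm \<Rightarrow> 'n) module" where
  "hom_module R M N =
     \<lparr>carrier = mod_hom R M N, monoid.mult = undefined, monoid.one = undefined,
      ring.zero = (\<lambda>x\<in>carrier M. \<zero>\<^bsub>N\<^esub>),
      ring.add = (\<lambda>f g. \<lambda>x\<in>carrier M. f x \<oplus>\<^bsub>N\<^esub> g x),
      smult = (\<lambda>r f. \<lambda>x\<in>carrier M. r \<odot>\<^bsub>N\<^esub> f x)\<rparr>"

definition prod_module :: "'i set \<Rightarrow> ('i \<Rightarrow> ('r,'m) module) \<Rightarrow> ('r, 'i \<Rightarrow> 'm) module" where
  "prod_module I M =
     \<lparr>carrier = (\<Pi>\<^sub>E i\<in>I. carrier (M i)), monoid.mult = undefined, monoid.one = undefined,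
      ring.zero = (\<lambda>i\<in>I. \<zero>\<^bsub>M i\<^esub>),
      ring.add = (\<lambda>f g. \<lambda>i\<in>I. f i \<oplus>\<^bsub>M i\<^esub> g i),
      smult = (\<lambda>r f. \<lambda>i\<in>I. r \<odot>\<^bsub>M i\<^esub> f i)\<rparr>"

definition free_module :: "('r,'z) ring_scheme \<Rightarrow> 'x set \<Rightarrow> ('r, 'x \<Rightarrow> 'r) module" where
  "free_module R X =
     \<lparr>carrier = {c \<in> X \<rightarrow>\<^sub>E carrier R. finite {x \<in> X. c x \<noteq> \<zero>\<^bsub>R\<^esub>}},
      monoid.mult = undefined, monoid.one = undefined,
      ring.zero = (\<lambda>x\<in>X. \<zero>\<^bsub>R\<^esub>),
      ring.add = (\<lambda>c d. \<lambda>x\<in>X. c x \<oplus>\<^bsub>R\<^esub> d x),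
      smult = (\<lambda>r c. \<lambda>x\<in>X. r \<otimes>\<^bsub>R\<^esub> c x)\<rparr>"

definition free_gen :: "('r,'z) ring_scheme \<Rightarrow> 'x set \<Rightarrow> 'x \<Rightarrow> ('x \<Rightarrow> 'r)" where
  "free_gen R X x = (\<lambda>y\<in>X. if y = x then \<one>\<^bsub>R\<^esub> else \<zero>\<^bsub>R\<^esub>)"

definition mspan :: "('r,'z) ring_scheme \<Rightarrow> ('r,'m) module \<Rightarrow> 'm set \<Rightarrow> 'm set" where
  "mspan R M S = \<Inter>{N. submodule N R M \<and> S \<subseteq> N}"

definition quot_module :: "('r,'m) module \<Rightarrow> 'm set \<Rightarrow> ('r, 'm set) module" where
  "quot_module M N =
     \<lparr>carrier = a_rcosets\<^bsub>M\<^esub> N, monoid.mult = undefined, monoid.one = undefined,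
      ring.zero = N,
      ring.add = (\<lambda>X Y. X <+>\<^bsub>M\<^esub> Y),
      smult = (\<lambda>r X. \<Union>x\<in>X. N +>\<^bsub>M\<^esub> (r \<odot>\<^bsub>M\<^esub> x))\<rparr>"

definition res_scal :: "('k,'l) module \<Rightarrow> ('l,'m) module \<Rightarrow> ('k,'m) module" where
  "res_scal l M =
     \<lparr>carrier = carrier M, monoid.mult = undefined, monoid.one = undefined,
      ring.zero = ring.zero M, ring.add = ring.add M,
      smult = (\<lambda>r x. (r \<odot>\<^bsub>l\<^esub> \<one>\<^bsub>l\<^esub>) \<odot>\<^bsub>M\<^esub> x)\<rparr>"

definition fin_gen :: "('r,'z) ring_scheme \<Rightarrow> ('r,'m) module \<Rightarrow> bool" where
  "fin_gen R M \<longleftrightarrow> (\<exists>S. finite S \<and> S \<subseteq> carrier M \<and> mspan R M S = carrier M)"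

text \<open>
  A module is projective if it is a direct summand (retract) of a free module.  Taking the basis
  inside the type of elements of the module is no restriction, since the free module on the
  underlying set of a projective module always works.
\<close>

definition projective :: "('r,'z) ring_scheme \<Rightarrow> ('r,'m) module \<Rightarrow> bool" where
  "projective R M \<longleftrightarrow> (\<exists>X::'m set. \<exists>i\<in>mod_hom R M (free_module R X).
     \<exists>p\<in>mod_hom R (free_module R X) M. \<forall>x\<in>carrier M. p (i x) = x)"


section \<open>Tensor products\<close>

definition tensor_rels ::
  "('r,'z) ring_scheme \<Rightarrow> ('r,'m) module \<Rightarrow> ('r,'n) module \<Rightarrow> ('m \<times> 'n \<Rightarrow> 'r) set" where
  "tensor_rels R M N =
     (let F = free_module R (carrier M \<times> carrier N);
          g = (\<lambda>x y. free_gen R (carrier M \<times> carrier N) (x, y))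
      in {g (x \<oplus>\<^bsub>M\<^esub> x') y \<ominus>\<^bsub>F\<^esub> (g x y \<oplus>\<^bsub>F\<^esub> g x' y) | x x' y.
            x \<in> carrier M \<and> x' \<in> carrier M \<and> y \<in> carrier N} \<union>
         {g x (y \<oplus>\<^bsub>N\<^esub> y') \<ominus>\<^bsub>F\<^esub> (g x y \<oplus>\<^bsub>F\<^esub> g x y') | x y y'.
            x \<in> carrier M \<and> y \<in> carrier N \<and> y' \<in> carrier N} \<union>
         {g (r \<odot>\<^bsub>M\<^esub> x) y \<ominus>\<^bsub>F\<^esub> (r \<odot>\<^bsub>F\<^esub> g x y) | r x y.
            r \<in> carrier R \<and> x \<in> carrier M \<and> y \<in> carrier N} \<union>
         {g x (r \<odot>\<^bsub>N\<^esub> y) \<ominus>\<^bsub>F\<^esub> (r \<odot>\<^bsub>F\<^esub> g x y) | r x y.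
            r \<in> carrier R \<and> x \<in> carrier M \<and> y \<in> carrier N})"

definition tensor ::
  "('r,'z) ring_scheme \<Rightarrow> ('r,'m) module \<Rightarrow> ('r,'n) module \<Rightarrow> ('r, ('m \<times> 'n \<Rightarrow> 'r) set) module"
  where
  "tensor R M N = quot_module (free_module R (carrier M \<times> carrier N))
     (mspan R (free_module R (carrier M \<times> carrier N)) (tensor_rels R M N))"

definition tens ::
  "('r,'z) ring_scheme \<Rightarrow> ('r,'m) module \<Rightarrow> ('r,'n) module \<Rightarrow> 'm \<Rightarrow> 'n \<Rightarrow> ('m \<times> 'n \<Rightarrow> 'r) set" where
  "tens R M N x y = mspan R (free_module R (carrier M \<times> carrier N)) (tensor_rels R M N)
     +>\<^bsub>free_module R (carrier M \<times> carrier N)\<^esub> free_gen R (carrier M \<times> carrier N) (x, y)"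

definition tmap ::
  "('r,'z) ring_scheme \<Rightarrow> ('r,'m) module \<Rightarrow> ('r,'n) module \<Rightarrow> ('r,'m2) module \<Rightarrow> ('r,'n2) module \<Rightarrow>
   ('m \<Rightarrow> 'm2) \<Rightarrow> ('n \<Rightarrow> 'n2) \<Rightarrow> ('m \<times> 'n \<Rightarrow> 'r) set \<Rightarrow> ('m2 \<times> 'n2 \<Rightarrow> 'r) set" where
  "tmap R M N M' N' f g = (THE h. h \<in> mod_hom R (tensor R M N) (tensor R M' N') \<and>
     (\<forall>x\<in>carrier M. \<forall>y\<in>carrier N. h (tens R M N x y) = tens R M' N' (f x) (g y)))"

text \<open>
  A graded module is a family of modules indexed by the integers.  A word is a list of homogeneous
  elements, each paired with its degree.  The degree m part of the n-fold tensor power of M is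
  the direct sum, over all degrees adding up to m, of the tensor products of the corresponding
  components.  It is presented by the words of length n and total degree m, subject to linearity
  in each entry.
\<close>

definition wdeg :: "(int \<times> 'm) list \<Rightarrow> int" where
  "wdeg w = sum_list (map fst w)"

definition words :: "(int \<Rightarrow> ('r,'m) module) \<Rightarrow> nat \<Rightarrow> int \<Rightarrow> (int \<times> 'm) list set" where
  "words M n m = {w. length w = n \<and> (\<forall>(i, x)\<in>set w. x \<in> carrier (M i)) \<and> wdeg w = m}"

definition tpow_rels ::
  "('r,'z) ring_scheme \<Rightarrow> (int \<Rightarrow> ('r,'m) module) \<Rightarrow> nat \<Rightarrow> int \<Rightarrow> ((int \<times> 'm) list \<Rightarrow> 'r) set" where
  "tpow_rels R M n m =
     (let F = free_module R (words M n m); g = free_gen R (words M n m)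
      in {g (u @ (i, x \<oplus>\<^bsub>M i\<^esub> y) # v) \<ominus>\<^bsub>F\<^esub> (g (u @ (i, x) # v) \<oplus>\<^bsub>F\<^esub> g (u @ (i, y) # v)) | u v i x y.
            u @ (i, x) # v \<in> words M n m \<and> y \<in> carrier (M i)} \<union>
         {g (u @ (i, r \<odot>\<^bsub>M i\<^esub> x) # v) \<ominus>\<^bsub>F\<^esub> (r \<odot>\<^bsub>F\<^esub> g (u @ (i, x) # v)) | u v i r x.
            u @ (i, x) # v \<in> words M n m \<and> r \<in> carrier R})"

definition tpow ::
  "('r,'z) ring_scheme \<Rightarrow> (int \<Rightarrow> ('r,'m) module) \<Rightarrow> nat \<Rightarrow> int \<Rightarrow>
   ('r, ((int \<times> 'm) list \<Rightarrow> 'r) set) module" where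
  "tpow R M n m = quot_module (free_module R (words M n m))
     (mspan R (free_module R (words M n m)) (tpow_rels R M n m))"

definition pure ::
  "('r,'z) ring_scheme \<Rightarrow> (int \<Rightarrow> ('r,'m) module) \<Rightarrow> (int \<times> 'm) list \<Rightarrow> ((int \<times> 'm) list \<Rightarrow> 'r) set"
  where
  "pure R M w =
     mspan R (free_module R (words M (length w) (wdeg w))) (tpow_rels R M (length w) (wdeg w))
       +>\<^bsub>free_module R (words M (length w) (wdeg w))\<^esub>
     free_gen R (words M (length w) (wdeg w)) w"


section \<open>Hochschild cochains\<close>

definition susp :: "(int \<Rightarrow> ('r,'m) module) \<Rightarrow> int \<Rightarrow> ('r,'m) module" where
  "susp M = (\<lambda>n. M (n - 1))"

definition ghom ::
  "('r,'z) ring_scheme \<Rightarrow> (int \<Rightarrow> ('r,'m) module) \<Rightarrow> (int \<Rightarrow> ('r,'n) module) \<Rightarrow> int \<Rightarrow>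
   ('r, int \<Rightarrow> 'm \<Rightarrow> 'n) module" where
  "ghom R M N d = prod_module UNIV (\<lambda>i. hom_module R (M i) (N (i + d)))"

type_synonym ('r, 'a, 'b) cochain = "nat \<Rightarrow> int \<Rightarrow> ((int \<times> 'a) list \<Rightarrow> 'r) set \<Rightarrow> 'b"

definition CCn ::
  "('r,'z) ring_scheme \<Rightarrow> (int \<Rightarrow> ('r,'a) module) \<Rightarrow> (int \<Rightarrow> ('r,'b) module) \<Rightarrow> nat \<Rightarrow> int \<Rightarrow>
   ('r, int \<Rightarrow> ((int \<times> 'a) list \<Rightarrow> 'r) set \<Rightarrow> 'b) module" where
  "CCn R A B n d = ghom R (tpow R (susp A) n) (susp B) d"

definition CC ::
  "('r,'z) ring_scheme \<Rightarrow> (int \<Rightarrow> ('r,'a) module) \<Rightarrow> (int \<Rightarrow> ('r,'b) module) \<Rightarrow> int \<Rightarrow>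
   ('r, ('r,'a,'b) cochain) module" where
  "CC R A B d = prod_module {1..} (\<lambda>n. CCn R A B n d)"

text \<open>
  The value of a cochain on a word in the suspension of A.  The entry [a] of the word is written
  (i + 1, a) for a of degree i in A, since the degree 1 map s is the identity on elements.
  The value of a cochain of degree d on w lies in degree wdeg w + d of the suspension.
\<close>

definition ev ::
  "('r,'z) ring_scheme \<Rightarrow> (int \<Rightarrow> ('r,'a) module) \<Rightarrow> ('r,'a,'b) cochain \<Rightarrow> (int \<times> 'a) list \<Rightarrow> 'b" where
  "ev R A f w = f (length w) (wdeg w) (pure R (susp A) w)"

definition ksign :: "('r,'m) module \<Rightarrow> int \<Rightarrow> 'm \<Rightarrow> 'm" where
  "ksign M e x = (if even e then x else \<ominus>\<^bsub>M\<^esub> x)"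

text \<open>
  The degree m component of the tensor product of j identities, the component of arity p of a
  cochain f of degree d, and q identities.  The sign is the Koszul sign for moving f past the
  first j entries.
\<close>

definition insert_map ::
  "('r,'z) ring_scheme \<Rightarrow> (int \<Rightarrow> ('r,'a) module) \<Rightarrow> int \<Rightarrow> ('r,'a,'a) cochain \<Rightarrow>
   nat \<Rightarrow> nat \<Rightarrow> nat \<Rightarrow> int \<Rightarrow> ((int \<times> 'a) list \<Rightarrow> 'r) set \<Rightarrow> ((int \<times> 'a) list \<Rightarrow> 'r) set" where
  "insert_map R A d f j p q m =
     (THE h. h \<in> mod_hom R (tpow R (susp A) (j + p + q) m) (tpow R (susp A) (j + 1 + q) (m + d)) \<and>
        (\<forall>u w v. length u = j \<longrightarrow> length w = p \<longrightarrow> length v = q \<longrightarrow>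
           u @ w @ v \<in> words (susp A) (j + p + q) m \<longrightarrow>
           h (pure R (susp A) (u @ w @ v)) =
             ksign (tpow R (susp A) (j + 1 + q) (m + d)) (d * wdeg u)
               (pure R (susp A) (u @ [(wdeg w + d, ev R A f w)] @ v))))"

text \<open>The Gerstenhaber product of g of degree e with f of degree d.\<close>

definition gerst ::
  "('r,'z) ring_scheme \<Rightarrow> (int \<Rightarrow> ('r,'a) module) \<Rightarrow> int \<Rightarrow> int \<Rightarrow>
   ('r,'a,'a) cochain \<Rightarrow> ('r,'a,'a) cochain \<Rightarrow> ('r,'a,'a) cochain" where
  "gerst R A e d g f = (\<lambda>n\<in>{1..}. \<lambda>m.
     finsum (hom_module R (tpow R (susp A) n m) (susp A (m + (e + d))))
       (\<lambda>(i, j). compose (carrier (tpow R (susp A) n m))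
          (g i (m + d)) (insert_map R A d f j (n - i + 1) (i - j - 1) m))
       (SIGMA i:{1..n}. {0..i - 1}))"

definition gbracket ::
  "('r,'z) ring_scheme \<Rightarrow> (int \<Rightarrow> ('r,'a) module) \<Rightarrow> int \<Rightarrow> int \<Rightarrow>
   ('r,'a,'a) cochain \<Rightarrow> ('r,'a,'a) cochain \<Rightarrow> ('r,'a,'a) cochain" where
  "gbracket R A d e f g =
     gerst R A d e f g \<ominus>\<^bsub>CC R A A (d + e)\<^esub> ksign (CC R A A (d + e)) (d * e) (gerst R A e d g f)"

definition A_infinity ::
  "('r,'z) ring_scheme \<Rightarrow> (int \<Rightarrow> ('r,'a) module) \<Rightarrow> ('r,'a,'a) cochain \<Rightarrow> bool" where
  "A_infinity R A \<nu> \<longleftrightarrow>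
     \<nu> \<in> carrier (CC R A A (-1)) \<and> gerst R A (-1) (-1) \<nu> \<nu> = \<zero>\<^bsub>CC R A A (-2)\<^esub>"


section \<open>Split units and reduced cochains\<close>

definition self_alg :: "('k,'z) ring_scheme \<Rightarrow> ('k,'k) module" where
  "self_alg k = \<lparr>carrier = carrier k, monoid.mult = monoid.mult k, monoid.one = monoid.one k,
     ring.zero = ring.zero k, ring.add = ring.add k, smult = monoid.mult k\<rparr>"

text \<open>
  The base ring sits in degree 0, so a graded splitting is given by its component sp in degree 0.
\<close>

definition split_element ::
  "('k,'z) ring_scheme \<Rightarrow> (int \<Rightarrow> ('k,'a) module) \<Rightarrow> 'a \<Rightarrow> ('a \<Rightarrow> 'k) \<Rightarrow> bool" where
  "split_element k A e sp \<longleftrightarrow>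
     (\<forall>i. module k (A i)) \<and> e \<in> carrier (A 0) \<and>
     (\<forall>r\<in>carrier k. r \<odot>\<^bsub>A 0\<^esub> e = \<zero>\<^bsub>A 0\<^esub> \<longrightarrow> r = \<zero>\<^bsub>k\<^esub>) \<and>
     sp \<in> mod_hom k (A 0) (self_alg k) \<and> sp e = \<one>\<^bsub>k\<^esub>"

text \<open>
  The quotient of A by the span of the unit e, realised inside A by means of the splitting, and
  the projection of A onto it.
\<close>

definition bar_mod ::
  "('k,'z) ring_scheme \<Rightarrow> (int \<Rightarrow> ('k,'a) module) \<Rightarrow> ('a \<Rightarrow> 'k) \<Rightarrow> int \<Rightarrow> ('k,'a) module" where
  "bar_mod k A sp i =
     (if i = 0 then (A 0)\<lparr>carrier := {a \<in> carrier (A 0). sp a = \<zero>\<^bsub>k\<^esub>}\<rparr> else A i)"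

definition bar_proj ::
  "(int \<Rightarrow> ('k,'a) module) \<Rightarrow> 'a \<Rightarrow> ('a \<Rightarrow> 'k) \<Rightarrow> int \<Rightarrow> 'a \<Rightarrow> 'a" where
  "bar_proj A e sp i a = (if i = 0 then a \<ominus>\<^bsub>A 0\<^esub> (sp a \<odot>\<^bsub>A 0\<^esub> e) else a)"

definition bar_proj_pow ::
  "('k,'z) ring_scheme \<Rightarrow> (int \<Rightarrow> ('k,'a) module) \<Rightarrow> 'a \<Rightarrow> ('a \<Rightarrow> 'k) \<Rightarrow> nat \<Rightarrow> int \<Rightarrow>
   ((int \<times> 'a) list \<Rightarrow> 'k) set \<Rightarrow> ((int \<times> 'a) list \<Rightarrow> 'k) set" where
  "bar_proj_pow k A e sp n m =
     (THE h. h \<in> mod_hom k (tpow k (susp A) n m) (tpow k (susp (bar_mod k A sp)) n m) \<and>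
        (\<forall>w\<in>words (susp A) n m. h (pure k (susp A) w) =
           pure k (susp (bar_mod k A sp)) (map (\<lambda>(i, a). (i, bar_proj A e sp (i - 1) a)) w)))"

definition bar_incl ::
  "('k,'z) ring_scheme \<Rightarrow> (int \<Rightarrow> ('k,'a) module) \<Rightarrow> 'a \<Rightarrow> ('a \<Rightarrow> 'k) \<Rightarrow>
   ('k,'a,'a) cochain \<Rightarrow> ('k,'a,'a) cochain" where
  "bar_incl k A e sp f = (\<lambda>n\<in>{1..}. \<lambda>m.
     compose (carrier (tpow k (susp A) n m)) (f n m) (bar_proj_pow k A e sp n m))"

text \<open>Cochains on the quotient, as a submodule of the cochains on A.\<close>

definition CC_red ::
  "('k,'z) ring_scheme \<Rightarrow> (int \<Rightarrow> ('k,'a) module) \<Rightarrow> 'a \<Rightarrow> ('a \<Rightarrow> 'k) \<Rightarrow> int \<Rightarrow>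
   ('k, ('k,'a,'a) cochain) module" where
  "CC_red k A e sp d =
     (CC k A A d)\<lparr>carrier := bar_incl k A e sp ` carrier (CC k (bar_mod k A sp) A d)\<rparr>"

definition mu_su ::
  "('k,'z) ring_scheme \<Rightarrow> (int \<Rightarrow> ('k,'a) module) \<Rightarrow> 'a \<Rightarrow> ('a \<Rightarrow> 'k) \<Rightarrow> ('k,'a,'a) cochain" where
  "mu_su k A e sp = (THE \<nu>. \<nu> \<in> carrier (CC k A A (-1)) \<and>
     (\<forall>n\<ge>1. n \<noteq> 2 \<longrightarrow> \<nu> n = \<zero>\<^bsub>CCn k A A n (-1)\<^esub>) \<and>
     (\<forall>i. \<forall>a\<in>carrier (A i). ev k A \<nu> [(1, e), (i + 1, a)] = a) \<and>
     (\<forall>i. \<forall>a\<in>carrier (A i). ev k A \<nu> [(i + 1, a), (1, e)] = ksign (A i) i a) \<and>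
     (\<forall>i j. \<forall>a\<in>carrier (bar_mod k A sp i). \<forall>b\<in>carrier (bar_mod k A sp j).
        ev k A \<nu> [(i + 1, a), (j + 1, b)] = \<zero>\<^bsub>A (i + j)\<^esub>))"

definition strictly_unital ::
  "('r,'z) ring_scheme \<Rightarrow> (int \<Rightarrow> ('r,'a) module) \<Rightarrow> 'a \<Rightarrow> ('r,'a,'a) cochain \<Rightarrow> bool" where
  "strictly_unital R A e \<nu> \<longleftrightarrow>
     \<nu> \<in> carrier (CC R A A (-1)) \<and>
     (\<forall>i. \<forall>a\<in>carrier (A i). ev R A \<nu> [(1, e), (i + 1, a)] = a \<and>
        a = ksign (A i) i (ev R A \<nu> [(i + 1, a), (1, e)])) \<and>
     (\<forall>n\<ge>1. n \<noteq> 2 \<longrightarrow> (\<forall>m. \<forall>w\<in>words (susp A) n m. (1, e) \<in> set w \<longrightarrow>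
        ev R A \<nu> w = \<zero>\<^bsub>susp A (m - 1)\<^esub>))"

definition A_infinity_split_unit ::
  "('k,'z) ring_scheme \<Rightarrow> (int \<Rightarrow> ('k,'a) module) \<Rightarrow> 'a \<Rightarrow> ('a \<Rightarrow> 'k) \<Rightarrow> ('k,'a,'a) cochain \<Rightarrow> bool"
  where
  "A_infinity_split_unit k A e sp \<nu> \<longleftrightarrow>
     split_element k A e sp \<and> A_infinity k A \<nu> \<and> strictly_unital k A e \<nu>"


section \<open>Augmented algebras and set-valued functors\<close>

type_synonym ('k, 'l) aug = "('k, 'l) module \<times> ('l \<Rightarrow> 'k)"

definition alg_hom ::
  "('k,'z) ring_scheme \<Rightarrow> ('k,'l) module \<Rightarrow> ('k,'m) module \<Rightarrow> ('l \<Rightarrow> 'm) set" where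
  "alg_hom k l l' = mod_hom k l l' \<inter> ring_hom l l'"

definition aug_ker :: "('k,'z) ring_scheme \<Rightarrow> ('k,'l) aug \<Rightarrow> ('k,'l) module" where
  "aug_ker k X = (fst X)\<lparr>carrier := {x \<in> carrier (fst X). snd X x = \<zero>\<^bsub>k\<^esub>}\<rparr>"

definition aug_obj :: "('k,'z) ring_scheme \<Rightarrow> ('k,'l) aug set" where
  "aug_obj k = {X. algebra k (fst X) \<and> fin_gen k (fst X) \<and> projective k (fst X) \<and>
     snd X \<in> alg_hom k (fst X) (self_alg k) \<and>
     (\<exists>N\<ge>1. carrier (aug_ker k X) [^]\<^bsub>ideals_set (fst X)\<^esub> (N::nat) = {\<zero>\<^bsub>fst X\<^esub>})}"

definition aug_hom ::
  "('k,'z) ring_scheme \<Rightarrow> ('k,'l) aug \<Rightarrow> ('k,'l) aug \<Rightarrow> ('l \<Rightarrow> 'l) set" where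
  "aug_hom k X Y = {\<phi> \<in> alg_hom k (fst X) (fst Y). \<forall>x\<in>carrier (fst X). snd Y (\<phi> x) = snd X x}"

text \<open>A functor to sets is given by its values Fo on objects and Fm on morphisms.\<close>

definition set_functor ::
  "('k,'z) ring_scheme \<Rightarrow> (('k,'l) aug \<Rightarrow> 'x set) \<Rightarrow>
   (('k,'l) aug \<Rightarrow> ('k,'l) aug \<Rightarrow> ('l \<Rightarrow> 'l) \<Rightarrow> 'x \<Rightarrow> 'x) \<Rightarrow> bool" where
  "set_functor k Fo Fm \<longleftrightarrow>
     (\<forall>X\<in>aug_obj k. \<forall>Y\<in>aug_obj k. \<forall>\<phi>\<in>aug_hom k X Y. Fm X Y \<phi> \<in> Fo X \<rightarrow> Fo Y) \<and>
     (\<forall>X\<in>aug_obj k. \<forall>v\<in>Fo X. Fm X X (\<lambda>x\<in>carrier (fst X). x) v = v) \<and>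
     (\<forall>X\<in>aug_obj k. \<forall>Y\<in>aug_obj k. \<forall>Z\<in>aug_obj k.
        \<forall>\<phi>\<in>aug_hom k X Y. \<forall>\<psi>\<in>aug_hom k Y Z. \<forall>v\<in>Fo X.
          Fm X Z (compose (carrier (fst X)) \<psi> \<phi>) v = Fm Y Z \<psi> (Fm X Y \<phi> v))"

definition functor_iso ::
  "('k,'z) ring_scheme \<Rightarrow>
   (('k,'l) aug \<Rightarrow> 'x set) \<Rightarrow> (('k,'l) aug \<Rightarrow> ('k,'l) aug \<Rightarrow> ('l \<Rightarrow> 'l) \<Rightarrow> 'x \<Rightarrow> 'x) \<Rightarrow>
   (('k,'l) aug \<Rightarrow> 'y set) \<Rightarrow> (('k,'l) aug \<Rightarrow> ('k,'l) aug \<Rightarrow> ('l \<Rightarrow> 'l) \<Rightarrow> 'y \<Rightarrow> 'y) \<Rightarrow>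
   (('k,'l) aug \<Rightarrow> 'x \<Rightarrow> 'y) \<Rightarrow> bool" where
  "functor_iso k Fo Fm Go Gm \<eta> \<longleftrightarrow>
     set_functor k Fo Fm \<and> set_functor k Go Gm \<and>
     (\<forall>X\<in>aug_obj k. bij_betw (\<eta> X) (Fo X) (Go X)) \<and>
     (\<forall>X\<in>aug_obj k. \<forall>Y\<in>aug_obj k. \<forall>\<phi>\<in>aug_hom k X Y. \<forall>v\<in>Fo X.
        \<eta> Y (Fm X Y \<phi> v) = Gm X Y \<phi> (\<eta> X v))"


section \<open>The Maurer--Cartan functor\<close>

text \<open>
  The data of a dg-Lie algebra with differential of degree -1: lie_br p q is the bracket of elements
  of degrees p and q, and lie_diff p is the differential on elements of degree p.
\<close>

record ('k, 'c) dglie =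
  lie_mod :: "int \<Rightarrow> ('k, 'c) module"
  lie_br :: "int \<Rightarrow> int \<Rightarrow> 'c \<Rightarrow> 'c \<Rightarrow> 'c"
  lie_diff :: "int \<Rightarrow> 'c \<Rightarrow> 'c"

text \<open>The algebra l is concentrated in degree 0, so the degree p part is the following.\<close>

definition lie_tensor ::
  "('k,'z) ring_scheme \<Rightarrow> ('k,'c) dglie \<Rightarrow> ('k,'l) aug \<Rightarrow> int \<Rightarrow> ('k, ('c \<times> 'l \<Rightarrow> 'k) set) module" where
  "lie_tensor k L X p = tensor k (lie_mod L p) (aug_ker k X)"

definition lie_tensor_br ::
  "('k,'z) ring_scheme \<Rightarrow> ('k,'c) dglie \<Rightarrow> ('k,'l) aug \<Rightarrow> int \<Rightarrow> int \<Rightarrow>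
   ('c \<times> 'l \<Rightarrow> 'k) set \<Rightarrow> ('c \<times> 'l \<Rightarrow> 'k) set \<Rightarrow> ('c \<times> 'l \<Rightarrow> 'k) set" where
  "lie_tensor_br k L X p q =
     (THE b. b \<in> mod_hom k (lie_tensor k L X p)
                  (hom_module k (lie_tensor k L X q) (lie_tensor k L X (p + q))) \<and>
        (\<forall>v\<in>carrier (lie_mod L p). \<forall>x\<in>carrier (aug_ker k X).
         \<forall>v'\<in>carrier (lie_mod L q). \<forall>x'\<in>carrier (aug_ker k X).
           b (tens k (lie_mod L p) (aug_ker k X) v x) (tens k (lie_mod L q) (aug_ker k X) v' x') =
           tens k (lie_mod L (p + q)) (aug_ker k X) (lie_br L p q v v') (x \<otimes>\<^bsub>fst X\<^esub> x')))"

definition lie_tensor_diff ::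
  "('k,'z) ring_scheme \<Rightarrow> ('k,'c) dglie \<Rightarrow> ('k,'l) aug \<Rightarrow> int \<Rightarrow>
   ('c \<times> 'l \<Rightarrow> 'k) set \<Rightarrow> ('c \<times> 'l \<Rightarrow> 'k) set" where
  "lie_tensor_diff k L X p = tmap k (lie_mod L p) (aug_ker k X) (lie_mod L (p - 1)) (aug_ker k X)
     (lie_diff L p) (\<lambda>x. x)"

definition MC :: "('k,'z) ring_scheme \<Rightarrow> ('k,'c) dglie \<Rightarrow> ('k,'l) aug \<Rightarrow> ('c \<times> 'l \<Rightarrow> 'k) set set" where
  "MC k L X = {v \<in> carrier (lie_tensor k L X (-1)).
     lie_tensor_diff k L X (-1) v \<oplus>\<^bsub>lie_tensor k L X (-2)\<^esub>
       (inv\<^bsub>k\<^esub> (\<one>\<^bsub>k\<^esub> \<oplus>\<^bsub>k\<^esub> \<one>\<^bsub>k\<^esub>) \<odot>\<^bsub>lie_tensor k L X (-2)\<^esub> lie_tensor_br k L X (-1) (-1) v v)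
     = \<zero>\<^bsub>lie_tensor k L X (-2)\<^esub>}"

definition MC_map ::
  "('k,'z) ring_scheme \<Rightarrow> ('k,'c) dglie \<Rightarrow> ('k,'l) aug \<Rightarrow> ('k,'l) aug \<Rightarrow> ('l \<Rightarrow> 'l) \<Rightarrow>
   ('c \<times> 'l \<Rightarrow> 'k) set \<Rightarrow> ('c \<times> 'l \<Rightarrow> 'k) set" where
  "MC_map k L X Y \<phi> =
     tmap k (lie_mod L (-1)) (aug_ker k X) (lie_mod L (-1)) (aug_ker k Y) (\<lambda>f. f) \<phi>"

definition controls ::
  "('k,'z) ring_scheme \<Rightarrow> ('k,'c) dglie \<Rightarrow> (('k,'l) aug \<Rightarrow> 'y set) \<Rightarrow>
   (('k,'l) aug \<Rightarrow> ('k,'l) aug \<Rightarrow> ('l \<Rightarrow> 'l) \<Rightarrow> 'y \<Rightarrow> 'y) \<Rightarrow> bool" where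
  "controls k L Fo Fm \<longleftrightarrow> (\<exists>\<eta>. functor_iso k (MC k L) (MC_map k L) Fo Fm \<eta>)"

definition red_Hochschild ::
  "('k,'z) ring_scheme \<Rightarrow> (int \<Rightarrow> ('k,'a) module) \<Rightarrow> 'a \<Rightarrow> ('a \<Rightarrow> 'k) \<Rightarrow> ('k,'a,'a) cochain \<Rightarrow>
   ('k, ('k,'a,'a) cochain) dglie" where
  "red_Hochschild k A e sp \<nu> =
     \<lparr>lie_mod = CC_red k A e sp, lie_br = gbracket k A, lie_diff = (\<lambda>p. gbracket k A (-1) p \<nu>)\<rparr>"


section \<open>Infinitesimal strictly unital deformations\<close>

text \<open>The tensor product of A with l, as a graded k-module and as a graded l-module.\<close>

definition ext_k ::
  "('k,'z) ring_scheme \<Rightarrow> (int \<Rightarrow> ('k,'a) module) \<Rightarrow> ('k,'l) module \<Rightarrow> int \<Rightarrow>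
   ('k, ('a \<times> 'l \<Rightarrow> 'k) set) module" where
  "ext_k k A l i = tensor k (A i) l"

definition ext ::
  "('k,'z) ring_scheme \<Rightarrow> (int \<Rightarrow> ('k,'a) module) \<Rightarrow> ('k,'l) module \<Rightarrow> int \<Rightarrow>
   ('l, ('a \<times> 'l \<Rightarrow> 'k) set) module" where
  "ext k A l i =
     \<lparr>carrier = carrier (tensor k (A i) l), monoid.mult = undefined, monoid.one = undefined,
      ring.zero = ring.zero (tensor k (A i) l), ring.add = ring.add (tensor k (A i) l),
      smult = (\<lambda>y. tmap k (A i) l (A i) l (\<lambda>a. a) (\<lambda>x. y \<otimes>\<^bsub>l\<^esub> x))\<rparr>"

text \<open>
  The isomorphism from l-linear cochains on the extension of A to k-linear cochains on A with
  values in the extension, in degree d: restriction along the map taking a to its tensor with 1.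
\<close>

definition restr ::
  "('k,'z) ring_scheme \<Rightarrow> (int \<Rightarrow> ('k,'a) module) \<Rightarrow> ('k,'l) module \<Rightarrow> int \<Rightarrow>
   ('l, ('a \<times> 'l \<Rightarrow> 'k) set, ('a \<times> 'l \<Rightarrow> 'k) set) cochain \<Rightarrow>
   ('k, 'a, ('a \<times> 'l \<Rightarrow> 'k) set) cochain" where
  "restr k A l d N = (THE f. f \<in> carrier (CC k A (ext_k k A l) d) \<and>
     (\<forall>n\<ge>1. \<forall>m. \<forall>w\<in>words (susp A) n m.
        ev k A f w = ev l (ext k A l) N (map (\<lambda>(i, a). (i, tens k (A (i - 1)) l a \<one>\<^bsub>l\<^esub>)) w)))"

text \<open>Composition of a cochain on A of degree d with a family of maps on its values.\<close>

definition push ::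
  "('r,'z) ring_scheme \<Rightarrow> (int \<Rightarrow> ('r,'a) module) \<Rightarrow> int \<Rightarrow> (int \<Rightarrow> 'b \<Rightarrow> 'c) \<Rightarrow>
   ('r,'a,'b) cochain \<Rightarrow> ('r,'a,'c) cochain" where
  "push R A d h f = (\<lambda>n\<in>{1..}. \<lambda>m.
     compose (carrier (tpow R (susp A) n m)) (h (m + d - 1)) (f n m))"

definition base_change ::
  "('k,'z) ring_scheme \<Rightarrow> (int \<Rightarrow> ('k,'a) module) \<Rightarrow> ('k,'l) aug \<Rightarrow> ('k,'l) aug \<Rightarrow> ('l \<Rightarrow> 'l) \<Rightarrow>
   ('l, ('a \<times> 'l \<Rightarrow> 'k) set, ('a \<times> 'l \<Rightarrow> 'k) set) cochain \<Rightarrow>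
   ('l, ('a \<times> 'l \<Rightarrow> 'k) set, ('a \<times> 'l \<Rightarrow> 'k) set) cochain" where
  "base_change k A X Y \<phi> N =
     (THE N'. N' \<in> carrier (CC (fst Y) (ext k A (fst Y)) (ext k A (fst Y)) (-1)) \<and>
        restr k A (fst Y) (-1) N' =
          push k A (-1) (\<lambda>i. tmap k (A i) (fst X) (A i) (fst Y) (\<lambda>a. a) \<phi>)
            (restr k A (fst X) (-1) N))"

text \<open>The map induced by the augmentation from the extension of A back to A, in degree i.\<close>

definition aug_map ::
  "('k,'z) ring_scheme \<Rightarrow> (int \<Rightarrow> ('k,'a) module) \<Rightarrow> ('k,'l) aug \<Rightarrow> int \<Rightarrow> ('a \<times> 'l \<Rightarrow> 'k) set \<Rightarrow> 'a"
  where
  "aug_map k A X i = (THE h. h \<in> mod_hom k (tensor k (A i) (fst X)) (A i) \<and>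
     (\<forall>a\<in>carrier (A i). \<forall>x\<in>carrier (fst X).
        h (tens k (A i) (fst X) a x) = snd X x \<odot>\<^bsub>A i\<^esub> a))"

definition infDef_su ::
  "('k,'z) ring_scheme \<Rightarrow> (int \<Rightarrow> ('k,'a) module) \<Rightarrow> 'a \<Rightarrow> ('k,'a,'a) cochain \<Rightarrow> ('k,'l) aug \<Rightarrow>
   ('l, ('a \<times> 'l \<Rightarrow> 'k) set, ('a \<times> 'l \<Rightarrow> 'k) set) cochain set" where
  "infDef_su k A e \<nu> X = {N.
     A_infinity (fst X) (ext k A (fst X)) N \<and>
     strictly_unital (fst X) (ext k A (fst X)) (tens k (A 0) (fst X) e \<one>\<^bsub>fst X\<^esub>) N \<and>
     push k A (-1) (aug_map k A X) (restr k A (fst X) (-1) N) = \<nu>}"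

text \<open>
  In the next definition a triple (i, a, x) stands for the tensor of a, of degree i in A,
  with the element x of l.
\<close>

definition theta ::
  "('k,'z) ring_scheme \<Rightarrow> (int \<Rightarrow> ('k,'a) module) \<Rightarrow> ('k,'l) module \<Rightarrow> int \<Rightarrow>
   (('k,'a,'a) cochain \<times> 'l \<Rightarrow> 'k) set \<Rightarrow>
   ('l, ('a \<times> 'l \<Rightarrow> 'k) set, ('a \<times> 'l \<Rightarrow> 'k) set) cochain" where
  "theta k A l d =
     (THE h. h \<in> mod_hom k (tensor k (CC k A A d) l) (res_scal l (CC l (ext k A l) (ext k A l) d)) \<and>
        (\<forall>f\<in>carrier (CC k A A d). \<forall>y\<in>carrier l. \<forall>w. w \<noteq> [] \<longrightarrow>
           (\<forall>(i, a, x)\<in>set w. a \<in> carrier (A i) \<and> x \<in> carrier l) \<longrightarrow>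
           (let wA = map (\<lambda>(i, a, x). (i + 1, a)) w in
            ev l (ext k A l) (h (tens k (CC k A A d) l f y))
              (map (\<lambda>(i, a, x). (i + 1, tens k (A i) l a x)) w) =
            tens k (susp A (wdeg wA + d)) l (ev k A f wA)
              (y \<otimes>\<^bsub>l\<^esub> foldr (\<otimes>\<^bsub>l\<^esub>) (map (\<lambda>(i, a, x). x) w) \<one>\<^bsub>l\<^esub>))))"

definition def_map ::
  "('k,'z) ring_scheme \<Rightarrow> (int \<Rightarrow> ('k,'a) module) \<Rightarrow> 'a \<Rightarrow> ('a \<Rightarrow> 'k) \<Rightarrow> ('k,'a,'a) cochain \<Rightarrow>
   ('k,'l) aug \<Rightarrow> (('k,'a,'a) cochain \<times> 'l \<Rightarrow> 'k) set \<Rightarrow>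
   ('l, ('a \<times> 'l \<Rightarrow> 'k) set, ('a \<times> 'l \<Rightarrow> 'k) set) cochain" where
  "def_map k A e sp \<mu> X v =
     (let l = fst X; C = CC k A A (-1); T = tensor k C l in
      theta k A l (-1)
        (tmap k (CC_red k A e sp (-1)) (aug_ker k X) C l (\<lambda>f. f) (\<lambda>x. x) v
         \<oplus>\<^bsub>T\<^esub> tens k C l \<mu> \<one>\<^bsub>l\<^esub> \<oplus>\<^bsub>T\<^esub> tens k C l (mu_su k A e sp) \<one>\<^bsub>l\<^esub>))"

end

theory Submission
  imports Defs
begin

text \<open>
  A cochain is the same thing as a family of functions on words that are linear in each letter, and
  all operations are computed on words.  Over l an l-linear cochain on the extension of A is
  determined by its values on words in the letters a \<otimes> 1, and conversely a k-multilinear function on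
  words in A with values in an l-module extends uniquely.  On these words the Gerstenhaber product of
  the images of g \<otimes> y' and f \<otimes> y is the Gerstenhaber product of g and f, tensored with y' y, so
  additivity turns the square of the image of v + \<nu> \<otimes> 1 into the Maurer--Cartan expression of v;
  the factor 1/2 enters because the bracket of v with itself is twice its square.

  Reduced cochains are those vanishing on words with a letter 1.  Strict unitality makes \<nu>, hence
  every strictly unital deformation, take prescribed values on such words, so the difference of a
  deformation and \<nu> is reduced.  Finally a dual basis of the finitely generated projective
  augmentation ideal makes evaluation on words injective on the tensor product of the reduced
  cochains with the augmentation ideal, and identifies its image.  Functoriality of the deformations
  is transported from the Maurer--Cartan functor along the bijection, which is natural.
\<close>

text \<open>One obstacle shapes the proof: cochains form an infinite product of Hom modules, and
  tensoring with l does not commute with such products in general. An element of the tensor product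
  is therefore not simply an l-valued cochain, and the finite dual basis is what bridges the two. It
  is obtained by projecting a dual basis of l onto the augmentation ideal along the multiples of 1.

  A second point is not formal: \<nu> is not reduced, yet the bracket with it must preserve reduced
  cochains. On a word with a letter [1] the surviving insertions all have, up to sign, the value of
  the other cochain on the word without that letter; since [1] has odd degree and a right unit
  carries a sign, these signs are opposite.

  Thirdly, most constructions of the statement are definite descriptions, which say nothing before
  existence and uniqueness are known. Tensor products and tensor powers are therefore handled
  together as modules given by generators and relations. Extension of multilinear functions from A
  to the extension of A goes letter by letter, and its linearity in the letter being processed rests
  on uniqueness for the remaining ones.\<close>

lemma mod_homI:
  assumes "h \<in> carrier M \<rightarrow>\<^sub>E carrier N"
    and "\<And>x y. x \<in> carrier M \<Longrightarrow> y \<in> carrier M \<Longrightarrow> h (x \<oplus>\<^bsub>M\<^esub> y) = h x \<oplus>\<^bsub>N\<^esub> h y"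
    and "\<And>r x. r \<in> carrier R \<Longrightarrow> x \<in> carrier M \<Longrightarrow> h (r \<odot>\<^bsub>M\<^esub> x) = r \<odot>\<^bsub>N\<^esub> h x"
  shows "h \<in> mod_hom R M N"
  using assms by (simp add: mod_hom_def)

lemma mod_hom_mem: "h \<in> mod_hom R M N \<Longrightarrow> x \<in> carrier M \<Longrightarrow> h x \<in> carrier N"
  and mod_hom_add: "h \<in> mod_hom R M N \<Longrightarrow> x \<in> carrier M \<Longrightarrow> y \<in> carrier M \<Longrightarrow> h (x \<oplus>\<^bsub>M\<^esub> y) = h x \<oplus>\<^bsub>N\<^esub> h y"
  and mod_hom_smult: "h \<in> mod_hom R M N \<Longrightarrow> r \<in> carrier R \<Longrightarrow> x \<in> carrier M \<Longrightarrow> h (r \<odot>\<^bsub>M\<^esub> x) = r \<odot>\<^bsub>N\<^esub> h x"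
  and mod_hom_undef: "h \<in> mod_hom R M N \<Longrightarrow> x \<notin> carrier M \<Longrightarrow> h x = undefined"
  by (auto simp: mod_hom_def PiE_def extensional_def)

lemma mod_hom_eqI:
  assumes "h \<in> mod_hom R M N" "h' \<in> mod_hom R' M N'" "\<And>x. x \<in> carrier M \<Longrightarrow> h x = h' x"
  shows "h = h'"
  using assms by (metis (no_types, lifting) ext mod_hom_undef)

lemma mod_hom_restrict:
  assumes "module R M" "\<And>x. x \<in> carrier M \<Longrightarrow> h x \<in> carrier N"
    and "\<And>x y. x \<in> carrier M \<Longrightarrow> y \<in> carrier M \<Longrightarrow> h (x \<oplus>\<^bsub>M\<^esub> y) = h x \<oplus>\<^bsub>N\<^esub> h y"
    and "\<And>r x. r \<in> carrier R \<Longrightarrow> x \<in> carrier M \<Longrightarrow> h (r \<odot>\<^bsub>M\<^esub> x) = r \<odot>\<^bsub>N\<^esub> h x"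
  shows "(\<lambda>x\<in>carrier M. h x) \<in> mod_hom R M N"
proof -
  interpret M: module R M by fact
  show ?thesis using assms(2-) by (intro mod_homI) auto
qed

lemma mod_hom_zero:
  assumes "module R M" "module R N" "h \<in> mod_hom R M N"
  shows "h \<zero>\<^bsub>M\<^esub> = \<zero>\<^bsub>N\<^esub>"
proof -
  interpret M: module R M by fact
  interpret N: module R N by fact
  have "h (\<zero>\<^bsub>R\<^esub> \<odot>\<^bsub>M\<^esub> \<zero>\<^bsub>M\<^esub>) = \<zero>\<^bsub>R\<^esub> \<odot>\<^bsub>N\<^esub> h \<zero>\<^bsub>M\<^esub>"
    using assms(3) by (intro mod_hom_smult) auto
  then show ?thesis using mod_hom_mem[OF assms(3) M.zero_closed] by simp
qed

text \<open>Negation becomes a scalar multiplication, so compatibility with scalars yields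
  compatibility with negatives, and closure under scalars yields closure under negatives.\<close>

lemma module_neg_eq:
  assumes "module R M" "x \<in> carrier M"
  shows "\<ominus>\<^bsub>M\<^esub> x = (\<ominus>\<^bsub>R\<^esub> \<one>\<^bsub>R\<^esub>) \<odot>\<^bsub>M\<^esub> x"
proof -
  interpret M: module R M by fact
  show ?thesis using assms(2) by (simp add: M.smult_l_minus)
qed

lemma mod_hom_neg:
  assumes "module R M" "module R N" "h \<in> mod_hom R M N" "x \<in> carrier M"
  shows "h (\<ominus>\<^bsub>M\<^esub> x) = \<ominus>\<^bsub>N\<^esub> h x"
proof -
  interpret M: module R M by fact
  show ?thesis using assms
    by (simp add: module_neg_eq[of R] mod_hom_smult mod_hom_mem)
qed

lemma mod_hom_minus:
  assumes "module R M" "module R N" "h \<in> mod_hom R M N" "x \<in> carrier M" "y \<in> carrier M"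
  shows "h (x \<ominus>\<^bsub>M\<^esub> y) = h x \<ominus>\<^bsub>N\<^esub> h y"
proof -
  interpret M: module R M by fact
  show ?thesis using assms by (simp add: a_minus_def mod_hom_neg mod_hom_add)
qed

lemma mod_hom_finsum:
  assumes "module R M" "module R N" "h \<in> mod_hom R M N" "finite I" "f \<in> I \<rightarrow> carrier M"
  shows "h (finsum M f I) = finsum N (\<lambda>i. h (f i)) I"
proof -
  interpret M: module R M by fact
  interpret N: module R N by fact
  show ?thesis using assms(4,5)
  proof induction
    case empty then show ?case using mod_hom_zero[OF assms(1-3)] by simp
  next
    case (insert i I)
    then have "f i \<in> carrier M" "f \<in> I \<rightarrow> carrier M" by auto
    then show ?case using insert
      by (simp add: mod_hom_add[OF assms(3)] M.finsum_closed mod_hom_mem[OF assms(3)] Pi_iff)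
  qed
qed

lemma mod_hom_compose:
  assumes "module R M" "g \<in> mod_hom R N P" "f \<in> mod_hom R M N"
  shows "compose (carrier M) g f \<in> mod_hom R M P"
  unfolding compose_def using assms(2,3)
  by (intro mod_hom_restrict[OF assms(1)]) (auto simp: mod_hom_mem mod_hom_add mod_hom_smult)

lemma mod_hom_id: "module R M \<Longrightarrow> (\<lambda>x\<in>carrier M. x) \<in> mod_hom R M M"
  by (rule mod_hom_restrict) auto

lemma module_smult_comm:
  assumes "module R M" "r \<in> carrier R" "s \<in> carrier R" "x \<in> carrier M"
  shows "r \<odot>\<^bsub>M\<^esub> (s \<odot>\<^bsub>M\<^esub> x) = s \<odot>\<^bsub>M\<^esub> (r \<odot>\<^bsub>M\<^esub> x)"
proof -
  interpret M: module R M by fact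
  show ?thesis using assms by (metis M.R.m_comm M.smult_assoc1)
qed

section \<open>Hom modules and products of modules\<close>

lemma hom_module_simps:
  "carrier (hom_module R M N) = mod_hom R M N"
  "\<zero>\<^bsub>hom_module R M N\<^esub> = (\<lambda>x\<in>carrier M. \<zero>\<^bsub>N\<^esub>)"
  "f \<oplus>\<^bsub>hom_module R M N\<^esub> g = (\<lambda>x\<in>carrier M. f x \<oplus>\<^bsub>N\<^esub> g x)"
  "r \<odot>\<^bsub>hom_module R M N\<^esub> f = (\<lambda>x\<in>carrier M. r \<odot>\<^bsub>N\<^esub> f x)"
  by (simp_all add: hom_module_def)

lemma hom_module_module:
  assumes "module R M" "module R N"
  shows "module R (hom_module R M N)"
proof -
  interpret M: module R M by fact
  interpret N: module R N by fact
  note ms = mod_hom_mem mod_hom_add mod_hom_smult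
  have z: "(\<lambda>x\<in>carrier M. \<zero>\<^bsub>N\<^esub>) \<in> mod_hom R M N"
    by (rule mod_hom_restrict[OF assms(1)]) auto
  have a: "(\<lambda>x\<in>carrier M. f x \<oplus>\<^bsub>N\<^esub> g x) \<in> mod_hom R M N"
    if "f \<in> mod_hom R M N" "g \<in> mod_hom R M N" for f g
    using that by (intro mod_hom_restrict[OF assms(1)]) (auto simp: ms N.smult_r_distr N.a_ac)
  have s: "(\<lambda>x\<in>carrier M. r \<odot>\<^bsub>N\<^esub> f x) \<in> mod_hom R M N"
    if "f \<in> mod_hom R M N" "r \<in> carrier R" for f r
    using that by (intro mod_hom_restrict[OF assms(1)])
      (auto simp: ms N.smult_r_distr module_smult_comm[OF assms(2)])
  have eq: "f = g" if "f \<in> mod_hom R M N" "g \<in> mod_hom R M N" "\<And>x. x \<in> carrier M \<Longrightarrow> f x = g x" for f g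
    using that by (rule mod_hom_eqI)
  note c = hom_module_simps
  show ?thesis
  proof (intro moduleI abelian_groupI, unfold c, goal_cases)
    case (2 f g) then show ?case by (rule a)
  next
    case 3 show ?case by (rule z)
  next
    case (4 f g h)
    show ?case
      by (rule eq) (use 4 a in \<open>simp_all add: ms N.a_ac del: restrict_apply, simp_all add: ms N.a_ac\<close>)
  next
    case (5 f g)
    then show ?case using N.a_comm by (auto simp: ms intro!: restrict_ext)
  next
    case (6 f)
    show ?case by (rule eq[OF a[OF z 6] 6]) (use 6 in \<open>simp add: ms\<close>)
  next
    case (7 f)
    \<comment> \<open>The inverse of \<open>f\<close> is exhibited as its multiple by -1, so that
      its membership in the Hom module is an instance of \<open>s\<close>.\<close>
    have "(\<lambda>x\<in>carrier M. (\<lambda>x\<in>carrier M. (\<ominus>\<^bsub>R\<^esub> \<one>\<^bsub>R\<^esub>) \<odot>\<^bsub>N\<^esub> f x) x \<oplus>\<^bsub>N\<^esub> f x) = (\<lambda>x\<in>carrier M. \<zero>\<^bsub>N\<^esub>)"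
      using 7 by (auto simp: ms N.smult_l_minus N.l_neg intro!: restrict_ext)
    then show ?case using s 7 by blast
  next
    case 1 show ?case ..
  next
    case (8 r f) then show ?case using s by blast
  next
    case (9 r t f)
    then show ?case by (auto simp: ms N.smult_l_distr intro!: restrict_ext)
  next
    case (10 r f g)
    then show ?case by (auto simp: ms N.smult_r_distr intro!: restrict_ext)
  next
    case (11 r t f)
    then show ?case by (auto simp: ms N.smult_assoc1 intro!: restrict_ext)
  next
    case (12 f)
    show ?case by (rule eq) (use 12 s[of f] in \<open>simp_all add: ms\<close>)
  qed
qed

lemma hom_module_finsum:
  assumes "module R M" "module R N" "finite I" "f \<in> I \<rightarrow> mod_hom R M N" "x \<in> carrier M"
  shows "finsum (hom_module R M N) f I x = finsum N (\<lambda>i. f i x) I"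
proof -
  interpret M: module R M by fact
  interpret N: module R N by fact
  interpret H: module R "hom_module R M N" by (rule hom_module_module) fact+
  show ?thesis using assms(3,4)
  proof induction
    case empty then show ?case using assms(5) by (simp add: hom_module_simps)
  next
    case (insert i I)
    then have 1: "f i \<in> carrier (hom_module R M N)" "f \<in> I \<rightarrow> carrier (hom_module R M N)"
      by (auto simp: hom_module_simps(1))
    then have 2: "f i x \<in> carrier N" "(\<lambda>i. f i x) \<in> I \<rightarrow> carrier N"
      using mod_hom_mem assms(5) by (fastforce simp: hom_module_simps(1))+
    show ?case using insert 1 2 assms(5)
      by (simp add: hom_module_simps(3))
  qed
qed

lemma prod_module_simps:
  "carrier (prod_module I M) = (\<Pi>\<^sub>E i\<in>I. carrier (M i))"
  "\<zero>\<^bsub>prod_module I M\<^esub> = (\<lambda>i\<in>I. \<zero>\<^bsub>M i\<^esub>)"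
  "f \<oplus>\<^bsub>prod_module I M\<^esub> g = (\<lambda>i\<in>I. f i \<oplus>\<^bsub>M i\<^esub> g i)"
  "r \<odot>\<^bsub>prod_module I M\<^esub> f = (\<lambda>i\<in>I. r \<odot>\<^bsub>M i\<^esub> f i)"
  by (simp_all add: prod_module_def)

lemma prod_module_module:
  assumes "cring R" "\<And>i. i \<in> I \<Longrightarrow> module R (M i)"
  shows "module R (prod_module I M)"
proof -
  interpret R: cring R by fact
  note m = assms(2)
  note ag = module.axioms(2)[OF m]
  have z: "\<zero>\<^bsub>prod_module I M\<^esub> \<in> carrier (prod_module I M)"
    using abelian_groupE(2)[OF ag] by (simp add: prod_module_simps)
  have a: "f \<oplus>\<^bsub>prod_module I M\<^esub> g \<in> carrier (prod_module I M)"
    if "f \<in> carrier (prod_module I M)" "g \<in> carrier (prod_module I M)" for f g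
    using that by (auto simp: prod_module_simps intro!: abelian_groupE(1)[OF ag] intro: PiE_mem)
  have s: "r \<odot>\<^bsub>prod_module I M\<^esub> f \<in> carrier (prod_module I M)"
    if "r \<in> carrier R" "f \<in> carrier (prod_module I M)" for r f
    using that by (auto simp: prod_module_simps intro!: module.smult_closed[OF m] intro: PiE_mem)
  have eq: "f = g" if "f \<in> carrier (prod_module I M)" "g \<in> carrier (prod_module I M)"
    "\<And>i. i \<in> I \<Longrightarrow> f i = g i" for f g
    using that by (auto simp: prod_module_simps intro: PiE_ext)
  have c: "f i \<in> carrier (M i)" if "f \<in> carrier (prod_module I M)" "i \<in> I" for f i
    using that by (auto simp: prod_module_simps)
  show ?thesis
  proof (intro moduleI abelian_groupI, goal_cases)
    case (2 f g) then show ?case by (rule a)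
  next
    case 3 show ?case by (rule z)
  next
    case (8 r f) then show ?case by (rule s)
  next
    case (4 f g h)
    show ?case
      by (rule eq, use 4 in \<open>blast intro: a z s\<close>, use 4 in \<open>blast intro: a z s\<close>,
          use 4 in \<open>simp add: prod_module_simps(3) c abelian_groupE(1,3)[OF ag]\<close>)
  next
    case (5 f g)
    show ?case
      by (rule eq, use 5 in \<open>blast intro: a z s\<close>, use 5 in \<open>blast intro: a z s\<close>,
          use 5 in \<open>simp add: prod_module_simps(3) c abelian_groupE(1,4)[OF ag]\<close>)
  next
    case (6 f)
    show ?case
      by (rule eq, use 6 in \<open>blast intro: a z s\<close>, use 6 in \<open>blast intro: a z s\<close>,
          use 6 in \<open>simp add: prod_module_simps(2,3) c abelian_groupE(5)[OF ag]\<close>)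
  next
    case (7 f)
    have "(\<ominus>\<^bsub>R\<^esub> \<one>\<^bsub>R\<^esub>) \<odot>\<^bsub>prod_module I M\<^esub> f \<oplus>\<^bsub>prod_module I M\<^esub> f = \<zero>\<^bsub>prod_module I M\<^esub>"
      by (rule eq, use 7 in \<open>blast intro: a z s\<close>, use 7 in \<open>blast intro: a z s\<close>,
          use 7 in \<open>simp add: prod_module_simps(2-) c
            module_neg_eq[symmetric, OF m] abelian_group.l_neg[OF ag]\<close>)
    then show ?case using s 7 by blast
  next
    case 1 show ?case ..
  next
    case (9 r t f)
    show ?case
      by (rule eq, use 9 in \<open>blast intro: a z s\<close>, use 9 in \<open>blast intro: a z s\<close>,
          use 9 in \<open>simp add: prod_module_simps(3,4) c module.smult_l_distr[OF m]\<close>)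
  next
    case (10 r f g)
    show ?case
      by (rule eq, use 10 in \<open>blast intro: a z s\<close>, use 10 in \<open>blast intro: a z s\<close>,
          use 10 in \<open>simp add: prod_module_simps(3,4) c module.smult_r_distr[OF m]\<close>)
  next
    case (11 r t f)
    show ?case
      by (rule eq, use 11 in \<open>blast intro: a z s\<close>, use 11 in \<open>blast intro: a z s\<close>,
          use 11 in \<open>simp add: prod_module_simps(3,4) c module.smult_assoc1[OF m]\<close>)
  next
    case (12 f)
    show ?case
      by (rule eq, use 12 in \<open>blast intro: a z s\<close>, use 12 in \<open>blast intro: a z s\<close>,
          use 12 in \<open>simp add: prod_module_simps(3,4) c module.smult_one[OF m]\<close>)
  qed
qed

text \<open>The axioms are equations between terms in the operations, together with the existence of
  negatives, and all of these pass along a surjection respecting the operations. Applied below to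
  the map from elements to cosets.\<close>

lemma module_image:
  assumes "module R M" and carrier: "carrier Q = \<pi> ` carrier M"
    and zero: "\<zero>\<^bsub>Q\<^esub> = \<pi> \<zero>\<^bsub>M\<^esub>"
    and add: "\<And>x y. x \<in> carrier M \<Longrightarrow> y \<in> carrier M \<Longrightarrow> \<pi> x \<oplus>\<^bsub>Q\<^esub> \<pi> y = \<pi> (x \<oplus>\<^bsub>M\<^esub> y)"
    and smult: "\<And>r x. r \<in> carrier R \<Longrightarrow> x \<in> carrier M \<Longrightarrow> r \<odot>\<^bsub>Q\<^esub> \<pi> x = \<pi> (r \<odot>\<^bsub>M\<^esub> x)"
  shows "module R Q"
proof -
  interpret M: module R M by fact
  show ?thesis
  proof (intro moduleI abelian_groupI, goal_cases)
    case (7 x)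
    then obtain a where "x = \<pi> a" "a \<in> carrier M" by (auto simp: carrier)
    then show ?case
      by (intro bexI[of _ "\<pi> (\<ominus>\<^bsub>M\<^esub> a)"]) (auto simp: carrier zero add M.l_neg)
  next
    case 1 show ?case ..
  next
    case (5 x y)
    then show ?case by (auto simp: carrier add M.a_comm)
  qed (auto simp: carrier zero add smult M.a_assoc M.smult_l_distr M.smult_r_distr M.smult_assoc1)
qed

lemma self_alg_module:
  assumes "cring R"
  shows "module R (self_alg R)"
proof -
  interpret R: cring R by fact
  show ?thesis
  proof (intro moduleI abelian_groupI, goal_cases)
    case (7 x)
    then show ?case by (intro bexI[of _ "\<ominus>\<^bsub>R\<^esub> x"]) (auto simp: self_alg_def R.l_neg)
  qed (auto simp: self_alg_def R.cring_axioms R.a_assoc R.l_distr R.r_distr R.m_assoc intro: R.a_comm)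
qed

section \<open>Free modules and spans\<close>

lemma free_module_simps:
  "carrier (free_module R X) = {c \<in> X \<rightarrow>\<^sub>E carrier R. finite {x \<in> X. c x \<noteq> \<zero>\<^bsub>R\<^esub>}}"
  "\<zero>\<^bsub>free_module R X\<^esub> = (\<lambda>x\<in>X. \<zero>\<^bsub>R\<^esub>)"
  "c \<oplus>\<^bsub>free_module R X\<^esub> d = (\<lambda>x\<in>X. c x \<oplus>\<^bsub>R\<^esub> d x)"
  "r \<odot>\<^bsub>free_module R X\<^esub> c = (\<lambda>x\<in>X. r \<otimes>\<^bsub>R\<^esub> c x)"
  by (simp_all add: free_module_def)

text \<open>The free module is the submodule of finitely supported functions in a power of the ring:
  scalars shrink supports, and the support of a sum lies in the union of the two supports.\<close>

lemma free_module_module: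
  assumes "cring R"
  shows "module R (free_module R X)"
proof -
  interpret R: cring R by fact
  let ?P = "prod_module X (\<lambda>_. self_alg R)" and ?F = "free_module R X"
  interpret P: module R ?P
    using assms self_alg_module by (intro prod_module_module)
  have F: "?F = ?P\<lparr>carrier := carrier ?F\<rparr>"
    by (simp add: free_module_def prod_module_def self_alg_def)
  have sub: "carrier ?F \<subseteq> carrier ?P"
    by (auto simp: free_module_simps prod_module_simps self_alg_def)
  have s: "r \<odot>\<^bsub>?P\<^esub> c \<in> carrier ?F" if "r \<in> carrier R" "c \<in> carrier ?F" for r c
  proof -
    have "{x \<in> X. (r \<odot>\<^bsub>?P\<^esub> c) x \<noteq> \<zero>\<^bsub>R\<^esub>} \<subseteq> {x \<in> X. c x \<noteq> \<zero>\<^bsub>R\<^esub>}"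
      using that by (auto simp: prod_module_simps self_alg_def)
    then show ?thesis using that P.smult_closed[OF that(1) subsetD[OF sub that(2)]]
      by (auto simp: free_module_simps(1) prod_module_simps(1) self_alg_def dest: finite_subset)
  qed
  have a: "c \<oplus>\<^bsub>?P\<^esub> d \<in> carrier ?F" if "c \<in> carrier ?F" "d \<in> carrier ?F" for c d
  proof -
    have "{x \<in> X. (c \<oplus>\<^bsub>?P\<^esub> d) x \<noteq> \<zero>\<^bsub>R\<^esub>} \<subseteq> {x \<in> X. c x \<noteq> \<zero>\<^bsub>R\<^esub>} \<union> {x \<in> X. d x \<noteq> \<zero>\<^bsub>R\<^esub>}"
      using that by (auto simp: prod_module_simps self_alg_def)
    then show ?thesis using that P.a_closed[OF subsetD[OF sub that(1)] subsetD[OF sub that(2)]]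
      by (auto simp: free_module_simps(1) prod_module_simps(1) self_alg_def dest: finite_subset)
  qed
  have "submodule (carrier ?F) R ?P"
  proof (rule P.submoduleI[OF sub])
    show "\<zero>\<^bsub>?P\<^esub> \<in> carrier ?F"
      by (auto simp: free_module_simps prod_module_simps self_alg_def)
    show "\<ominus>\<^bsub>?P\<^esub> c \<in> carrier ?F" if "c \<in> carrier ?F" for c
      using that subsetD[OF sub that] by (subst module_neg_eq[OF P.module_axioms]) (auto intro: s)
  qed (rule a s; assumption)+
  then show ?thesis
    by (subst F) (rule submodule.submodule_is_module[OF _ P.module_axioms])
qed

lemma free_gen_mem: "cring R \<Longrightarrow> x \<in> X \<Longrightarrow> free_gen R X x \<in> carrier (free_module R X)"
proof -
  assume "cring R" "x \<in> X"
  interpret R: cring R by fact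
  have "finite {y \<in> X. free_gen R X x y \<noteq> \<zero>\<^bsub>R\<^esub>}"
    by (rule finite_subset[of _ "{x}"]) (auto simp: free_gen_def)
  then show ?thesis by (auto simp: free_module_simps free_gen_def)
qed

lemma free_lift:
  assumes "module R P" "\<And>x. x \<in> X \<Longrightarrow> \<phi> x \<in> carrier P"
  obtains h where "h \<in> mod_hom R (free_module R X) P" "\<And>x. x \<in> X \<Longrightarrow> h (free_gen R X x) = \<phi> x"
proof -
  interpret P: module R P by fact
  note cr = P.R.cring_axioms
  let ?F = "free_module R X"
  interpret F: module R ?F by (rule free_module_module[OF cr])
  define S where "S c = {x \<in> X. c x \<noteq> \<zero>\<^bsub>R\<^esub>}" for c
  define h where "h c = finsum P (\<lambda>x. c x \<odot>\<^bsub>P\<^esub> \<phi> x) (S c)" for c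
  have c: "c x \<in> carrier R" if "c \<in> carrier ?F" "x \<in> X" for c x
    using that by (auto simp: free_module_simps)
  have fS: "finite (S c)" if "c \<in> carrier ?F" for c
    using that by (auto simp: free_module_simps S_def)
  \<comment> \<open>Any finite set containing the support gives the same sum. This allows the sums
    for \<open>c\<close>, \<open>d\<close> and their sum to be compared over the union of two
    supports.\<close>
  have h_eq: "h c = finsum P (\<lambda>x. c x \<odot>\<^bsub>P\<^esub> \<phi> x) T" if "c \<in> carrier ?F" "S c \<subseteq> T" "T \<subseteq> X" "finite T" for c T
    unfolding h_def using that assms(2) c[OF that(1)]
    by (intro P.add.finprod_mono_neutral_cong_left) (auto simp: S_def)
  have 1: "(\<lambda>c\<in>carrier ?F. h c) \<in> mod_hom R ?F P"
  proof (rule mod_hom_restrict[OF F.module_axioms])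
    show "h c \<in> carrier P" if "c \<in> carrier ?F" for c
      unfolding h_def using that c assms(2) by (intro P.finsum_closed) (auto simp: S_def)
    show "h (c \<oplus>\<^bsub>?F\<^esub> d) = h c \<oplus>\<^bsub>P\<^esub> h d" if cd: "c \<in> carrier ?F" "d \<in> carrier ?F" for c d
    proof -
      let ?T = "S c \<union> S d"
      have T: "?T \<subseteq> X" "finite ?T" using cd fS by (auto simp: S_def)
      have "S (c \<oplus>\<^bsub>?F\<^esub> d) \<subseteq> ?T" using cd by (auto simp: S_def free_module_simps)
      then have "h (c \<oplus>\<^bsub>?F\<^esub> d) = finsum P (\<lambda>x. (c \<oplus>\<^bsub>?F\<^esub> d) x \<odot>\<^bsub>P\<^esub> \<phi> x) ?T"
        using cd T by (intro h_eq) auto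
      also have "\<dots> = finsum P (\<lambda>x. c x \<odot>\<^bsub>P\<^esub> \<phi> x \<oplus>\<^bsub>P\<^esub> d x \<odot>\<^bsub>P\<^esub> \<phi> x) ?T"
        using T c cd assms(2)
        by (intro P.finsum_cong') (auto simp: free_module_simps(3) P.smult_l_distr subset_iff)
      also have "\<dots> = h c \<oplus>\<^bsub>P\<^esub> h d"
        using T c cd assms(2) h_eq[OF cd(1) _ T] h_eq[OF cd(2) _ T]
        by (subst P.finsum_addf) (auto simp: subset_iff)
      finally show ?thesis .
    qed
    show "h (r \<odot>\<^bsub>?F\<^esub> d) = r \<odot>\<^bsub>P\<^esub> h d" if cd: "r \<in> carrier R" "d \<in> carrier ?F" for r d
    proof -
      have T: "S d \<subseteq> X" "finite (S d)" using cd fS by (auto simp: S_def)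
      have "S (r \<odot>\<^bsub>?F\<^esub> d) \<subseteq> S d" using cd by (auto simp: S_def free_module_simps)
      then have "h (r \<odot>\<^bsub>?F\<^esub> d) = finsum P (\<lambda>x. (r \<odot>\<^bsub>?F\<^esub> d) x \<odot>\<^bsub>P\<^esub> \<phi> x) (S d)"
        using cd T by (intro h_eq) auto
      also have "\<dots> = finsum P (\<lambda>x. r \<odot>\<^bsub>P\<^esub> (d x \<odot>\<^bsub>P\<^esub> \<phi> x)) (S d)"
        using T c cd assms(2)
        by (intro P.finsum_cong') (auto simp: free_module_simps(4) P.smult_assoc1 subset_iff)
      also have "\<dots> = r \<odot>\<^bsub>P\<^esub> h d"
        unfolding h_def using T c cd assms(2) by (subst P.finsum_smult_ldistr) (auto simp: subset_iff)
      finally show ?thesis .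
    qed
  qed
  have 2: "h (free_gen R X x) = \<phi> x" if x: "x \<in> X" for x
  proof -
    have "h (free_gen R X x) = finsum P (\<lambda>y. free_gen R X x y \<odot>\<^bsub>P\<^esub> \<phi> y) {x}"
      using x free_gen_mem[OF cr x] by (intro h_eq) (auto simp: S_def free_gen_def)
    also have "\<dots> = \<phi> x" using x assms(2) by (simp add: free_gen_def)
    finally show ?thesis .
  qed
  show thesis by (rule that[OF 1]) (use 2 free_gen_mem[OF cr, of _ X] in simp)
qed

text \<open>\<open>T\<close> may be larger than the support of \<open>c\<close>. In
  \<open>dual_basis\<close> this makes it possible to expand all elements over one and the same
  finite set.\<close>

lemma free_module_expand:
  assumes "cring R" "c \<in> carrier (free_module R X)" "finite T" "T \<subseteq> X" "\<And>x. x \<in> X - T \<Longrightarrow> c x = \<zero>\<^bsub>R\<^esub>"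
  shows "c = finsum (free_module R X) (\<lambda>x. c x \<odot>\<^bsub>free_module R X\<^esub> free_gen R X x) T"
proof -
  interpret R: cring R by fact
  let ?F = "free_module R X"
  interpret F: module R ?F by (rule free_module_module[OF assms(1)])
  have m: "c x \<odot>\<^bsub>?F\<^esub> free_gen R X x \<in> carrier ?F" if "x \<in> X" for x
    using that assms(2) by (intro F.smult_closed free_gen_mem R.cring_axioms) (auto simp: free_module_simps)
  \<comment> \<open>Coordinates of the partial sums. For \<open>U\<close> equal to \<open>T\<close>
    they are those of \<open>c\<close>, because \<open>c\<close> vanishes off
    \<open>T\<close>.\<close>
  have ev: "finsum ?F (\<lambda>x. c x \<odot>\<^bsub>?F\<^esub> free_gen R X x) U y =
      (if y \<in> U then c y else \<zero>\<^bsub>R\<^esub>)" if "finite U" "U \<subseteq> X" "y \<in> X" for U y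
    using that
  proof (induction U)
    case empty then show ?case by (simp add: free_module_simps)
  next
    case (insert x U)
    then have cc: "c x \<in> carrier R" "c y \<in> carrier R"
      using assms(2) by (auto simp: free_module_simps)
    have "finsum ?F (\<lambda>x. c x \<odot>\<^bsub>?F\<^esub> free_gen R X x) (insert x U) =
      c x \<odot>\<^bsub>?F\<^esub> free_gen R X x \<oplus>\<^bsub>?F\<^esub> finsum ?F (\<lambda>x. c x \<odot>\<^bsub>?F\<^esub> free_gen R X x) U"
      using insert m by (intro F.finsum_insert) auto
    then have "finsum ?F (\<lambda>x. c x \<odot>\<^bsub>?F\<^esub> free_gen R X x) (insert x U) y =
      c x \<otimes>\<^bsub>R\<^esub> free_gen R X x y \<oplus>\<^bsub>R\<^esub> finsum ?F (\<lambda>x. c x \<odot>\<^bsub>?F\<^esub> free_gen R X x) U y"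
      using insert.prems by (simp only: free_module_simps(3,4) restrict_apply if_True simp_thms)
    moreover have "free_gen R X x y = (if y = x then \<one>\<^bsub>R\<^esub> else \<zero>\<^bsub>R\<^esub>)"
      using insert.prems by (simp add: free_gen_def)
    moreover note insert.IH[of] insert.hyps insert.prems
    ultimately show ?case using cc by auto
  qed
  have "finsum ?F (\<lambda>x. c x \<odot>\<^bsub>?F\<^esub> free_gen R X x) T \<in> carrier ?F"
    using m assms(4) by (intro F.finsum_closed) auto
  then show ?thesis
    using assms(2,5) ev[OF assms(3,4)]
    by (intro PiE_ext[of _ X "\<lambda>_. carrier R"]) (auto simp: free_module_simps(1))
qed

lemma mspan_submodule:
  assumes "module R M" "S \<subseteq> carrier M"
  shows "submodule (mspan R M S) R M" "S \<subseteq> mspan R M S"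
proof -
  interpret M: module R M by fact
  show "submodule (mspan R M S) R M"
    unfolding mspan_def
  proof (rule M.submoduleI)
    show "\<Inter>{N. submodule N R M \<and> S \<subseteq> N} \<subseteq> carrier M"
      using M.carrier_is_submodule assms(2) by auto
    show "\<zero>\<^bsub>M\<^esub> \<in> \<Inter>{N. submodule N R M \<and> S \<subseteq> N}"
      using subgroup.one_closed[OF submodule.axioms(1)] by fastforce
  qed (auto dest: M.submoduleE(3,5) M.submoduleE(4))
  show "S \<subseteq> mspan R M S" by (auto simp: mspan_def)
qed

lemma mspan_least: "submodule N R M \<Longrightarrow> S \<subseteq> N \<Longrightarrow> mspan R M S \<subseteq> N"
  by (auto simp: mspan_def)

lemma mod_hom_kernel_submodule:
  assumes "module R M" "module R P" "h \<in> mod_hom R M P"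
  shows "submodule {x \<in> carrier M. h x = \<zero>\<^bsub>P\<^esub>} R M"
proof -
  interpret M: module R M by fact
  interpret P: module R P by fact
  show ?thesis
    by (rule M.submoduleI)
      (auto simp: mod_hom_zero[OF assms] mod_hom_neg[OF assms] mod_hom_add[OF assms(3)] mod_hom_smult[OF assms(3)])
qed

lemma free_module_span:
  assumes "cring R" "submodule N R (free_module R X)" "\<And>x. x \<in> X \<Longrightarrow> free_gen R X x \<in> N"
  shows "carrier (free_module R X) \<subseteq> N"
proof
  fix c assume c: "c \<in> carrier (free_module R X)"
  let ?F = "free_module R X" and ?T = "{x \<in> X. c x \<noteq> \<zero>\<^bsub>R\<^esub>}"
  interpret F: module R ?F by (rule free_module_module[OF assms(1)])
  note N = F.submoduleE[OF assms(2)]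
  have sum: "finsum ?F (\<lambda>x. c x \<odot>\<^bsub>?F\<^esub> free_gen R X x) U \<in> N" if "finite U" "U \<subseteq> X" for U
    using that
  proof induction
    case empty then show ?case using subgroup.one_closed[OF submodule.axioms(1)[OF assms(2)]] by simp
  next
    case (insert x U)
    have m: "c y \<odot>\<^bsub>?F\<^esub> free_gen R X y \<in> N" if "y \<in> X" for y
      using that c assms(3) by (intro N) (auto simp: free_module_simps)
    then show ?case using insert N(1)
      by (subst F.finsum_insert) (auto intro!: N(5))
  qed
  have "finsum ?F (\<lambda>x. c x \<odot>\<^bsub>?F\<^esub> free_gen R X x) ?T \<in> N"
    using c by (intro sum) (auto simp: free_module_simps)
  also have "finsum ?F (\<lambda>x. c x \<odot>\<^bsub>?F\<^esub> free_gen R X x) ?T = c"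
    using c by (intro free_module_expand[symmetric] assms(1)) (auto simp: free_module_simps)
  finally show "c \<in> N" .
qed

section \<open>Quotients, and presentations by generators and relations\<close>

context
  fixes R :: "('r, 'z) ring_scheme" and M :: "('r, 'm) module" and N
  assumes M: "module R M" and N: "submodule N R M"
begin

interpretation M: module R M by (rule M)

lemma quot_subgroup: "abelian_subgroup N M"
  by (rule abelian_subgroupI3[OF additive_subgroupI[OF submodule.axioms(1)[OF N]] M.abelian_group_axioms])

interpretation N: abelian_subgroup N M by (rule quot_subgroup)

lemma quot_carrier: "carrier (quot_module M N) = (\<lambda>x. N +>\<^bsub>M\<^esub> x) ` carrier M"
  by (auto simp: quot_module_def A_RCOSETS_def')

lemma quot_add: "x \<in> carrier M \<Longrightarrow> y \<in> carrier M \<Longrightarrow>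
    (N +>\<^bsub>M\<^esub> x) \<oplus>\<^bsub>quot_module M N\<^esub> (N +>\<^bsub>M\<^esub> y) = N +>\<^bsub>M\<^esub> (x \<oplus>\<^bsub>M\<^esub> y)"
  by (simp add: quot_module_def N.a_rcos_sum)

lemma quot_zero: "\<zero>\<^bsub>quot_module M N\<^esub> = N +>\<^bsub>M\<^esub> \<zero>\<^bsub>M\<^esub>"
  by (simp add: quot_module_def N.a_subset)

lemma quot_eq_iff: "x \<in> carrier M \<Longrightarrow> y \<in> carrier M \<Longrightarrow> N +>\<^bsub>M\<^esub> x = N +>\<^bsub>M\<^esub> y \<longleftrightarrow> x \<ominus>\<^bsub>M\<^esub> y \<in> N"
  using N.a_repr_independence'[of x y] N.a_repr_independenceD[of x y] N.a_rcos_module[of y x]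
  by (auto simp: M.minus_eq)

lemma quot_smult:
  assumes "r \<in> carrier R" "x \<in> carrier M"
  shows "r \<odot>\<^bsub>quot_module M N\<^esub> (N +>\<^bsub>M\<^esub> x) = N +>\<^bsub>M\<^esub> (r \<odot>\<^bsub>M\<^esub> x)"
proof -
  have 1: "N +>\<^bsub>M\<^esub> (r \<odot>\<^bsub>M\<^esub> y) = N +>\<^bsub>M\<^esub> (r \<odot>\<^bsub>M\<^esub> x)" if y: "y \<in> N +>\<^bsub>M\<^esub> x" for y
  proof -
    have yM: "y \<in> carrier M" using y assms M.a_r_coset_subset_G[OF N.a_subset] by blast
    have "y \<ominus>\<^bsub>M\<^esub> x \<in> N" using y yM assms by (simp add: N.a_rcos_module M.minus_eq)
    then have "r \<odot>\<^bsub>M\<^esub> (y \<ominus>\<^bsub>M\<^esub> x) \<in> N" using N assms by (simp add: submodule.smult_closed)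
    moreover have "r \<odot>\<^bsub>M\<^esub> (y \<ominus>\<^bsub>M\<^esub> x) = r \<odot>\<^bsub>M\<^esub> y \<ominus>\<^bsub>M\<^esub> r \<odot>\<^bsub>M\<^esub> x"
      using yM assms by (simp add: M.minus_eq M.smult_r_distr M.smult_r_minus)
    ultimately show ?thesis using yM assms by (simp add: quot_eq_iff)
  qed
  \<comment> \<open>The definition takes the union of the cosets obtained from all representatives.
    By \<open>1\<close> they coincide; the union is then that coset because the index set is
    nonempty.\<close>
  have "N +>\<^bsub>M\<^esub> x \<noteq> {}" using N.a_rcos_self[OF assms(2)] by blast
  then have "(\<Union>y\<in>N +>\<^bsub>M\<^esub> x. N +>\<^bsub>M\<^esub> (r \<odot>\<^bsub>M\<^esub> y)) = N +>\<^bsub>M\<^esub> (r \<odot>\<^bsub>M\<^esub> x)"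
    by (rule SUP_eq_const) (rule 1)
  then show ?thesis unfolding quot_module_def module.simps .
qed

lemma quot_module_module: "module R (quot_module M N)"
  by (rule module_image[OF M quot_carrier quot_zero]) (auto simp: quot_add quot_smult)

lemma quot_lift:
  assumes P: "module R P" and h: "h \<in> mod_hom R M P" and ker: "\<And>x. x \<in> N \<Longrightarrow> h x = \<zero>\<^bsub>P\<^esub>"
  obtains h' where "h' \<in> mod_hom R (quot_module M N) P" "\<And>x. x \<in> carrier M \<Longrightarrow> h' (N +>\<^bsub>M\<^esub> x) = h x"
proof -
  interpret P: module R P by (rule P)
  let ?Q = "quot_module M N"
  have eq: "h x = h y" if "x \<in> carrier M" "y \<in> carrier M" "N +>\<^bsub>M\<^esub> x = N +>\<^bsub>M\<^esub> y" for x y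
  proof -
    have "h (x \<ominus>\<^bsub>M\<^esub> y) = \<zero>\<^bsub>P\<^esub>" using that ker quot_eq_iff by blast
    then have "h x \<ominus>\<^bsub>P\<^esub> h y = \<zero>\<^bsub>P\<^esub>" using that mod_hom_minus[OF M P h] by simp
    moreover have "h x = (h x \<ominus>\<^bsub>P\<^esub> h y) \<oplus>\<^bsub>P\<^esub> h y"
      using that mod_hom_mem[OF h] by (simp add: P.minus_eq P.a_assoc P.l_neg)
    ultimately show ?thesis using that mod_hom_mem[OF h] by simp
  qed
  \<comment> \<open>A representative is chosen, and by \<open>eq\<close> the value does not depend
    on the choice. The restriction to the carrier keeps \<open>h'\<close> extensional.\<close>
  define h' where "h' = (\<lambda>X\<in>carrier ?Q. h (SOME x. x \<in> carrier M \<and> N +>\<^bsub>M\<^esub> x = X))"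
  have h': "h' (N +>\<^bsub>M\<^esub> x) = h x" if x: "x \<in> carrier M" for x
  proof -
    have "\<exists>y. y \<in> carrier M \<and> N +>\<^bsub>M\<^esub> y = N +>\<^bsub>M\<^esub> x" using x by blast
    from someI_ex[OF this] have "h (SOME y. y \<in> carrier M \<and> N +>\<^bsub>M\<^esub> y = N +>\<^bsub>M\<^esub> x) = h x"
      using x eq by blast
    then show ?thesis using x by (simp add: h'_def quot_carrier)
  qed
  have "h' \<in> mod_hom R ?Q P"
  proof (rule mod_homI)
    show "h' \<in> carrier ?Q \<rightarrow>\<^sub>E carrier P"
      using h' mod_hom_mem[OF h] by (auto simp: quot_carrier h'_def)
  qed (auto simp: quot_carrier quot_add quot_smult h' mod_hom_add[OF h] mod_hom_smult[OF h])
  then show thesis using that h' by blast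
qed

end

text \<open>The common form of \<open>tensor\<close> and \<open>tpow\<close>: a free module modulo
  the span of relations \<open>S\<close>. The universal property is proved once here and then
  specialised to both.\<close>

definition pres :: "('r, 'z) ring_scheme \<Rightarrow> 'x set \<Rightarrow> ('x \<Rightarrow> 'r) set \<Rightarrow> ('r, ('x \<Rightarrow> 'r) set) module" where
  "pres R X S = quot_module (free_module R X) (mspan R (free_module R X) S)"

definition pgen :: "('r, 'z) ring_scheme \<Rightarrow> 'x set \<Rightarrow> ('x \<Rightarrow> 'r) set \<Rightarrow> 'x \<Rightarrow> ('x \<Rightarrow> 'r) set" where
  "pgen R X S x = mspan R (free_module R X) S +>\<^bsub>free_module R X\<^esub> free_gen R X x"

context
  fixes R :: "('r, 'z) ring_scheme" and X :: "'x set" and S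
  assumes R: "cring R" and S: "S \<subseteq> carrier (free_module R X)"
begin

interpretation F: module R "free_module R X" by (rule free_module_module[OF R])

lemmas pres_span = mspan_submodule[OF F.module_axioms S]

lemma pres_module: "module R (pres R X S)"
  unfolding pres_def by (rule quot_module_module[OF F.module_axioms pres_span(1)])

lemma pgen_mem: "x \<in> X \<Longrightarrow> pgen R X S x \<in> carrier (pres R X S)"
  unfolding pres_def pgen_def quot_carrier[OF F.module_axioms pres_span(1)]
  by (rule imageI) (rule free_gen_mem[OF R])

lemma pres_rel_add:
  assumes "free_gen R X a \<ominus>\<^bsub>free_module R X\<^esub> (free_gen R X b \<oplus>\<^bsub>free_module R X\<^esub> free_gen R X c) \<in> S"
    and "a \<in> X" "b \<in> X" "c \<in> X"
  shows "pgen R X S a = pgen R X S b \<oplus>\<^bsub>pres R X S\<^esub> pgen R X S c"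
proof -
  note g = free_gen_mem[OF R assms(2)] free_gen_mem[OF R assms(3)] free_gen_mem[OF R assms(4)]
  note F = F.module_axioms pres_span(1)
  show ?thesis
    unfolding pres_def pgen_def quot_add[OF F g(2,3)] quot_eq_iff[OF F g(1) F.a_closed[OF g(2,3)]]
    using assms(1) pres_span(2) by blast
qed

lemma pres_rel_smult:
  assumes "free_gen R X a \<ominus>\<^bsub>free_module R X\<^esub> (r \<odot>\<^bsub>free_module R X\<^esub> free_gen R X b) \<in> S"
    and "a \<in> X" "b \<in> X" "r \<in> carrier R"
  shows "pgen R X S a = r \<odot>\<^bsub>pres R X S\<^esub> pgen R X S b"
proof -
  note g = free_gen_mem[OF R assms(2)] free_gen_mem[OF R assms(3)]
  note F = F.module_axioms pres_span(1)
  show ?thesis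
    unfolding pres_def pgen_def quot_smult[OF F assms(4) g(2)] quot_eq_iff[OF F g(1) F.smult_closed[OF assms(4) g(2)]]
    using assms(1) pres_span(2) by blast
qed

text \<open>The preimage of \<open>N\<close> in the free module is a submodule containing the free
  generators, hence it is everything; the projection is onto.\<close>

lemma pres_span_gen:
  assumes N: "submodule N R (pres R X S)" and gen: "\<And>x. x \<in> X \<Longrightarrow> pgen R X S x \<in> N"
  shows "carrier (pres R X S) \<subseteq> N"
proof -
  note F = F.module_axioms pres_span(1)
  interpret P: module R "pres R X S" by (rule pres_module)
  let ?\<pi> = "\<lambda>x. mspan R (free_module R X) S +>\<^bsub>free_module R X\<^esub> x"
  note NE = P.submoduleE[OF N]
  note q = quot_add[OF F, folded pres_def] quot_smult[OF F, folded pres_def]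
  have "submodule {c \<in> carrier (free_module R X). ?\<pi> c \<in> N} R (free_module R X)"
  proof (rule F.submoduleI)
    show "\<zero>\<^bsub>free_module R X\<^esub> \<in> {c \<in> carrier (free_module R X). ?\<pi> c \<in> N}"
      using subgroup.one_closed[OF submodule.axioms(1)[OF N]] quot_zero[OF F, folded pres_def] by simp
    show "\<ominus>\<^bsub>free_module R X\<^esub> c \<in> {c \<in> carrier (free_module R X). ?\<pi> c \<in> N}"
      if "c \<in> {c \<in> carrier (free_module R X). ?\<pi> c \<in> N}" for c
      using that q(2)[of "\<ominus>\<^bsub>R\<^esub> \<one>\<^bsub>R\<^esub>" c, symmetric] NE(4)
      by (simp add: module_neg_eq[OF F.module_axioms])
    show "a \<oplus>\<^bsub>free_module R X\<^esub> b \<in> {c \<in> carrier (free_module R X). ?\<pi> c \<in> N}"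
      if "a \<in> {c \<in> carrier (free_module R X). ?\<pi> c \<in> N}" "b \<in> {c \<in> carrier (free_module R X). ?\<pi> c \<in> N}" for a b
      using that q(1)[of a b, symmetric] NE(5) by simp
    show "r \<odot>\<^bsub>free_module R X\<^esub> c \<in> {c \<in> carrier (free_module R X). ?\<pi> c \<in> N}"
      if "r \<in> carrier R" "c \<in> {c \<in> carrier (free_module R X). ?\<pi> c \<in> N}" for r c
      using that q(2)[of r c, symmetric] NE(4) by simp
  qed auto
  moreover have "free_gen R X x \<in> {c \<in> carrier (free_module R X). ?\<pi> c \<in> N}" if "x \<in> X" for x
    using gen[OF that] free_gen_mem[OF R that] by (simp add: pgen_def)
  ultimately have "carrier (free_module R X) \<subseteq> {c \<in> carrier (free_module R X). ?\<pi> c \<in> N}"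
    by (rule free_module_span[OF R])
  then show ?thesis by (auto simp: pres_def quot_carrier[OF F])
qed

text \<open>The set on which two linear maps agree is a submodule, so \<open>pres_span_gen\<close>
  applies to it.\<close>

lemma pres_hom_eqI:
  assumes "module R P" "h \<in> mod_hom R (pres R X S) P" "h' \<in> mod_hom R (pres R X S) P"
    and "\<And>x. x \<in> X \<Longrightarrow> h (pgen R X S x) = h' (pgen R X S x)"
  shows "h = h'"
proof (rule mod_hom_eqI[OF assms(2,3)])
  interpret Q: module R "pres R X S" by (rule pres_module)
  interpret P: module R P by fact
  note h = mod_hom_mem[OF assms(2)] mod_hom_add[OF assms(2)] mod_hom_smult[OF assms(2)]
    mod_hom_zero[OF Q.module_axioms assms(1,2)] mod_hom_neg[OF Q.module_axioms assms(1,2)]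
  note h' = mod_hom_mem[OF assms(3)] mod_hom_add[OF assms(3)] mod_hom_smult[OF assms(3)]
    mod_hom_zero[OF Q.module_axioms assms(1,3)] mod_hom_neg[OF Q.module_axioms assms(1,3)]
  have "submodule {z \<in> carrier (pres R X S). h z = h' z} R (pres R X S)"
    by (rule Q.submoduleI) (simp_all add: h h' subset_iff)
  then have "carrier (pres R X S) \<subseteq> {z \<in> carrier (pres R X S). h z = h' z}"
    by (rule pres_span_gen) (simp add: pgen_mem assms(4))
  then show "h z = h' z" if "z \<in> carrier (pres R X S)" for z using that by blast
qed

text \<open>The condition on relations is stated for every linear map \<open>h\<close> extending
  \<phi> to the free module, because the extension itself is only obtained inside the proof.\<close>

lemma pres_lift:
  assumes P: "module R P" and \<phi>: "\<And>x. x \<in> X \<Longrightarrow> \<phi> x \<in> carrier P"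
    and rel: "\<And>h z. h \<in> mod_hom R (free_module R X) P \<Longrightarrow> \<forall>x\<in>X. h (free_gen R X x) = \<phi> x \<Longrightarrow>
      z \<in> S \<Longrightarrow> h z = \<zero>\<^bsub>P\<^esub>"
  shows "\<exists>h\<in>mod_hom R (pres R X S) P. \<forall>x\<in>X. h (pgen R X S x) = \<phi> x"
proof -
  obtain h where h1: "h \<in> mod_hom R (free_module R X) P" and h2: "\<And>x. x \<in> X \<Longrightarrow> h (free_gen R X x) = \<phi> x"
    using free_lift[of R P X \<phi>, OF P \<phi>] by blast
  have h: "h \<in> mod_hom R (free_module R X) P" "\<forall>x\<in>X. h (free_gen R X x) = \<phi> x"
    using h1 h2 by auto
  have "mspan R (free_module R X) S \<subseteq> {z \<in> carrier (free_module R X). h z = \<zero>\<^bsub>P\<^esub>}"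
    using S rel[OF h]
    by (intro mspan_least mod_hom_kernel_submodule[OF F.module_axioms P h(1)]) auto
  then have "h z = \<zero>\<^bsub>P\<^esub>" if "z \<in> mspan R (free_module R X) S" for z using that by blast
  then obtain h' where h': "h' \<in> mod_hom R (pres R X S) P"
      "\<And>x. x \<in> carrier (free_module R X) \<Longrightarrow> h' (mspan R (free_module R X) S +>\<^bsub>free_module R X\<^esub> x) = h x"
    unfolding pres_def using quot_lift[OF F.module_axioms pres_span(1) P h(1)] by metis
  show ?thesis
    by (rule bexI[OF _ h'(1)]) (simp add: pgen_def h'(2) h(2) free_gen_mem[OF R])
qed

end

lemma module_minus_self_eq: "module R M \<Longrightarrow> x = y \<Longrightarrow> x \<in> carrier M \<Longrightarrow> x \<ominus>\<^bsub>M\<^esub> y = \<zero>\<^bsub>M\<^esub>"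
  by (simp add: module_def abelian_group.r_neg a_minus_def)

section \<open>Tensor products\<close>

lemma tensor_pres: "tensor R M N = pres R (carrier M \<times> carrier N) (tensor_rels R M N)"
  and tens_pgen: "tens R M N x y = pgen R (carrier M \<times> carrier N) (tensor_rels R M N) (x, y)"
  by (simp_all add: tensor_def tens_def pres_def pgen_def)

definition bilin :: "('r, 'z) ring_scheme \<Rightarrow> ('r, 'm) module \<Rightarrow> ('r, 'n) module \<Rightarrow> ('r, 'p) module \<Rightarrow>
    ('m \<Rightarrow> 'n \<Rightarrow> 'p) \<Rightarrow> bool" where
  "bilin R M N P b \<longleftrightarrow>
     (\<forall>x\<in>carrier M. \<forall>y\<in>carrier N. b x y \<in> carrier P) \<and>
     (\<forall>x\<in>carrier M. \<forall>x'\<in>carrier M. \<forall>y\<in>carrier N. b (x \<oplus>\<^bsub>M\<^esub> x') y = b x y \<oplus>\<^bsub>P\<^esub> b x' y) \<and>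
     (\<forall>x\<in>carrier M. \<forall>y\<in>carrier N. \<forall>y'\<in>carrier N. b x (y \<oplus>\<^bsub>N\<^esub> y') = b x y \<oplus>\<^bsub>P\<^esub> b x y') \<and>
     (\<forall>r\<in>carrier R. \<forall>x\<in>carrier M. \<forall>y\<in>carrier N. b (r \<odot>\<^bsub>M\<^esub> x) y = r \<odot>\<^bsub>P\<^esub> b x y) \<and>
     (\<forall>r\<in>carrier R. \<forall>x\<in>carrier M. \<forall>y\<in>carrier N. b x (r \<odot>\<^bsub>N\<^esub> y) = r \<odot>\<^bsub>P\<^esub> b x y)"

text \<open>Copies the definite description used in \<open>tmap\<close> and \<open>aug_map\<close>,
  so that these become instances of it and the existence and uniqueness proved in
  \<open>tensor_lift_ex1\<close> serve for all of them.\<close>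

definition tlift :: "('r, 'z) ring_scheme \<Rightarrow> ('r, 'm) module \<Rightarrow> ('r, 'n) module \<Rightarrow> ('r, 'p) module \<Rightarrow>
    ('m \<Rightarrow> 'n \<Rightarrow> 'p) \<Rightarrow> ('m \<times> 'n \<Rightarrow> 'r) set \<Rightarrow> 'p" where
  "tlift R M N P b = (THE h. h \<in> mod_hom R (tensor R M N) P \<and>
     (\<forall>x\<in>carrier M. \<forall>y\<in>carrier N. h (tens R M N x y) = b x y))"

context
  fixes R :: "('r, 'z) ring_scheme" and M :: "('r, 'm) module" and N :: "('r, 'n) module"
  assumes M: "module R M" and N: "module R N"
begin

interpretation M: module R M by (rule M)
interpretation N: module R N by (rule N)

lemma tensor_rels_subset: "tensor_rels R M N \<subseteq> carrier (free_module R (carrier M \<times> carrier N))"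
proof -
  interpret F: module R "free_module R (carrier M \<times> carrier N)"
    by (rule free_module_module[OF M.R.cring_axioms])
  have g: "free_gen R (carrier M \<times> carrier N) (x, y) \<in> carrier (free_module R (carrier M \<times> carrier N))"
    if "x \<in> carrier M" "y \<in> carrier N" for x y
    using that by (intro free_gen_mem M.R.cring_axioms) simp
  show ?thesis
    by (auto simp: tensor_rels_def Let_def g)
qed

lemmas tensor_rels_facts = M.R.cring_axioms tensor_rels_subset

lemma tensor_module: "module R (tensor R M N)"
  unfolding tensor_pres by (rule pres_module[OF tensor_rels_facts])

lemma tens_mem: "x \<in> carrier M \<Longrightarrow> y \<in> carrier N \<Longrightarrow> tens R M N x y \<in> carrier (tensor R M N)"
  unfolding tensor_pres tens_pgen by (rule pgen_mem[OF tensor_rels_facts]) simp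

lemma tens_add_l: "x \<in> carrier M \<Longrightarrow> x' \<in> carrier M \<Longrightarrow> y \<in> carrier N \<Longrightarrow>
    tens R M N (x \<oplus>\<^bsub>M\<^esub> x') y = tens R M N x y \<oplus>\<^bsub>tensor R M N\<^esub> tens R M N x' y"
  unfolding tensor_pres tens_pgen
  by (rule pres_rel_add[OF tensor_rels_facts]) (auto simp: tensor_rels_def Let_def)

lemma tens_add_r: "x \<in> carrier M \<Longrightarrow> y \<in> carrier N \<Longrightarrow> y' \<in> carrier N \<Longrightarrow>
    tens R M N x (y \<oplus>\<^bsub>N\<^esub> y') = tens R M N x y \<oplus>\<^bsub>tensor R M N\<^esub> tens R M N x y'"
  unfolding tensor_pres tens_pgen
  by (rule pres_rel_add[OF tensor_rels_facts]) (auto simp: tensor_rels_def Let_def)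

lemma tens_smult_l: "r \<in> carrier R \<Longrightarrow> x \<in> carrier M \<Longrightarrow> y \<in> carrier N \<Longrightarrow>
    tens R M N (r \<odot>\<^bsub>M\<^esub> x) y = r \<odot>\<^bsub>tensor R M N\<^esub> tens R M N x y"
  unfolding tensor_pres tens_pgen
  by (rule pres_rel_smult[OF tensor_rels_facts]) (auto simp: tensor_rels_def Let_def)

lemma tens_smult_r: "r \<in> carrier R \<Longrightarrow> x \<in> carrier M \<Longrightarrow> y \<in> carrier N \<Longrightarrow>
    tens R M N x (r \<odot>\<^bsub>N\<^esub> y) = r \<odot>\<^bsub>tensor R M N\<^esub> tens R M N x y"
  unfolding tensor_pres tens_pgen
  by (rule pres_rel_smult[OF tensor_rels_facts]) (auto simp: tensor_rels_def Let_def)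

lemma bilin_tens: "bilin R M N (tensor R M N) (tens R M N)"
  by (simp add: bilin_def tens_mem tens_add_l tens_add_r tens_smult_l tens_smult_r)

lemma tens_zero_l: "y \<in> carrier N \<Longrightarrow> tens R M N \<zero>\<^bsub>M\<^esub> y = \<zero>\<^bsub>tensor R M N\<^esub>"
  using tens_smult_l[of "\<zero>\<^bsub>R\<^esub>" "\<zero>\<^bsub>M\<^esub>" y] module.smult_l_null[OF tensor_module tens_mem] by simp

lemma tensor_hom_eqI:
  assumes "module R P" "h \<in> mod_hom R (tensor R M N) P" "h' \<in> mod_hom R (tensor R M N) P"
    and "\<And>x y. x \<in> carrier M \<Longrightarrow> y \<in> carrier N \<Longrightarrow> h (tens R M N x y) = h' (tens R M N x y)"
  shows "h = h'"
  using assms unfolding tensor_pres tens_pgen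
  by (intro pres_hom_eqI[OF tensor_rels_facts assms(1)]) auto

lemma tensor_lift_ex1:
  assumes P: "module R P" and b: "bilin R M N P b"
  shows "\<exists>!h. h \<in> mod_hom R (tensor R M N) P \<and>
    (\<forall>x\<in>carrier M. \<forall>y\<in>carrier N. h (tens R M N x y) = b x y)"
proof -
  interpret P: module R P by (rule P)
  let ?X = "carrier M \<times> carrier N"
  interpret F: module R "free_module R ?X"
    by (rule free_module_module[OF M.R.cring_axioms])
  have g: "free_gen R ?X (x, y) \<in> carrier (free_module R ?X)"
    if "x \<in> carrier M" "y \<in> carrier N" for x y
    using that by (intro free_gen_mem M.R.cring_axioms) simp
  note b' = b[unfolded bilin_def, THEN conjunct1, rule_format]
    b[unfolded bilin_def, THEN conjunct2, THEN conjunct1, rule_format]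
    b[unfolded bilin_def, THEN conjunct2, THEN conjunct2, THEN conjunct1, rule_format]
    b[unfolded bilin_def, THEN conjunct2, THEN conjunct2, THEN conjunct2, THEN conjunct1, rule_format]
    b[unfolded bilin_def, THEN conjunct2, THEN conjunct2, THEN conjunct2, THEN conjunct2, rule_format]
  have "\<exists>h. h \<in> mod_hom R (tensor R M N) P \<and>
    (\<forall>x\<in>carrier M. \<forall>y\<in>carrier N. h (tens R M N x y) = b x y)"
  proof -
    have rel: "h z = \<zero>\<^bsub>P\<^esub>" if h: "h \<in> mod_hom R (free_module R ?X) P"
      and gen: "\<forall>x\<in>?X. h (free_gen R ?X x) = (\<lambda>(x, y). b x y) x"
      and z: "z \<in> tensor_rels R M N" for h z
    proof -
      have gen': "h (free_gen R ?X (x, y)) = b x y" if "x \<in> carrier M" "y \<in> carrier N" for x y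
        using gen that by simp
      note hs = gen' g mod_hom_minus[OF F.module_axioms P h] mod_hom_add[OF h] mod_hom_smult[OF h]
        b' P.minus_eq P.r_neg
      show ?thesis using z unfolding tensor_rels_def Let_def by (auto simp: hs)
    qed
    have c: "(\<lambda>(x, y). b x y) x \<in> carrier P" if "x \<in> ?X" for x
      using that b'(1) by auto
    have "\<exists>h\<in>mod_hom R (pres R ?X (tensor_rels R M N)) P.
        \<forall>x\<in>?X. h (pgen R ?X (tensor_rels R M N) x) = (\<lambda>(x, y). b x y) x"
      by (rule pres_lift[OF tensor_rels_facts P, of "\<lambda>(x, y). b x y"]) (fact c, fact rel)
    then show ?thesis unfolding tensor_pres tens_pgen by auto
  qed
  then show ?thesis
    using tensor_hom_eqI[OF P] by (metis (no_types, lifting))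
qed

lemma tlift:
  assumes "module R P" "bilin R M N P b"
  shows "tlift R M N P b \<in> mod_hom R (tensor R M N) P"
    and "x \<in> carrier M \<Longrightarrow> y \<in> carrier N \<Longrightarrow> tlift R M N P b (tens R M N x y) = b x y"
  using theI'[OF tensor_lift_ex1[OF assms]] unfolding tlift_def by blast+

text \<open>Pure tensors absorb scalars, so sums of pure tensors already form a submodule.\<close>

lemma tensor_induct [consumes 1, case_names tens add]:
  assumes "t \<in> carrier (tensor R M N)"
    and tens: "\<And>x y. x \<in> carrier M \<Longrightarrow> y \<in> carrier N \<Longrightarrow> Q (tens R M N x y)"
    and add: "\<And>s t. s \<in> carrier (tensor R M N) \<Longrightarrow> t \<in> carrier (tensor R M N) \<Longrightarrow> Q s \<Longrightarrow> Q t \<Longrightarrow>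
      Q (s \<oplus>\<^bsub>tensor R M N\<^esub> t)"
  shows "Q t"
proof -
  interpret T: module R "tensor R M N" by (rule tensor_module)
  let ?N = "{t \<in> carrier (tensor R M N). Q t \<and> (\<forall>r\<in>carrier R. Q (r \<odot>\<^bsub>tensor R M N\<^esub> t))}"
  have z: "Q \<zero>\<^bsub>tensor R M N\<^esub>" using tens[OF M.zero_closed N.zero_closed] tens_zero_l by simp
  have "submodule ?N R (tensor R M N)"
  proof (rule T.submoduleI)
    show "\<ominus>\<^bsub>tensor R M N\<^esub> a \<in> ?N" if "a \<in> ?N" for a
      using that by (simp add: module_neg_eq[OF T.module_axioms] T.smult_assoc1[symmetric])
    show "a \<oplus>\<^bsub>tensor R M N\<^esub> b \<in> ?N" if "a \<in> ?N" "b \<in> ?N" for a b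
      using that add by (simp add: T.smult_r_distr)
    show "r \<odot>\<^bsub>tensor R M N\<^esub> a \<in> ?N" if "r \<in> carrier R" "a \<in> ?N" for r a
      using that by (simp add: T.smult_assoc1[symmetric])
  qed (auto simp: z)
  then have "carrier (tensor R M N) \<subseteq> ?N"
    unfolding tensor_pres
  proof (rule pres_span_gen[OF tensor_rels_facts])
    fix p assume "p \<in> carrier M \<times> carrier N"
    then obtain x y where p: "p = (x, y)" "x \<in> carrier M" "y \<in> carrier N" by auto
    have "tens R M N x y \<in> ?N"
      using p tens tens_smult_l[symmetric] by (simp add: tens_mem)
    then show "pgen R (carrier M \<times> carrier N) (tensor_rels R M N) p \<in>
      {t \<in> carrier (pres R (carrier M \<times> carrier N) (tensor_rels R M N)). Q t \<and>
       (\<forall>r\<in>carrier R. Q (r \<odot>\<^bsub>pres R (carrier M \<times> carrier N) (tensor_rels R M N)\<^esub> t))}"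
      by (simp add: p tensor_pres tens_pgen)
  qed
  then show ?thesis using assms(1) by blast
qed

end

lemma bilinI:
  assumes "\<And>x y. x \<in> carrier M \<Longrightarrow> y \<in> carrier N \<Longrightarrow> b x y \<in> carrier P"
    "\<And>x x' y. x \<in> carrier M \<Longrightarrow> x' \<in> carrier M \<Longrightarrow> y \<in> carrier N \<Longrightarrow> b (x \<oplus>\<^bsub>M\<^esub> x') y = b x y \<oplus>\<^bsub>P\<^esub> b x' y"
    "\<And>x y y'. x \<in> carrier M \<Longrightarrow> y \<in> carrier N \<Longrightarrow> y' \<in> carrier N \<Longrightarrow> b x (y \<oplus>\<^bsub>N\<^esub> y') = b x y \<oplus>\<^bsub>P\<^esub> b x y'"
    "\<And>r x y. r \<in> carrier R \<Longrightarrow> x \<in> carrier M \<Longrightarrow> y \<in> carrier N \<Longrightarrow> b (r \<odot>\<^bsub>M\<^esub> x) y = r \<odot>\<^bsub>P\<^esub> b x y"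
    "\<And>r x y. r \<in> carrier R \<Longrightarrow> x \<in> carrier M \<Longrightarrow> y \<in> carrier N \<Longrightarrow> b x (r \<odot>\<^bsub>N\<^esub> y) = r \<odot>\<^bsub>P\<^esub> b x y"
  shows "bilin R M N P b"
  using assms by (simp add: bilin_def)

lemma bilinD:
  assumes "bilin R M N P b"
  shows "\<And>x y. x \<in> carrier M \<Longrightarrow> y \<in> carrier N \<Longrightarrow> b x y \<in> carrier P"
    "\<And>x x' y. x \<in> carrier M \<Longrightarrow> x' \<in> carrier M \<Longrightarrow> y \<in> carrier N \<Longrightarrow> b (x \<oplus>\<^bsub>M\<^esub> x') y = b x y \<oplus>\<^bsub>P\<^esub> b x' y"
    "\<And>x y y'. x \<in> carrier M \<Longrightarrow> y \<in> carrier N \<Longrightarrow> y' \<in> carrier N \<Longrightarrow> b x (y \<oplus>\<^bsub>N\<^esub> y') = b x y \<oplus>\<^bsub>P\<^esub> b x y'"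
    "\<And>r x y. r \<in> carrier R \<Longrightarrow> x \<in> carrier M \<Longrightarrow> y \<in> carrier N \<Longrightarrow> b (r \<odot>\<^bsub>M\<^esub> x) y = r \<odot>\<^bsub>P\<^esub> b x y"
    "\<And>r x y. r \<in> carrier R \<Longrightarrow> x \<in> carrier M \<Longrightarrow> y \<in> carrier N \<Longrightarrow> b x (r \<odot>\<^bsub>N\<^esub> y) = r \<odot>\<^bsub>P\<^esub> b x y"
  using assms by (simp_all add: bilin_def)

text \<open>Unlike mod_hom this does not ask for an extensional map, so it applies to plain abstractions.\<close>

definition lin :: "('r, 'z) ring_scheme \<Rightarrow> ('r, 'm) module \<Rightarrow> ('r, 'n) module \<Rightarrow> ('m \<Rightarrow> 'n) \<Rightarrow> bool" where
  "lin R M N f \<longleftrightarrow> (\<forall>x\<in>carrier M. f x \<in> carrier N) \<and>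
     (\<forall>x\<in>carrier M. \<forall>y\<in>carrier M. f (x \<oplus>\<^bsub>M\<^esub> y) = f x \<oplus>\<^bsub>N\<^esub> f y) \<and>
     (\<forall>r\<in>carrier R. \<forall>x\<in>carrier M. f (r \<odot>\<^bsub>M\<^esub> x) = r \<odot>\<^bsub>N\<^esub> f x)"

lemma linI:
  assumes "\<And>x. x \<in> carrier M \<Longrightarrow> f x \<in> carrier N"
    "\<And>x y. x \<in> carrier M \<Longrightarrow> y \<in> carrier M \<Longrightarrow> f (x \<oplus>\<^bsub>M\<^esub> y) = f x \<oplus>\<^bsub>N\<^esub> f y"
    "\<And>r x. r \<in> carrier R \<Longrightarrow> x \<in> carrier M \<Longrightarrow> f (r \<odot>\<^bsub>M\<^esub> x) = r \<odot>\<^bsub>N\<^esub> f x"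
  shows "lin R M N f"
  using assms by (simp add: lin_def)

lemma linD:
  assumes "lin R M N f"
  shows "\<And>x. x \<in> carrier M \<Longrightarrow> f x \<in> carrier N"
    "\<And>x y. x \<in> carrier M \<Longrightarrow> y \<in> carrier M \<Longrightarrow> f (x \<oplus>\<^bsub>M\<^esub> y) = f x \<oplus>\<^bsub>N\<^esub> f y"
    "\<And>r x. r \<in> carrier R \<Longrightarrow> x \<in> carrier M \<Longrightarrow> f (r \<odot>\<^bsub>M\<^esub> x) = r \<odot>\<^bsub>N\<^esub> f x"
  using assms by (simp_all add: lin_def)

lemma mod_hom_lin: "f \<in> mod_hom R M N \<Longrightarrow> lin R M N f"
  by (simp add: lin_def mod_hom_mem mod_hom_add mod_hom_smult)

lemma lin_id: "lin R M M (\<lambda>x. x)"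
  by (simp add: lin_def)

lemma tmap_tlift: "tmap R M N M' N' f g = tlift R M N (tensor R M' N') (\<lambda>x y. tens R M' N' (f x) (g y))"
  by (simp add: tmap_def tlift_def)

lemma tmap:
  assumes "module R M" "module R N" "module R M'" "module R N'" "lin R M M' f" "lin R N N' g"
  shows "tmap R M N M' N' f g \<in> mod_hom R (tensor R M N) (tensor R M' N')"
    and "x \<in> carrier M \<Longrightarrow> y \<in> carrier N \<Longrightarrow>
      tmap R M N M' N' f g (tens R M N x y) = tens R M' N' (f x) (g y)"
proof -
  have b: "bilin R M N (tensor R M' N') (\<lambda>x y. tens R M' N' (f x) (g y))"
    using linD[OF assms(5)] linD[OF assms(6)] bilinD[OF bilin_tens[OF assms(3,4)]]
    by (intro bilinI) simp_all
  note T = tlift[OF assms(1,2) tensor_module[OF assms(3,4)] b]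
  show "tmap R M N M' N' f g \<in> mod_hom R (tensor R M N) (tensor R M' N')"
    "x \<in> carrier M \<Longrightarrow> y \<in> carrier N \<Longrightarrow> tmap R M N M' N' f g (tens R M N x y) = tens R M' N' (f x) (g y)"
    unfolding tmap_tlift by (rule T; assumption)+
qed

lemma lin_restrict: "module R M \<Longrightarrow> lin R M N f \<Longrightarrow> (\<lambda>x\<in>carrier M. f x) \<in> mod_hom R M N"
  by (rule mod_hom_restrict) (auto dest: linD)

lemma lin_zero: "module R M \<Longrightarrow> module R N \<Longrightarrow> lin R M N f \<Longrightarrow> f \<zero>\<^bsub>M\<^esub> = \<zero>\<^bsub>N\<^esub>"
  using mod_hom_zero[of R M N "\<lambda>x\<in>carrier M. f x"] lin_restrict[of R M N f]
  by (simp add: module_def abelian_groupE(2))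

lemma lin_neg: "module R M \<Longrightarrow> module R N \<Longrightarrow> lin R M N f \<Longrightarrow> x \<in> carrier M \<Longrightarrow> f (\<ominus>\<^bsub>M\<^esub> x) = \<ominus>\<^bsub>N\<^esub> f x"
  using mod_hom_neg[of R M N "\<lambda>x\<in>carrier M. f x" x] lin_restrict[of R M N f]
  by (simp add: module_def abelian_group.a_inv_closed)

lemma lin_minus:
  assumes "module R M" "module R N" "lin R M N f" "x \<in> carrier M" "y \<in> carrier M"
  shows "f (x \<ominus>\<^bsub>M\<^esub> y) = f x \<ominus>\<^bsub>N\<^esub> f y"
  using mod_hom_minus[OF assms(1,2) lin_restrict[OF assms(1,3)] assms(4,5)] assms
  by (simp add: module_def abelian_group.minus_closed)

lemma lin_finsum:
  assumes "module R M" "module R N" "lin R M N f" "finite I" "g \<in> I \<rightarrow> carrier M"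
  shows "f (finsum M g I) = finsum N (\<lambda>i. f (g i)) I"
proof -
  interpret M: module R M by fact
  interpret N: module R N by fact
  have "f (finsum M g I) = finsum N (\<lambda>i. (\<lambda>x\<in>carrier M. f x) (g i)) I"
    using mod_hom_finsum[OF assms(1,2) lin_restrict[OF assms(1,3)] assms(4,5)] M.finsum_closed[OF assms(5)] by simp
  also have "\<dots> = finsum N (\<lambda>i. f (g i)) I"
    using assms(5) linD(1)[OF assms(3)] by (intro N.finsum_cong') auto
  finally show ?thesis .
qed

lemma lin_comp: "lin R N P g \<Longrightarrow> lin R M N f \<Longrightarrow> lin R M P (\<lambda>x. g (f x))"
  by (simp add: lin_def)

lemma ksign_mem: "module R M \<Longrightarrow> x \<in> carrier M \<Longrightarrow> ksign M d x \<in> carrier M"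
  by (simp add: ksign_def module_def abelian_group.a_inv_closed)

lemma ksign_lin: "module R M \<Longrightarrow> lin R M M (ksign M d)"
proof -
  assume M: "module R M"
  then interpret M: module R M .
  show ?thesis
    by (rule linI) (auto simp: ksign_def M.smult_r_minus M.minus_add)
qed

lemma lin_ksign: "module R M \<Longrightarrow> module R N \<Longrightarrow> lin R M N f \<Longrightarrow> x \<in> carrier M \<Longrightarrow> f (ksign M d x) = ksign N d (f x)"
  by (simp add: ksign_def lin_neg)

section \<open>Words and multilinear functions\<close>

text \<open>Unlike \<open>words\<close>, no length and no degree is fixed, so words can be cut and
  concatenated freely; \<open>words_iff\<close> restores both numbers when a component of a tensor
  power is needed.\<close>

definition wset :: "(int \<Rightarrow> ('r, 'm) module) \<Rightarrow> (int \<times> 'm) list set" where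
  "wset M = {w. \<forall>(i, x)\<in>set w. x \<in> carrier (M i)}"

lemma wset_simps [simp]:
  "[] \<in> wset M"
  "(i, x) # w \<in> wset M \<longleftrightarrow> x \<in> carrier (M i) \<and> w \<in> wset M"
  "u @ v \<in> wset M \<longleftrightarrow> u \<in> wset M \<and> v \<in> wset M"
  by (auto simp: wset_def)

lemma wset_take: "w \<in> wset M \<Longrightarrow> take j w \<in> wset M"
  and wset_drop: "w \<in> wset M \<Longrightarrow> drop j w \<in> wset M"
  by (auto simp: wset_def dest: in_set_takeD in_set_dropD)

lemma wdeg_simps [simp]:
  "wdeg [] = 0"
  "wdeg (p # w) = fst p + wdeg w"
  "wdeg (u @ v) = wdeg u + wdeg v"
  by (simp_all add: wdeg_def)

lemma words_iff: "w \<in> words M n m \<longleftrightarrow> w \<in> wset M \<and> length w = n \<and> wdeg w = m"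
  by (auto simp: words_def wset_def)

text \<open>The target depends on the degree of the word. The degree is written
  \<open>wdeg u + (i + wdeg v)\<close> because this is what simplification makes of the degree of
  \<open>u @ (i, x) # v\<close>.\<close>

definition mlin :: "('r, 'z) ring_scheme \<Rightarrow> (int \<Rightarrow> ('r, 'm) module) \<Rightarrow> (int \<Rightarrow> ('r, 'p) module) \<Rightarrow> nat \<Rightarrow>
    ((int \<times> 'm) list \<Rightarrow> 'p) \<Rightarrow> bool" where
  "mlin R M P n g \<longleftrightarrow>
     (\<forall>w\<in>wset M. length w = n \<longrightarrow> g w \<in> carrier (P (wdeg w))) \<and>
     (\<forall>u v i. u \<in> wset M \<longrightarrow> v \<in> wset M \<longrightarrow> Suc (length u + length v) = n \<longrightarrow>
        lin R (M i) (P (wdeg u + (i + wdeg v))) (\<lambda>x. g (u @ (i, x) # v)))"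

lemma mlinI:
  assumes "\<And>w. w \<in> wset M \<Longrightarrow> length w = n \<Longrightarrow> g w \<in> carrier (P (wdeg w))"
    and "\<And>u v i. u \<in> wset M \<Longrightarrow> v \<in> wset M \<Longrightarrow> Suc (length u + length v) = n \<Longrightarrow>
      lin R (M i) (P (wdeg u + (i + wdeg v))) (\<lambda>x. g (u @ (i, x) # v))"
  shows "mlin R M P n g"
  using assms unfolding mlin_def by blast

lemma mlin_mem: "mlin R M P n g \<Longrightarrow> w \<in> wset M \<Longrightarrow> length w = n \<Longrightarrow> g w \<in> carrier (P (wdeg w))"
  by (auto simp: mlin_def)

lemma mlin_lin: "mlin R M P n g \<Longrightarrow> u \<in> wset M \<Longrightarrow> v \<in> wset M \<Longrightarrow> Suc (length u + length v) = n \<Longrightarrow>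
    lin R (M i) (P (wdeg u + (i + wdeg v))) (\<lambda>x. g (u @ (i, x) # v))"
  by (simp add: mlin_def)

lemma tpow_pres: "tpow R M n m = pres R (words M n m) (tpow_rels R M n m)"
  and pure_pgen: "pure R M w = pgen R (words M (length w) (wdeg w)) (tpow_rels R M (length w) (wdeg w)) w"
  by (simp_all add: tpow_def pure_def pres_def pgen_def)

context
  fixes R :: "('r, 'z) ring_scheme" and M :: "int \<Rightarrow> ('r, 'm) module"
  assumes R: "cring R" and M: "\<And>i. module R (M i)"
begin

lemma tpow_rels_subset: "tpow_rels R M n m \<subseteq> carrier (free_module R (words M n m))"
proof -
  interpret F: module R "free_module R (words M n m)" by (rule free_module_module[OF R])
  let ?X = "words M n m"
  note g = free_gen_mem[OF R, of _ ?X]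
  show ?thesis
  proof
    fix z assume "z \<in> tpow_rels R M n m"
    then consider (add) u v i x y where "u @ (i, x) # v \<in> ?X" "y \<in> carrier (M i)"
        "z = free_gen R ?X (u @ (i, x \<oplus>\<^bsub>M i\<^esub> y) # v) \<ominus>\<^bsub>free_module R ?X\<^esub>
          (free_gen R ?X (u @ (i, x) # v) \<oplus>\<^bsub>free_module R ?X\<^esub> free_gen R ?X (u @ (i, y) # v))"
      | (smult) u v i r x where "u @ (i, x) # v \<in> ?X" "r \<in> carrier R"
        "z = free_gen R ?X (u @ (i, r \<odot>\<^bsub>M i\<^esub> x) # v) \<ominus>\<^bsub>free_module R ?X\<^esub>
          (r \<odot>\<^bsub>free_module R ?X\<^esub> free_gen R ?X (u @ (i, x) # v))"
      unfolding tpow_rels_def Let_def by blast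
    then show "z \<in> carrier (free_module R ?X)"
    proof cases
      case add
      interpret Mi: module R "M i" by (rule M)
      have "u @ (i, x \<oplus>\<^bsub>M i\<^esub> y) # v \<in> ?X" "u @ (i, y) # v \<in> ?X"
        using add(1,2) by (auto simp: words_iff)
      then show ?thesis unfolding add(3) by (intro F.minus_closed F.a_closed g add(1))
    next
      case smult
      interpret Mi: module R "M i" by (rule M)
      have "u @ (i, r \<odot>\<^bsub>M i\<^esub> x) # v \<in> ?X"
        using smult(1,2) by (auto simp: words_iff)
      then show ?thesis unfolding smult(3) by (intro F.minus_closed F.smult_closed g smult(1,2))
    qed
  qed
qed

lemmas tpow_rels_facts = R tpow_rels_subset

lemma tpow_module: "module R (tpow R M n m)"
  unfolding tpow_pres by (rule pres_module[OF tpow_rels_facts])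

lemma pure_mem: "w \<in> wset M \<Longrightarrow> pure R M w \<in> carrier (tpow R M (length w) (wdeg w))"
  unfolding tpow_pres pure_pgen by (rule pgen_mem[OF tpow_rels_facts]) (simp add: words_iff)

lemma mlin_pure: "mlin R M (tpow R M n) n (pure R M)"
proof (rule mlinI)
  show "pure R M w \<in> carrier (tpow R M n (wdeg w))" if "w \<in> wset M" "length w = n" for w
    using pure_mem[OF that(1)] that(2) by simp
  fix u v i assume u: "u \<in> wset M" and v: "v \<in> wset M" and n: "Suc (length u + length v) = n"
  let ?m = "wdeg u + (i + wdeg v)"
  interpret Mi: module R "M i" by (rule M)
  have p: "pure R M (u @ (i, x) # v) = pgen R (words M n ?m) (tpow_rels R M n ?m) (u @ (i, x) # v)" for x
    unfolding pure_pgen by (simp add: n)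
  have w: "u @ (i, x) # v \<in> words M n ?m" if "x \<in> carrier (M i)" for x
    using that u v n by (simp add: words_iff)
  show "lin R (M i) (tpow R M n ?m) (\<lambda>x. pure R M (u @ (i, x) # v))"
  proof (rule linI)
    show "pure R M (u @ (i, x) # v) \<in> carrier (tpow R M n ?m)" if "x \<in> carrier (M i)" for x
      unfolding p tpow_pres by (rule pgen_mem[OF tpow_rels_facts w[OF that]])
    show "pure R M (u @ (i, x \<oplus>\<^bsub>M i\<^esub> y) # v) =
        pure R M (u @ (i, x) # v) \<oplus>\<^bsub>tpow R M n ?m\<^esub> pure R M (u @ (i, y) # v)"
      if xy: "x \<in> carrier (M i)" "y \<in> carrier (M i)" for x y
      unfolding p tpow_pres
    proof (rule pres_rel_add[OF tpow_rels_facts _ w w w])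
      show "free_gen R (words M n ?m) (u @ (i, x \<oplus>\<^bsub>M i\<^esub> y) # v) \<ominus>\<^bsub>free_module R (words M n ?m)\<^esub>
          (free_gen R (words M n ?m) (u @ (i, x) # v) \<oplus>\<^bsub>free_module R (words M n ?m)\<^esub>
           free_gen R (words M n ?m) (u @ (i, y) # v)) \<in> tpow_rels R M n ?m"
        unfolding tpow_rels_def Let_def using w[OF xy(1)] xy(2) by blast
    qed (use xy in auto)
    show "pure R M (u @ (i, r \<odot>\<^bsub>M i\<^esub> x) # v) = r \<odot>\<^bsub>tpow R M n ?m\<^esub> pure R M (u @ (i, x) # v)"
      if r: "r \<in> carrier R" and x: "x \<in> carrier (M i)" for r x
      unfolding p tpow_pres
    proof (rule pres_rel_smult[OF tpow_rels_facts _ w w r])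
      show "free_gen R (words M n ?m) (u @ (i, r \<odot>\<^bsub>M i\<^esub> x) # v) \<ominus>\<^bsub>free_module R (words M n ?m)\<^esub>
          (r \<odot>\<^bsub>free_module R (words M n ?m)\<^esub> free_gen R (words M n ?m) (u @ (i, x) # v))
          \<in> tpow_rels R M n ?m"
        unfolding tpow_rels_def Let_def using w[OF x] r by blast
    qed (use r x in auto)
  qed
qed

lemma tpow_hom_eqI:
  assumes "module R P" "h \<in> mod_hom R (tpow R M n m) P" "h' \<in> mod_hom R (tpow R M n m) P"
    and "\<And>w. w \<in> words M n m \<Longrightarrow> h (pure R M w) = h' (pure R M w)"
  shows "h = h'"
proof -
  have "h (pgen R (words M n m) (tpow_rels R M n m) w) = h' (pgen R (words M n m) (tpow_rels R M n m) w)"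
    if "w \<in> words M n m" for w
    using assms(4)[OF that] that by (simp add: pure_pgen words_iff)
  then show ?thesis
    using assms(2,3) unfolding tpow_pres by (intro pres_hom_eqI[OF tpow_rels_facts assms(1)])
qed

text \<open>The two families in \<open>tpow_rels\<close> are additivity and homogeneity in a single
  letter, which is what \<open>mlin\<close> provides; hence the linear extension of \<open>g\<close>
  to the free module kills the relations.\<close>

lemma tpow_lift_ex1:
  assumes P: "module R (P m)" and g: "mlin R M P n g"
  shows "\<exists>!h. h \<in> mod_hom R (tpow R M n m) (P m) \<and> (\<forall>w\<in>words M n m. h (pure R M w) = g w)"
proof -
  interpret P: module R "P m" by (rule P)
  let ?X = "words M n m"
  interpret F: module R "free_module R ?X" by (rule free_module_module[OF R])
  have c: "g w \<in> carrier (P m)" if "w \<in> ?X" for w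
    using that mlin_mem[OF g, of w] by (simp add: words_iff)
  have rel: "h z = \<zero>\<^bsub>P m\<^esub>" if h: "h \<in> mod_hom R (free_module R ?X) (P m)"
    and gen: "\<forall>x\<in>?X. h (free_gen R ?X x) = g x" and z: "z \<in> tpow_rels R M n m" for h z
  proof -
    note hs = mod_hom_minus[OF F.module_axioms P h] mod_hom_add[OF h] mod_hom_smult[OF h]
    from z consider (add) u v i x y where "u @ (i, x) # v \<in> ?X" "y \<in> carrier (M i)"
        "z = free_gen R ?X (u @ (i, x \<oplus>\<^bsub>M i\<^esub> y) # v) \<ominus>\<^bsub>free_module R ?X\<^esub>
          (free_gen R ?X (u @ (i, x) # v) \<oplus>\<^bsub>free_module R ?X\<^esub> free_gen R ?X (u @ (i, y) # v))"
      | (smult) u v i r x where "u @ (i, x) # v \<in> ?X" "r \<in> carrier R"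
        "z = free_gen R ?X (u @ (i, r \<odot>\<^bsub>M i\<^esub> x) # v) \<ominus>\<^bsub>free_module R ?X\<^esub>
          (r \<odot>\<^bsub>free_module R ?X\<^esub> free_gen R ?X (u @ (i, x) # v))"
      unfolding tpow_rels_def Let_def by blast
    then show ?thesis
    proof cases
      case add
      interpret Mi: module R "M i" by (rule M)
      have w: "u @ (i, x \<oplus>\<^bsub>M i\<^esub> y) # v \<in> ?X" "u @ (i, y) # v \<in> ?X"
        using add(1,2) by (auto simp: words_iff)
      have "lin R (M i) (P m) (\<lambda>x. g (u @ (i, x) # v))"
        using mlin_lin[OF g, of u v i] add(1) by (simp add: words_iff)
      from linD(2)[OF this, of x y] show ?thesis
        using add w c gen by (simp add: hs free_gen_mem[OF R] words_iff P.minus_eq P.r_neg)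
    next
      case smult
      interpret Mi: module R "M i" by (rule M)
      have w: "u @ (i, r \<odot>\<^bsub>M i\<^esub> x) # v \<in> ?X"
        using smult(1,2) by (auto simp: words_iff)
      have "lin R (M i) (P m) (\<lambda>x. g (u @ (i, x) # v))"
        using mlin_lin[OF g, of u v i] smult(1) by (simp add: words_iff)
      from linD(3)[OF this, of r x] show ?thesis
        using smult w c gen by (simp add: hs free_gen_mem[OF R] words_iff P.minus_eq P.r_neg)
    qed
  qed
  obtain h where h: "h \<in> mod_hom R (tpow R M n m) (P m)" "\<forall>w\<in>words M n m. h (pure R M w) = g w"
    using pres_lift[OF tpow_rels_facts P, of n m g] c rel
    unfolding tpow_pres pure_pgen by (auto simp: words_iff)
  show ?thesis
    using h by (intro ex1I[of _ h]) (auto intro!: tpow_hom_eqI[OF P])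
qed

end

section \<open>Cochains as multilinear functions\<close>

lemma susp_module: "(\<And>i. module R (A i)) \<Longrightarrow> module R (susp A i)"
  by (simp add: susp_def)

lemma CC_mem_iff: "f \<in> carrier (CC R A B d) \<longleftrightarrow> f \<in> extensional {1..} \<and>
    (\<forall>n\<ge>1. \<forall>m. f n m \<in> mod_hom R (tpow R (susp A) n m) (susp B (m + d)))"
  by (auto simp: CC_def CCn_def ghom_def prod_module_simps hom_module_simps PiE_def Pi_def)

lemma CC_memD: "f \<in> carrier (CC R A B d) \<Longrightarrow> 1 \<le> n \<Longrightarrow>
    f n m \<in> mod_hom R (tpow R (susp A) n m) (susp B (m + d))"
  by (simp add: CC_mem_iff)

lemma CCn_module:
  assumes "cring R" "\<And>i. module R (A i)" "\<And>i. module R (B i)"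
  shows "module R (CCn R A B n d)"
  unfolding CCn_def ghom_def using assms
  by (intro prod_module_module hom_module_module tpow_module susp_module)

lemma CC_module:
  assumes "cring R" "\<And>i. module R (A i)" "\<And>i. module R (B i)"
  shows "module R (CC R A B d)"
  unfolding CC_def using assms by (intro prod_module_module CCn_module)

text \<open>Inverse to \<open>ev\<close> on multilinear functions. Cochains have no component of
  arity 0, which is why the empty word is excluded in the statements about
  \<open>ev\<close>.\<close>

definition cc_of :: "('r, 'z) ring_scheme \<Rightarrow> (int \<Rightarrow> ('r, 'a) module) \<Rightarrow> (int \<Rightarrow> ('r, 'b) module) \<Rightarrow> int \<Rightarrow>
    ((int \<times> 'a) list \<Rightarrow> 'b) \<Rightarrow> ('r, 'a, 'b) cochain" where
  "cc_of R A B d g = (\<lambda>n\<in>{1..}. \<lambda>m. THE h. h \<in> mod_hom R (tpow R (susp A) n m) (susp B (m + d)) \<and>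
     (\<forall>w\<in>words (susp A) n m. h (pure R (susp A) w) = g w))"

definition cmlin :: "('r, 'z) ring_scheme \<Rightarrow> (int \<Rightarrow> ('r, 'a) module) \<Rightarrow> (int \<Rightarrow> ('r, 'b) module) \<Rightarrow> int \<Rightarrow>
    ((int \<times> 'a) list \<Rightarrow> 'b) \<Rightarrow> bool" where
  "cmlin R A B d g \<longleftrightarrow> (\<forall>n\<ge>1. mlin R (susp A) (\<lambda>m. susp B (m + d)) n g)"

context
  fixes R :: "('r, 'z) ring_scheme" and A :: "int \<Rightarrow> ('r, 'a) module" and B :: "int \<Rightarrow> ('r, 'b) module"
  assumes R: "cring R" and A: "\<And>i. module R (A i)" and B: "\<And>i. module R (B i)"
begin

lemmas sA = susp_module[of R A, OF A]
lemmas sB = susp_module[of R B, OF B]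

lemma cmlin_ev: 
  assumes f: "f \<in> carrier (CC R A B d)"
  shows "cmlin R A B d (ev R A f)"
  unfolding cmlin_def
proof (intro allI impI)
  fix n :: nat assume n: "n \<ge> 1"
  note p = mlin_pure[OF R sA, where n = n]
  have fl: "lin R (tpow R (susp A) n m) (susp B (m + d)) (f n m)" for m
    by (rule mod_hom_lin[OF CC_memD[OF f n]])
  show "mlin R (susp A) (\<lambda>m. susp B (m + d)) n (ev R A f)"
  proof (rule mlinI)
    show "ev R A f w \<in> carrier (susp B (wdeg w + d))" if "w \<in> wset (susp A)" "length w = n" for w
      using linD(1)[OF fl mlin_mem[OF p that]] that(2) by (simp add: ev_def)
    fix u v i assume uv: "u \<in> wset (susp A)" "v \<in> wset (susp A)" "Suc (length u + length v) = n"
    show "lin R (susp A i) (susp B (wdeg u + (i + wdeg v) + d)) (\<lambda>x. ev R A f (u @ (i, x) # v))"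
      using lin_comp[OF fl mlin_lin[OF p uv, of i]] uv(3) by (simp add: ev_def)
  qed
qed

text \<open>Words generate each tensor power and cochains are extensional in the arity, so nothing
  beyond the values on nonempty words has to be compared.\<close>

lemma CC_eqI:
  assumes f: "f \<in> carrier (CC R A B d)" and g: "g \<in> carrier (CC R A B d)"
    and eq: "\<And>w. w \<in> wset (susp A) \<Longrightarrow> w \<noteq> [] \<Longrightarrow> ev R A f w = ev R A g w"
  shows "f = g"
proof (rule extensionalityI[of _ "{1..}"])
  fix n :: nat assume "n \<in> {1..}"
  then have n: "1 \<le> n" by simp
  show "f n = g n"
  proof
    fix m
    show "f n m = g n m"
    proof (rule tpow_hom_eqI[OF R sA sB CC_memD[OF f n] CC_memD[OF g n]])
      show "f n m (pure R (susp A) w) = g n m (pure R (susp A) w)" if "w \<in> words (susp A) n m" for w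
        using eq[of w] that n by (cases w) (auto simp: ev_def words_iff)
    qed
  qed
qed (use f g in \<open>auto simp: CC_mem_iff\<close>)

lemma cc_of:
  assumes g: "cmlin R A B d g"
  shows "cc_of R A B d g \<in> carrier (CC R A B d)"
    and "w \<in> wset (susp A) \<Longrightarrow> w \<noteq> [] \<Longrightarrow> ev R A (cc_of R A B d g) w = g w"
proof -
  have h: "cc_of R A B d g n m \<in> mod_hom R (tpow R (susp A) n m) (susp B (m + d)) \<and>
     (\<forall>w\<in>words (susp A) n m. cc_of R A B d g n m (pure R (susp A) w) = g w)" if n: "1 \<le> n" for n m
    using theI'[OF tpow_lift_ex1[OF R sA, where P = "\<lambda>m. susp B (m + d)" and m = m and n = n and g = g, OF sB]] g n
    by (simp add: cc_of_def cmlin_def)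
  then show "cc_of R A B d g \<in> carrier (CC R A B d)"
    by (simp add: CC_mem_iff) (simp add: cc_of_def)
  show "ev R A (cc_of R A B d g) w = g w" if "w \<in> wset (susp A)" "w \<noteq> []"
    using h[of "length w" "wdeg w"] that by (cases w) (auto simp: ev_def words_iff)
qed

lemma ev_lin:
  assumes w: "w \<in> wset (susp A)" "w \<noteq> []"
  shows "lin R (CC R A B d) (susp B (wdeg w + d)) (\<lambda>f. ev R A f w)"
proof -
  have n: "1 \<le> length w" using w(2) by (cases w) auto
  have p: "pure R (susp A) w \<in> carrier (tpow R (susp A) (length w) (wdeg w))"
    by (rule pure_mem[OF R sA w(1)])
  show ?thesis
  proof (rule linI)
    show "ev R A f w \<in> carrier (susp B (wdeg w + d))" if "f \<in> carrier (CC R A B d)" for f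
      unfolding ev_def by (rule mod_hom_mem[OF CC_memD[OF that n] p])
  qed (use n p in \<open>simp_all add: ev_def CC_def CCn_def ghom_def prod_module_simps hom_module_simps\<close>)
qed

lemma ev_mem: "f \<in> carrier (CC R A B d) \<Longrightarrow> w \<in> wset (susp A) \<Longrightarrow> w \<noteq> [] \<Longrightarrow>
    ev R A f w \<in> carrier (susp B (wdeg w + d))"
  by (rule linD(1)[OF ev_lin])

text \<open>Linearity in one letter for a fixed cochain, as opposed to \<open>ev_lin\<close>, which
  is linearity in the cochain for a fixed word.\<close>

lemma ev_slot_lin:
  assumes "f \<in> carrier (CC R A B d)" "u \<in> wset (susp A)" "v \<in> wset (susp A)"
  shows "lin R (susp A i) (susp B (wdeg u + (i + wdeg v) + d)) (\<lambda>x. ev R A f (u @ (i, x) # v))"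
  using mlin_lin[of R "susp A" "\<lambda>m. susp B (m + d)" "Suc (length u + length v)" "ev R A f" u v i]
    cmlin_ev[OF assms(1)] assms(2,3) by (simp add: cmlin_def)

end

section \<open>The Gerstenhaber product on words\<close>

lemma wdeg_take_drop: "wdeg (take k w) + wdeg (drop k w) = wdeg w"
  by (metis append_take_drop_id wdeg_simps(3))

text \<open>An insertion treats the entries before, inside and after its block differently. The
  varied letter lies in one of these three pieces, and each of the last three hypotheses covers one
  position.\<close>

lemma mlin_split3:
  assumes mem: "\<And>u x v. u \<in> wset M \<Longrightarrow> x \<in> wset M \<Longrightarrow> v \<in> wset M \<Longrightarrow>
      length u = j \<Longrightarrow> length x = p \<Longrightarrow> length v = q \<Longrightarrow> G u x v \<in> carrier (P (wdeg u + wdeg x + wdeg v))"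
    and l1: "\<And>u u' i x v. u \<in> wset M \<Longrightarrow> u' \<in> wset M \<Longrightarrow> x \<in> wset M \<Longrightarrow> v \<in> wset M \<Longrightarrow>
      Suc (length u + length u') = j \<Longrightarrow> length x = p \<Longrightarrow> length v = q \<Longrightarrow>
      lin R (M i) (P (wdeg u + (i + wdeg u') + wdeg x + wdeg v)) (\<lambda>a. G (u @ (i, a) # u') x v)"
    and l2: "\<And>u x x' i v. u \<in> wset M \<Longrightarrow> x \<in> wset M \<Longrightarrow> x' \<in> wset M \<Longrightarrow> v \<in> wset M \<Longrightarrow>
      length u = j \<Longrightarrow> Suc (length x + length x') = p \<Longrightarrow> length v = q \<Longrightarrow>
      lin R (M i) (P (wdeg u + (wdeg x + (i + wdeg x')) + wdeg v)) (\<lambda>a. G u (x @ (i, a) # x') v)"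
    and l3: "\<And>u x v v' i. u \<in> wset M \<Longrightarrow> x \<in> wset M \<Longrightarrow> v \<in> wset M \<Longrightarrow> v' \<in> wset M \<Longrightarrow>
      length u = j \<Longrightarrow> length x = p \<Longrightarrow> Suc (length v + length v') = q \<Longrightarrow>
      lin R (M i) (P (wdeg u + wdeg x + (wdeg v + (i + wdeg v')))) (\<lambda>a. G u x (v @ (i, a) # v'))"
  shows "mlin R M P (j + p + q) (\<lambda>w. G (take j w) (take p (drop j w)) (drop (j + p) w))"
proof (rule mlinI)
  fix w assume w: "w \<in> wset M" "length w = j + p + q"
  have "wdeg (take j w) + wdeg (take p (drop j w)) + wdeg (drop (j + p) w) = wdeg w"
    using wdeg_take_drop[of j w] wdeg_take_drop[of p "drop j w"] by (simp add: add.commute)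
  with mem[of "take j w" "take p (drop j w)" "drop (j + p) w"] w
  show "G (take j w) (take p (drop j w)) (drop (j + p) w) \<in> carrier (P (wdeg w))"
    by (simp add: wset_take wset_drop)
next
  fix u v i assume u: "u \<in> wset M" and v: "v \<in> wset M" and len: "Suc (length u + length v) = j + p + q"
  consider "length u < j" | "j \<le> length u" "length u < j + p" | "j + p \<le> length u" by linarith
  then show "lin R (M i) (P (wdeg u + (i + wdeg v)))
      (\<lambda>x. G (take j (u @ (i, x) # v)) (take p (drop j (u @ (i, x) # v))) (drop (j + p) (u @ (i, x) # v)))"
  proof cases
    case 1
    \<comment> \<open>The first piece consists of \<open>u\<close>, the varied letter and
      \<open>k\<close> further letters taken from \<open>v\<close>.\<close>
    then obtain k where k: "j = Suc (length u + k)" using less_imp_Suc_add by blast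
    have "wdeg u + (i + wdeg (take k v)) + wdeg (take p (drop k v)) + wdeg (drop (k + p) v) =
        wdeg u + (i + wdeg v)"
      using wdeg_take_drop[of k v] wdeg_take_drop[of p "drop k v"] by (simp add: add.commute)
    with l1[of u "take k v" "take p (drop k v)" "drop (k + p) v" i] u v len k
    show ?thesis by (simp add: wset_take wset_drop)
  next
    case 2
    \<comment> \<open>Here the first \<open>k\<close> letters of \<open>v\<close> complete the
      middle piece, which begins with the part of \<open>u\<close> beyond the first \<open>j\<close>
      letters.\<close>
    then obtain k where k: "j + p = Suc (length u + k)" using less_imp_Suc_add by blast
    have eq: "wdeg (take j u) + (wdeg (drop j u) + (i + wdeg (take k v))) + wdeg (drop k v) =
        wdeg u + (i + wdeg v)"
      using wdeg_take_drop[of j u] wdeg_take_drop[of k v] by simp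
    have "lin R (M i) (P (wdeg u + (i + wdeg v)))
        (\<lambda>a. G (take j u) (drop j u @ (i, a) # take k v) (drop k v))"
      unfolding eq[symmetric] using u v len k 2 by (intro l2) (auto simp: wset_take wset_drop)
    moreover have "p + j - length u = Suc k" "p - (length u - j) = Suc k" using k 2 by simp_all
    ultimately show ?thesis using u v len k 2 by simp
  next
    case 3
    have "wdeg (take j u) + wdeg (take p (drop j u)) + (wdeg (drop (j + p) u) + (i + wdeg v)) =
        wdeg u + (i + wdeg v)"
      using wdeg_take_drop[of j u] wdeg_take_drop[of p "drop j u"] by (simp add: add.commute)
    with l3[of "take j u" "take p (drop j u)" "drop (j + p) u" v i] u v len 3
    show ?thesis by (simp add: wset_take wset_drop)
  qed
qed

text \<open>The pair (j, p) stands for an insertion at the p entries following the first j.\<close>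

definition splits :: "nat \<Rightarrow> (nat \<times> nat) set" where
  "splits n = {(j, p). 1 \<le> p \<and> j + p \<le> n}"

lemma finite_splits [simp]: "finite (splits n)"
  by (rule finite_subset[of _ "{..n} \<times> {..n}"]) (auto simp: splits_def)

definition ins :: "('r, 'z) ring_scheme \<Rightarrow> (int \<Rightarrow> ('r, 'a) module) \<Rightarrow> int \<Rightarrow> ('r, 'a, 'a) cochain \<Rightarrow>
    nat \<Rightarrow> nat \<Rightarrow> (int \<times> 'a) list \<Rightarrow> (int \<times> 'a) list" where
  "ins R A d f j p w =
     take j w @ (wdeg (take p (drop j w)) + d, ev R A f (take p (drop j w))) # drop (j + p) w"

lemma wdeg_ins: "wdeg (ins R A d f j p w) = wdeg w + d"
  using wdeg_take_drop[of j w] wdeg_take_drop[of p "drop j w"] by (simp add: ins_def add.commute)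

lemma length_ins: "j + p \<le> length w \<Longrightarrow> length (ins R A d f j p w) = length w - p + 1"
  by (simp add: ins_def)

lemma ins_not_Nil [simp]: "ins R A d f j p w \<noteq> []"
  by (simp add: ins_def)

text \<open>One summand of the Gerstenhaber product on a word. The Koszul sign of
  \<open>insert_map\<close>, which sits on a tensor, has been moved outside \<open>g\<close> onto
  the value; this is possible because \<open>g\<close> is linear.\<close>

definition gterm :: "('r, 'z) ring_scheme \<Rightarrow> (int \<Rightarrow> ('r, 'a) module) \<Rightarrow> int \<Rightarrow> int \<Rightarrow>
    ('r, 'a, 'a) cochain \<Rightarrow> ('r, 'a, 'a) cochain \<Rightarrow> (int \<times> 'a) list \<Rightarrow> nat \<times> nat \<Rightarrow> 'a" where
  "gterm R A e d g f w s = ksign (susp A (wdeg w + (e + d))) (d * wdeg (take (fst s) w))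
     (ev R A g (ins R A d f (fst s) (snd s) w))"

lemma lin_cong:
  assumes "module R M" "lin R M N f" "\<And>x. x \<in> carrier M \<Longrightarrow> g x = f x"
  shows "lin R M N g"
proof -
  interpret M: module R M by fact
  show ?thesis using assms(2,3) by (simp add: lin_def)
qed

lemma lin_finsum_fun:
  assumes "module R M" "module R N" "finite I" "\<And>i. i \<in> I \<Longrightarrow> lin R M N (F i)"
  shows "lin R M N (\<lambda>x. finsum N (\<lambda>i. F i x) I)"
proof -
  interpret M: module R M by fact
  interpret N: module R N by fact
  note L = linD[OF assms(4)]
  have m: "(\<lambda>i. F i x) \<in> I \<rightarrow> carrier N" if "x \<in> carrier M" for x
    using L(1) that by blast
  show ?thesis
  proof (rule linI)
    fix x y assume xy: "x \<in> carrier M" "y \<in> carrier M"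
    have "finsum N (\<lambda>i. F i (x \<oplus>\<^bsub>M\<^esub> y)) I = finsum N (\<lambda>i. F i x \<oplus>\<^bsub>N\<^esub> F i y) I"
      using L xy by (intro N.finsum_cong') auto
    also have "\<dots> = finsum N (\<lambda>i. F i x) I \<oplus>\<^bsub>N\<^esub> finsum N (\<lambda>i. F i y) I"
      by (rule N.finsum_addf[OF m[OF xy(1)] m[OF xy(2)]])
    finally show "finsum N (\<lambda>i. F i (x \<oplus>\<^bsub>M\<^esub> y)) I = finsum N (\<lambda>i. F i x) I \<oplus>\<^bsub>N\<^esub> finsum N (\<lambda>i. F i y) I" .
  next
    fix r x assume rx: "r \<in> carrier R" "x \<in> carrier M"
    have "finsum N (\<lambda>i. F i (r \<odot>\<^bsub>M\<^esub> x)) I = finsum N (\<lambda>i. r \<odot>\<^bsub>N\<^esub> F i x) I"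
      using L rx by (intro N.finsum_cong') auto
    then show "finsum N (\<lambda>i. F i (r \<odot>\<^bsub>M\<^esub> x)) I = r \<odot>\<^bsub>N\<^esub> finsum N (\<lambda>i. F i x) I"
      using N.finsum_smult_ldistr[OF assms(3) rx(1) m[OF rx(2)]] by simp
  qed (use m in \<open>blast intro: N.finsum_closed\<close>)
qed

context
  fixes R :: "('r, 'z) ring_scheme" and A :: "int \<Rightarrow> ('r, 'a) module"
  assumes R: "cring R" and A: "\<And>i. module R (A i)"
begin

lemmas sA' = susp_module[of R A, OF A]

lemma ins_wset:
  assumes "f \<in> carrier (CC R A A d)" "w \<in> wset (susp A)" "1 \<le> p" "j + p \<le> length w"
  shows "ins R A d f j p w \<in> wset (susp A)"
  using assms by (auto simp: ins_def wset_take wset_drop intro!: ev_mem[OF R A A])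

text \<open>The description quantifies over triples of words. Recovering the triple from the whole
  word by \<open>take\<close> and \<open>drop\<close> turns it into a condition on one multilinear
  function, for which \<open>tpow_lift_ex1\<close> gives existence and uniqueness.\<close>

lemma insert_map:
  assumes f: "f \<in> carrier (CC R A A d)" and p: "1 \<le> p"
  shows "insert_map R A d f j p q m \<in>
      mod_hom R (tpow R (susp A) (j + p + q) m) (tpow R (susp A) (j + 1 + q) (m + d))" (is ?A)
    and "w \<in> words (susp A) (j + p + q) m \<Longrightarrow> insert_map R A d f j p q m (pure R (susp A) w) =
      ksign (tpow R (susp A) (j + 1 + q) (m + d)) (d * wdeg (take j w)) (pure R (susp A) (ins R A d f j p w))"
    (is "_ \<Longrightarrow> ?B w")
proof -
  let ?T = "\<lambda>m. tpow R (susp A) (j + 1 + q) (m + d)"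
  note T = tpow_module[OF R sA']
  note P = mlin_pure[where M = "susp A" and n = "j + 1 + q", OF R sA']
  define I where "I w = ksign (?T (wdeg w)) (d * wdeg (take j w)) (pure R (susp A) (ins R A d f j p w))" for w
  define G where "G u x v = ksign (?T (wdeg u + wdeg x + wdeg v)) (d * wdeg u)
    (pure R (susp A) (u @ (wdeg x + d, ev R A f x) # v))" for u x v
  have I: "I w = G (take j w) (take p (drop j w)) (drop (j + p) w)" for w
  proof -
    have "wdeg (take j w) + wdeg (take p (drop j w)) + wdeg (drop (j + p) w) = wdeg w"
      using wdeg_take_drop[of j w] wdeg_take_drop[of p "drop j w"] by (simp add: add.commute)
    then show ?thesis by (simp only: I_def G_def ins_def)
  qed
  have fx: "ev R A f x \<in> carrier (susp A (wdeg x + d))" if "x \<in> wset (susp A)" "length x = p" for x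
    using that p by (intro ev_mem[OF R A A f]) auto
  have "mlin R (susp A) ?T (j + p + q) (\<lambda>w. G (take j w) (take p (drop j w)) (drop (j + p) w))"
  proof (rule mlin_split3)
    fix u x v assume a: "u \<in> wset (susp A)" "x \<in> wset (susp A)" "v \<in> wset (susp A)"
      "length u = j" "length x = p" "length v = q"
    have eq: "wdeg u + (wdeg x + d + wdeg v) = wdeg u + wdeg x + wdeg v + d" by simp
    show "G u x v \<in> carrier (?T (wdeg u + wdeg x + wdeg v))"
      using mlin_mem[OF P, where w = "u @ (wdeg x + d, ev R A f x) # v"] a fx
      unfolding G_def by (intro ksign_mem[OF T]) (simp add: eq)
  next
    fix u u' i x v assume a: "u \<in> wset (susp A)" "u' \<in> wset (susp A)" "x \<in> wset (susp A)" "v \<in> wset (susp A)"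
      "Suc (length u + length u') = j" "length x = p" "length v = q"
    have eq: "wdeg u + (i + (wdeg u' + (wdeg x + d + wdeg v))) = wdeg u + (i + wdeg u') + wdeg x + wdeg v + d"
      by simp
    have "lin R (susp A i) (?T (wdeg u + (i + wdeg u') + wdeg x + wdeg v))
        (\<lambda>a. pure R (susp A) (u @ (i, a) # u' @ (wdeg x + d, ev R A f x) # v))"
      using mlin_lin[OF P, where u = u and v = "u' @ (wdeg x + d, ev R A f x) # v" and i = i] a fx by (simp add: eq)
    from lin_comp[OF ksign_lin[OF T] this]
    show "lin R (susp A i) (?T (wdeg u + (i + wdeg u') + wdeg x + wdeg v)) (\<lambda>a. G (u @ (i, a) # u') x v)"
      unfolding G_def by simp
  next
    fix u x x' i v assume a: "u \<in> wset (susp A)" "x \<in> wset (susp A)" "x' \<in> wset (susp A)" "v \<in> wset (susp A)"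
      "length u = j" "Suc (length x + length x') = p" "length v = q"
    have eq: "wdeg u + (wdeg x + (i + wdeg x') + d + wdeg v) = wdeg u + (wdeg x + (i + wdeg x')) + wdeg v + d"
      by simp
    have "lin R (susp A (wdeg x + (i + wdeg x') + d)) (?T (wdeg u + (wdeg x + (i + wdeg x')) + wdeg v))
        (\<lambda>b. pure R (susp A) (u @ (wdeg x + (i + wdeg x') + d, b) # v))"
      using mlin_lin[OF P, where u = u and v = v and i = "wdeg x + (i + wdeg x') + d"] a unfolding eq by simp
    from lin_comp[OF this ev_slot_lin[OF R A A f a(2,3), of i]]
    have "lin R (susp A i) (?T (wdeg u + (wdeg x + (i + wdeg x')) + wdeg v))
      (\<lambda>a. pure R (susp A) (u @ (wdeg x + (i + wdeg x') + d, ev R A f (x @ (i, a) # x')) # v))" .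
    from lin_comp[OF ksign_lin[OF T] this]
    show "lin R (susp A i) (?T (wdeg u + (wdeg x + (i + wdeg x')) + wdeg v)) (\<lambda>a. G u (x @ (i, a) # x') v)"
      unfolding G_def by simp
  next
    fix u x v v' i assume a: "u \<in> wset (susp A)" "x \<in> wset (susp A)" "v \<in> wset (susp A)" "v' \<in> wset (susp A)"
      "length u = j" "length x = p" "Suc (length v + length v') = q"
    have eq: "wdeg u + (wdeg x + d + wdeg v) + (i + wdeg v') = wdeg u + wdeg x + (wdeg v + (i + wdeg v')) + d"
      by simp
    have "lin R (susp A i) (?T (wdeg u + wdeg x + (wdeg v + (i + wdeg v'))))
        (\<lambda>a. pure R (susp A) (u @ (wdeg x + d, ev R A f x) # v @ (i, a) # v'))"
      using mlin_lin[OF P, where u = "u @ (wdeg x + d, ev R A f x) # v" and v = v' and i = i, simplified, unfolded eq] a fx by simp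
    from lin_comp[OF ksign_lin[OF T] this]
    show "lin R (susp A i) (?T (wdeg u + wdeg x + (wdeg v + (i + wdeg v')))) (\<lambda>a. G u x (v @ (i, a) # v'))"
      unfolding G_def by simp
  qed
  then have mI: "mlin R (susp A) ?T (j + p + q) I" by (simp add: I[abs_def])
  have "insert_map R A d f j p q m = (THE h. h \<in> mod_hom R (tpow R (susp A) (j + p + q) m) (?T m) \<and>
      (\<forall>w\<in>words (susp A) (j + p + q) m. h (pure R (susp A) w) = I w))"
  proof -
    have "(\<forall>u w v. length u = j \<longrightarrow> length w = p \<longrightarrow> length v = q \<longrightarrow> u @ w @ v \<in> words (susp A) (j + p + q) m \<longrightarrow>
        h (pure R (susp A) (u @ w @ v)) = ksign (?T m) (d * wdeg u)
          (pure R (susp A) (u @ [(wdeg w + d, ev R A f w)] @ v))) \<longleftrightarrow>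
      (\<forall>w\<in>words (susp A) (j + p + q) m. h (pure R (susp A) w) = I w)" (is "?L \<longleftrightarrow> ?R") for h
    proof
      assume L: ?L
      show ?R
      proof
        fix w assume w: "w \<in> words (susp A) (j + p + q) m"
        have "w = take j w @ take p (drop j w) @ drop (j + p) w"
          by (metis append_take_drop_id drop_drop add.commute)
        moreover have "length (take j w) = j" "length (take p (drop j w)) = p" "length (drop (j + p) w) = q"
          using w by (auto simp: words_iff)
        ultimately show "h (pure R (susp A) w) = I w"
          using L[rule_format, of "take j w" "take p (drop j w)" "drop (j + p) w"] w
          by (simp add: I_def ins_def words_iff)
      qed
    next
      assume ?R
      then show ?L by (auto simp: I_def ins_def words_iff)
    qed
    then show ?thesis by (simp add: insert_map_def)
  qed
  with theI'[OF tpow_lift_ex1[OF R sA', where P = ?T and m = m and g = I, OF T mI]]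
  show ?A "w \<in> words (susp A) (j + p + q) m \<Longrightarrow> ?B w" by (auto simp: I_def words_iff)
qed

lemma gterm_lin_left:
  assumes f: "f \<in> carrier (CC R A A d)" and w: "w \<in> wset (susp A)" and s: "s \<in> splits (length w)"
  shows "lin R (CC R A A e) (susp A (wdeg w + (e + d))) (\<lambda>g. gterm R A e d g f w s)"
proof -
  obtain j p where [simp]: "s = (j, p)" by (cases s)
  have "ins R A d f j p w \<in> wset (susp A)" using ins_wset[OF f w] s by (auto simp: splits_def)
  from ev_lin[OF R A A this ins_not_Nil, where d = e]
  have "lin R (CC R A A e) (susp A (wdeg w + (e + d))) (\<lambda>g. ev R A g (ins R A d f j p w))"
    by (simp add: wdeg_ins ac_simps)
  then show ?thesis unfolding gterm_def by (simp add: lin_comp[OF ksign_lin[OF sA']])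
qed

lemma gterm_lin_right:
  assumes g: "g \<in> carrier (CC R A A e)" and w: "w \<in> wset (susp A)" and s: "s \<in> splits (length w)"
  shows "lin R (CC R A A d) (susp A (wdeg w + (e + d))) (\<lambda>f. gterm R A e d g f w s)"
proof -
  obtain j p where [simp]: "s = (j, p)" by (cases s)
  let ?x = "take p (drop j w)"
  have x: "?x \<in> wset (susp A)" "?x \<noteq> []"
    using w s by (auto simp: splits_def wset_take wset_drop)
  have "wdeg (take j w) + (wdeg ?x + d + wdeg (drop (j + p) w)) + e = wdeg w + (e + d)"
    using wdeg_take_drop[of j w] wdeg_take_drop[of p "drop j w"] by (simp add: add.commute)
  with ev_slot_lin[OF R A A g wset_take[OF w] wset_drop[OF w], of "wdeg ?x + d" j "j + p"]
  have "lin R (susp A (wdeg ?x + d)) (susp A (wdeg w + (e + d)))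
      (\<lambda>x. ev R A g (take j w @ (wdeg ?x + d, x) # drop (j + p) w))"
    by simp
  from lin_comp[OF this ev_lin[OF R A A x, where d = d]]
  have "lin R (CC R A A d) (susp A (wdeg w + (e + d))) (\<lambda>f. ev R A g (ins R A d f j p w))"
    by (simp add: ins_def)
  then show ?thesis unfolding gterm_def by (simp add: lin_comp[OF ksign_lin[OF sA']])
qed

lemma
  assumes g: "g \<in> carrier (CC R A A e)" and f: "f \<in> carrier (CC R A A d)"
  shows gerst_mem: "gerst R A e d g f \<in> carrier (CC R A A (e + d))"
    and ev_gerst: "w \<in> wset (susp A) \<Longrightarrow> w \<noteq> [] \<Longrightarrow> ev R A (gerst R A e d g f) w =
      finsum (susp A (wdeg w + (e + d))) (gterm R A e d g f w) (splits (length w))"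
proof -
  let ?T = "\<lambda>n m. tpow R (susp A) n m"
  let ?Sg = "\<lambda>n. SIGMA i:{1..n}. {0..i - 1}"
  note T = tpow_module[OF R sA']
  define t where "t n m = (\<lambda>(i, j). compose (carrier (?T n m))
      (g i (m + d)) (insert_map R A d f j (n - i + 1) (i - j - 1) m))" for n :: nat and m
  have im: "insert_map R A d f j (n - i + 1) (i - j - 1) m \<in> mod_hom R (?T n m) (?T i (m + d))"
    if "(i, j) \<in> ?Sg n" for n m i j
  proof -
    have "j + (n - i + 1) + (i - j - 1) = n" "j + 1 + (i - j - 1) = i" using that by auto
    then show ?thesis using insert_map(1)[OF f, of "n - i + 1" j "i - j - 1" m] by simp
  qed
  have t: "t n m s \<in> mod_hom R (?T n m) (susp A (m + (e + d)))" if "s \<in> ?Sg n" for n m s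
  proof -
    obtain i j where s: "s = (i, j)" by (cases s)
    have "g i (m + d) \<in> mod_hom R (?T i (m + d)) (susp A (m + (e + d)))"
      using CC_memD[OF g, of i "m + d"] that s by (simp add: ac_simps)
    moreover have "insert_map R A d f j (n - i + 1) (i - j - 1) m \<in> mod_hom R (?T n m) (?T i (m + d))"
      using that unfolding s by (rule im)
    ultimately show ?thesis unfolding t_def s prod.case by (rule mod_hom_compose[OF T])
  qed
  have ge: "gerst R A e d g f = (\<lambda>n\<in>{1..}. \<lambda>m. finsum (hom_module R (?T n m) (susp A (m + (e + d)))) (t n m) (?Sg n))"
    unfolding gerst_def t_def ..
  have "finsum (hom_module R (?T n m) (susp A (m + (e + d)))) (t n m) (?Sg n) \<in> mod_hom R (?T n m) (susp A (m + (e + d)))" for n m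
  proof -
    interpret H: module R "hom_module R (?T n m) (susp A (m + (e + d)))"
      by (rule hom_module_module[OF T sA'])
    show ?thesis
      using H.finsum_closed[of "t n m" "?Sg n"] t unfolding hom_module_simps(1) by blast
  qed
  then show "gerst R A e d g f \<in> carrier (CC R A A (e + d))"
    unfolding ge CC_mem_iff by simp
  show "ev R A (gerst R A e d g f) w =
      finsum (susp A (wdeg w + (e + d))) (gterm R A e d g f w) (splits (length w))"
    if w: "w \<in> wset (susp A)" "w \<noteq> []"
  proof -
    let ?n = "length w" and ?m = "wdeg w"
    let ?N = "susp A (?m + (e + d))"
    interpret N: module R ?N by (rule sA')
    have n: "1 \<le> ?n" using w(2) by (cases w) auto
    have p: "pure R (susp A) w \<in> carrier (?T ?n ?m)" by (rule pure_mem[OF R sA' w(1)])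
    have "ev R A (gerst R A e d g f) w =
        finsum (hom_module R (?T ?n ?m) ?N) (t ?n ?m) (?Sg ?n) (pure R (susp A) w)"
      using n by (simp add: ev_def ge)
    also have "\<dots> = finsum ?N (\<lambda>s. t ?n ?m s (pure R (susp A) w)) (?Sg ?n)"
      using t by (intro hom_module_finsum[OF T sA' _ _ p]) auto
    also have "\<dots> = finsum ?N (\<lambda>s. gterm R A e d g f w (snd s, ?n - fst s + 1)) (?Sg ?n)"
    proof (rule N.finsum_cong')
      have S: "(snd s, ?n - fst s + 1) \<in> splits ?n" if "s \<in> ?Sg ?n" for s
        using that by (auto simp: splits_def)
      show "(\<lambda>s. gterm R A e d g f w (snd s, ?n - fst s + 1)) \<in> ?Sg ?n \<rightarrow> carrier ?N"
        using linD(1)[OF gterm_lin_left[OF f w(1) S] g] by blast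
      fix s assume s: "s \<in> ?Sg ?n"
      obtain i j where [simp]: "s = (i, j)" by (cases s)
      have ij: "1 \<le> i" "i \<le> ?n" "j \<le> i - 1" using s by auto
      have eq: "j + (?n - i + 1) + (i - j - 1) = ?n" "j + 1 + (i - j - 1) = i" using ij by auto
      have ww: "w \<in> words (susp A) ?n ?m" using w by (simp add: words_iff)
      let ?v = "ins R A d f j (?n - i + 1) w"
      have v: "?v \<in> wset (susp A)" "length ?v = i" "wdeg ?v = ?m + d"
        using ij ins_wset[OF f w(1)] by (auto simp: wdeg_ins length_ins)
      have gl: "lin R (?T i (?m + d)) ?N (g i (?m + d))"
        using mod_hom_lin[OF CC_memD[OF g ij(1), of "?m + d"]] by (simp add: ac_simps)
      have "t ?n ?m s (pure R (susp A) w) =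
          g i (?m + d) (ksign (?T i (?m + d)) (d * wdeg (take j w)) (pure R (susp A) ?v))"
        using p insert_map(2)[OF f, of "?n - i + 1" w j "i - j - 1" ?m] ww
        unfolding t_def by (simp only: eq) (simp add: compose_def)
      also have "\<dots> = ksign ?N (d * wdeg (take j w)) (g i (?m + d) (pure R (susp A) ?v))"
        using pure_mem[OF R sA' v(1)] v(2,3) by (intro lin_ksign[OF T sA' gl]) simp
      also have "\<dots> = gterm R A e d g f w (snd s, ?n - fst s + 1)"
        using v(2,3) by (simp add: gterm_def ev_def)
      finally show "t ?n ?m s (pure R (susp A) w) = gterm R A e d g f w (snd s, ?n - fst s + 1)" .
    qed simp
    \<comment> \<open>The definition indexes summands by the arity \<open>i\<close> of the outer
      cochain and the position \<open>j\<close>. The inner cochain then has arity p = n - i + 1, and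
      conversely i = n - p + 1, so the index becomes the pair (j, p).\<close>
    also have "\<dots> = finsum ?N (gterm R A e d g f w) ((\<lambda>s. (snd s, ?n - fst s + 1)) ` ?Sg ?n)"
    proof (rule N.finsum_reindex[symmetric])
      show "inj_on (\<lambda>s. (snd s, ?n - fst s + 1)) (?Sg ?n)" by (auto simp: inj_on_def)
      show "gterm R A e d g f w \<in> (\<lambda>s. (snd s, ?n - fst s + 1)) ` ?Sg ?n \<rightarrow> carrier ?N"
        using linD(1)[OF gterm_lin_left[OF f w(1)] g] by (auto simp: splits_def)
    qed
    also have "(\<lambda>s. (snd s, ?n - fst s + 1)) ` ?Sg ?n = splits ?n"
    proof
      show "splits ?n \<subseteq> (\<lambda>s. (snd s, ?n - fst s + 1)) ` ?Sg ?n"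
      proof
        fix s assume "s \<in> splits ?n"
        then show "s \<in> (\<lambda>s. (snd s, ?n - fst s + 1)) ` ?Sg ?n"
          by (intro image_eqI[of _ _ "(?n - snd s + 1, fst s)"]) (auto simp: splits_def)
      qed
    qed (auto simp: splits_def)
    finally show ?thesis .
  qed
qed

text \<open>Linear dependence of a cochain on a parameter can be tested one word at a time. This
  yields linearity of the Gerstenhaber product in each argument from that of its summands.\<close>

lemma CC_linI:
  assumes "\<And>x. x \<in> carrier M \<Longrightarrow> F x \<in> carrier (CC R A A d)"
    and "\<And>w. w \<in> wset (susp A) \<Longrightarrow> w \<noteq> [] \<Longrightarrow> lin R M (susp A (wdeg w + d)) (\<lambda>x. ev R A (F x) w)"
    and "module R M"
  shows "lin R M (CC R A A d) F"
proof -
  interpret M: module R M by fact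
  interpret C: module R "CC R A A d" by (rule CC_module[OF R A A])
  show ?thesis
  proof (rule linI)
    show "F (x \<oplus>\<^bsub>M\<^esub> y) = F x \<oplus>\<^bsub>CC R A A d\<^esub> F y" if "x \<in> carrier M" "y \<in> carrier M" for x y
    proof (rule CC_eqI[OF R A A])
      show "ev R A (F (x \<oplus>\<^bsub>M\<^esub> y)) w = ev R A (F x \<oplus>\<^bsub>CC R A A d\<^esub> F y) w"
        if w: "w \<in> wset (susp A)" "w \<noteq> []" for w
        using linD(2)[OF ev_lin[OF R A A w]] linD(2)[OF assms(2)[OF w]] assms(1) \<open>x \<in> _\<close> \<open>y \<in> _\<close> by simp
    qed (use that assms(1) in auto)
    show "F (r \<odot>\<^bsub>M\<^esub> x) = r \<odot>\<^bsub>CC R A A d\<^esub> F x" if "r \<in> carrier R" "x \<in> carrier M" for r x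
    proof (rule CC_eqI[OF R A A])
      show "ev R A (F (r \<odot>\<^bsub>M\<^esub> x)) w = ev R A (r \<odot>\<^bsub>CC R A A d\<^esub> F x) w"
        if w: "w \<in> wset (susp A)" "w \<noteq> []" for w
        using linD(3)[OF ev_lin[OF R A A w]] linD(3)[OF assms(2)[OF w]] assms(1) \<open>r \<in> _\<close> \<open>x \<in> _\<close> by simp
    qed (use that assms(1) in auto)
  qed (use assms(1) in auto)
qed

lemma gerst_lin_left:
  assumes f: "f \<in> carrier (CC R A A d)"
  shows "lin R (CC R A A e) (CC R A A (e + d)) (\<lambda>g. gerst R A e d g f)"
proof (rule CC_linI)
  fix w assume w: "w \<in> wset (susp A)" "w \<noteq> []"
  have "lin R (CC R A A e) (susp A (wdeg w + (e + d)))
      (\<lambda>g. finsum (susp A (wdeg w + (e + d))) (\<lambda>s. gterm R A e d g f w s) (splits (length w)))"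
    by (intro lin_finsum_fun CC_module[OF R A A] sA' finite_splits gterm_lin_left[OF f w(1)])
  then show "lin R (CC R A A e) (susp A (wdeg w + (e + d))) (\<lambda>g. ev R A (gerst R A e d g f) w)"
    by (rule lin_cong[OF CC_module[OF R A A]]) (rule ev_gerst[OF _ f w])
qed (auto intro: gerst_mem[OF _ f] CC_module[OF R A A])

lemma gerst_lin_right:
  assumes g: "g \<in> carrier (CC R A A e)"
  shows "lin R (CC R A A d) (CC R A A (e + d)) (\<lambda>f. gerst R A e d g f)"
proof (rule CC_linI)
  fix w assume w: "w \<in> wset (susp A)" "w \<noteq> []"
  have "lin R (CC R A A d) (susp A (wdeg w + (e + d)))
      (\<lambda>f. finsum (susp A (wdeg w + (e + d))) (\<lambda>s. gterm R A e d g f w s) (splits (length w)))"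
    by (intro lin_finsum_fun CC_module[OF R A A] sA' finite_splits gterm_lin_right[OF g w(1)])
  then show "lin R (CC R A A d) (susp A (wdeg w + (e + d))) (\<lambda>f. ev R A (gerst R A e d g f) w)"
    by (rule lin_cong[OF CC_module[OF R A A]]) (rule ev_gerst[OF g _ w])
qed (auto intro: gerst_mem[OF g] CC_module[OF R A A])

end

section \<open>Extension of scalars\<close>

lemma res_scal_simps [simp]:
  "carrier (res_scal l M) = carrier M"
  "\<zero>\<^bsub>res_scal l M\<^esub> = \<zero>\<^bsub>M\<^esub>"
  "x \<oplus>\<^bsub>res_scal l M\<^esub> y = x \<oplus>\<^bsub>M\<^esub> y"
  "r \<odot>\<^bsub>res_scal l M\<^esub> x = (r \<odot>\<^bsub>l\<^esub> \<one>\<^bsub>l\<^esub>) \<odot>\<^bsub>M\<^esub> x"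
  by (simp_all add: res_scal_def)

lemma res_scal_module:
  assumes "algebra k l" "module l M"
  shows "module k (res_scal l M)"
proof -
  interpret l: algebra k l by fact
  interpret M: module l M by fact
  show ?thesis
  proof (intro moduleI abelian_groupI, goal_cases)
    case 1 show ?case by (rule l.R_cring)
  next
    case (7 x) then show ?case by (intro bexI[of _ "\<ominus>\<^bsub>M\<^esub> x"]) (auto simp: M.l_neg)
  next
    case (11 r s x)
    \<comment> \<open>Associativity of the restricted action is associativity over l, once the
      multiples of the unit of l are seen to multiply like the scalars of k.\<close>
    have "(r \<otimes>\<^bsub>k\<^esub> s) \<odot>\<^bsub>l\<^esub> \<one>\<^bsub>l\<^esub> = (r \<odot>\<^bsub>l\<^esub> \<one>\<^bsub>l\<^esub>) \<otimes>\<^bsub>l\<^esub> (s \<odot>\<^bsub>l\<^esub> \<one>\<^bsub>l\<^esub>)"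
      using 11 by (simp add: l.smult_assoc2 l.smult_assoc1)
    then show ?case using 11 by (simp add: M.smult_assoc1)
  qed (auto simp: M.a_ac M.smult_l_distr M.smult_r_distr l.smult_l_distr)
qed

lemma lin_res_scal:
  assumes "algebra k l" "lin l M N f"
  shows "lin k (res_scal l M) (res_scal l N) f"
proof -
  interpret l: algebra k l by fact
  show ?thesis using linD[OF assms(2)] by (intro linI) auto
qed

lemma lin_add:
  assumes "module R N" "lin R M N f" "lin R M N g"
  shows "lin R M N (\<lambda>x. f x \<oplus>\<^bsub>N\<^esub> g x)"
proof -
  interpret N: module R N by fact
  note L = linD[OF assms(2)] linD[OF assms(3)]
  show ?thesis using L by (intro linI) (simp_all add: N.a_ac N.smult_r_distr)
qed

lemma lin_smult:
  assumes "module R N" "lin R M N f" "r \<in> carrier R"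
  shows "lin R M N (\<lambda>x. r \<odot>\<^bsub>N\<^esub> f x)"
proof -
  interpret N: module R N by fact
  show ?thesis using linD[OF assms(2)] assms(3)
    by (intro linI) (simp_all add: N.smult_r_distr module_smult_comm[OF assms(1)])
qed

lemma mlin_add:
  assumes "\<And>m. module R (P m)" "mlin R M P n f" "mlin R M P n g"
  shows "mlin R M P n (\<lambda>w. f w \<oplus>\<^bsub>P (wdeg w)\<^esub> g w)"
proof (rule mlinI)
  fix w assume w: "w \<in> wset M" "length w = n"
  interpret P: module R "P (wdeg w)" by (rule assms(1))
  show "f w \<oplus>\<^bsub>P (wdeg w)\<^esub> g w \<in> carrier (P (wdeg w))"
    using mlin_mem[OF assms(2) w] mlin_mem[OF assms(3) w] by simp
next
  fix u v i assume uv: "u \<in> wset M" "v \<in> wset M" "Suc (length u + length v) = n"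
  from lin_add[OF assms(1) mlin_lin[OF assms(2) uv] mlin_lin[OF assms(3) uv], of i]
  show "lin R (M i) (P (wdeg u + (i + wdeg v)))
     (\<lambda>x. f (u @ (i, x) # v) \<oplus>\<^bsub>P (wdeg (u @ (i, x) # v))\<^esub> g (u @ (i, x) # v))" by simp
qed

lemma mlin_smult:
  assumes "\<And>m. module R (P m)" "mlin R M P n f" "r \<in> carrier R"
  shows "mlin R M P n (\<lambda>w. r \<odot>\<^bsub>P (wdeg w)\<^esub> f w)"
proof (rule mlinI)
  fix w assume w: "w \<in> wset M" "length w = n"
  show "r \<odot>\<^bsub>P (wdeg w)\<^esub> f w \<in> carrier (P (wdeg w))"
    using mlin_mem[OF assms(2) w] module.smult_closed[OF assms(1)] assms(3) by blast
next
  fix u v i assume uv: "u \<in> wset M" "v \<in> wset M" "Suc (length u + length v) = n"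
  from lin_smult[OF assms(1) mlin_lin[OF assms(2) uv] assms(3), of i]
  show "lin R (M i) (P (wdeg u + (i + wdeg v)))
     (\<lambda>x. r \<odot>\<^bsub>P (wdeg (u @ (i, x) # v))\<^esub> f (u @ (i, x) # v))" by simp
qed

text \<open>The l-multilinear extension of \<open>g\<close> from words in A to words in the
  extension of A. The first letter is removed by the universal property of the tensor product; for
  the rest, \<open>g\<close> has its first letter fixed and the target \<open>P\<close> is shifted
  by the degree of that letter, so both change along the recursion.\<close>

fun extw :: "('k, 'z) ring_scheme \<Rightarrow> (int \<Rightarrow> ('k, 'a) module) \<Rightarrow> ('k, 'l) module \<Rightarrow> (int \<Rightarrow> ('l, 'p) module) \<Rightarrow>
    ((int \<times> 'a) list \<Rightarrow> 'p) \<Rightarrow> (int \<times> ('a \<times> 'l \<Rightarrow> 'k) set) list \<Rightarrow> 'p" where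
  "extw k A l P g [] = g []"
| "extw k A l P g ((i, t) # w) = tlift k (susp A i) l (res_scal l (P (i + wdeg w)))
     (\<lambda>a x. x \<odot>\<^bsub>P (i + wdeg w)\<^esub> extw k A l (\<lambda>m. P (i + m)) (\<lambda>w'. g ((i, a) # w')) w) t"

declare extw.simps(2) [simp del]

locale base_ext =
  fixes k :: "('k, 'z) ring_scheme" and A :: "int \<Rightarrow> ('k, 'a) module" and l :: "('k, 'l) module"
  assumes A: "module k (A i)" and l: "algebra k l"
begin

sublocale l: algebra k l by (rule l)

lemma k: "cring k" by (rule l.R_cring)
lemma lk: "module k l" by (rule l.module)
lemma lc: "cring l" by (rule l.M_cring)

lemmas L_l_distr = ringE(3)[OF cring.axioms(1)[OF lc]]
  and L_r_distr = ringE(4)[OF cring.axioms(1)[OF lc]]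
  and L_m_assoc = monoid.m_assoc[OF ringE(2)[OF cring.axioms(1)[OF lc]]]
  and L_m_comm = comm_monoid.m_comm[OF cring.axioms(2)[OF lc]]

abbreviation "T i \<equiv> tensor k (A i) l"
abbreviation "X \<equiv> ext k A l"
abbreviation "tn i \<equiv> tens k (A i) l"

lemma sA: "module k (susp A i)" by (simp add: susp_def A)
lemma T_module: "module k (T i)" by (rule tensor_module[OF A lk])

lemma mult_lin: "y \<in> carrier l \<Longrightarrow> lin k l l (\<lambda>x. y \<otimes>\<^bsub>l\<^esub> x)"
  by (rule linI) (auto simp: L_r_distr l.smult_assoc2 L_m_comm[of y])

lemma ext_simps [simp]:
  "carrier (X i) = carrier (T i)" "\<zero>\<^bsub>X i\<^esub> = \<zero>\<^bsub>T i\<^esub>" "x \<oplus>\<^bsub>X i\<^esub> y = x \<oplus>\<^bsub>T i\<^esub> y"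
  by (simp_all add: ext_def)

lemma ext_smult_hom: "y \<in> carrier l \<Longrightarrow> (\<lambda>t. y \<odot>\<^bsub>X i\<^esub> t) \<in> mod_hom k (T i) (T i)"
  unfolding ext_def using tmap(1)[OF A lk A lk lin_id mult_lin] by simp

lemma ext_smult_tens [simp]:
  "y \<in> carrier l \<Longrightarrow> a \<in> carrier (A i) \<Longrightarrow> x \<in> carrier l \<Longrightarrow> y \<odot>\<^bsub>X i\<^esub> tn i a x = tn i a (y \<otimes>\<^bsub>l\<^esub> x)"
  unfolding ext_def using tmap(2)[OF A lk A lk lin_id mult_lin] by simp

lemmas tn_mem = tens_mem[OF A lk]
lemmas T_induct = tensor_induct[OF A lk, consumes 1, case_names tens add]

lemma ext_smult_add: "y \<in> carrier l \<Longrightarrow> s \<in> carrier (T i) \<Longrightarrow> t \<in> carrier (T i) \<Longrightarrow>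
    y \<odot>\<^bsub>X i\<^esub> (s \<oplus>\<^bsub>T i\<^esub> t) = y \<odot>\<^bsub>X i\<^esub> s \<oplus>\<^bsub>T i\<^esub> y \<odot>\<^bsub>X i\<^esub> t"
  using mod_hom_add[OF ext_smult_hom] .

lemma ext_smult_mem: "y \<in> carrier l \<Longrightarrow> t \<in> carrier (T i) \<Longrightarrow> y \<odot>\<^bsub>X i\<^esub> t \<in> carrier (T i)"
  using mod_hom_mem[OF ext_smult_hom] .

text \<open>Each scalar acts by a \<open>tmap\<close> and is therefore additive. The other axioms
  are identities preserved by sums, so they are checked on pure tensors.\<close>

lemma ext_module: "module l (X i)"
proof -
  interpret T: module k "T i" by (rule T_module)
  have ag: "abelian_group (X i)"
    by (intro abelian_groupI) (auto simp: T.a_ac intro!: bexI[of _ "\<ominus>\<^bsub>T i\<^esub> _"] T.l_neg)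
  have 1: "(x \<oplus>\<^bsub>l\<^esub> y) \<odot>\<^bsub>X i\<^esub> t = x \<odot>\<^bsub>X i\<^esub> t \<oplus>\<^bsub>T i\<^esub> y \<odot>\<^bsub>X i\<^esub> t"
    if "x \<in> carrier l" "y \<in> carrier l" "t \<in> carrier (T i)" for x y t
    using that(3)
  proof (induction rule: T_induct)
    case (tens a z)
    then show ?case using that by (simp add: L_l_distr tens_add_r[OF A lk])
  next
    case (add s t)
    then show ?case using that
      by (simp add: ext_smult_add ext_smult_mem T.a_ac)
  qed
  have 2: "(x \<otimes>\<^bsub>l\<^esub> y) \<odot>\<^bsub>X i\<^esub> t = x \<odot>\<^bsub>X i\<^esub> (y \<odot>\<^bsub>X i\<^esub> t)"
    if "x \<in> carrier l" "y \<in> carrier l" "t \<in> carrier (T i)" for x y t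
    using that(3)
  proof (induction rule: T_induct)
    case (tens a z)
    then show ?case using that by (simp add: L_m_assoc)
  next
    case (add s t)
    then show ?case using that by (simp add: ext_smult_add ext_smult_mem)
  qed
  have 3: "\<one>\<^bsub>l\<^esub> \<odot>\<^bsub>X i\<^esub> t = t" if "t \<in> carrier (T i)" for t
    using that
  proof (induction rule: T_induct)
    case (tens a z) then show ?case by simp
  next
    case (add s t) then show ?case by (simp add: ext_smult_add)
  qed
  show ?thesis
    by (intro moduleI lc ag) (simp_all add: 1 2 3 ext_smult_add ext_smult_mem)
qed

lemma ext_smult_scal:
  assumes "r \<in> carrier k" "t \<in> carrier (T i)"
  shows "(r \<odot>\<^bsub>l\<^esub> \<one>\<^bsub>l\<^esub>) \<odot>\<^bsub>X i\<^esub> t = r \<odot>\<^bsub>T i\<^esub> t"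
  using assms(2)
proof (induction rule: T_induct)
  case (tens a z)
  then show ?case using assms(1) by (simp add: l.smult_assoc2 tens_smult_r[OF A lk])
next
  case (add s t)
  interpret T: module k "T i" by (rule T_module)
  show ?case using add assms(1) by (simp add: ext_smult_add T.smult_r_distr)
qed

lemma sX: "module l (susp X i)" by (simp add: susp_def ext_module)

text \<open>The two target modules are different records whose operations agree on the carrier, and
  linearity looks no further.\<close>

lemma lin_res_ext: "lin k M (res_scal l (X i)) f \<longleftrightarrow> lin k M (T i) f"
  by (auto simp: lin_def ext_smult_scal)

text \<open>The degree recorded in a letter is the one in the suspension, so the letter itself
  belongs to degree \<open>i - 1\<close> of A.\<close>

definition emb :: "(int \<times> 'a) list \<Rightarrow> (int \<times> ('a \<times> 'l \<Rightarrow> 'k) set) list" where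
  "emb w = map (\<lambda>(i, a). (i, tens k (A (i - 1)) l a \<one>\<^bsub>l\<^esub>)) w"

lemma emb_simps [simp]:
  "emb [] = []"
  "emb ((i, a) # w) = (i, tens k (A (i - 1)) l a \<one>\<^bsub>l\<^esub>) # emb w"
  "emb (u @ v) = emb u @ emb v"
  "length (emb w) = length w"
  "emb w = [] \<longleftrightarrow> w = []"
  by (simp_all add: emb_def)

lemma wdeg_emb [simp]: "wdeg (emb w) = wdeg w"
  by (induction w) auto

lemma emb_wset [simp]: "w \<in> wset (susp A) \<Longrightarrow> emb w \<in> wset (susp X)"
  by (induction w) (auto simp: susp_def tn_mem)

lemma emb_take: "take j (emb w) = emb (take j w)" and emb_drop: "drop j (emb w) = emb (drop j w)"
  by (simp_all add: emb_def take_map drop_map)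

lemma mlin_tens_slot:
  assumes F: "mlin l (susp X) P n F" and "u \<in> wset (susp X)" "v \<in> wset (susp X)" "Suc (length u + length v) = n"
    and "a \<in> carrier (susp A i)" "x \<in> carrier l"
  shows "F (u @ (i, tn (i - 1) a x) # v) =
    x \<odot>\<^bsub>P (wdeg u + (i + wdeg v))\<^esub> F (u @ (i, tn (i - 1) a \<one>\<^bsub>l\<^esub>) # v)"
  using linD(3)[OF mlin_lin[OF F assms(2-4), of i], of x "tn (i - 1) a \<one>\<^bsub>l\<^esub>"] assms(5,6)
  by (simp add: susp_def tn_mem)

text \<open>The set Z restricts the comparison to words with an entry from Z; it is empty when no restriction is meant.\<close>

lemma mlin_emb_unique:
  assumes F: "mlin l (susp X) P n F" and G: "mlin l (susp X) P n G" and P: "\<And>m. module l (P m)"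
    and Z: "\<And>i a. (i, a) \<in> Z \<Longrightarrow> a \<in> carrier (susp A i)"
    and eq: "\<And>w. w \<in> wset (susp A) \<Longrightarrow> length w = n \<Longrightarrow> Z = {} \<or> set w \<inter> Z \<noteq> {} \<Longrightarrow> F (emb w) = G (emb w)"
    and w: "w \<in> wset (susp X)" "length w = n" "Z = {} \<or> set w \<inter> (\<lambda>(i, a). (i, tn (i - 1) a \<one>\<^bsub>l\<^esub>)) ` Z \<noteq> {}"
  shows "F w = G w"
proof -
  \<comment> \<open>\<open>p\<close> collects the letters already replaced by letters a \<otimes> 1;
    the induction works through \<open>u\<close> from the left.\<close>
  have "F (emb p @ u) = G (emb p @ u)"
    if "p \<in> wset (susp A)" "u \<in> wset (susp X)" "length p + length u = n"
      "Z = {} \<or> set p \<inter> Z \<noteq> {} \<or> set u \<inter> (\<lambda>(i, a). (i, tn (i - 1) a \<one>\<^bsub>l\<^esub>)) ` Z \<noteq> {}" for p u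
    using that
  proof (induction u arbitrary: p)
    case Nil
    then show ?case using eq[of p] by auto
  next
    case (Cons it u)
    obtain i t where it: "it = (i, t)" by (cases it)
    have step: "F (emb p @ (i, tn (i - 1) a \<one>\<^bsub>l\<^esub>) # u) = G (emb p @ (i, tn (i - 1) a \<one>\<^bsub>l\<^esub>) # u)"
      if "a \<in> carrier (susp A i)" "Z = {} \<or> set (p @ [(i, a)]) \<inter> Z \<noteq> {} \<or>
        set u \<inter> (\<lambda>(i, a). (i, tn (i - 1) a \<one>\<^bsub>l\<^esub>)) ` Z \<noteq> {}" for a
      using Cons.IH[of "p @ [(i, a)]"] Cons.prems that by (simp add: it)
    show ?case
    \<comment> \<open>If the current letter comes from \<open>Z\<close>, it is already of the form a
      \<otimes> 1 and is kept as it stands. Splitting it into pure tensors could lose the only entry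
      from \<open>Z\<close>.\<close>
    proof (cases "\<exists>a. (i, a) \<in> Z \<and> t = tn (i - 1) a \<one>\<^bsub>l\<^esub>")
      case True
      then obtain a where "(i, a) \<in> Z" "t = tn (i - 1) a \<one>\<^bsub>l\<^esub>" by blast
      then show ?thesis using step[of a] Z by (auto simp: it)
    next
      case False
      then have ne: "Z = {} \<or> set p \<inter> Z \<noteq> {} \<or> set u \<inter> (\<lambda>(i, a). (i, tn (i - 1) a \<one>\<^bsub>l\<^esub>)) ` Z \<noteq> {}"
        using Cons.prems(4) by (auto simp: it)
      have u: "emb p \<in> wset (susp X)" "u \<in> wset (susp X)" "Suc (length (emb p) + length u) = n"
        using Cons.prems by (simp_all add: it)
      note LF = mlin_lin[OF F u, of i] and LG = mlin_lin[OF G u, of i]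
      have "t \<in> carrier (T (i - 1))" using Cons.prems by (simp add: it susp_def)
      then have "F (emb p @ (i, t) # u) = G (emb p @ (i, t) # u)"
      proof (induction rule: T_induct)
        case (tens a x)
        then have a: "a \<in> carrier (susp A i)" by (simp add: susp_def)
        have "F (emb p @ (i, tn (i - 1) a \<one>\<^bsub>l\<^esub>) # u) = G (emb p @ (i, tn (i - 1) a \<one>\<^bsub>l\<^esub>) # u)"
          by (rule step[OF a]) (use ne in auto)
        then show ?case
          unfolding mlin_tens_slot[OF F u a tens(2)] mlin_tens_slot[OF G u a tens(2)] by simp
      next
        case (add s t)
        then show ?case using linD(2)[OF LF, of s t] linD(2)[OF LG, of s t] by (simp add: susp_def)
      qed
      then show ?thesis by (simp add: it)
    qed
  qed
  from this[of "[]" w] w show ?thesis by simp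
qed

text \<open>The existence counterpart of \<open>mlin_emb_unique\<close>. Linearity in later letters
  comes from induction. Linearity in the first letter is not visible in the recursion and is deduced
  from uniqueness.\<close>

lemma extw:
  assumes P: "\<And>m. module l (P m)" and g: "mlin k (susp A) (\<lambda>m. res_scal l (P m)) n g"
  shows "mlin l (susp X) P n (extw k A l P g) \<and>
    (\<forall>w\<in>wset (susp A). length w = n \<longrightarrow> extw k A l P g (emb w) = g w)"
  using assms
proof (induction n arbitrary: P g)
  case 0
  then show ?case by (auto simp: mlin_def)
next
  case (Suc n)
  note P = Suc.prems(1) and g = Suc.prems(2)
  define E where "E i a = extw k A l (\<lambda>m. P (i + m)) (\<lambda>w'. g ((i, a) # w'))" for i a
  define b where "b i w = (\<lambda>a x. x \<odot>\<^bsub>P (i + wdeg w)\<^esub> E i a w)" for i :: int and w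
  have extw_Cons: "extw k A l P g ((i, t) # w) = tlift k (susp A i) l (res_scal l (P (i + wdeg w))) (b i w) t"
    for i t w by (simp add: E_def b_def extw.simps(2))
  have P': "module l (P (i + m))" for i m by (rule P)
  have E: "mlin l (susp X) (\<lambda>m. P (i + m)) n (E i a)"
    "\<And>w. w \<in> wset (susp A) \<Longrightarrow> length w = n \<Longrightarrow> E i a (emb w) = g ((i, a) # w)"
    if a: "a \<in> carrier (susp A i)" for i a
  proof -
    have "mlin k (susp A) (\<lambda>m. res_scal l (P (i + m))) n (\<lambda>w'. g ((i, a) # w'))"
    proof (rule mlinI)
      show "g ((i, a) # w) \<in> carrier (res_scal l (P (i + wdeg w)))" if "w \<in> wset (susp A)" "length w = n" for w
        using mlin_mem[OF g, of "(i, a) # w"] that a by simp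
      show "lin k (susp A j) (res_scal l (P (i + (wdeg u + (j + wdeg v))))) (\<lambda>x. g ((i, a) # u @ (j, x) # v))"
        if "u \<in> wset (susp A)" "v \<in> wset (susp A)" "Suc (length u + length v) = n" for u v j
        using mlin_lin[OF g, of "(i, a) # u" v j] that a by (simp add: add.assoc)
    qed
    from Suc.IH[OF P' this] show "mlin l (susp X) (\<lambda>m. P (i + m)) n (E i a)"
      "\<And>w. w \<in> wset (susp A) \<Longrightarrow> length w = n \<Longrightarrow> E i a (emb w) = g ((i, a) # w)"
      by (auto simp: E_def)
  qed
  have g_lin: "lin k (susp A i) (res_scal l (P (i + wdeg w))) (\<lambda>a. g ((i, a) # w))"
    if "w \<in> wset (susp A)" "length w = n" for i w
    using mlin_lin[OF g, of "[]" w i] that by simp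
  \<comment> \<open>The extension belonging to a sum of first letters and the sum of the two
    extensions agree on words a \<otimes> 1, hence on all words; likewise for scalar
    multiples.\<close>
  have E_lin: "lin k (susp A i) (res_scal l (P (i + wdeg w))) (\<lambda>a. E i a w)"
    if w: "w \<in> wset (susp X)" "length w = n" for i w
  proof (rule linI)
    interpret sAi: module k "susp A i" by (rule sA)
    show "E i a w \<in> carrier (res_scal l (P (i + wdeg w)))" if "a \<in> carrier (susp A i)" for a
      using mlin_mem[OF E(1)[OF that] w] by simp
    show "E i (a \<oplus>\<^bsub>susp A i\<^esub> a') w = E i a w \<oplus>\<^bsub>res_scal l (P (i + wdeg w))\<^esub> E i a' w"
      if a: "a \<in> carrier (susp A i)" "a' \<in> carrier (susp A i)" for a a'
      using mlin_emb_unique[OF E(1)[OF sAi.a_closed[OF a]] mlin_add[OF P' E(1)[OF a(1)] E(1)[OF a(2)]] P',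
          of "{}" w] w linD(2)[OF g_lin a] a
      by (simp add: E(2))
    show "E i (r \<odot>\<^bsub>susp A i\<^esub> a) w = r \<odot>\<^bsub>res_scal l (P (i + wdeg w))\<^esub> E i a w"
      if a: "r \<in> carrier k" "a \<in> carrier (susp A i)" for r a
      using mlin_emb_unique[OF E(1)[OF sAi.smult_closed[OF a]]
          mlin_smult[OF P' E(1)[OF a(2)], of "r \<odot>\<^bsub>l\<^esub> \<one>\<^bsub>l\<^esub>"] P', of "{}" w] w linD(3)[OF g_lin a] a
      by (simp add: E(2))
  qed
  have b: "bilin k (susp A i) l (res_scal l (P (i + wdeg w))) (b i w)"
    if w: "w \<in> wset (susp X)" "length w = n" for i w
  proof -
    interpret Pw: module l "P (i + wdeg w)" by (rule P)
    note L = linD[OF E_lin[OF w, of i], unfolded res_scal_simps]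
    show ?thesis
    proof (rule bilinI)
      show "b i w (r \<odot>\<^bsub>susp A i\<^esub> a) x = r \<odot>\<^bsub>res_scal l (P (i + wdeg w))\<^esub> b i w a x"
        if "r \<in> carrier k" "a \<in> carrier (susp A i)" "x \<in> carrier l" for r a x
        using that L by (simp add: b_def module_smult_comm[OF Pw.module_axioms])
      show "b i w a (r \<odot>\<^bsub>l\<^esub> x) = r \<odot>\<^bsub>res_scal l (P (i + wdeg w))\<^esub> b i w a x"
        if "r \<in> carrier k" "a \<in> carrier (susp A i)" "x \<in> carrier l" for r a x
      proof -
        have "r \<odot>\<^bsub>l\<^esub> x = (r \<odot>\<^bsub>l\<^esub> \<one>\<^bsub>l\<^esub>) \<otimes>\<^bsub>l\<^esub> x" using that by (simp add: l.smult_assoc2)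
        then show ?thesis using that L by (simp add: b_def Pw.smult_assoc1)
      qed
    qed (use L in \<open>auto simp: b_def Pw.smult_l_distr Pw.smult_r_distr\<close>)
  qed
  note R = res_scal_module[OF l P]
  note t_hom = tlift(1)[OF sA lk R b] and t_tens = tlift(2)[OF sA lk R b]
  have t_lin: "lin l (susp X i) (P (i + wdeg w)) (\<lambda>t. extw k A l P g ((i, t) # w))"
    if w: "w \<in> wset (susp X)" "length w = n" for i w
  proof -
    interpret Pw: module l "P (i + wdeg w)" by (rule P)
    note h = t_hom[OF w, of i]
    note hm = mod_hom_mem[OF h, unfolded res_scal_simps] mod_hom_add[OF h, unfolded res_scal_simps]
    show ?thesis
    proof (rule linI)
      \<comment> \<open>\<open>tlift\<close> provides a k-linear map only. Linearity over l is
        obtained on pure tensors, where the scalar is absorbed by the second factor, and then by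
        additivity.\<close>
      fix y t assume y: "y \<in> carrier l" and t: "t \<in> carrier (susp X i)"
      have "t \<in> carrier (T (i - 1))" using t by (simp add: susp_def)
      then have "extw k A l P g ((i, y \<odot>\<^bsub>X (i - 1)\<^esub> t) # w) = y \<odot>\<^bsub>P (i + wdeg w)\<^esub> extw k A l P g ((i, t) # w)"
      proof (induction rule: T_induct)
        case (tens a x)
        have m: "E i a w \<in> carrier (P (i + wdeg w))"
          using mlin_mem[OF E(1) w] tens by (simp add: susp_def)
        have "extw k A l P g ((i, tn (i - 1) a z) # w) = z \<odot>\<^bsub>P (i + wdeg w)\<^esub> E i a w" if "z \<in> carrier l" for z
          using t_tens[OF w, of a i z] that tens unfolding extw_Cons by (simp add: susp_def b_def)
        then show ?case using tens y m by (simp add: Pw.smult_assoc1)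
      next
        case (add s t)
        then show ?case using y hm unfolding extw_Cons
          by (simp add: susp_def ext_smult_add ext_smult_mem Pw.smult_r_distr)
      qed
      then show "extw k A l P g ((i, y \<odot>\<^bsub>susp X i\<^esub> t) # w) = y \<odot>\<^bsub>P (i + wdeg w)\<^esub> extw k A l P g ((i, t) # w)"
        by (simp add: susp_def)
    qed (use hm in \<open>simp_all add: extw_Cons susp_def\<close>)
  qed
  show ?case
  proof (intro conjI ballI impI mlinI)
    fix w assume w: "w \<in> wset (susp X)" "length w = Suc n"
    then obtain i t w' where "w = (i, t) # w'" by (cases w) auto
    then show "extw k A l P g w \<in> carrier (P (wdeg w))"
      using linD(1)[OF t_lin, of w' t i] w by simp
  next
    fix w assume w: "w \<in> wset (susp A)" "length w = Suc n"
    then obtain i a w' where w': "w = (i, a) # w'" by (cases w) auto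
    then have ww: "emb w' \<in> wset (susp X)" "length (emb w') = n" "w' \<in> wset (susp A)" "length w' = n"
      "a \<in> carrier (susp A i)" using w by auto
    interpret Pw: module l "P (i + wdeg w')" by (rule P)
    have "g w \<in> carrier (P (i + wdeg w'))" using mlin_mem[OF g w] w' by simp
    then show "extw k A l P g (emb w) = g w"
      using t_tens[OF ww(1,2), of a i "\<one>\<^bsub>l\<^esub>"] ww E(2)[OF ww(5,3,4)] unfolding w' emb_simps extw_Cons
      by (simp add: susp_def b_def)
  next
    fix u v i assume uv: "u \<in> wset (susp X)" "v \<in> wset (susp X)" "Suc (length u + length v) = Suc n"
    show "lin l (susp X i) (P (wdeg u + (i + wdeg v))) (\<lambda>x. extw k A l P g (u @ (i, x) # v))"
    proof (cases u)
      case Nil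
      then show ?thesis using t_lin[of v i] uv by simp
    next
      case (Cons jt u')
      obtain j t where jt: "jt = (j, t)" by (cases jt)
      let ?P = "P (wdeg u + (i + wdeg v))"
      have Pe: "P (j + wdeg (u' @ (i, x) # v)) = ?P" for x :: "('a \<times> 'l \<Rightarrow> 'k) set"
        by (simp add: Cons jt add.assoc)
      have u': "u' \<in> wset (susp X)" "Suc (length u' + length v) = n" using uv Cons jt by auto
      have W: "u' @ (i, x) # v \<in> wset (susp X)" "length (u' @ (i, x) # v) = n"
        if "x \<in> carrier (susp X i)" for x using that u' uv by auto
      have "t \<in> carrier (T (j - 1))" using uv Cons jt by (simp add: susp_def)
      \<comment> \<open>For linearity in a later letter the first letter is decomposed: for a pure
        tensor the claim is that for \<open>E\<close>, and a sum of linear maps is linear.\<close>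
      then have "lin l (susp X i) ?P (\<lambda>x. extw k A l P g ((j, t) # u' @ (i, x) # v))"
      proof (induction rule: T_induct)
        case (tens a z)
        have a: "a \<in> carrier (susp A j)" using tens by (simp add: susp_def)
        have "lin l (susp X i) ?P (\<lambda>x. E j a (u' @ (i, x) # v))"
          using mlin_lin[OF E(1)[OF a] u'(1) uv(2) u'(2), of i] by (simp add: Cons jt add.assoc)
        from lin_smult[OF P this tens(2)]
        have L: "lin l (susp X i) ?P (\<lambda>x. z \<odot>\<^bsub>?P\<^esub> E j a (u' @ (i, x) # v))" .
        show ?case
        proof (rule lin_cong[OF sX L])
          fix x assume x: "x \<in> carrier (susp X i)"
          show "extw k A l P g ((j, tn (j - 1) a z) # u' @ (i, x) # v) = z \<odot>\<^bsub>?P\<^esub> E j a (u' @ (i, x) # v)"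
            using t_tens[OF W[OF x] a tens(2)] unfolding extw_Cons b_def Pe by (simp add: susp_def)
        qed
      next
        case (add s t)
        show ?case
        proof (rule lin_cong[OF sX lin_add[OF P add.IH]])
          fix x assume x: "x \<in> carrier (susp X i)"
          from linD(2)[OF t_lin[OF W[OF x]], of s j t] add.hyps
          show "extw k A l P g ((j, s \<oplus>\<^bsub>T (j - 1)\<^esub> t) # u' @ (i, x) # v) =
              extw k A l P g ((j, s) # u' @ (i, x) # v) \<oplus>\<^bsub>?P\<^esub> extw k A l P g ((j, t) # u' @ (i, x) # v)"
            unfolding Pe by (simp add: susp_def)
        qed
      qed
      then show ?thesis by (simp add: Cons jt)
    qed
  qed
qed

end

lemma length_ge_1 [simp]: "Suc 0 \<le> length w \<longleftrightarrow> w \<noteq> []"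
  by (cases w) auto

text \<open>Contraction of the second factor with a linear functional. For the functionals of a dual
  basis it yields the coordinates of a tensor, for the augmentation it is
  \<open>aug_map\<close>.\<close>

definition contr :: "('k, 'z) ring_scheme \<Rightarrow> ('k, 'm) module \<Rightarrow> ('k, 'n) module \<Rightarrow> ('n \<Rightarrow> 'k) \<Rightarrow>
    ('m \<times> 'n \<Rightarrow> 'k) set \<Rightarrow> 'm" where
  "contr k M L \<phi> = tlift k M L M (\<lambda>m y. \<phi> y \<odot>\<^bsub>M\<^esub> m)"

lemma self_alg_simps [simp]:
  "carrier (self_alg k) = carrier k" "x \<oplus>\<^bsub>self_alg k\<^esub> y = x \<oplus>\<^bsub>k\<^esub> y" "r \<odot>\<^bsub>self_alg k\<^esub> x = r \<otimes>\<^bsub>k\<^esub> x"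
  "\<zero>\<^bsub>self_alg k\<^esub> = \<zero>\<^bsub>k\<^esub>" "\<one>\<^bsub>self_alg k\<^esub> = \<one>\<^bsub>k\<^esub>" "x \<otimes>\<^bsub>self_alg k\<^esub> y = x \<otimes>\<^bsub>k\<^esub> y"
  by (simp_all add: self_alg_def)

lemma contr:
  assumes "module k M" "module k L" "lin k L (self_alg k) \<phi>"
  shows "contr k M L \<phi> \<in> mod_hom k (tensor k M L) M"
    and "m \<in> carrier M \<Longrightarrow> y \<in> carrier L \<Longrightarrow> contr k M L \<phi> (tens k M L m y) = \<phi> y \<odot>\<^bsub>M\<^esub> m"
proof -
  interpret M: module k M by fact
  have b: "bilin k M L M (\<lambda>m y. \<phi> y \<odot>\<^bsub>M\<^esub> m)"
    using linD[OF assms(3)]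
    by (intro bilinI) (simp_all add: M.smult_r_distr M.smult_l_distr M.smult_assoc1 module_smult_comm[OF assms(1)])
  note T = tlift[OF assms(1,2,1) b]
  show "contr k M L \<phi> \<in> mod_hom k (tensor k M L) M"
    "m \<in> carrier M \<Longrightarrow> y \<in> carrier L \<Longrightarrow> contr k M L \<phi> (tens k M L m y) = \<phi> y \<odot>\<^bsub>M\<^esub> m"
    unfolding contr_def by (rule T; assumption)+
qed

lemma push:
  assumes R: "cring R" and A: "\<And>i. module R (A i)" and B: "\<And>i. module R (B i)" and C: "\<And>i. module R (C i)"
    and h: "\<And>i. lin R (B i) (C i) (h i)" and f: "f \<in> carrier (CC R A B d)"
  shows "push R A d h f \<in> carrier (CC R A C d)"
    and "w \<in> wset (susp A) \<Longrightarrow> w \<noteq> [] \<Longrightarrow> ev R A (push R A d h f) w = h (wdeg w + d - 1) (ev R A f w)"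
proof -
  show "push R A d h f \<in> carrier (CC R A C d)"
    unfolding CC_mem_iff
  proof (intro conjI allI impI)
    fix n :: nat and m :: int assume n: "1 \<le> n"
    have T: "module R (tpow R (susp A) n m)" by (rule tpow_module[OF R]) (simp add: susp_def A)
    note fm = CC_memD[OF f n, of m]
    have "lin R (tpow R (susp A) n m) (susp C (m + d)) (\<lambda>x. h (m + d - 1) (f n m x))"
      using lin_comp[OF h mod_hom_lin[OF fm, unfolded susp_def]] by (simp add: susp_def)
    from lin_restrict[OF T this]
    show "push R A d h f n m \<in> mod_hom R (tpow R (susp A) n m) (susp C (m + d))"
      using n by (simp add: push_def compose_def)
  qed (simp add: push_def)
  assume w: "w \<in> wset (susp A)" "w \<noteq> []"
  have "pure R (susp A) w \<in> carrier (tpow R (susp A) (length w) (wdeg w))"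
    by (rule pure_mem[OF R _ w(1)]) (simp add: susp_def A)
  moreover have "1 \<le> length w" using w(2) by (cases w) auto
  ultimately show "ev R A (push R A d h f) w = h (wdeg w + d - 1) (ev R A f w)"
    by (simp add: ev_def push_def compose_def)
qed

section \<open>Cochains over the extension and the map \<open>theta\<close>\<close>

context base_ext
begin

lemma ext_k_eq: "ext_k k A l = T"
  by (simp add: ext_k_def fun_eq_iff)

lemma ext_a_inv: "\<ominus>\<^bsub>X i\<^esub> t = \<ominus>\<^bsub>T i\<^esub> t"
  by (simp add: a_inv_def m_inv_def)

lemma ext_ksign: "ksign (X i) s t = ksign (T i) s t"
  by (simp add: ksign_def ext_a_inv)

lemma ext_finsum:
  assumes "f \<in> S \<rightarrow> carrier (T i)" "finite S"
  shows "finsum (X i) f S = finsum (T i) f S"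
proof -
  interpret X: module l "X i" by (rule ext_module)
  interpret T: module k "T i" by (rule T_module)
  show ?thesis using assms(2,1)
  proof induction
    case (insert s S)
    then have "f s \<in> carrier (T i)" "f \<in> S \<rightarrow> carrier (T i)" by auto
    with insert show ?case by simp
  qed simp
qed

lemma tn_lin: "x \<in> carrier l \<Longrightarrow> lin k (A i) (T i) (\<lambda>a. tn i a x)"
  by (rule linI) (auto simp: tn_mem tens_add_l[OF A lk] tens_smult_l[OF A lk])

lemma tn_lin_r: "a \<in> carrier (A i) \<Longrightarrow> lin k l (T i) (tn i a)"
  by (rule linI) (auto simp: tn_mem tens_add_r[OF A lk] tens_smult_r[OF A lk])

lemma cmlin_res_ext: "cmlin k A (\<lambda>i. res_scal l (X i)) d g \<longleftrightarrow> cmlin k A T d g"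
  by (simp add: cmlin_def mlin_def susp_def lin_res_ext)

lemma CC_ext_eqI:
  assumes B: "\<And>i. module l (B i)" and F: "F \<in> carrier (CC l X B d)" and G: "G \<in> carrier (CC l X B d)"
    and eq: "\<And>w. w \<in> wset (susp A) \<Longrightarrow> w \<noteq> [] \<Longrightarrow> ev l X F (emb w) = ev l X G (emb w)"
  shows "F = G"
proof (rule CC_eqI[OF lc ext_module B F G])
  fix w assume w: "w \<in> wset (susp X)" "w \<noteq> []"
  then have n: "1 \<le> length w" by (cases w) auto
  have m: "mlin l (susp X) (\<lambda>m. susp B (m + d)) (length w) (ev l X H)" if "H \<in> carrier (CC l X B d)" for H
    using cmlin_ev[OF lc ext_module B that] n by (simp add: cmlin_def)
  show "ev l X F w = ev l X G w"
  proof (rule mlin_emb_unique[OF m[OF F] m[OF G], of "{}"])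
    show "ev l X F (emb v) = ev l X G (emb v)" if "v \<in> wset (susp A)" "length v = length w" for v
      using eq[OF that(1)] that(2) w(2) by (cases v) auto
  qed (use w B in \<open>auto simp: susp_def\<close>)
qed

lemma cmlin_ev_emb:
  assumes B: "\<And>i. module l (B i)" and F: "F \<in> carrier (CC l X B d)"
  shows "cmlin k A (\<lambda>i. res_scal l (B i)) d (\<lambda>w. ev l X F (emb w))"
  unfolding cmlin_def
proof (intro allI impI mlinI)
  fix n :: nat and w assume n: "1 \<le> n" and w: "w \<in> wset (susp A)" "length w = n"
  have "ev l X F (emb w) \<in> carrier (susp B (wdeg w + d))"
    using ev_mem[OF lc ext_module B F, of "emb w"] w n by auto
  then show "ev l X F (emb w) \<in> carrier (susp (\<lambda>i. res_scal l (B i)) (wdeg w + d))"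
    by (simp add: susp_def)
next
  fix n :: nat and u v i assume n: "1 \<le> n" and uv: "u \<in> wset (susp A)" "v \<in> wset (susp A)"
    "Suc (length u + length v) = n"
  have "lin k (res_scal l (X (i - 1))) (res_scal l (B (wdeg u + (i + wdeg v) + d - 1)))
      (\<lambda>x. ev l X F (emb u @ (i, x) # emb v))"
    using lin_res_scal[OF l ev_slot_lin[OF lc ext_module B F emb_wset[OF uv(1)] emb_wset[OF uv(2)], of i]]
    by (simp add: susp_def)
  from lin_comp[OF this, of "A (i - 1)" "\<lambda>a. tn (i - 1) a \<one>\<^bsub>l\<^esub>"] 
  have "lin k (A (i - 1)) (res_scal l (B (wdeg u + (i + wdeg v) + d - 1)))
      (\<lambda>a. ev l X F (emb u @ (i, tn (i - 1) a \<one>\<^bsub>l\<^esub>) # emb v))"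
    by (simp add: lin_res_ext tn_lin)
  then show "lin k (susp A i) (susp (\<lambda>i. res_scal l (B i)) (wdeg u + (i + wdeg v) + d))
      (\<lambda>x. ev l X F (emb (u @ (i, x) # v)))"
    by (simp add: susp_def)
qed

text \<open>The l-linear cochain with prescribed values on words a \<otimes> 1, to be compared with
  \<open>CC_ext_eqI\<close>: together they say that restriction to such words is bijective.\<close>

definition cc_ext :: "(int \<Rightarrow> ('l, 'b) module) \<Rightarrow> int \<Rightarrow> ((int \<times> 'a) list \<Rightarrow> 'b) \<Rightarrow>
    ('l, ('a \<times> 'l \<Rightarrow> 'k) set, 'b) cochain" where
  "cc_ext B d g = cc_of l X B d (extw k A l (\<lambda>m. susp B (m + d)) g)"

lemma cc_ext:
  assumes B: "\<And>i. module l (B i)" and g: "cmlin k A (\<lambda>i. res_scal l (B i)) d g"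
  shows "cc_ext B d g \<in> carrier (CC l X B d)"
    and "w \<in> wset (susp A) \<Longrightarrow> w \<noteq> [] \<Longrightarrow> ev l X (cc_ext B d g) (emb w) = g w"
proof -
  have sB: "module l (susp B (m + d))" for m by (simp add: susp_def B)
  have "mlin k (susp A) (\<lambda>m. res_scal l (susp B (m + d))) n g" if "1 \<le> n" for n
    using g that by (simp add: cmlin_def susp_def)
  note E = extw[where P = "\<lambda>m. susp B (m + d)", OF sB this]
  have c: "cmlin l X B d (extw k A l (\<lambda>m. susp B (m + d)) g)"
    unfolding cmlin_def using E by blast
  show "cc_ext B d g \<in> carrier (CC l X B d)"
    unfolding cc_ext_def by (rule cc_of(1)[OF lc ext_module B c])
  assume w: "w \<in> wset (susp A)" "w \<noteq> []"
  then have "1 \<le> length w" by (cases w) auto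
  with E[of "length w"] w
  show "ev l X (cc_ext B d g) (emb w) = g w"
    unfolding cc_ext_def by (subst cc_of(2)[OF lc ext_module B c]) auto
qed

lemma ev_slot_tens:
  assumes F: "F \<in> carrier (CC l X B d)" and B: "\<And>i. module l (B i)"
    and u: "u \<in> wset (susp X)" and v: "v \<in> wset (susp X)"
    and "a \<in> carrier (A (i - 1))" "x \<in> carrier l"
  shows "ev l X F (u @ (i, tn (i - 1) a x) # v) =
    x \<odot>\<^bsub>susp B (wdeg u + (i + wdeg v) + d)\<^esub> ev l X F (u @ (i, tn (i - 1) a \<one>\<^bsub>l\<^esub>) # v)"
  using linD(3)[OF ev_slot_lin[OF lc ext_module B F u v, of i], of x "tn (i - 1) a \<one>\<^bsub>l\<^esub>"] assms(5,6)
  by (simp add: susp_def tn_mem)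

text \<open>By l-linearity each letter a \<otimes> x releases its scalar x. The induction keeps a
  prefix of letters already brought to the form a \<otimes> 1, so the scalars come out in the order
  of the \<open>foldr\<close>.\<close>

lemma ev_tens_word:
  assumes F: "F \<in> carrier (CC l X B d)" and B: "\<And>i. module l (B i)" and ne: "w \<noteq> []"
    and w: "\<forall>(i, a, x)\<in>set w. a \<in> carrier (A i) \<and> x \<in> carrier l"
  shows "ev l X F (map (\<lambda>(i, a, x). (i + 1, tn i a x)) w) =
    foldr (\<otimes>\<^bsub>l\<^esub>) (map (\<lambda>(i, a, x). x) w) \<one>\<^bsub>l\<^esub> \<odot>\<^bsub>susp B (wdeg (map (\<lambda>(i, a, x). (i + 1, a)) w) + d)\<^esub>
      ev l X F (emb (map (\<lambda>(i, a, x). (i + 1, a)) w))"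
proof -
  let ?A = "map (\<lambda>(i, a, x). (i + 1, a))" and ?X = "map (\<lambda>(i, a, x). (i + 1, tn i a x))"
  let ?l = "map (\<lambda>(i, a, x). x)"
  have deg: "wdeg (?X w) = wdeg (?A w)" for w :: "(int \<times> 'a \<times> 'l) list"
    by (induction w) auto
  have mem: "?A w \<in> wset (susp A)" "?X w \<in> wset (susp X)" "foldr (\<otimes>\<^bsub>l\<^esub>) (?l w) \<one>\<^bsub>l\<^esub> \<in> carrier l"
    if "\<forall>(i, a, x)\<in>set w. a \<in> carrier (A i) \<and> x \<in> carrier l" for w
    using that by (induction w) (auto simp: susp_def tn_mem)
  have "ev l X F (emb p @ ?X w) = foldr (\<otimes>\<^bsub>l\<^esub>) (?l w) \<one>\<^bsub>l\<^esub> \<odot>\<^bsub>susp B (wdeg p + wdeg (?A w) + d)\<^esub>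
      ev l X F (emb (p @ ?A w))"
    if "\<forall>(i, a, x)\<in>set w. a \<in> carrier (A i) \<and> x \<in> carrier l" "p \<in> wset (susp A)" "p @ ?A w \<noteq> []" for p
    using that
  proof (induction w arbitrary: p)
    case Nil
    interpret Bp: module l "susp B (wdeg p + d)" by (simp add: susp_def B)
    show ?case using Nil ev_mem[OF lc ext_module B F, of "emb p"] by simp
  next
    case (Cons t w)
    obtain i a x where t: "t = (i, a, x)" by (cases t)
    have ax: "a \<in> carrier (A i)" "x \<in> carrier l" and w: "\<forall>(i, a, x)\<in>set w. a \<in> carrier (A i) \<and> x \<in> carrier l"
      using Cons.prems(1) by (auto simp: t)
    have deg': "wdeg p + (i + 1 + wdeg (?A w)) + d = wdeg (p @ [(i + 1, a)]) + wdeg (?A w) + d" by simp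
    interpret Bp: module l "susp B (wdeg p + (i + 1 + wdeg (?A w)) + d)" by (simp add: susp_def B)
    have "ev l X F (emb p @ ?X (t # w)) =
        x \<odot>\<^bsub>susp B (wdeg p + (i + 1 + wdeg (?A w)) + d)\<^esub> ev l X F (emb (p @ [(i + 1, a)]) @ ?X w)"
      using ev_slot_tens[OF F B emb_wset[OF Cons.prems(2)] mem(2)[OF w], of a "i + 1" x] ax
      by (simp add: t deg)
    also have "ev l X F (emb (p @ [(i + 1, a)]) @ ?X w) = foldr (\<otimes>\<^bsub>l\<^esub>) (?l w) \<one>\<^bsub>l\<^esub>
        \<odot>\<^bsub>susp B (wdeg p + (i + 1 + wdeg (?A w)) + d)\<^esub> ev l X F (emb (p @ [(i + 1, a)] @ ?A w))"
      using Cons.IH[OF w, of "p @ [(i + 1, a)]"] Cons.prems ax unfolding deg'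
      by (simp add: susp_def)
    also have "x \<odot>\<^bsub>susp B (wdeg p + (i + 1 + wdeg (?A w)) + d)\<^esub> \<dots> =
        (x \<otimes>\<^bsub>l\<^esub> foldr (\<otimes>\<^bsub>l\<^esub>) (?l w) \<one>\<^bsub>l\<^esub>) \<odot>\<^bsub>susp B (wdeg p + (i + 1 + wdeg (?A w)) + d)\<^esub>
          ev l X F (emb (p @ [(i + 1, a)] @ ?A w))"
    proof (rule Bp.smult_assoc1[symmetric, OF ax(2) mem(3)[OF w]])
      show "ev l X F (emb (p @ [(i + 1, a)] @ ?A w)) \<in> carrier (susp B (wdeg p + (i + 1 + wdeg (?A w)) + d))"
        using ev_mem[OF lc ext_module B F emb_wset, of "p @ [(i + 1, a)] @ ?A w"] Cons.prems ax mem(1)[OF w]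
        by (simp add: susp_def)
    qed
    finally show ?case by (simp add: t add.assoc)
  qed
  from this[of "[]"] w ne show ?thesis by simp
qed

text \<open>The map \<theta> on a pure tensor f \<otimes> y, specified on words a \<otimes> 1 only.
  The formula for arbitrary letters a \<otimes> x then follows from
  \<open>ev_tens_word\<close>.\<close>

definition theta1 :: "int \<Rightarrow> ('k, 'a, 'a) cochain \<Rightarrow> 'l \<Rightarrow> ('l, ('a \<times> 'l \<Rightarrow> 'k) set, ('a \<times> 'l \<Rightarrow> 'k) set) cochain" where
  "theta1 d f y = cc_ext X d (\<lambda>w. tens k (susp A (wdeg w + d)) l (ev k A f w) y)"

lemma theta1:
  assumes f: "f \<in> carrier (CC k A A d)" and y: "y \<in> carrier l"
  shows "theta1 d f y \<in> carrier (CC l X X d)"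
    and "w \<in> wset (susp A) \<Longrightarrow> w \<noteq> [] \<Longrightarrow> ev l X (theta1 d f y) (emb w) =
      tens k (susp A (wdeg w + d)) l (ev k A f w) y"
proof -
  have "cmlin k A T d (\<lambda>w. tens k (susp A (wdeg w + d)) l (ev k A f w) y)"
    unfolding cmlin_def
  proof (intro allI impI mlinI)
    fix n :: nat and w assume "1 \<le> n" and w: "w \<in> wset (susp A)" "length w = n"
    then show "tens k (susp A (wdeg w + d)) l (ev k A f w) y \<in> carrier (susp T (wdeg w + d))"
      using ev_mem[OF k A A f, of w] y by (auto simp: susp_def tn_mem)
  next
    fix n :: nat and u v i assume "1 \<le> n" and uv: "u \<in> wset (susp A)" "v \<in> wset (susp A)"
      "Suc (length u + length v) = n"
    from lin_comp[OF tn_lin[OF y] ev_slot_lin[OF k A A f uv(1,2), of i, unfolded susp_def]]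
    show "lin k (susp A i) (susp T (wdeg u + (i + wdeg v) + d))
      (\<lambda>x. tens k (susp A (wdeg (u @ (i, x) # v) + d)) l (ev k A f (u @ (i, x) # v)) y)"
      by (simp add: susp_def)
  qed
  then have c: "cmlin k A (\<lambda>i. res_scal l (X i)) d (\<lambda>w. tens k (susp A (wdeg w + d)) l (ev k A f w) y)"
    by (simp add: cmlin_res_ext)
  show "theta1 d f y \<in> carrier (CC l X X d)"
    and "w \<in> wset (susp A) \<Longrightarrow> w \<noteq> [] \<Longrightarrow> ev l X (theta1 d f y) (emb w) =
      tens k (susp A (wdeg w + d)) l (ev k A f w) y"
    unfolding theta1_def by (rule cc_ext[OF ext_module c]; assumption)+
qed

lemma CCl_module: "module l (CC l X X d)" by (rule CC_module[OF lc ext_module ext_module])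
lemma CCk_module: "module k (CC k A A d)" by (rule CC_module[OF k A A])
lemma CCr_module: "module k (res_scal l (CC l X X d))" by (rule res_scal_module[OF l CCl_module])

lemma ev_emb_lin:
  assumes "w \<in> wset (susp A)" "w \<noteq> []"
  shows "lin l (CC l X X d) (X (wdeg w + d - 1)) (\<lambda>F. ev l X F (emb w))"
  using ev_lin[where R = l and A = X and B = X, OF lc ext_module ext_module, of "emb w"] assms emb_wset[OF assms(1)] by (simp add: susp_def)

lemma theta1_bilin: "bilin k (CC k A A d) l (res_scal l (CC l X X d)) (theta1 d)"
proof -
  interpret C: module k "CC k A A d" by (rule CCk_module)
  interpret D: module l "CC l X X d" by (rule CCl_module)
  interpret D': module k "res_scal l (CC l X X d)" by (rule CCr_module)
  note eqI = CC_ext_eqI[OF ext_module]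
  note cl = theta1 C.a_closed C.smult_closed D.a_closed
    D'.smult_closed[unfolded res_scal_simps]
  show ?thesis
  proof (rule bilinI, unfold res_scal_simps)
    fix f g y assume a: "f \<in> carrier (CC k A A d)" "g \<in> carrier (CC k A A d)" "y \<in> carrier l"
    show "theta1 d (f \<oplus>\<^bsub>CC k A A d\<^esub> g) y = theta1 d f y \<oplus>\<^bsub>CC l X X d\<^esub> theta1 d g y"
    proof (rule eqI)
      fix w assume w: "w \<in> wset (susp A)" "w \<noteq> []"
      show "ev l X (theta1 d (f \<oplus>\<^bsub>CC k A A d\<^esub> g) y) (emb w) = ev l X (theta1 d f y \<oplus>\<^bsub>CC l X X d\<^esub> theta1 d g y) (emb w)"
        using a w ev_mem[OF k A A a(1) w] ev_mem[OF k A A a(2) w]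
        by (simp add: cl linD(2)[OF ev_emb_lin] linD(2)[OF ev_lin[OF k A A]] susp_def tens_add_l[OF A lk])
    qed (use a cl in auto)
  next
    fix f y z assume a: "f \<in> carrier (CC k A A d)" "y \<in> carrier l" "z \<in> carrier l"
    show "theta1 d f (y \<oplus>\<^bsub>l\<^esub> z) = theta1 d f y \<oplus>\<^bsub>CC l X X d\<^esub> theta1 d f z"
    proof (rule eqI)
      fix w assume w: "w \<in> wset (susp A)" "w \<noteq> []"
      show "ev l X (theta1 d f (y \<oplus>\<^bsub>l\<^esub> z)) (emb w) = ev l X (theta1 d f y \<oplus>\<^bsub>CC l X X d\<^esub> theta1 d f z) (emb w)"
        using a w ev_mem[OF k A A a(1) w]
        by (simp add: cl linD(2)[OF ev_emb_lin] susp_def tens_add_r[OF A lk])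
    qed (use a cl in auto)
  next
    fix r f y assume a: "r \<in> carrier k" "f \<in> carrier (CC k A A d)" "y \<in> carrier l"
    show "theta1 d (r \<odot>\<^bsub>CC k A A d\<^esub> f) y = (r \<odot>\<^bsub>l\<^esub> \<one>\<^bsub>l\<^esub>) \<odot>\<^bsub>CC l X X d\<^esub> theta1 d f y"
    proof (rule eqI)
      fix w assume w: "w \<in> wset (susp A)" "w \<noteq> []"
      show "ev l X (theta1 d (r \<odot>\<^bsub>CC k A A d\<^esub> f) y) (emb w) = ev l X ((r \<odot>\<^bsub>l\<^esub> \<one>\<^bsub>l\<^esub>) \<odot>\<^bsub>CC l X X d\<^esub> theta1 d f y) (emb w)"
        using a w ev_mem[OF k A A a(2) w]
        by (simp add: cl linD(3)[OF ev_emb_lin] linD(3)[OF ev_lin[OF k A A]] susp_def tens_smult_l[OF A lk]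
            l.smult_assoc2 tens_smult_r[OF A lk])
    qed (use a cl in auto)
    show "theta1 d f (r \<odot>\<^bsub>l\<^esub> y) = (r \<odot>\<^bsub>l\<^esub> \<one>\<^bsub>l\<^esub>) \<odot>\<^bsub>CC l X X d\<^esub> theta1 d f y"
    proof (rule eqI)
      fix w assume w: "w \<in> wset (susp A)" "w \<noteq> []"
      show "ev l X (theta1 d f (r \<odot>\<^bsub>l\<^esub> y)) (emb w) = ev l X ((r \<odot>\<^bsub>l\<^esub> \<one>\<^bsub>l\<^esub>) \<odot>\<^bsub>CC l X X d\<^esub> theta1 d f y) (emb w)"
        using a w ev_mem[OF k A A a(2) w]
        by (simp add: cl linD(3)[OF ev_emb_lin] susp_def l.smult_assoc2)
    qed (use a cl in auto)
  qed (use theta1 in auto)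
qed

lemma foldr_one: "foldr (\<otimes>\<^bsub>l\<^esub>) (map (\<lambda>_. \<one>\<^bsub>l\<^esub>) w) \<one>\<^bsub>l\<^esub> = \<one>\<^bsub>l\<^esub>"
  by (induction w) auto

text \<open>The description of \<open>theta\<close> prescribes values on all words of pure tensors.
  Words a \<otimes> 1 already force the value on f \<otimes> y to be \<open>theta1 d f y\<close>,
  and the remaining conditions follow from l-linearity, which leaves the description of a
  \<open>tlift\<close>.\<close>

lemma theta_tlift: "theta k A l d = tlift k (CC k A A d) l (res_scal l (CC l X X d)) (theta1 d)"
proof -
  have eq: "(\<forall>f\<in>carrier (CC k A A d). \<forall>y\<in>carrier l. \<forall>w. w \<noteq> [] \<longrightarrow>
           (\<forall>(i, a, x)\<in>set w. a \<in> carrier (A i) \<and> x \<in> carrier l) \<longrightarrow>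
           (let wA = map (\<lambda>(i, a, x). (i + 1, a)) w in
            ev l X (h (tens k (CC k A A d) l f y))
              (map (\<lambda>(i, a, x). (i + 1, tens k (A i) l a x)) w) =
            tens k (susp A (wdeg wA + d)) l (ev k A f wA)
              (y \<otimes>\<^bsub>l\<^esub> foldr (\<otimes>\<^bsub>l\<^esub>) (map (\<lambda>(i, a, x). x) w) \<one>\<^bsub>l\<^esub>))) \<longleftrightarrow>
      (\<forall>f\<in>carrier (CC k A A d). \<forall>y\<in>carrier l. h (tens k (CC k A A d) l f y) = theta1 d f y)"
    (is "?L \<longleftrightarrow> ?R") if h: "h \<in> mod_hom k (tensor k (CC k A A d) l) (res_scal l (CC l X X d))" for h
  proof
    assume L: ?L
    show ?R
    proof (intro ballI)
      fix f y assume fy: "f \<in> carrier (CC k A A d)" "y \<in> carrier l"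
      have hm: "h (tens k (CC k A A d) l f y) \<in> carrier (CC l X X d)"
        using mod_hom_mem[OF h tens_mem[OF CCk_module lk fy]] by simp
      show "h (tens k (CC k A A d) l f y) = theta1 d f y"
      proof (rule CC_ext_eqI[OF ext_module hm theta1(1)[OF fy]])
        fix w assume w: "w \<in> wset (susp A)" "w \<noteq> []"
        \<comment> \<open>All second factors are taken to be 1, so the product over the word is 1;
          the shift by -1 undoes the suspension.\<close>
        let ?t = "map (\<lambda>(i, a). (i - 1, a, \<one>\<^bsub>l\<^esub>)) w"
        have t: "map (\<lambda>(i, a, x). (i + 1, a)) ?t = w" "map (\<lambda>(i, a, x). (i + 1, tens k (A i) l a x)) ?t = emb w"
          by (auto simp: emb_def intro!: map_idI)
        have f: "foldr (\<otimes>\<^bsub>l\<^esub>) (map (\<lambda>(i, a, x). x) ?t) \<one>\<^bsub>l\<^esub> = \<one>\<^bsub>l\<^esub>"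
          using foldr_one[of w] by (simp add: o_def case_prod_unfold)
        have "?t \<noteq> []" "\<forall>(i, a, x)\<in>set ?t. a \<in> carrier (A i) \<and> x \<in> carrier l"
          using w by (auto simp: wset_def susp_def)
        with L[rule_format, OF fy, of ?t]
        have "ev l X (h (tens k (CC k A A d) l f y)) (emb w) =
            tens k (susp A (wdeg w + d)) l (ev k A f w) (y \<otimes>\<^bsub>l\<^esub> \<one>\<^bsub>l\<^esub>)"
          unfolding Let_def t f by blast
        then show "ev l X (h (tens k (CC k A A d) l f y)) (emb w) = ev l X (theta1 d f y) (emb w)"
          using theta1(2)[OF fy w] fy by (simp add: L_m_comm[of y])
      qed
    qed
  next
    assume R: ?R
    show ?L
    proof (intro ballI allI impI)
      fix f y and w :: "(int \<times> 'a \<times> 'l) list" assume fy: "f \<in> carrier (CC k A A d)" "y \<in> carrier l" and ne: "w \<noteq> []"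
        and w: "\<forall>(i, a, x)\<in>set w. a \<in> carrier (A i) \<and> x \<in> carrier l"
      let ?A = "map (\<lambda>(i, a, x). (i + 1, a)) w" and ?z = "foldr (\<otimes>\<^bsub>l\<^esub>) (map (\<lambda>(i, a, x). x) w) \<one>\<^bsub>l\<^esub>"
      have A': "?A \<in> wset (susp A)" "?A \<noteq> []"
        using w ne by (auto simp: wset_def susp_def)
      have z: "?z \<in> carrier l" using w by (induction w) auto
      show "let wA = ?A in ev l X (h (tens k (CC k A A d) l f y))
              (map (\<lambda>(i, a, x). (i + 1, tens k (A i) l a x)) w) =
            tens k (susp A (wdeg wA + d)) l (ev k A f wA) (y \<otimes>\<^bsub>l\<^esub> ?z)"
        using R fy ev_tens_word[OF theta1(1)[OF fy] ext_module ne w] theta1(2)[OF fy A']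
          ev_mem[OF k A A fy(1) A'] z
        by (simp add: Let_def susp_def L_m_comm)
    qed
  qed
  show ?thesis unfolding theta_def tlift_def
    by (intro arg_cong[where f = The] ext conj_cong refl) (rule eq)
qed

lemma theta:
  shows "theta k A l d \<in> mod_hom k (tensor k (CC k A A d) l) (res_scal l (CC l X X d))"
    and "f \<in> carrier (CC k A A d) \<Longrightarrow> y \<in> carrier l \<Longrightarrow> theta k A l d (tens k (CC k A A d) l f y) = theta1 d f y"
  unfolding theta_tlift by (rule tlift[OF CCk_module lk CCr_module theta1_bilin]; assumption)+

lemma restr:
  assumes N: "N \<in> carrier (CC l X X d)"
  shows "restr k A l d N \<in> carrier (CC k A T d)"
    and "w \<in> wset (susp A) \<Longrightarrow> w \<noteq> [] \<Longrightarrow> ev k A (restr k A l d N) w = ev l X N (emb w)"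
proof -
  let ?P = "\<lambda>f. f \<in> carrier (CC k A T d) \<and> (\<forall>n\<ge>1. \<forall>m. \<forall>w\<in>words (susp A) n m. ev k A f w = ev l X N (emb w))"
  have c: "cmlin k A T d (\<lambda>w. ev l X N (emb w))"
    using cmlin_ev_emb[OF ext_module N] by (simp add: cmlin_res_ext)
  have "\<exists>!f. ?P f"
  proof (rule ex1I)
    let ?f = "cc_of k A T d (\<lambda>w. ev l X N (emb w))"
    show "?P ?f"
      using cc_of(1)[OF k A T_module c] cc_of(2)[OF k A T_module c] by (auto simp: words_iff)
    show "f = ?f" if f: "?P f" for f
    proof (rule CC_eqI[OF k A T_module])
      fix w assume w: "w \<in> wset (susp A)" "w \<noteq> []"
      then have "1 \<le> length w" "w \<in> words (susp A) (length w) (wdeg w)" by (auto simp: words_iff)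
      with f have "ev k A f w = ev l X N (emb w)" by blast
      then show "ev k A f w = ev k A ?f w" using cc_of(2)[OF k A T_module c w] by simp
    qed (use f cc_of(1)[OF k A T_module c] in auto)
  qed
  from theI'[OF this] have P: "?P (restr k A l d N)"
    unfolding restr_def ext_k_eq emb_def .
  then show "restr k A l d N \<in> carrier (CC k A T d)" by blast
  assume w: "w \<in> wset (susp A)" "w \<noteq> []"
  then have "1 \<le> length w" "w \<in> words (susp A) (length w) (wdeg w)" by (auto simp: words_iff)
  with P show "ev k A (restr k A l d N) w = ev l X N (emb w)" by blast
qed

text \<open>The inner cochain produces a letter of the form b \<otimes> y. Its scalar y leaves the
  outer cochain through the slot of that letter and multiplies y'. As l sits in degree 0, no
  additional sign arises.\<close>

lemma ev_gerst_theta1: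
  assumes g: "g \<in> carrier (CC k A A d')" and y': "y' \<in> carrier l"
    and f: "f \<in> carrier (CC k A A d)" and y: "y \<in> carrier l"
    and w: "w \<in> wset (susp A)" "w \<noteq> []"
  shows "ev l X (gerst l X d' d (theta1 d' g y') (theta1 d f y)) (emb w) =
    tens k (susp A (wdeg w + (d' + d))) l (ev k A (gerst k A d' d g f) w) (y' \<otimes>\<^bsub>l\<^esub> y)"
proof -
  let ?D = "wdeg w + (d' + d) - 1"
  note G = theta1(1)[OF g y'] and F = theta1(1)[OF f y]
  have yy: "y' \<otimes>\<^bsub>l\<^esub> y \<in> carrier l" using y y' by simp
  have gm: "gterm k A d' d g f w s \<in> carrier (A ?D)" if "s \<in> splits (length w)" for s
    using linD(1)[OF gterm_lin_left[OF k A f w(1) that] g] by (simp add: susp_def)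
  have t: "gterm l X d' d (theta1 d' g y') (theta1 d f y) (emb w) s = tn ?D (gterm k A d' d g f w s) (y' \<otimes>\<^bsub>l\<^esub> y)"
    if s: "s \<in> splits (length w)" for s
  proof -
    obtain j p where [simp]: "s = (j, p)" by (cases s)
    let ?x = "take p (drop j w)"
    have jp: "1 \<le> p" "j + p \<le> length w" using s by (auto simp: splits_def)
    have x: "?x \<in> wset (susp A)" "?x \<noteq> []" using jp w by (auto simp: wset_take wset_drop)
    note fx = ev_mem[OF k A A f x]
    let ?i = "wdeg ?x + d"
    have iw: "ins k A d f j p w \<in> wset (susp A)" by (rule ins_wset[OF k A f w(1) jp])
    note gv = ev_mem[OF k A A g iw ins_not_Nil]
    have deg: "wdeg (take j w) + (?i + wdeg (drop (j + p) w)) = wdeg w + d"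
      using wdeg_take_drop[of j w] wdeg_take_drop[of p "drop j w"] by (simp add: add.commute)
    have "ev l X (theta1 d' g y') (ins l X d (theta1 d f y) j p (emb w)) =
        ev l X (theta1 d' g y') (emb (take j w) @ (?i, tn (?i - 1) (ev k A f ?x) y) # emb (drop (j + p) w))"
      using theta1(2)[OF f y x] by (simp add: ins_def emb_take emb_drop susp_def)
    also have "\<dots> = y \<odot>\<^bsub>X (?D)\<^esub> ev l X (theta1 d' g y') (emb (ins k A d f j p w))"
      using ev_slot_tens[OF G ext_module emb_wset[OF wset_take[OF w(1)]] emb_wset[OF wset_drop[OF w(1)]],
          of "ev k A f ?x" ?i y j "j + p"] fx y
      unfolding wdeg_emb deg by (simp add: susp_def ins_def ac_simps)
    also have "\<dots> = y \<odot>\<^bsub>X ?D\<^esub> tn ?D (ev k A g (ins k A d f j p w)) y'"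
      using theta1(2)[OF g y' iw ins_not_Nil] by (simp add: susp_def wdeg_ins ac_simps)
    also have "\<dots> = tn ?D (ev k A g (ins k A d f j p w)) (y' \<otimes>\<^bsub>l\<^esub> y)"
      using gv y y' by (simp add: susp_def wdeg_ins ac_simps L_m_comm)
    finally have "gterm l X d' d (theta1 d' g y') (theta1 d f y) (emb w) s =
        ksign (T ?D) (d * wdeg (take j w)) (tn ?D (ev k A g (ins k A d f j p w)) (y' \<otimes>\<^bsub>l\<^esub> y))"
      by (simp add: gterm_def emb_take susp_def ext_ksign)
    also have "\<dots> = tn ?D (gterm k A d' d g f w s) (y' \<otimes>\<^bsub>l\<^esub> y)"
      using lin_ksign[OF A T_module tn_lin[OF yy], symmetric] gv
      by (simp add: gterm_def susp_def wdeg_ins ac_simps)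
    finally show ?thesis .
  qed
  have "ev l X (gerst l X d' d (theta1 d' g y') (theta1 d f y)) (emb w) =
      finsum (X ?D) (gterm l X d' d (theta1 d' g y') (theta1 d f y) (emb w)) (splits (length w))"
    using ev_gerst[OF lc ext_module G F, of "emb w"] w emb_wset[OF w(1)] by (simp add: susp_def)
  also have "\<dots> = finsum (X ?D) (\<lambda>s. tn ?D (gterm k A d' d g f w s) (y' \<otimes>\<^bsub>l\<^esub> y)) (splits (length w))"
  proof -
    interpret X: module l "X ?D" by (rule ext_module)
    show ?thesis by (rule X.finsum_cong') (use t gm yy in \<open>auto simp: tn_mem\<close>)
  qed
  also have "\<dots> = finsum (T ?D) (\<lambda>s. tn ?D (gterm k A d' d g f w s) (y' \<otimes>\<^bsub>l\<^esub> y)) (splits (length w))"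
    by (rule ext_finsum) (use gm yy in \<open>auto simp: tn_mem\<close>)
  also have "\<dots> = tn ?D (finsum (A ?D) (gterm k A d' d g f w) (splits (length w))) (y' \<otimes>\<^bsub>l\<^esub> y)"
    by (rule lin_finsum[OF A T_module tn_lin[OF yy], symmetric]) (use gm in auto)
  finally show ?thesis using ev_gerst[OF k A g f w] by (simp add: susp_def)
qed

end

section \<open>Reduced cochains\<close>

lemma ev_slot_zero:
  assumes "cring R" "\<And>i. module R (A i)" "\<And>i. module R (B i)" "f \<in> carrier (CC R A B d)"
    and "u \<in> wset (susp A)" "v \<in> wset (susp A)"
  shows "ev R A f (u @ (i, \<zero>\<^bsub>susp A i\<^esub>) # v) = \<zero>\<^bsub>susp B (wdeg u + (i + wdeg v) + d)\<^esub>"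
  using lin_zero[OF _ _ ev_slot_lin[OF assms, of i]] assms(2,3) by (simp add: susp_def)

locale split_unit =
  fixes k :: "('k, 'z) ring_scheme" and A :: "int \<Rightarrow> ('k, 'a) module" and e :: 'a and sp :: "'a \<Rightarrow> 'k"
  assumes k: "cring k" and split: "split_element k A e sp"
begin

lemma A: "module k (A i)" and e_mem: "e \<in> carrier (A 0)" and sp_hom: "sp \<in> mod_hom k (A 0) (self_alg k)"
  and sp_e: "sp e = \<one>\<^bsub>k\<^esub>"
  using split by (auto simp: split_element_def)

abbreviation "Q \<equiv> bar_mod k A sp"
abbreviation "\<pi> \<equiv> bar_proj A e sp"

lemma sA: "module k (susp A i)" by (simp add: susp_def A)

lemma sp_lin: "lin k (A 0) (self_alg k) sp" by (rule mod_hom_lin[OF sp_hom])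

lemma sp_mem: "a \<in> carrier (A 0) \<Longrightarrow> sp a \<in> carrier k"
  using linD(1)[OF sp_lin] by simp

lemma Q_simps [simp]:
  "\<zero>\<^bsub>Q i\<^esub> = \<zero>\<^bsub>A i\<^esub>" "x \<oplus>\<^bsub>Q i\<^esub> y = x \<oplus>\<^bsub>A i\<^esub> y" "r \<odot>\<^bsub>Q i\<^esub> x = r \<odot>\<^bsub>A i\<^esub> x"
  by (simp_all add: bar_mod_def)

lemma Q_carrier: "a \<in> carrier (Q i) \<longleftrightarrow> a \<in> carrier (A i) \<and> (i = 0 \<longrightarrow> sp a = \<zero>\<^bsub>k\<^esub>)"
  by (auto simp: bar_mod_def)

lemma Q_module: "module k (Q i)"
proof (cases "i = 0")
  case True
  have "submodule {x \<in> carrier (A 0). sp x = \<zero>\<^bsub>self_alg k\<^esub>} k (A 0)"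
    by (rule mod_hom_kernel_submodule[OF A self_alg_module[OF k] sp_hom])
  from submodule.submodule_is_module[OF this A] show ?thesis by (simp add: bar_mod_def True)
qed (simp add: bar_mod_def A)

lemma sQ: "module k (susp Q i)" by (simp add: susp_def Q_module)

lemma \<pi>_lin: "lin k (A i) (Q i) (\<pi> i)"
proof -
  interpret Ai: module k "A i" by (rule A)
  interpret A0: module k "A 0" by (rule A)
  note s = linD[OF sp_lin, unfolded self_alg_simps]
  have sm: "sp (a \<ominus>\<^bsub>A 0\<^esub> (sp a \<odot>\<^bsub>A 0\<^esub> e)) = \<zero>\<^bsub>k\<^esub>" if "a \<in> carrier (A 0)" for a
  proof -
    have "sp (a \<ominus>\<^bsub>A 0\<^esub> (sp a \<odot>\<^bsub>A 0\<^esub> e)) = sp a \<ominus>\<^bsub>self_alg k\<^esub> sp (sp a \<odot>\<^bsub>A 0\<^esub> e)"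
      using that by (intro mod_hom_minus[OF A self_alg_module[OF k] sp_hom] A0.smult_closed e_mem sp_mem)
    also have "sp (sp a \<odot>\<^bsub>A 0\<^esub> e) = sp a"
      using that s(1,3) e_mem by (simp add: sp_e)
    also have "sp a \<ominus>\<^bsub>self_alg k\<^esub> sp a = \<zero>\<^bsub>k\<^esub>"
      using module_minus_self_eq[OF self_alg_module[OF k], of "sp a" "sp a"] s(1)[OF that] by simp
    finally show ?thesis .
  qed
  show ?thesis
  proof (rule linI)
    show "\<pi> i x \<in> carrier (Q i)" if "x \<in> carrier (A i)" for x
      using that sm e_mem s(1) by (auto simp: bar_proj_def Q_carrier)
    show "\<pi> i (x \<oplus>\<^bsub>A i\<^esub> y) = \<pi> i x \<oplus>\<^bsub>Q i\<^esub> \<pi> i y" if "x \<in> carrier (A i)" "y \<in> carrier (A i)" for x y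
      using that s e_mem by (auto simp: bar_proj_def A0.minus_eq A0.smult_l_distr A0.minus_add A0.a_ac)
    show "\<pi> i (r \<odot>\<^bsub>A i\<^esub> x) = r \<odot>\<^bsub>Q i\<^esub> \<pi> i x" if "r \<in> carrier k" "x \<in> carrier (A i)" for r x
      using that s e_mem
      by (auto simp: bar_proj_def A0.minus_eq A0.smult_r_distr A0.smult_r_minus A0.smult_assoc1)
  qed
qed

lemma \<pi>_mem: "a \<in> carrier (A i) \<Longrightarrow> \<pi> i a \<in> carrier (Q i)"
  by (rule linD(1)[OF \<pi>_lin])

lemma \<pi>_decomp: "a \<in> carrier (A 0) \<Longrightarrow> a = \<pi> 0 a \<oplus>\<^bsub>A 0\<^esub> sp a \<odot>\<^bsub>A 0\<^esub> e"
proof -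
  interpret A0: module k "A 0" by (rule A)
  show "a \<in> carrier (A 0) \<Longrightarrow> a = \<pi> 0 a \<oplus>\<^bsub>A 0\<^esub> sp a \<odot>\<^bsub>A 0\<^esub> e"
    using sp_mem e_mem by (simp add: bar_proj_def A0.minus_eq A0.a_assoc A0.l_neg)
qed

lemma \<pi>_e: "\<pi> 0 e = \<zero>\<^bsub>A 0\<^esub>"
proof -
  interpret A0: module k "A 0" by (rule A)
  show ?thesis using e_mem by (simp add: bar_proj_def sp_e A0.minus_eq A0.r_neg)
qed

definition bw :: "(int \<times> 'a) list \<Rightarrow> (int \<times> 'a) list" where
  "bw w = map (\<lambda>(i, a). (i, \<pi> (i - 1) a)) w"

lemma bw_simps [simp]:
  "bw [] = []" "bw ((i, a) # w) = (i, \<pi> (i - 1) a) # bw w" "bw (u @ v) = bw u @ bw v"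
  "length (bw w) = length w"
  by (simp_all add: bw_def)

lemma wdeg_bw [simp]: "wdeg (bw w) = wdeg w"
  by (induction w) auto

lemma bw_wset: "w \<in> wset (susp A) \<Longrightarrow> bw w \<in> wset (susp Q)"
  by (induction w) (auto simp: susp_def \<pi>_mem)

lemma wset_Q: "w \<in> wset (susp Q) \<Longrightarrow> w \<in> wset (susp A)"
  by (induction w) (auto simp: susp_def Q_carrier)

lemma bar_proj_pow:
  shows "bar_proj_pow k A e sp n m \<in> mod_hom k (tpow k (susp A) n m) (tpow k (susp Q) n m)"
    and "w \<in> words (susp A) n m \<Longrightarrow> bar_proj_pow k A e sp n m (pure k (susp A) w) = pure k (susp Q) (bw w)"
proof -
  have "mlin k (susp A) (tpow k (susp Q) n) n (\<lambda>w. pure k (susp Q) (bw w))"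
  proof (rule mlinI)
    show "pure k (susp Q) (bw w) \<in> carrier (tpow k (susp Q) n (wdeg w))"
      if "w \<in> wset (susp A)" "length w = n" for w
      using pure_mem[where M = "susp Q", OF k sQ bw_wset[OF that(1)]] that(2) by simp
    show "lin k (susp A i) (tpow k (susp Q) n (wdeg u + (i + wdeg v))) (\<lambda>x. pure k (susp Q) (bw (u @ (i, x) # v)))"
      if "u \<in> wset (susp A)" "v \<in> wset (susp A)" "Suc (length u + length v) = n" for u v i
      using lin_comp[OF mlin_lin[OF mlin_pure[where M = "susp Q", OF k sQ], of "bw u" "bw v" n i, unfolded susp_def]
          \<pi>_lin[of "i - 1"]] that bw_wset by (simp add: susp_def)
  qed
  from theI'[OF tpow_lift_ex1[where M = "susp A" and P = "tpow k (susp Q) n", OF k sA tpow_module[OF k sQ] this, of m]]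
  show "bar_proj_pow k A e sp n m \<in> mod_hom k (tpow k (susp A) n m) (tpow k (susp Q) n m)"
    "w \<in> words (susp A) n m \<Longrightarrow> bar_proj_pow k A e sp n m (pure k (susp A) w) = pure k (susp Q) (bw w)"
    unfolding bar_proj_pow_def bw_def by blast+
qed

lemma bar_incl:
  assumes f: "f \<in> carrier (CC k Q A d)"
  shows "bar_incl k A e sp f \<in> carrier (CC k A A d)"
    and "w \<in> wset (susp A) \<Longrightarrow> w \<noteq> [] \<Longrightarrow> ev k A (bar_incl k A e sp f) w = ev k Q f (bw w)"
proof -
  show "bar_incl k A e sp f \<in> carrier (CC k A A d)"
    unfolding CC_mem_iff
  proof (intro conjI allI impI)
    fix n :: nat and m assume n: "1 \<le> n"
    show "bar_incl k A e sp f n m \<in> mod_hom k (tpow k (susp A) n m) (susp A (m + d))"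
      using n mod_hom_compose[OF tpow_module[OF k sA] CC_memD[OF f n] bar_proj_pow(1)]
      by (simp add: bar_incl_def)
  qed (simp add: bar_incl_def)
  assume w: "w \<in> wset (susp A)" "w \<noteq> []"
  show "ev k A (bar_incl k A e sp f) w = ev k Q f (bw w)"
    using w bar_proj_pow(2)[of w "length w" "wdeg w"] pure_mem[where M = "susp A", OF k sA w(1)]
    by (simp add: ev_def bar_incl_def compose_def words_iff)
qed

lemma CC_red_simps [simp]:
  "\<zero>\<^bsub>CC_red k A e sp d\<^esub> = \<zero>\<^bsub>CC k A A d\<^esub>" "f \<oplus>\<^bsub>CC_red k A e sp d\<^esub> g = f \<oplus>\<^bsub>CC k A A d\<^esub> g"
  "r \<odot>\<^bsub>CC_red k A e sp d\<^esub> f = r \<odot>\<^bsub>CC k A A d\<^esub> f"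
  by (simp_all add: CC_red_def)

text \<open>A letter of degree 0 in A is its projection plus a multiple of \<open>e\<close>, and by
  hypothesis the second part contributes zero. The letters are exchanged one at a time, with a
  prefix \<open>p\<close> carried along.\<close>

lemma ev_bw:
  assumes f: "f \<in> carrier (CC k A A d)"
    and van: "\<And>w. w \<in> wset (susp A) \<Longrightarrow> (1, e) \<in> set w \<Longrightarrow> ev k A f w = \<zero>\<^bsub>susp A (wdeg w + d)\<^esub>"
    and w: "w \<in> wset (susp A)"
  shows "ev k A f (bw w) = ev k A f w"
proof -
  have "ev k A f (p @ bw w) = ev k A f (p @ w)" if "p \<in> wset (susp A)" "w \<in> wset (susp A)" for p w
    using that
  proof (induction w arbitrary: p)
    case (Cons s w)
    obtain i a where s: "s = (i, a)" by (cases s)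
    have a: "a \<in> carrier (A (i - 1))" "w \<in> wset (susp A)" using Cons.prems by (auto simp: s susp_def)
    have \<pi>a: "\<pi> (i - 1) a \<in> carrier (A (i - 1))" using \<pi>_mem[OF a(1)] by (simp add: Q_carrier)
    have "ev k A f (p @ bw (s # w)) = ev k A f (p @ (i, \<pi> (i - 1) a) # w)"
      using Cons.IH[of "p @ [(i, \<pi> (i - 1) a)]"] Cons.prems \<pi>a by (simp add: s susp_def)
    also have "\<dots> = ev k A f (p @ (i, a) # w)"
    \<comment> \<open>Degree 1 in the suspension is degree 0 in A, the only degree in which the
      projection is not the identity.\<close>
    proof (cases "i = 1")
      case True
      let ?N = "susp A (wdeg p + (1 + wdeg w) + d)"
      interpret N: module k ?N by (rule sA)
      interpret A0: module k "A 0" by (rule A)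
      note L = ev_slot_lin[OF k A A f Cons.prems(1) a(2), of 1]
      have a0: "a \<in> carrier (A 0)" using a(1) True by simp
      have m: "ev k A f (p @ (1, \<pi> 0 a) # w) \<in> carrier ?N"
        using linD(1)[OF L] \<pi>a True by (simp add: susp_def)
      have "ev k A f (p @ (1, a) # w) = ev k A f (p @ (1, \<pi> 0 a \<oplus>\<^bsub>A 0\<^esub> sp a \<odot>\<^bsub>A 0\<^esub> e) # w)"
        using \<pi>_decomp[OF a0] by simp
      also have "\<dots> = ev k A f (p @ (1, \<pi> 0 a) # w) \<oplus>\<^bsub>?N\<^esub> sp a \<odot>\<^bsub>?N\<^esub> ev k A f (p @ (1, e) # w)"
        using linD(2)[OF L, of "\<pi> 0 a" "sp a \<odot>\<^bsub>A 0\<^esub> e"] linD(3)[OF L, of "sp a" e] \<pi>a True sp_mem[OF a0] e_mem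
        by (simp add: susp_def)
      also have "ev k A f (p @ (1, e) # w) = \<zero>\<^bsub>?N\<^esub>"
        using van[of "p @ (1, e) # w"] Cons.prems a e_mem by (simp add: susp_def)
      finally show ?thesis using m sp_mem[OF a0] True by simp
    qed (simp add: bar_proj_def)
    finally show ?case by (simp add: s)
  qed simp
  from this[of "[]" w] w show ?thesis by simp
qed

text \<open>Reduced cochains are defined as an image. Under the projection a letter \<open>e\<close>
  becomes 0, which gives vanishing. Conversely, a cochain with this vanishing is restricted to words
  in the quotient, and \<open>ev_bw\<close> shows that the restriction induces it again.\<close>

lemma CC_red_iff: "f \<in> carrier (CC_red k A e sp d) \<longleftrightarrow> f \<in> carrier (CC k A A d) \<and>
    (\<forall>w\<in>wset (susp A). (1, e) \<in> set w \<longrightarrow> ev k A f w = \<zero>\<^bsub>susp A (wdeg w + d)\<^esub>)"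
proof
  assume "f \<in> carrier (CC_red k A e sp d)"
  then obtain g where g: "g \<in> carrier (CC k Q A d)" "f = bar_incl k A e sp g"
    by (auto simp: CC_red_def)
  have "ev k A f w = \<zero>\<^bsub>susp A (wdeg w + d)\<^esub>" if w: "w \<in> wset (susp A)" "(1, e) \<in> set w" for w
  proof -
    obtain u v where uv: "w = u @ (1, e) # v" using split_list[OF w(2)] by blast
    then have "bw u \<in> wset (susp Q)" "bw v \<in> wset (susp Q)" using w bw_wset by auto
    from ev_slot_zero[where A = Q and B = A, OF k Q_module A g(1) this, of 1]
    show ?thesis using bar_incl(2)[OF g(1) w(1)] w by (simp add: uv g(2) \<pi>_e susp_def)
  qed
  then show "f \<in> carrier (CC k A A d) \<and>
    (\<forall>w\<in>wset (susp A). (1, e) \<in> set w \<longrightarrow> ev k A f w = \<zero>\<^bsub>susp A (wdeg w + d)\<^esub>)"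
    using bar_incl(1)[OF g(1)] g(2) by blast
next
  assume R: "f \<in> carrier (CC k A A d) \<and>
    (\<forall>w\<in>wset (susp A). (1, e) \<in> set w \<longrightarrow> ev k A f w = \<zero>\<^bsub>susp A (wdeg w + d)\<^esub>)"
  then have f: "f \<in> carrier (CC k A A d)" by blast
  have c: "cmlin k Q A d (ev k A f)"
    unfolding cmlin_def
  proof (intro allI impI mlinI)
    fix n :: nat and w assume "1 \<le> n" and w: "w \<in> wset (susp Q)" "length w = n"
    then show "ev k A f w \<in> carrier (susp A (wdeg w + d))"
      using ev_mem[OF k A A f wset_Q[OF w(1)]] by auto
  next
    fix n :: nat and u v i assume "1 \<le> n" and uv: "u \<in> wset (susp Q)" "v \<in> wset (susp Q)"
      "Suc (length u + length v) = n"
    show "lin k (susp Q i) (susp A (wdeg u + (i + wdeg v) + d)) (\<lambda>x. ev k A f (u @ (i, x) # v))"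
      using linD[OF ev_slot_lin[OF k A A f wset_Q[OF uv(1)] wset_Q[OF uv(2)], of i]]
      by (intro linI) (auto simp: susp_def Q_carrier)
  qed
  let ?g = "cc_of k Q A d (ev k A f)"
  note g = cc_of[OF k Q_module A c]
  have "bar_incl k A e sp ?g = f"
  proof (rule CC_eqI[OF k A A bar_incl(1)[OF g(1)] f])
    fix w assume w: "w \<in> wset (susp A)" "w \<noteq> []"
    then have "bw w \<noteq> []" by (cases w) auto
    then have "ev k A (bar_incl k A e sp ?g) w = ev k A f (bw w)"
      using bar_incl(2)[OF g(1) w] g(2)[OF bw_wset[OF w(1)]] by simp
    also have "\<dots> = ev k A f w" using R w(1) by (intro ev_bw[OF f]) auto
    finally show "ev k A (bar_incl k A e sp ?g) w = ev k A f w" .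
  qed
  then show "f \<in> carrier (CC_red k A e sp d)"
    using g(1) unfolding CC_red_def by force
qed

lemma CC_red_subset: "f \<in> carrier (CC_red k A e sp d) \<Longrightarrow> f \<in> carrier (CC k A A d)"
  and CC_red_vanish: "f \<in> carrier (CC_red k A e sp d) \<Longrightarrow> w \<in> wset (susp A) \<Longrightarrow> (1, e) \<in> set w \<Longrightarrow>
    ev k A f w = \<zero>\<^bsub>susp A (wdeg w + d)\<^esub>"
  by (auto simp: CC_red_iff)

lemma CC_module': "module k (CC k A A d)" by (rule CC_module[OF k A A])

text \<open>By \<open>CC_red_iff\<close> the reduced cochains are the common kernel of linear
  evaluation maps.\<close>

lemma CC_red_module: "module k (CC_red k A e sp d)"
proof -
  interpret C: module k "CC k A A d" by (rule CC_module')
  have ne: "w \<noteq> []" if "(1, e) \<in> set w" for w using that by auto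
  have "submodule (carrier (CC_red k A e sp d)) k (CC k A A d)"
  proof (rule C.submoduleI)
    note L = ev_lin[OF k A A _ ne]
    have z: "\<zero>\<^bsub>susp A i\<^esub> \<oplus>\<^bsub>susp A i\<^esub> \<zero>\<^bsub>susp A i\<^esub> = \<zero>\<^bsub>susp A i\<^esub>" "\<ominus>\<^bsub>susp A i\<^esub> \<zero>\<^bsub>susp A i\<^esub> = \<zero>\<^bsub>susp A i\<^esub>"
      "r \<in> carrier k \<Longrightarrow> r \<odot>\<^bsub>susp A i\<^esub> \<zero>\<^bsub>susp A i\<^esub> = \<zero>\<^bsub>susp A i\<^esub>" for r i
    proof -
      interpret S: module k "susp A i" by (rule sA)
      show "\<zero>\<^bsub>susp A i\<^esub> \<oplus>\<^bsub>susp A i\<^esub> \<zero>\<^bsub>susp A i\<^esub> = \<zero>\<^bsub>susp A i\<^esub>" "\<ominus>\<^bsub>susp A i\<^esub> \<zero>\<^bsub>susp A i\<^esub> = \<zero>\<^bsub>susp A i\<^esub>"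
        "r \<in> carrier k \<Longrightarrow> r \<odot>\<^bsub>susp A i\<^esub> \<zero>\<^bsub>susp A i\<^esub> = \<zero>\<^bsub>susp A i\<^esub>" by simp_all
    qed
    show "\<zero>\<^bsub>CC k A A d\<^esub> \<in> carrier (CC_red k A e sp d)"
      using lin_zero[OF CC_module' sA L] by (auto simp: CC_red_iff)
    show "\<ominus>\<^bsub>CC k A A d\<^esub> f \<in> carrier (CC_red k A e sp d)" if "f \<in> carrier (CC_red k A e sp d)" for f
      using that lin_neg[OF CC_module' sA L] by (auto simp: CC_red_iff z)
    show "f \<oplus>\<^bsub>CC k A A d\<^esub> g \<in> carrier (CC_red k A e sp d)"
      if "f \<in> carrier (CC_red k A e sp d)" "g \<in> carrier (CC_red k A e sp d)" for f g
      using that linD(2)[OF L] by (auto simp: CC_red_iff z)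
    show "r \<odot>\<^bsub>CC k A A d\<^esub> f \<in> carrier (CC_red k A e sp d)"
      if "r \<in> carrier k" "f \<in> carrier (CC_red k A e sp d)" for r f
      using that linD(3)[OF L] by (auto simp: CC_red_iff z)
  qed (use CC_red_subset in blast)
  from submodule.submodule_is_module[OF this C.module_axioms] show ?thesis
    by (simp add: CC_red_def)
qed

text \<open>A bilinear formula for the product: the unit component of the first letter times the
  second letter, plus the signed term for the unit component of the second. The second term uses
  \<pi> of the first letter, so that unit times unit is counted once. A word of degree i + j has its
  value in degree i + j - 1 of the suspension, that is i + j - 2 of A.\<close>

fun mu_su_val :: "(int \<times> 'a) list \<Rightarrow> 'a" where
  "mu_su_val [(i, a), (j, b)] =
    (if i = 1 then sp a \<odot>\<^bsub>A (j - 1)\<^esub> b else \<zero>\<^bsub>A (i + j - 2)\<^esub>) \<oplus>\<^bsub>A (i + j - 2)\<^esub>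
    (if j = 1 then ksign (A (i - 1)) (i - 1) (sp b \<odot>\<^bsub>A (i - 1)\<^esub> \<pi> (i - 1) a) else \<zero>\<^bsub>A (i + j - 2)\<^esub>)"
| "mu_su_val w = \<zero>\<^bsub>A (wdeg w - 2)\<^esub>"

lemma mu_su_val_other: "length w \<noteq> 2 \<Longrightarrow> mu_su_val w = \<zero>\<^bsub>A (wdeg w - 2)\<^esub>"
  by (induction w rule: mu_su_val.induct) auto

lemma lin_const_zero: "module k N \<Longrightarrow> lin k M N (\<lambda>x. \<zero>\<^bsub>N\<^esub>)"
proof -
  assume "module k N"
  then interpret N: module k N .
  show ?thesis by (rule linI) auto
qed

lemma mu_su_val_cmlin: "cmlin k A A (-1) mu_su_val"
  unfolding cmlin_def
proof (intro allI impI)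
  fix n :: nat assume "1 \<le> n"
  have Az: "\<zero>\<^bsub>A i\<^esub> \<in> carrier (A i)" for i using A[of i] by (simp add: module_def abelian_groupE(2))
  have lsp: "lin k (A 0) (A j) (\<lambda>x. sp x \<odot>\<^bsub>A j\<^esub> b)" if "b \<in> carrier (A j)" for b j
  proof -
    interpret Aj: module k "A j" by (rule A)
    show ?thesis using that linD[OF sp_lin] by (intro linI) (auto simp: Aj.smult_l_distr Aj.smult_assoc1)
  qed
  have lsm: "lin k (A j) (A j) (\<lambda>x. r \<odot>\<^bsub>A j\<^esub> x)" if "r \<in> carrier k" for r j
    by (rule lin_smult[OF A lin_id that])
  have l\<pi>: "lin k (A i) (A i) (\<pi> i)" for i
    using linD[OF \<pi>_lin[of i]] by (intro linI) (auto simp: Q_carrier)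
  have L1: "lin k (A (i - 1)) (A (i + j - 2)) (\<lambda>a. mu_su_val [(i, a), (j, b)])" if "b \<in> carrier (A (j - 1))" for i j b
    unfolding mu_su_val.simps
  proof (rule lin_add[OF A])
    show "lin k (A (i - 1)) (A (i + j - 2)) (\<lambda>a. if i = 1 then sp a \<odot>\<^bsub>A (j - 1)\<^esub> b else \<zero>\<^bsub>A (i + j - 2)\<^esub>)"
      using lsp[OF that] lin_const_zero[OF A] by (cases "i = 1") (simp_all)
    show "lin k (A (i - 1)) (A (i + j - 2)) (\<lambda>a. if j = 1 then
        ksign (A (i - 1)) (i - 1) (sp b \<odot>\<^bsub>A (i - 1)\<^esub> \<pi> (i - 1) a) else \<zero>\<^bsub>A (i + j - 2)\<^esub>)"
    proof (cases "j = 1")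
      case True
      then show ?thesis
        using lin_comp[OF ksign_lin[OF A] lin_comp[OF lsm l\<pi>[of "i - 1"]]] sp_mem that by simp
    qed (simp add: lin_const_zero[OF A])
  qed
  have L2: "lin k (A (j - 1)) (A (i + j - 2)) (\<lambda>b. mu_su_val [(i, a), (j, b)])" if a: "a \<in> carrier (A (i - 1))" for i j a
    unfolding mu_su_val.simps
  proof (rule lin_add[OF A])
    show "lin k (A (j - 1)) (A (i + j - 2)) (\<lambda>b. if i = 1 then sp a \<odot>\<^bsub>A (j - 1)\<^esub> b else \<zero>\<^bsub>A (i + j - 2)\<^esub>)"
      using lsm[of "sp a" "j - 1"] lin_const_zero[OF A] sp_mem a by (cases "i = 1") simp_all
    show "lin k (A (j - 1)) (A (i + j - 2)) (\<lambda>b. if j = 1 then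
        ksign (A (i - 1)) (i - 1) (sp b \<odot>\<^bsub>A (i - 1)\<^esub> \<pi> (i - 1) a) else \<zero>\<^bsub>A (i + j - 2)\<^esub>)"
    proof (cases "j = 1")
      case True
      then show ?thesis
        using lin_comp[OF ksign_lin[OF A] lsp[OF linD(1)[OF l\<pi> a]]] by simp
    qed (simp add: lin_const_zero[OF A])
  qed
  show "mlin k (susp A) (\<lambda>m. susp A (m + - 1)) n mu_su_val"
  proof (rule mlinI)
    fix w assume w: "w \<in> wset (susp A)" "length w = n"
    show "mu_su_val w \<in> carrier (susp A (wdeg w + - 1))"
    proof (cases "length w = 2")
      case True
      then obtain i a j b where "w = [(i, a), (j, b)]"
        by (auto simp: length_Suc_conv numeral_2_eq_2)
      then show ?thesis using w linD(1)[OF L1[where i = i and j = j and b = b], of a] by (simp add: susp_def add.commute diff_add_eq)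
    qed (simp add: mu_su_val_other susp_def Az)
  next
    fix u v i assume uv: "u \<in> wset (susp A)" "v \<in> wset (susp A)" "Suc (length u + length v) = n"
    show "lin k (susp A i) (susp A (wdeg u + (i + wdeg v) + - 1)) (\<lambda>x. mu_su_val (u @ (i, x) # v))"
    proof (cases "n = 2")
      case True
      then consider j b where "u = []" "v = [(j, b)]" | j b where "v = []" "u = [(j, b)]"
        using uv(3) by (cases u; cases v) auto
      then show ?thesis
      proof cases
        case 1
        then have b: "b \<in> carrier (A (j - 1))" and deg: "wdeg u + (i + wdeg v) + - 1 - 1 = i + j - 2"
          using uv by (simp_all add: susp_def)
        show ?thesis
          unfolding susp_def deg using L1[OF b, of i] 1 by (simp del: mu_su_val.simps)
      next
        case 2
        then have b: "b \<in> carrier (A (j - 1))" and deg: "wdeg u + (i + wdeg v) + - 1 - 1 = j + i - 2"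
          using uv by (simp_all add: susp_def)
        show ?thesis
          unfolding susp_def deg using L2[OF b, of i] 2 by (simp del: mu_su_val.simps)
      qed
    next
      case False
      then have "mu_su_val (u @ (i, x) # v) = \<zero>\<^bsub>A (wdeg u + (i + wdeg v) - 2)\<^esub>" for x
        using uv(3) by (subst mu_su_val_other) auto
      then show ?thesis using lin_const_zero[OF A] by (simp add: susp_def)
    qed
  qed
qed

definition is_mu_su :: "('k, 'a, 'a) cochain \<Rightarrow> bool" where
  "is_mu_su \<nu> \<longleftrightarrow> \<nu> \<in> carrier (CC k A A (-1)) \<and>
     (\<forall>n\<ge>1. n \<noteq> 2 \<longrightarrow> \<nu> n = \<zero>\<^bsub>CCn k A A n (-1)\<^esub>) \<and>
     (\<forall>i. \<forall>a\<in>carrier (A i). ev k A \<nu> [(1, e), (i + 1, a)] = a) \<and>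
     (\<forall>i. \<forall>a\<in>carrier (A i). ev k A \<nu> [(i + 1, a), (1, e)] = ksign (A i) i a) \<and>
     (\<forall>i j. \<forall>a\<in>carrier (Q i). \<forall>b\<in>carrier (Q j). ev k A \<nu> [(i + 1, a), (j + 1, b)] = \<zero>\<^bsub>A (i + j)\<^esub>)"

lemma is_mu_su_exists: "is_mu_su (cc_of k A A (-1) mu_su_val)"
proof -
  let ?m = "cc_of k A A (-1) mu_su_val"
  note m = cc_of[OF k A A mu_su_val_cmlin]
  have "?m n = \<zero>\<^bsub>CCn k A A n (-1)\<^esub>" if n: "1 \<le> n" "n \<noteq> 2" for n
  proof
    fix j
    interpret H: module k "hom_module k (tpow k (susp A) n j) (susp A (j + - 1))"
      by (rule hom_module_module[OF tpow_module[OF k sA] sA])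
    have z: "\<zero>\<^bsub>CCn k A A n (-1)\<^esub> j = \<zero>\<^bsub>hom_module k (tpow k (susp A) n j) (susp A (j + - 1))\<^esub>"
      by (simp add: CCn_def ghom_def prod_module_simps)
    show "?m n j = \<zero>\<^bsub>CCn k A A n (-1)\<^esub> j"
      unfolding z
    proof (rule tpow_hom_eqI[OF k sA sA])
      show "?m n j \<in> mod_hom k (tpow k (susp A) n j) (susp A (j + - 1))" by (rule CC_memD[OF m(1) n(1)])
      show "\<zero>\<^bsub>hom_module k (tpow k (susp A) n j) (susp A (j + - 1))\<^esub> \<in> mod_hom k (tpow k (susp A) n j) (susp A (j + - 1))"
        using H.zero_closed unfolding hom_module_simps(1) .
      fix w assume w: "w \<in> words (susp A) n j"
      then have "?m n j (pure k (susp A) w) = mu_su_val w"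
        using m(2)[of w] n by (auto simp: words_iff ev_def)
      also have "\<dots> = \<zero>\<^bsub>susp A (j + - 1)\<^esub>" using w n by (simp add: words_iff mu_su_val_other susp_def)
      also have "\<dots> = \<zero>\<^bsub>hom_module k (tpow k (susp A) n j) (susp A (j + - 1))\<^esub> (pure k (susp A) w)"
        using pure_mem[where M = "susp A", OF k sA, of w] w by (simp add: words_iff hom_module_simps)
      finally show "?m n j (pure k (susp A) w) = \<zero>\<^bsub>hom_module k (tpow k (susp A) n j) (susp A (j + - 1))\<^esub> (pure k (susp A) w)" .
    qed
  qed
  moreover have "ev k A ?m [(1, e), (i + 1, a)] = a" if a: "a \<in> carrier (A i)" for i a
  proof -
    interpret Ai: module k "A i" by (rule A)
    interpret A0: module k "A 0" by (rule A)
    have "ev k A ?m [(1, e), (i + 1, a)] = mu_su_val [(1, e), (i + 1, a)]"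
      using a e_mem by (intro m(2)) (auto simp: susp_def)
    also have "\<dots> = a" using a sp_mem by (cases "i = 0") (simp_all add: sp_e \<pi>_e ksign_def)
    finally show ?thesis .
  qed
  moreover have "ev k A ?m [(i + 1, a), (1, e)] = ksign (A i) i a" if a: "a \<in> carrier (A i)" for i a
  proof -
    interpret Ai: module k "A i" by (rule A)
    interpret A0: module k "A 0" by (rule A)
    have \<pi>: "\<pi> i a \<in> carrier (A i)" using \<pi>_mem[OF a] by (simp add: Q_carrier)
    have "ev k A ?m [(i + 1, a), (1, e)] = mu_su_val [(i + 1, a), (1, e)]"
      using a e_mem by (intro m(2)) (auto simp: susp_def)
    also have "\<dots> = ksign (A i) i a"
    \<comment> \<open>In degree 0 both summands of \<open>mu_su_val\<close> occur and recombine to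
      \<open>a\<close>. In other degrees only the second occurs, and \<pi> is the identity.\<close>
    proof (cases "i = 0")
      case True
      have "mu_su_val [(i + 1, a), (1, e)] = sp a \<odot>\<^bsub>A 0\<^esub> e \<oplus>\<^bsub>A 0\<^esub> \<pi> 0 a"
        using \<pi> True by (simp add: sp_e ksign_def)
      also have "\<dots> = a" using \<pi>_decomp[of a] a \<pi> True A0.a_comm[of "\<pi> 0 a" "sp a \<odot>\<^bsub>A 0\<^esub> e"] sp_mem e_mem by simp
      finally show ?thesis using True by (simp add: ksign_def)
    next
      case False
      then show ?thesis using a by (simp add: sp_e bar_proj_def ksign_mem[OF A])
    qed
    finally show ?thesis .
  qed
  moreover have "ev k A ?m [(i + 1, a), (j + 1, b)] = \<zero>\<^bsub>A (i + j)\<^esub>"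
    if ab: "a \<in> carrier (Q i)" "b \<in> carrier (Q j)" for i j a b
  proof -
    interpret Ai: module k "A i" by (rule A)
    interpret Aj: module k "A j" by (rule A)
    interpret A0: module k "A 0" by (rule A)
    interpret Aij: module k "A (i + j)" by (rule A)
    have ab': "a \<in> carrier (A i)" "b \<in> carrier (A j)" using ab by (auto simp: Q_carrier)
    have \<pi>: "\<pi> i a \<in> carrier (A i)" using \<pi>_mem[OF ab'(1)] by (simp add: Q_carrier)
    have "ev k A ?m [(i + 1, a), (j + 1, b)] = mu_su_val [(i + 1, a), (j + 1, b)]"
      using ab' by (intro m(2)) (auto simp: susp_def)
    also have "\<dots> = \<zero>\<^bsub>A (i + j)\<^esub>" using ab ab' \<pi> by (auto simp: Q_carrier ksign_def)
    finally show ?thesis .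
  qed
  ultimately show ?thesis using m(1) unfolding is_mu_su_def by blast
qed

text \<open>Away from arity 2 both cochains are zero. In arity 2 each letter splits into its
  projection and a multiple of \<open>e\<close>, and the resulting values are all
  prescribed.\<close>

lemma is_mu_su_unique:
  assumes \<nu>: "is_mu_su \<nu>" and \<nu>': "is_mu_su \<nu>'"
  shows "\<nu> = \<nu>'"
proof (rule CC_eqI[OF k A A])
  show C: "\<nu> \<in> carrier (CC k A A (-1))" and C': "\<nu>' \<in> carrier (CC k A A (-1))"
    using \<nu> \<nu>' by (simp_all add: is_mu_su_def)
  fix w assume w: "w \<in> wset (susp A)" "w \<noteq> []"
  show "ev k A \<nu> w = ev k A \<nu>' w"
  proof (cases "length w = 2")
    case False
    then show ?thesis using \<nu> \<nu>' w(2) by (simp add: is_mu_su_def ev_def)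
  next
    case True
    then obtain i a j b where wab: "w = [(i, a), (j, b)]"
      by (auto simp: length_Suc_conv numeral_2_eq_2)
    then have a: "a \<in> carrier (A (i - 1))" and b: "b \<in> carrier (A (j - 1))"
      using w by (auto simp: susp_def)
    interpret A0: module k "A 0" by (rule A)
    have l: "ev k A \<nu> [(1, e), (j, b)] = ev k A \<nu>' [(1, e), (j, b)]" if "b \<in> carrier (A (j - 1))" for j b
      using \<nu> \<nu>' that spec[of _ "j - 1"] unfolding is_mu_su_def
      by (metis (no_types, lifting) diff_add_cancel)
    have r: "ev k A \<nu> [(i, a), (1, e)] = ev k A \<nu>' [(i, a), (1, e)]" if "a \<in> carrier (A (i - 1))" for i a
      using \<nu> \<nu>' that unfolding is_mu_su_def by (metis (no_types, lifting) diff_add_cancel)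
    have q: "ev k A \<nu> [(i, a), (j, b)] = ev k A \<nu>' [(i, a), (j, b)]"
      if "a \<in> carrier (Q (i - 1))" "b \<in> carrier (Q (j - 1))" for i j a b
      using \<nu> \<nu>' that unfolding is_mu_su_def by (metis (no_types, lifting) diff_add_cancel)
    have \<pi>m: "\<pi> 0 x \<in> carrier (A 0)" "\<pi> 0 x \<in> carrier (Q 0)" "sp x \<odot>\<^bsub>A 0\<^esub> e \<in> carrier (A 0)"
      if "x \<in> carrier (A 0)" for x
      using \<pi>_mem[OF that] sp_mem[OF that] e_mem by (simp_all add: Q_carrier)
    \<comment> \<open>The second letter is split first, with the first letter already in the
      quotient; splitting the first letter afterwards then reduces to this case.\<close>
    have q1: "ev k A \<nu> [(i, a), (j, b)] = ev k A \<nu>' [(i, a), (j, b)]" if aQ: "a \<in> carrier (Q (i - 1))" for i a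
    proof (cases "j = 1")
      case True
      then have b0: "b \<in> carrier (A 0)" using b by simp
      have aA: "a \<in> carrier (A (i - 1))" using aQ by (simp add: Q_carrier)
      then have u: "[(i, a)] \<in> wset (susp A)" by (simp add: susp_def)
      note L = ev_slot_lin[OF k A A C u, of "[]" 1, unfolded susp_def]
      note L' = ev_slot_lin[OF k A A C' u, of "[]" 1, unfolded susp_def]
      have "ev k A \<nu> [(i, a), (1, \<pi> 0 b \<oplus>\<^bsub>A 0\<^esub> sp b \<odot>\<^bsub>A 0\<^esub> e)] = ev k A \<nu>' [(i, a), (1, \<pi> 0 b \<oplus>\<^bsub>A 0\<^esub> sp b \<odot>\<^bsub>A 0\<^esub> e)]"
        using linD(2)[OF L, of "\<pi> 0 b" "sp b \<odot>\<^bsub>A 0\<^esub> e"] linD(2)[OF L', of "\<pi> 0 b" "sp b \<odot>\<^bsub>A 0\<^esub> e"]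
          linD(3)[OF L, of "sp b" e] linD(3)[OF L', of "sp b" e] \<pi>m[OF b0] sp_mem[OF b0] e_mem
          q[OF aQ, of "\<pi> 0 b" 1] r[OF aA] by simp
      then show ?thesis using \<pi>_decomp[OF b0] True by simp
    next
      case False
      then show ?thesis using b by (intro q aQ) (simp add: Q_carrier)
    qed
    have "ev k A \<nu> [(i, a), (j, b)] = ev k A \<nu>' [(i, a), (j, b)]"
    proof (cases "i = 1")
      case True
      then have a0: "a \<in> carrier (A 0)" using a by simp
      have v: "[(j, b)] \<in> wset (susp A)" using b by (simp add: susp_def)
      note L = ev_slot_lin[OF k A A C, of "[]" "[(j, b)]" 1, unfolded susp_def]
      note L' = ev_slot_lin[OF k A A C', of "[]" "[(j, b)]" 1, unfolded susp_def]
      have "ev k A \<nu> [(1, \<pi> 0 a \<oplus>\<^bsub>A 0\<^esub> sp a \<odot>\<^bsub>A 0\<^esub> e), (j, b)] = ev k A \<nu>' [(1, \<pi> 0 a \<oplus>\<^bsub>A 0\<^esub> sp a \<odot>\<^bsub>A 0\<^esub> e), (j, b)]"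
        using linD(2)[OF L, of "\<pi> 0 a" "sp a \<odot>\<^bsub>A 0\<^esub> e"] linD(2)[OF L', of "\<pi> 0 a" "sp a \<odot>\<^bsub>A 0\<^esub> e"]
          linD(3)[OF L, of "sp a" e] linD(3)[OF L', of "sp a" e] \<pi>m[OF a0] sp_mem[OF a0] e_mem v
          q1[of "\<pi> 0 a" 1] l[OF b] by (simp add: susp_def)
      then show ?thesis using \<pi>_decomp[OF a0] True by simp
    next
      case False
      then show ?thesis using a by (intro q1) (simp add: Q_carrier)
    qed
    then show ?thesis by (simp add: wab)
  qed
qed

lemma mu_su: "is_mu_su (mu_su k A e sp)"
proof -
  have "\<exists>!\<nu>. is_mu_su \<nu>" using is_mu_su_exists is_mu_su_unique by blast
  from theI'[OF this] show ?thesis unfolding mu_su_def is_mu_su_def .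
qed

lemma mu_su_mem: "mu_su k A e sp \<in> carrier (CC k A A (-1))"
  using mu_su by (simp add: is_mu_su_def)

section \<open>The unit letter under insertions, and products of reduced cochains\<close>

lemma e_in_ins:
  assumes "w = u @ (1, e) # v" "length u < j \<or> j + p \<le> length u"
  shows "(1, e) \<in> set (ins k A d f j p w)"
proof -
  have "(1, e) \<in> set (take j w) \<or> (1, e) \<in> set (drop (j + p) w)"
    using assms(2)
  proof
    assume "length u < j"
    then obtain n where "j - length u = Suc n" by (metis Suc_diff_Suc)
    then show ?thesis by (simp add: assms(1))
  qed (simp add: assms(1))
  then show ?thesis by (auto simp: ins_def)
qed

lemma e_in_block:
  assumes "w = u @ (1, e) # v" "j \<le> length u" "length u < j + p"
  shows "(1, e) \<in> set (take p (drop j w))"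
proof -
  have "0 < p - (length u - j)" using assms(2,3) by simp
  then obtain n where "p - (length u - j) = Suc n" by (metis Suc_pred)
  then show ?thesis using assms(1,2) by simp
qed

lemma ev_ins_zero:
  assumes g: "g \<in> carrier (CC k A A d')" and w: "w \<in> wset (susp A)"
    and z: "ev k A f (take p (drop j w)) = \<zero>\<^bsub>susp A (wdeg (take p (drop j w)) + d)\<^esub>"
  shows "ev k A g (ins k A d f j p w) = \<zero>\<^bsub>susp A (wdeg w + (d' + d))\<^esub>"
proof -
  have "wdeg (take j w) + (wdeg (take p (drop j w)) + d + wdeg (drop (j + p) w)) + d' = wdeg w + (d' + d)"
    using wdeg_take_drop[of j w] wdeg_take_drop[of p "drop j w"] by (simp add: add.commute)
  with ev_slot_zero[OF k A A g wset_take[OF w] wset_drop[OF w], of j "wdeg (take p (drop j w)) + d" "j + p"]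
  show ?thesis by (simp only: ins_def z)
qed

lemma ksign_zero: "ksign (A i) s \<zero>\<^bsub>A i\<^esub> = \<zero>\<^bsub>A i\<^esub>"
proof -
  interpret Ai: module k "A i" by (rule A)
  show ?thesis by (simp add: ksign_def)
qed

lemma gterm_zeroI:
  "ev k A g (ins k A d f (fst s) (snd s) w) = \<zero>\<^bsub>susp A (wdeg w + (d' + d))\<^esub> \<Longrightarrow>
    gterm k A d' d g f w s = \<zero>\<^bsub>susp A (wdeg w + (d' + d))\<^esub>"
  by (simp add: gterm_def susp_def ksign_zero)

text \<open>Every summand vanishes on a word with a letter \<open>e\<close>: if the letter lies
  outside the block it survives into the argument of \<open>g\<close>, and if it lies inside it is
  an argument of \<open>f\<close>.\<close>

lemma gerst_CC_red:
  assumes g: "g \<in> carrier (CC_red k A e sp d')" and f: "f \<in> carrier (CC_red k A e sp d)"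
  shows "gerst k A d' d g f \<in> carrier (CC_red k A e sp (d' + d))"
proof -
  note g' = CC_red_subset[OF g] and f' = CC_red_subset[OF f]
  have "ev k A (gerst k A d' d g f) w = \<zero>\<^bsub>susp A (wdeg w + (d' + d))\<^esub>"
    if w: "w \<in> wset (susp A)" and ew: "(1, e) \<in> set w" for w
  proof -
    obtain u v where uv: "w = u @ (1, e) # v" using split_list[OF ew] by blast
    interpret N: module k "susp A (wdeg w + (d' + d))" by (rule sA)
    have "gterm k A d' d g f w s = \<zero>\<^bsub>susp A (wdeg w + (d' + d))\<^esub>" if s: "s \<in> splits (length w)" for s
    proof (rule gterm_zeroI)
      let ?j = "fst s" and ?p = "snd s"
      have jp: "1 \<le> ?p" "?j + ?p \<le> length w" using s by (auto simp: splits_def)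
      show "ev k A g (ins k A d f ?j ?p w) = \<zero>\<^bsub>susp A (wdeg w + (d' + d))\<^esub>"
      proof (cases "length u < ?j \<or> ?j + ?p \<le> length u")
        case True
        from CC_red_vanish[OF g ins_wset[OF k A f' w jp] e_in_ins[OF uv True]]
        show ?thesis by (simp add: wdeg_ins ac_simps)
      next
        case False
        then show ?thesis
          using CC_red_vanish[OF f wset_take[OF wset_drop[OF w]] e_in_block[OF uv]]
          by (intro ev_ins_zero[OF g' w]) auto
      qed
    qed
    then have "finsum (susp A (wdeg w + (d' + d))) (gterm k A d' d g f w) (splits (length w)) =
        finsum (susp A (wdeg w + (d' + d))) (\<lambda>s. \<zero>\<^bsub>susp A (wdeg w + (d' + d))\<^esub>) (splits (length w))"
      by (intro N.finsum_cong') auto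
    then show ?thesis using ev_gerst[OF k A g' f' w] uv N.finsum_zero by simp
  qed
  then show ?thesis using gerst_mem[OF k A g' f'] by (simp add: CC_red_iff)
qed

end

lemma ksign_ksign: "module R M \<Longrightarrow> x \<in> carrier M \<Longrightarrow> ksign M s (ksign M t x) = ksign M (s + t) x"
  by (simp add: ksign_def module_def abelian_group.minus_minus)

lemma ksign_cong: "even s = even t \<Longrightarrow> ksign M s x = ksign M t x"
  by (simp add: ksign_def)

lemma finsum_subset:
  assumes "abelian_group N" "finite S" "S0 \<subseteq> S" "\<And>s. s \<in> S \<Longrightarrow> F s \<in> carrier N" "\<And>s. s \<in> S - S0 \<Longrightarrow> F s = \<zero>\<^bsub>N\<^esub>"
  shows "finsum N F S = finsum N F S0"
proof -
  interpret N: abelian_group N by fact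
  show ?thesis
    by (rule N.add.finprod_mono_neutral_cong_right) (use assms(2-) in auto)
qed

lemma strictly_unital_left:
  assumes "strictly_unital R A e \<nu>" "a \<in> carrier (A (j - 1))"
  shows "ev R A \<nu> [(1, e), (j, a)] = a"
  using assms unfolding strictly_unital_def by (metis diff_add_cancel)

lemma strictly_unital_right:
  assumes R: "cring R" and A: "\<And>i. module R (A i)" and e: "e \<in> carrier (A 0)"
    and \<nu>: "strictly_unital R A e \<nu>" and a: "a \<in> carrier (A (j - 1))"
  shows "ev R A \<nu> [(j, a), (1, e)] = ksign (A (j - 1)) (j - 1) a"
proof -
  have "\<nu> \<in> carrier (CC R A A (-1))" using \<nu> by (simp add: strictly_unital_def)
  from ev_mem[OF R A A this, of "[(j, a), (1, e)]"] a e
  have m: "ev R A \<nu> [(j, a), (1, e)] \<in> carrier (A (j - 1))" by (simp add: susp_def)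
  have "a = ksign (A (j - 1)) (j - 1) (ev R A \<nu> [(j, a), (1, e)])"
    using \<nu> a unfolding strictly_unital_def by (metis diff_add_cancel)
  then have "ksign (A (j - 1)) (j - 1) a = ksign (A (j - 1)) ((j - 1) + (j - 1)) (ev R A \<nu> [(j, a), (1, e)])"
    using ksign_ksign[OF A m] by metis
  then show ?thesis by (simp add: ksign_def)
qed

lemma strictly_unital_other:
  assumes "strictly_unital R A e \<nu>" "w \<in> wset (susp A)" "(1, e) \<in> set w" "length w \<noteq> 2"
  shows "ev R A \<nu> w = \<zero>\<^bsub>susp A (wdeg w + -1)\<^esub>"
proof -
  have "w \<noteq> []" "w \<in> words (susp A) (length w) (wdeg w)" using assms(2,3) by (auto simp: words_iff)
  then have "1 \<le> length w" by (cases w) auto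
  moreover have "\<forall>n\<ge>1. n \<noteq> 2 \<longrightarrow> (\<forall>m. \<forall>w\<in>words (susp A) n m. (1, e) \<in> set w \<longrightarrow> ev R A \<nu> w = \<zero>\<^bsub>susp A (m - 1)\<^esub>)"
    by (rule conjunct2[OF conjunct2[OF assms(1)[unfolded strictly_unital_def]]])
  ultimately have "ev R A \<nu> w = \<zero>\<^bsub>susp A (wdeg w - 1)\<^esub>"
    using assms(3,4) \<open>w \<in> words _ _ _\<close> by blast
  then show ?thesis by simp
qed

context split_unit
begin

text \<open>Only insertions at or next to the unit survive, and they cancel in pairs.\<close>

lemma ev_bracket_unit:
  assumes \<nu>: "strictly_unital k A e \<nu>" and f: "f \<in> carrier (CC_red k A e sp (-1))"
    and w: "w \<in> wset (susp A)" "(1, e) \<in> set w"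
  shows "ev k A (gerst k A (-1) (-1) \<nu> f) w \<oplus>\<^bsub>A (wdeg w - 3)\<^esub> ev k A (gerst k A (-1) (-1) f \<nu>) w = \<zero>\<^bsub>A (wdeg w - 3)\<^esub>"
proof -
  have \<nu>C: "\<nu> \<in> carrier (CC k A A (-1))" using \<nu> by (simp add: strictly_unital_def)
  note fC = CC_red_subset[OF f]
  obtain u v where uv: "w = u @ (1, e) # v" using split_list[OF w(2)] by blast
  have um: "u \<in> wset (susp A)" and vm: "v \<in> wset (susp A)" and ne: "w \<noteq> []" using w by (auto simp: uv)
  let ?q = "length u" and ?n = "length w"
  \<comment> \<open>The target of both products: a cochain of degree -2 on a word of degree
    \<open>wdeg w\<close> has values in degree \<open>wdeg w - 2\<close> of the suspension, hence
    \<open>wdeg w - 3\<close> of A.\<close>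
  define N where "N = A (wdeg w - 3)"
  have NN: "susp A (wdeg w + (-1 + -1)) = N" by (simp add: N_def susp_def)
  interpret N: module k N unfolding N_def by (rule A)
  \<comment> \<open>The value of \<open>f\<close> on the word with the unit letter deleted; all
    surviving summands are this value up to sign.\<close>
  define c where "c = ev k A f (u @ v)"
  define a where "a = gterm k A (-1) (-1) \<nu> f w"
  define b where "b = gterm k A (-1) (-1) f \<nu> w"
  have a_mem: "a s \<in> carrier N" if "s \<in> splits ?n" for s
    using linD(1)[OF gterm_lin_left[OF k A fC w(1) that] \<nu>C] by (simp only: a_def NN)
  have b_mem: "b s \<in> carrier N" if "s \<in> splits ?n" for s
    using linD(1)[OF gterm_lin_left[OF k A \<nu>C w(1) that] fC] by (simp only: b_def NN)
  have c_mem: "c \<in> carrier N" if "u @ v \<noteq> []"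
  proof -
    have deg: "wdeg w - 3 = wdeg (u @ v) + - 1 - 1" by (simp add: uv)
    show ?thesis
      unfolding c_def N_def deg using ev_mem[OF k A A fC, of "u @ v"] um vm that by (simp add: susp_def)
  qed
  \<comment> \<open>With \<nu> as outer cochain and the unit outside the block, \<nu> survives only
    if it is left with two arguments. Then the unit is the first or last letter of the word and
    \<open>f\<close> takes all the others.\<close>
  have a_zero: "a s = \<zero>\<^bsub>N\<^esub>" if s: "s \<in> splits ?n"
    and nz: "\<not> (u = [] \<and> s = (1, ?n - 1))" "\<not> (v = [] \<and> s = (0, ?n - 1))" for s
  proof -
    obtain j p where jp: "s = (j, p)" "1 \<le> p" "j + p \<le> ?n" using s by (auto simp: splits_def)
    have "ev k A \<nu> (ins k A (-1) f j p w) = \<zero>\<^bsub>susp A (wdeg w + (-1 + -1))\<^esub>"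
    proof (cases "?q < j \<or> j + p \<le> ?q")
      case True
      have "length (ins k A (-1) f j p w) \<noteq> 2"
      proof
        assume "length (ins k A (-1) f j p w) = 2"
        then have p: "p = ?q + length v" using jp(3) by (simp add: length_ins uv)
        from True have "?q = 0 \<and> j = 1 \<or> length v = 0 \<and> j = 0"
          using jp(3) unfolding p uv length_append list.size by linarith
        then show False using nz by (auto simp: jp(1) p uv)
      qed
      from strictly_unital_other[OF \<nu> ins_wset[OF k A fC w(1) jp(2,3)] e_in_ins[OF uv True] this]
      show ?thesis by (simp add: wdeg_ins)
    next
      case False
      then show ?thesis
        using CC_red_vanish[OF f wset_take[OF wset_drop[OF w(1)]] e_in_block[OF uv]]
        by (intro ev_ins_zero[OF \<nu>C w(1)]) auto
    qed
    then show ?thesis unfolding a_def jp(1) NN[symmetric] by (intro gterm_zeroI) simp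
  qed
  \<comment> \<open>With \<nu> as inner cochain, its block must contain the unit and have length 2,
    so it pairs the unit with its right or its left neighbour. The guard on \<open>u\<close> matters
    because \<open>?q - 1\<close> is truncated subtraction.\<close>
  have b_zero: "b s = \<zero>\<^bsub>N\<^esub>" if s: "s \<in> splits ?n"
    and nz: "s \<noteq> (?q, 2)" "\<not> (u \<noteq> [] \<and> s = (?q - 1, 2))" for s
  proof -
    obtain j p where jp: "s = (j, p)" "1 \<le> p" "j + p \<le> ?n" using s by (auto simp: splits_def)
    have "ev k A f (ins k A (-1) \<nu> j p w) = \<zero>\<^bsub>susp A (wdeg w + (-1 + -1))\<^esub>"
    proof (cases "?q < j \<or> j + p \<le> ?q")
      case True
      from CC_red_vanish[OF f ins_wset[OF k A \<nu>C w(1) jp(2,3)] e_in_ins[OF uv True]]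
      show ?thesis by (simp add: wdeg_ins)
    next
      case False
      have "p \<noteq> 2" using False nz jp(1) by (cases u) auto
      then have "length (take p (drop j w)) \<noteq> 2" using jp by simp
      with False show ?thesis
        using strictly_unital_other[OF \<nu> wset_take[OF wset_drop[OF w(1)]] e_in_block[OF uv]]
        by (intro ev_ins_zero[OF fC w(1)]) auto
    qed
    then show ?thesis unfolding b_def jp(1) NN[symmetric] by (intro gterm_zeroI) simp
  qed
  have b1: "b (?q, 2) = ksign N (wdeg u) c" and b1s: "(?q, 2) \<in> splits ?n" if "v \<noteq> []"
  proof -
    obtain j x v' where v: "v = (j, x) # v'" using \<open>v \<noteq> []\<close> by (cases v) auto
    have x: "x \<in> carrier (A (j - 1))" using vm by (simp add: v susp_def)
    have ins: "ins k A (-1) \<nu> ?q 2 w = u @ v"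
      using strictly_unital_left[OF \<nu> x] by (simp add: ins_def uv v)
    have t: "take ?q w = u" by (simp add: uv)
    show "b (?q, 2) = ksign N (wdeg u) c"
      unfolding b_def gterm_def NN fst_conv snd_conv ins t by (simp add: c_def ksign_def)
    show "(?q, 2) \<in> splits ?n" by (simp add: splits_def uv v)
  qed
  \<comment> \<open>Moving \<nu> past \<open>u'\<close> contributes the exponent
    \<open>- wdeg u'\<close>, and the unit on the right of the letter contributes
    \<open>i - 1\<close>. With \<open>wdeg u = wdeg u' + i\<close> the total has the parity of
    \<open>wdeg u + 1\<close>, opposite to the pairing with the right neighbour.\<close>
  have b2: "b (?q - 1, 2) = ksign N (wdeg u + 1) c" and b2s: "(?q - 1, 2) \<in> splits ?n" if "u \<noteq> []"
  proof -
    obtain i x u' where u: "u = u' @ [(i, x)]" using \<open>u \<noteq> []\<close> by (cases u rule: rev_cases) auto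
    have x: "x \<in> carrier (A (i - 1))" and u': "u' \<in> wset (susp A)" using um by (auto simp: u susp_def)
    have ins: "ins k A (-1) \<nu> (?q - 1) 2 w = u' @ (i, ksign (A (i - 1)) (i - 1) x) # v"
      using strictly_unital_right[OF k A e_mem \<nu> x] by (simp add: ins_def uv u)
    have deg: "wdeg w - 3 = wdeg u' + (i + wdeg v) + - 1 - 1" by (simp add: uv u)
    have L: "lin k (A (i - 1)) N (\<lambda>x. ev k A f (u' @ (i, x) # v))"
      unfolding N_def deg using ev_slot_lin[OF k A A fC u' vm, of i] by (simp add: susp_def)
    have cc: "c = ev k A f (u' @ (i, x) # v)" by (simp add: c_def u)
    have "ev k A f (u' @ (i, ksign (A (i - 1)) (i - 1) x) # v) = ksign N (i - 1) c"
      unfolding cc by (rule lin_ksign[OF A N.module_axioms L x])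
    moreover have "take (?q - 1) w = u'" by (simp add: uv u)
    ultimately have "b (?q - 1, 2) = ksign N (- wdeg u') (ksign N (i - 1) c)"
      unfolding b_def gterm_def NN fst_conv snd_conv ins by simp
    also have "\<dots> = ksign N (- wdeg u' + (i - 1)) c"
      by (rule ksign_ksign[OF N.module_axioms c_mem]) (simp add: u)
    also have "\<dots> = ksign N (wdeg u + 1) c"
      by (rule ksign_cong) (auto simp: u)
    finally show "b (?q - 1, 2) = ksign N (wdeg u + 1) c" .
    show "(?q - 1, 2) \<in> splits ?n" by (simp add: splits_def uv u)
  qed
  \<comment> \<open>The sign comes from moving the odd cochain \<open>f\<close> past the letter [1],
    which has degree 1.\<close>
  have a1: "a (1, ?n - 1) = ksign N 1 c" and a1s: "(1, ?n - 1) \<in> splits ?n" if "u = []" "v \<noteq> []"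
  proof -
    have m: "c \<in> carrier (A ((wdeg v - 1) - 1))"
      using c_mem that by (simp add: N_def uv)
    have ins: "ins k A (-1) f 1 (?n - 1) w = [(1, e), (wdeg v - 1, c)]"
      using that by (simp add: ins_def uv c_def)
    have t: "take 1 w = [(1, e)]" using that by (simp add: uv)
    show "a (1, ?n - 1) = ksign N 1 c"
      unfolding a_def gterm_def NN fst_conv snd_conv ins t strictly_unital_left[OF \<nu> m]
      by (simp add: ksign_def)
    show "(1, ?n - 1) \<in> splits ?n" using that by (auto simp: splits_def uv Suc_le_eq)
  qed
  \<comment> \<open>No letter is passed here. The sign is that of a unit on the right of
    \<open>c\<close>, whose degree in A is \<open>wdeg u - 2\<close>.\<close>
  have a2: "a (0, ?n - 1) = ksign N (wdeg u) c" and a2s: "(0, ?n - 1) \<in> splits ?n" if "v = []" "u \<noteq> []"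
  proof -
    have m: "c \<in> carrier (A ((wdeg u - 1) - 1))"
      using c_mem that by (simp add: N_def uv)
    have ins: "ins k A (-1) f 0 (?n - 1) w = [(wdeg u - 1, c), (1, e)]"
      using that by (simp add: ins_def uv c_def)
    have "a (0, ?n - 1) = ksign N 0 (ksign (A ((wdeg u - 1) - 1)) ((wdeg u - 1) - 1) c)"
      unfolding a_def gterm_def NN fst_conv snd_conv ins strictly_unital_right[OF k A e_mem \<nu> m] by simp
    also have "\<dots> = ksign N (wdeg u) c"
      using that by (simp add: ksign_def N_def uv)
    finally show "a (0, ?n - 1) = ksign N (wdeg u) c" .
    show "(0, ?n - 1) \<in> splits ?n" using that by (auto simp: splits_def uv Suc_le_eq)
  qed
  have ea: "ev k A (gerst k A (-1) (-1) \<nu> f) w = finsum N a (splits ?n)"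
    using ev_gerst[OF k A \<nu>C fC w(1) ne] by (simp only: a_def NN)
  have eb: "ev k A (gerst k A (-1) (-1) f \<nu>) w = finsum N b (splits ?n)"
    using ev_gerst[OF k A fC \<nu>C w(1) ne] by (simp only: b_def NN)
  have suma: "finsum N a (splits ?n) = finsum N a S" if "S \<subseteq> splits ?n"
    "\<And>s. s \<in> splits ?n \<Longrightarrow> u = [] \<and> s = (1, ?n - 1) \<or> v = [] \<and> s = (0, ?n - 1) \<Longrightarrow> s \<in> S" for S
    by (rule finsum_subset[OF N.abelian_group_axioms finite_splits that(1)]) (use a_mem a_zero that(2) in blast)+
  have sumb: "finsum N b (splits ?n) = finsum N b S" if "S \<subseteq> splits ?n"
    "\<And>s. s \<in> splits ?n \<Longrightarrow> s = (?q, 2) \<or> u \<noteq> [] \<and> s = (?q - 1, 2) \<Longrightarrow> s \<in> S" for S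
    by (rule finsum_subset[OF N.abelian_group_axioms finite_splits that(1)]) (use b_mem b_zero that(2) in blast)+
  have cancel: "ksign N s c \<oplus>\<^bsub>N\<^esub> ksign N (s + 1) c = \<zero>\<^bsub>N\<^esub>" "ksign N (s + 1) c \<oplus>\<^bsub>N\<^esub> ksign N s c = \<zero>\<^bsub>N\<^esub>"
    if "u @ v \<noteq> []" for s
    using c_mem[OF that] by (simp_all add: ksign_def N.l_neg N.r_neg)
  have "finsum N a (splits ?n) \<oplus>\<^bsub>N\<^esub> finsum N b (splits ?n) = \<zero>\<^bsub>N\<^esub>"
  proof (cases "u = []"; cases "v = []")
    \<comment> \<open>The word is the unit alone. Its only insertion feeds the unit to
      \<open>f\<close> in one product and to the arity 1 part of \<nu> in the other, and both are
      zero.\<close>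
    assume E: "u = []" "v = []"
    have "splits ?n = {(0, 1)}" by (auto simp: splits_def uv E)
    moreover have "a (0, 1) = \<zero>\<^bsub>N\<^esub>" using CC_red_vanish[OF f w]
      unfolding a_def NN[symmetric] by (intro gterm_zeroI ev_ins_zero[OF \<nu>C w(1)]) (simp add: uv E)
    moreover have "b (0, 1) = \<zero>\<^bsub>N\<^esub>" by (rule b_zero) (auto simp: splits_def uv E)
    ultimately show ?thesis by simp
  next
    assume E: "u = []" "v \<noteq> []"
    have "finsum N a (splits ?n) = finsum N a {(1, ?n - 1)}" by (rule suma) (use a1s E in auto)
    moreover have "finsum N b (splits ?n) = finsum N b {(?q, 2)}" by (rule sumb) (use b1s E in auto)
    ultimately show ?thesis
      using a1[OF E] b1[OF E(2)] a_mem[OF a1s[OF E]] b_mem[OF b1s[OF E(2)]] cancel(2)[of 0] E by simp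
  next
    assume E: "u \<noteq> []" "v = []"
    have "finsum N a (splits ?n) = finsum N a {(0, ?n - 1)}" by (rule suma) (use a2s E in auto)
    moreover have "finsum N b (splits ?n) = finsum N b {(?q - 1, 2)}"
      by (rule sumb) (use b2s E in \<open>auto simp: splits_def uv\<close>)
    ultimately show ?thesis
      using a2[OF E(2,1)] b2[OF E(1)] a_mem[OF a2s[OF E(2,1)]] b_mem[OF b2s[OF E(1)]] cancel(1)[of "wdeg u"] E by simp
  next
    assume E: "u \<noteq> []" "v \<noteq> []"
    have "finsum N a (splits ?n) = finsum N a {}" by (rule suma) (use E in auto)
    moreover have "finsum N b (splits ?n) = finsum N b {(?q, 2), (?q - 1, 2)}"
      by (rule sumb) (use b1s b2s E in auto)
    moreover have "?q \<noteq> ?q - 1" using E by (cases u) auto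
    then have "finsum N b {(?q, 2), (?q - 1, 2)} = b (?q, 2) \<oplus>\<^bsub>N\<^esub> b (?q - 1, 2)"
      using b_mem[OF b1s[OF E(2)]] b_mem[OF b2s[OF E(1)]] by simp
    ultimately show ?thesis
      using b1[OF E(2)] b2[OF E(1)] b_mem[OF b1s[OF E(2)]] b_mem[OF b2s[OF E(1)]] cancel(1)[of "wdeg u"] E by simp
  qed
  then show ?thesis by (simp add: ea eb N_def)
qed

text \<open>For two elements of degree -1 the sign in front of the second product is again a minus,
  so the difference in the bracket becomes a sum.\<close>

lemma gbracket_odd:
  assumes "f \<in> carrier (CC k A A (-1))" "g \<in> carrier (CC k A A (-1))"
  shows "gbracket k A (-1) (-1) f g = gerst k A (-1) (-1) f g \<oplus>\<^bsub>CC k A A (-2)\<^esub> gerst k A (-1) (-1) g f"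
proof -
  interpret C: module k "CC k A A (-2)" by (rule CC_module')
  have "gerst k A (-1) (-1) g f \<in> carrier (CC k A A (-2))" using gerst_mem[OF k A assms(2,1)] by simp
  then show ?thesis by (simp add: gbracket_def ksign_def C.minus_eq)
qed

text \<open>Needed for the differential to have values in reduced cochains, without which the
  descriptions behind \<open>lie_tensor_diff\<close> would have no solution to speak of. Neither
  product alone has to be reduced; by \<open>ev_bracket_unit\<close> their sum is.\<close>

lemma gbracket_unit_CC_red:
  assumes \<nu>: "strictly_unital k A e \<nu>" and f: "f \<in> carrier (CC_red k A e sp (-1))"
  shows "gbracket k A (-1) (-1) \<nu> f \<in> carrier (CC_red k A e sp (-2))"
proof -
  have \<nu>C: "\<nu> \<in> carrier (CC k A A (-1))" using \<nu> by (simp add: strictly_unital_def)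
  note fC = CC_red_subset[OF f]
  interpret C: module k "CC k A A (-2)" by (rule CC_module')
  have m: "gerst k A (-1) (-1) \<nu> f \<in> carrier (CC k A A (-2))" "gerst k A (-1) (-1) f \<nu> \<in> carrier (CC k A A (-2))"
    using gerst_mem[OF k A \<nu>C fC] gerst_mem[OF k A fC \<nu>C] by simp_all
  have "ev k A (gbracket k A (-1) (-1) \<nu> f) w = \<zero>\<^bsub>susp A (wdeg w + - 2)\<^esub>"
    if w: "w \<in> wset (susp A)" "(1, e) \<in> set w" for w
  proof -
    have "w \<noteq> []" using w by auto
    from linD(2)[OF ev_lin[OF k A A w(1) this] m] ev_bracket_unit[OF \<nu> f w]
    show ?thesis by (simp add: gbracket_odd[OF \<nu>C fC] susp_def)
  qed
  then show ?thesis using m by (simp add: CC_red_iff gbracket_odd[OF \<nu>C fC])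
qed

lemma gbracket_CC_red:
  assumes f: "f \<in> carrier (CC_red k A e sp (-1))" and g: "g \<in> carrier (CC_red k A e sp (-1))"
  shows "gbracket k A (-1) (-1) f g \<in> carrier (CC_red k A e sp (-2))"
proof -
  interpret C: module k "CC_red k A e sp (-2)" by (rule CC_red_module)
  show ?thesis
    using C.a_closed[of "gerst k A (-1) (-1) f g" "gerst k A (-1) (-1) g f"] gerst_CC_red[OF f g] gerst_CC_red[OF g f]
    by (simp add: gbracket_odd CC_red_subset f g)
qed

end

section \<open>Augmented algebras\<close>

lemma free_module_coord_lin:
  "x \<in> Y \<Longrightarrow> lin R (free_module R Y) (self_alg R) (\<lambda>c. c x)"
  by (rule linI) (auto simp: free_module_simps)

text \<open>Realise M as a retract of a free module. The images of finitely many generators involve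
  only finitely many basis elements; these form \<open>B\<close>. The functionals are the
  coordinates of the inclusion, and the vectors are the images of the basis elements under the
  retraction.\<close>

lemma dual_basis:
  assumes M: "module R M" and fg: "fin_gen R M" and proj: "projective R M"
  obtains B :: "'m set" and \<phi> :: "'m \<Rightarrow> 'm \<Rightarrow> 'r" and y :: "'m \<Rightarrow> 'm"
  where "finite B" "\<And>b. b \<in> B \<Longrightarrow> lin R (M :: ('r, 'm) module) (self_alg R) (\<phi> b)" "\<And>b. b \<in> B \<Longrightarrow> y b \<in> carrier M"
    "\<And>x. x \<in> carrier M \<Longrightarrow> x = finsum M (\<lambda>b. \<phi> b x \<odot>\<^bsub>M\<^esub> y b) B"
proof -
  interpret M: module R M by fact
  note R = M.R.cring_axioms
  from proj obtain Y :: "'m set" and i p where i: "i \<in> mod_hom R M (free_module R Y)"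
    and p: "p \<in> mod_hom R (free_module R Y) M" and pi: "\<And>x. x \<in> carrier M \<Longrightarrow> p (i x) = x"
    unfolding projective_def by blast
  from fg obtain S where S: "finite S" "S \<subseteq> carrier M" "mspan R M S = carrier M"
    unfolding fin_gen_def by blast
  interpret F: module R "free_module R Y" by (rule free_module_module[OF R])
  define B where "B = (\<Union>s\<in>S. {x \<in> Y. i s x \<noteq> \<zero>\<^bsub>R\<^esub>})"
  have ic: "i x \<in> carrier (free_module R Y)" if "x \<in> carrier M" for x by (rule mod_hom_mem[OF i that])
  have finB: "finite B" and BY: "B \<subseteq> Y"
    using S ic by (auto simp: B_def free_module_simps)
  have "submodule {x \<in> carrier M. \<forall>b\<in>Y - B. i x b = \<zero>\<^bsub>R\<^esub>} R M"
  proof (rule M.submoduleI)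
    note L = lin_comp[OF free_module_coord_lin mod_hom_lin[OF i]]
    note sa = self_alg_module[OF R]
    show "\<zero>\<^bsub>M\<^esub> \<in> {x \<in> carrier M. \<forall>b\<in>Y - B. i x b = \<zero>\<^bsub>R\<^esub>}"
      using lin_zero[OF M sa L] by auto
    show "\<ominus>\<^bsub>M\<^esub> x \<in> {x \<in> carrier M. \<forall>b\<in>Y - B. i x b = \<zero>\<^bsub>R\<^esub>}" if "x \<in> {x \<in> carrier M. \<forall>b\<in>Y - B. i x b = \<zero>\<^bsub>R\<^esub>}" for x
    proof -
      have "\<ominus>\<^bsub>self_alg R\<^esub> \<zero>\<^bsub>R\<^esub> = \<zero>\<^bsub>R\<^esub>"
        using abelian_group.minus_equality[OF module.axioms(2)[OF sa], of "\<zero>\<^bsub>R\<^esub>" "\<zero>\<^bsub>R\<^esub>"] by simp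
      with that lin_neg[OF M sa L, of _ x] show ?thesis by auto
    qed
    show "x \<oplus>\<^bsub>M\<^esub> z \<in> {x \<in> carrier M. \<forall>b\<in>Y - B. i x b = \<zero>\<^bsub>R\<^esub>}"
      if "x \<in> {x \<in> carrier M. \<forall>b\<in>Y - B. i x b = \<zero>\<^bsub>R\<^esub>}" "z \<in> {x \<in> carrier M. \<forall>b\<in>Y - B. i x b = \<zero>\<^bsub>R\<^esub>}" for x z
      using that linD(2)[OF L, of _ x z] by auto
    show "r \<odot>\<^bsub>M\<^esub> x \<in> {x \<in> carrier M. \<forall>b\<in>Y - B. i x b = \<zero>\<^bsub>R\<^esub>}"
      if "r \<in> carrier R" "x \<in> {x \<in> carrier M. \<forall>b\<in>Y - B. i x b = \<zero>\<^bsub>R\<^esub>}" for r x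
      using that linD(3)[OF L, of _ r x] by auto
  qed auto
  \<comment> \<open>The coordinates outside \<open>B\<close> vanish on the generators and hence on
    their span, which is all of M.\<close>
  then have "mspan R M S \<subseteq> {x \<in> carrier M. \<forall>b\<in>Y - B. i x b = \<zero>\<^bsub>R\<^esub>}"
    using S(2) by (intro mspan_least) (auto simp: B_def)
  then have supp: "i x b = \<zero>\<^bsub>R\<^esub>" if "x \<in> carrier M" "b \<in> Y - B" for x b
    using that S(3) by blast
  define y where "y b = p (free_gen R Y b)" for b
  have g: "free_gen R Y b \<in> carrier (free_module R Y)" if "b \<in> B" for b
    using that BY by (intro free_gen_mem[OF R]) auto
  show thesis
  proof (rule that[of B "\<lambda>b x. i x b" y])
    show "lin R M (self_alg R) (\<lambda>x. i x b)" if "b \<in> B" for b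
      using lin_comp[OF free_module_coord_lin mod_hom_lin[OF i]] that BY by auto
    show "y b \<in> carrier M" if "b \<in> B" for b
      unfolding y_def by (rule mod_hom_mem[OF p g[OF that]])
    fix x assume x: "x \<in> carrier M"
    have c: "i x b \<in> carrier R" if "b \<in> B" for b
      using ic[OF x] that BY by (auto simp: free_module_simps)
    have "x = p (i x)" using pi x by simp
    also have "i x = finsum (free_module R Y) (\<lambda>b. i x b \<odot>\<^bsub>free_module R Y\<^esub> free_gen R Y b) B"
      by (rule free_module_expand[OF R ic[OF x] finB BY supp[OF x]])
    also have "p \<dots> = finsum M (\<lambda>b. p (i x b \<odot>\<^bsub>free_module R Y\<^esub> free_gen R Y b)) B"
      using c g by (intro mod_hom_finsum[OF F.module_axioms M p finB]) auto
    also have "\<dots> = finsum M (\<lambda>b. i x b \<odot>\<^bsub>M\<^esub> y b) B"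
    proof (rule M.finsum_cong')
      show "(\<lambda>b. i x b \<odot>\<^bsub>M\<^esub> y b) \<in> B \<rightarrow> carrier M"
        unfolding y_def using c mod_hom_mem[OF p g] by auto
      show "p (i x b \<odot>\<^bsub>free_module R Y\<^esub> free_gen R Y b) = i x b \<odot>\<^bsub>M\<^esub> y b" if "b \<in> B" for b
        unfolding y_def by (rule mod_hom_smult[OF p c[OF that] g[OF that]])
    qed simp
    finally show "x = finsum M (\<lambda>b. i x b \<odot>\<^bsub>M\<^esub> y b) B" .
  qed (rule finB)
qed

lemma tensor_lin_eqI:
  assumes M: "module R M" and N: "module R N" and "module R P"
    and h: "lin R (tensor R M N) P h" and h': "lin R (tensor R M N) P h'"
    and "\<And>x y. x \<in> carrier M \<Longrightarrow> y \<in> carrier N \<Longrightarrow> h (tens R M N x y) = h' (tens R M N x y)"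
    and "t \<in> carrier (tensor R M N)"
  shows "h t = h' t"
  using assms(7)
proof (induction rule: tensor_induct[OF M N, consumes 1, case_names tens add])
  case (add s t)
  then show ?case using linD(2)[OF h, of s t] linD(2)[OF h', of s t] by simp
qed (rule assms(6))

locale aug_alg =
  fixes k :: "('k, 'z) ring_scheme" and X :: "('k, 'l) aug"
  assumes k: "cring k" and X: "X \<in> aug_obj k"
begin

abbreviation "l \<equiv> fst X"
abbreviation "\<epsilon> \<equiv> snd X"
abbreviation "m \<equiv> aug_ker k X"

lemma l: "algebra k l" and fg: "fin_gen k l" and proj: "projective k l" and \<epsilon>: "\<epsilon> \<in> alg_hom k l (self_alg k)"
  using X by (auto simp: aug_obj_def)

sublocale l: algebra k l by (rule l)

lemma lk: "module k l" by (rule l.module)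
lemma sk: "module k (self_alg k)" by (rule self_alg_module[OF k])

lemma \<epsilon>_hom: "\<epsilon> \<in> mod_hom k l (self_alg k)" using \<epsilon> by (simp add: alg_hom_def)
lemma \<epsilon>_lin: "lin k l (self_alg k) \<epsilon>" by (rule mod_hom_lin[OF \<epsilon>_hom])
lemma \<epsilon>_mem: "x \<in> carrier l \<Longrightarrow> \<epsilon> x \<in> carrier k" using linD(1)[OF \<epsilon>_lin] by simp

lemma \<epsilon>_mult: "x \<in> carrier l \<Longrightarrow> y \<in> carrier l \<Longrightarrow> \<epsilon> (x \<otimes>\<^bsub>l\<^esub> y) = \<epsilon> x \<otimes>\<^bsub>k\<^esub> \<epsilon> y"
  and \<epsilon>_one: "\<epsilon> \<one>\<^bsub>l\<^esub> = \<one>\<^bsub>k\<^esub>"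
  using \<epsilon> by (auto simp: alg_hom_def ring_hom_def)

lemma m_simps [simp]:
  "\<zero>\<^bsub>m\<^esub> = \<zero>\<^bsub>l\<^esub>" "x \<oplus>\<^bsub>m\<^esub> y = x \<oplus>\<^bsub>l\<^esub> y" "r \<odot>\<^bsub>m\<^esub> x = r \<odot>\<^bsub>l\<^esub> x"
  by (simp_all add: aug_ker_def)

lemma m_iff: "x \<in> carrier m \<longleftrightarrow> x \<in> carrier l \<and> \<epsilon> x = \<zero>\<^bsub>k\<^esub>"
  by (simp add: aug_ker_def)

lemma m_mem: "x \<in> carrier m \<Longrightarrow> x \<in> carrier l" by (simp add: m_iff)

lemma m_module: "module k m"
proof -
  have "submodule {x \<in> carrier l. \<epsilon> x = \<zero>\<^bsub>self_alg k\<^esub>} k l"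
    by (rule mod_hom_kernel_submodule[OF lk sk \<epsilon>_hom])
  from submodule.submodule_is_module[OF this lk] show ?thesis by (simp add: aug_ker_def)
qed

lemma m_mult: "x \<in> carrier m \<Longrightarrow> y \<in> carrier m \<Longrightarrow> x \<otimes>\<^bsub>l\<^esub> y \<in> carrier m"
  by (auto simp: m_iff \<epsilon>_mult)

text \<open>The projection of l onto the augmentation ideal along the multiples of 1.\<close>

definition aug_part :: "'l \<Rightarrow> 'l" where "aug_part x = x \<ominus>\<^bsub>l\<^esub> (\<epsilon> x \<odot>\<^bsub>l\<^esub> \<one>\<^bsub>l\<^esub>)"

lemma aug_part_lin: "lin k l m aug_part"
proof (rule linI)
  note e = linD[OF \<epsilon>_lin, unfolded self_alg_simps]
  show "aug_part x \<in> carrier m" if "x \<in> carrier l" for x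
  proof -
    have "\<epsilon> (aug_part x) = \<epsilon> x \<ominus>\<^bsub>self_alg k\<^esub> \<epsilon> (\<epsilon> x \<odot>\<^bsub>l\<^esub> \<one>\<^bsub>l\<^esub>)"
      unfolding aug_part_def using that e by (intro mod_hom_minus[OF lk sk \<epsilon>_hom]) auto
    also have "\<epsilon> (\<epsilon> x \<odot>\<^bsub>l\<^esub> \<one>\<^bsub>l\<^esub>) = \<epsilon> x" using that e by (simp add: \<epsilon>_one)
    also have "\<epsilon> x \<ominus>\<^bsub>self_alg k\<^esub> \<epsilon> x = \<zero>\<^bsub>k\<^esub>"
      using module_minus_self_eq[OF sk, of "\<epsilon> x" "\<epsilon> x"] e(1)[OF that] by simp
    finally show ?thesis using that e by (simp add: m_iff) (simp add: aug_part_def)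
  qed
  show "aug_part (x \<oplus>\<^bsub>l\<^esub> y) = aug_part x \<oplus>\<^bsub>m\<^esub> aug_part y" if "x \<in> carrier l" "y \<in> carrier l" for x y
    using that e by (simp add: aug_part_def l.smult_l_distr l.minus_eq l.minus_add l.a_ac)
  show "aug_part (r \<odot>\<^bsub>l\<^esub> x) = r \<odot>\<^bsub>m\<^esub> aug_part x" if "r \<in> carrier k" "x \<in> carrier l" for r x
    using that e by (simp add: aug_part_def l.smult_r_distr l.minus_eq l.smult_r_minus l.smult_assoc1)
qed

lemma aug_part_decomp: "x \<in> carrier l \<Longrightarrow> x = aug_part x \<oplus>\<^bsub>l\<^esub> \<epsilon> x \<odot>\<^bsub>l\<^esub> \<one>\<^bsub>l\<^esub>"
  using \<epsilon>_mem by (simp add: aug_part_def l.minus_eq l.a_assoc l.l_neg)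

lemma aug_part_m: "x \<in> carrier m \<Longrightarrow> aug_part x = x"
  by (simp add: aug_part_def m_iff l.minus_eq)

lemma aug_part_one: "aug_part \<one>\<^bsub>l\<^esub> = \<zero>\<^bsub>l\<^esub>"
  by (simp add: aug_part_def \<epsilon>_one l.minus_eq l.r_neg)

text \<open>A dual basis of l, with functionals and vectors both composed with
  \<open>aug_part\<close>, which is the identity on the augmentation ideal. That the new functionals
  kill 1 is used in \<open>\<eta>_surj\<close> to obtain reduced coordinate cochains.\<close>

lemma m_dual_basis:
  obtains B :: "'l set" and \<phi> :: "'l \<Rightarrow> 'l \<Rightarrow> 'k" and y :: "'l \<Rightarrow> 'l"
  where "finite B" "\<And>b. b \<in> B \<Longrightarrow> lin k l (self_alg k) (\<phi> b)" "\<And>b. b \<in> B \<Longrightarrow> y b \<in> carrier m"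
    "\<And>b. b \<in> B \<Longrightarrow> \<phi> b \<one>\<^bsub>l\<^esub> = \<zero>\<^bsub>k\<^esub>"
    "\<And>x. x \<in> carrier l \<Longrightarrow> aug_part x = finsum l (\<lambda>b. \<phi> b x \<odot>\<^bsub>l\<^esub> y b) B"
proof -
  obtain B :: "'l set" and \<phi> :: "'l \<Rightarrow> 'l \<Rightarrow> 'k" and y :: "'l \<Rightarrow> 'l"
    where B: "finite B" and \<phi>: "\<And>b. b \<in> B \<Longrightarrow> lin k l (self_alg k) (\<phi> b)" and y: "\<And>b. b \<in> B \<Longrightarrow> y b \<in> carrier l"
      and ex: "\<And>x. x \<in> carrier l \<Longrightarrow> x = finsum l (\<lambda>b. \<phi> b x \<odot>\<^bsub>l\<^esub> y b) B"
    using dual_basis[OF lk fg proj] by blast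
  note ap = linD(1)[OF aug_part_lin]
  interpret m: module k m by (rule m_module)
  have incl: "lin k m l (\<lambda>x. x)" by (rule linI) (auto simp: m_iff)
  have apl: "lin k l l aug_part" by (rule lin_comp[OF incl aug_part_lin])
  have \<phi>': "lin k l (self_alg k) (\<lambda>x. \<phi> b (aug_part x))" if "b \<in> B" for b
    by (rule lin_comp[OF \<phi>[OF that] apl])
  have \<phi>m: "\<phi> b (aug_part x) \<in> carrier k" if "b \<in> B" "x \<in> carrier l" for b x
    using linD(1)[OF \<phi>'[OF that(1)] that(2)] by simp
  show thesis
  proof (rule that[of B "\<lambda>b x. \<phi> b (aug_part x)" "\<lambda>b. aug_part (y b)"])
    show "\<phi> b (aug_part \<one>\<^bsub>l\<^esub>) = \<zero>\<^bsub>k\<^esub>" if "b \<in> B" for b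
      using lin_zero[OF lk sk \<phi>[OF that]] by (simp add: aug_part_one)
    fix x assume x: "x \<in> carrier l"
    have xl: "aug_part x \<in> carrier l" using ap[OF x] by (rule m_mem)
    have "aug_part x = aug_part (aug_part x)" by (rule aug_part_m[OF ap[OF x], symmetric])
    also have "\<dots> = aug_part (finsum l (\<lambda>b. \<phi> b (aug_part x) \<odot>\<^bsub>l\<^esub> y b) B)" using ex[OF xl] by simp
    also have "\<dots> = finsum l (\<lambda>b. aug_part (\<phi> b (aug_part x) \<odot>\<^bsub>l\<^esub> y b)) B"
      using \<phi>m[OF _ x] y by (intro lin_finsum[OF lk lk apl B]) auto
    also have "\<dots> = finsum l (\<lambda>b. \<phi> b (aug_part x) \<odot>\<^bsub>l\<^esub> aug_part (y b)) B"
    proof (rule l.finsum_cong')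
      show "(\<lambda>b. \<phi> b (aug_part x) \<odot>\<^bsub>l\<^esub> aug_part (y b)) \<in> B \<rightarrow> carrier l"
        using \<phi>m[OF _ x] ap[OF y] m_mem by auto
      show "aug_part (\<phi> b (aug_part x) \<odot>\<^bsub>l\<^esub> y b) = \<phi> b (aug_part x) \<odot>\<^bsub>l\<^esub> aug_part (y b)" if "b \<in> B" for b
        by (rule linD(3)[OF apl \<phi>m[OF that x] y[OF that]])
    qed simp
    finally show "aug_part x = finsum l (\<lambda>b. \<phi> b (aug_part x) \<odot>\<^bsub>l\<^esub> aug_part (y b)) B" .
  qed (use B \<phi>' ap y in auto)
qed

end

section \<open>The deformation map\<close>

locale deform = split_unit k A e sp + O: aug_alg k X
  for k :: "('k, 'z) ring_scheme" and A :: "int \<Rightarrow> ('k, 'a) module" and e :: 'a and sp :: "'a \<Rightarrow> 'k"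
    and X :: "('k, 'l) aug" +
  fixes \<nu> :: "('k, 'a, 'a) cochain"
  assumes \<nu>_inf: "A_infinity k A \<nu>" and \<nu>_su: "strictly_unital k A e \<nu>"
begin

sublocale E: base_ext k A "fst X"
  by (rule base_ext.intro[OF A O.l])

abbreviation "C \<equiv> CC_red k A e sp"
abbreviation "V p \<equiv> tensor k (C p) O.m"
abbreviation "cl d \<equiv> CC O.l E.X E.X d"

lemmas Cm = CC_red_module
lemmas mm = O.m_module
lemma Vm: "module k (V p)" by (rule tensor_module[OF Cm mm])
lemma \<nu>C: "\<nu> \<in> carrier (CC k A A (-1))" using \<nu>_su by (simp add: strictly_unital_def)

lemma incl_lin: "lin k (C p) (CC k A A p) (\<lambda>f. f)" "lin k O.m O.l (\<lambda>x. x)"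
  by (auto intro!: linI simp: CC_red_subset O.m_iff)

lemma ev_red_lin:
  assumes "w \<in> wset (susp A)" "w \<noteq> []"
  shows "lin k (C p) (A (wdeg w + p - 1)) (\<lambda>f. ev k A f w)"
  using lin_comp[OF ev_lin[OF k A A assms, where d = p] incl_lin(1)[of p]] by (simp add: susp_def)

text \<open>Evaluation on the word \<open>w\<close>, applied to the first factor. These maps compare
  the tensor product of reduced cochains and the augmentation ideal with functions on words valued
  in the extension of A.\<close>

definition K :: "int \<Rightarrow> (int \<times> 'a) list \<Rightarrow> (('k, 'a, 'a) cochain \<times> 'l \<Rightarrow> 'k) set \<Rightarrow> ('a \<times> 'l \<Rightarrow> 'k) set" where
  "K p w = tmap k (C p) O.m (A (wdeg w + p - 1)) O.l (\<lambda>f. ev k A f w) (\<lambda>x. x)"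

lemma K:
  assumes "w \<in> wset (susp A)" "w \<noteq> []"
  shows "lin k (V p) (E.T (wdeg w + p - 1)) (K p w)"
    and "f \<in> carrier (C p) \<Longrightarrow> x \<in> carrier O.m \<Longrightarrow>
      K p w (tens k (C p) O.m f x) = E.tn (wdeg w + p - 1) (ev k A f w) x"
  unfolding K_def using tmap[OF Cm mm A E.lk ev_red_lin[OF assms] incl_lin(2)] mod_hom_lin by blast+

text \<open>A dual basis of the augmentation ideal recovers an element of the tensor product from its evaluations.\<close>

lemma K_inj:
  assumes v: "v \<in> carrier (V p)" and z: "\<And>w. w \<in> wset (susp A) \<Longrightarrow> w \<noteq> [] \<Longrightarrow> K p w v = \<zero>\<^bsub>E.T (wdeg w + p - 1)\<^esub>"
  shows "v = \<zero>\<^bsub>V p\<^esub>"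
proof -
  interpret V: module k "V p" by (rule Vm)
  interpret Cp: module k "C p" by (rule Cm)
  interpret CC: module k "CC k A A p" by (rule CC_module')
  interpret m: module k O.m by (rule mm)
  obtain B :: "'l set" and \<phi> y where B: "finite B" and \<phi>: "\<And>b. b \<in> B \<Longrightarrow> lin k O.l (self_alg k) (\<phi> b)"
    and y: "\<And>b. b \<in> B \<Longrightarrow> y b \<in> carrier O.m" and "\<And>b. b \<in> B \<Longrightarrow> \<phi> b \<one>\<^bsub>O.l\<^esub> = \<zero>\<^bsub>k\<^esub>"
    and ex: "\<And>x. x \<in> carrier O.l \<Longrightarrow> O.aug_part x = finsum O.l (\<lambda>b. \<phi> b x \<odot>\<^bsub>O.l\<^esub> y b) B"
    by (rule O.m_dual_basis) blast
  have \<phi>': "lin k O.m (self_alg k) (\<phi> b)" if "b \<in> B" for b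
    by (rule lin_comp[OF \<phi>[OF that] incl_lin(2)])
  define \<psi> where "\<psi> b = contr k (C p) O.m (\<phi> b)" for b
  note \<psi> = contr[OF Cm[where d = p] mm \<phi>', folded \<psi>_def]
  note \<psi>l = mod_hom_lin[OF \<psi>(1)]
  \<comment> \<open>\<psi> gives the coordinate of \<open>v\<close> at \<open>b\<close>, a reduced
    cochain. Contracting the second factor commutes with evaluating the first, so its value on
    \<open>w\<close> is the contraction of \<open>K p w v\<close>, which is zero.\<close>
  have \<psi>0: "\<psi> b v = \<zero>\<^bsub>CC k A A p\<^esub>" if b: "b \<in> B" for b
  proof (rule CC_eqI[OF k A A])
    have m: "\<psi> b v \<in> carrier (C p)" by (rule linD(1)[OF \<psi>l[OF b] v])
    then show "\<psi> b v \<in> carrier (CC k A A p)" by (rule CC_red_subset)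
    fix w assume w: "w \<in> wset (susp A)" "w \<noteq> []"
    let ?i = "wdeg w + p - 1"
    interpret Ai: module k "A ?i" by (rule A)
    note c = contr[where M = "A ?i", OF A E.lk \<phi>[OF b]]
    note L1 = lin_comp[OF ev_red_lin[OF w] \<psi>l[OF b]]
    note L2 = lin_comp[OF mod_hom_lin[OF c(1)] K(1)[OF w]]
    have "ev k A (\<psi> b v) w = contr k (A ?i) O.l (\<phi> b) (K p w v)"
    proof (rule tensor_lin_eqI[OF Cm mm A L1 L2 _ v])
      fix f x assume fx: "f \<in> carrier (C p)" "x \<in> carrier O.m"
      have "\<phi> b x \<in> carrier k" using linD(1)[OF \<phi>'[OF b] fx(2)] by simp
      then show "ev k A (\<psi> b (tens k (C p) O.m f x)) w = contr k (A ?i) O.l (\<phi> b) (K p w (tens k (C p) O.m f x))"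
        using fx \<psi>(2)[OF b] K(2)[OF w] c(2) linD[OF ev_red_lin[OF w]] O.m_mem by simp
    qed
    also have "\<dots> = \<zero>\<^bsub>A ?i\<^esub>"
      using z[OF w] mod_hom_zero[OF E.T_module A c(1)] by simp
    also have "\<dots> = ev k A \<zero>\<^bsub>CC k A A p\<^esub> w"
      using lin_zero[OF CC_module' sA ev_lin[OF k A A w, where d = p]] by (simp add: susp_def)
    finally show "ev k A (\<psi> b v) w = ev k A \<zero>\<^bsub>CC k A A p\<^esub> w" .
  qed simp
  have Lt: "lin k (C p) (V p) (\<lambda>f. tens k (C p) O.m f (y b))" if "b \<in> B" for b
    using y[OF that] by (intro linI) (simp_all add: tens_mem[OF Cm mm] tens_add_l[OF Cm mm, unfolded CC_red_simps]
        tens_smult_l[OF Cm mm, unfolded CC_red_simps])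
  \<comment> \<open>On f \<otimes> x this is the expansion of x in the dual basis, with the
    coefficients moved to the first factor.\<close>
  have "v = finsum (V p) (\<lambda>b. tens k (C p) O.m (\<psi> b v) (y b)) B"
  proof (rule tensor_lin_eqI[OF Cm mm Vm lin_id _ _ v])
    show "lin k (V p) (V p) (\<lambda>v. finsum (V p) (\<lambda>b. tens k (C p) O.m (\<psi> b v) (y b)) B)"
      by (rule lin_finsum_fun[OF Vm Vm B lin_comp[OF Lt \<psi>l]])
    fix f x assume f: "f \<in> carrier (C p)" and x: "x \<in> carrier O.m"
    have \<phi>m: "\<phi> b x \<in> carrier k" if "b \<in> B" for b using linD(1)[OF \<phi>'[OF that] x] by simp
    have L: "lin k O.m (V p) (tens k (C p) O.m f)"
      using f by (intro linI) (simp_all add: tens_mem[OF Cm mm] tens_add_r[OF Cm mm, unfolded O.m_simps]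
        tens_smult_r[OF Cm mm, unfolded O.m_simps])
    have mfin: "finsum O.l g B = finsum O.m g B" if "g \<in> B \<rightarrow> carrier O.m" for g
      using B that
    proof induction
      case (insert b B)
      then have "g b \<in> carrier O.m" "g \<in> B \<rightarrow> carrier O.m" by auto
      moreover from this have "g b \<in> carrier O.l" "g \<in> B \<rightarrow> carrier O.l" using O.m_mem by auto
      ultimately show ?case using insert by simp
    qed simp
    have g: "(\<lambda>b. \<phi> b x \<odot>\<^bsub>O.m\<^esub> y b) \<in> B \<rightarrow> carrier O.m" using \<phi>m y by (intro Pi_I m.smult_closed) auto
    have "x = finsum O.m (\<lambda>b. \<phi> b x \<odot>\<^bsub>O.m\<^esub> y b) B"
      using ex[OF O.m_mem[OF x]] O.aug_part_m[OF x] mfin[OF g] by simp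
    then have "tens k (C p) O.m f x = tens k (C p) O.m f (finsum O.m (\<lambda>b. \<phi> b x \<odot>\<^bsub>O.m\<^esub> y b) B)" by simp
    also have "\<dots> = finsum (V p) (\<lambda>b. tens k (C p) O.m f (\<phi> b x \<odot>\<^bsub>O.m\<^esub> y b)) B"
      by (rule lin_finsum[OF mm Vm L B g])
    also have "\<dots> = finsum (V p) (\<lambda>b. tens k (C p) O.m (\<psi> b (tens k (C p) O.m f x)) (y b)) B"
    proof (rule V.finsum_cong')
      show "(\<lambda>b. tens k (C p) O.m (\<psi> b (tens k (C p) O.m f x)) (y b)) \<in> B \<rightarrow> carrier (V p)"
        using linD(1)[OF Lt linD(1)[OF \<psi>l tens_mem[OF Cm mm f x]]] by blast
      show "tens k (C p) O.m f (\<phi> b x \<odot>\<^bsub>O.m\<^esub> y b) = tens k (C p) O.m (\<psi> b (tens k (C p) O.m f x)) (y b)"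
        if b: "b \<in> B" for b
        using \<psi>(2)[OF b f x] linD(3)[OF L \<phi>m[OF b] y[OF b]] linD(3)[OF Lt[OF b] \<phi>m[OF b] f] by simp
    qed simp
    finally show "tens k (C p) O.m f x = finsum (V p) (\<lambda>b. tens k (C p) O.m (\<psi> b (tens k (C p) O.m f x)) (y b)) B" .
  qed
  also have "\<dots> = finsum (V p) (\<lambda>b. \<zero>\<^bsub>V p\<^esub>) B"
    using \<psi>0 y by (intro V.finsum_cong') (simp_all add: tens_zero_l[OF Cm mm, unfolded CC_red_simps])
  also have "\<dots> = \<zero>\<^bsub>V p\<^esub>" by (rule V.finsum_zero)
  finally show ?thesis .
qed

section \<open>Differential and bracket on the tensor product with the augmentation ideal\<close>

abbreviation "br \<equiv> gbracket k A (-1) (-1)"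
abbreviation "Lie \<equiv> red_Hochschild k A e sp \<nu>"
abbreviation "gl \<equiv> gerst O.l E.X (-1) (-1)"

lemma Lie_simps [simp]:
  "lie_mod Lie = C" "lie_br Lie = gbracket k A" "lie_diff Lie p = gbracket k A (-1) p \<nu>"
  by (simp_all add: red_Hochschild_def)

lemma lie_tensor_eq [simp]: "lie_tensor k Lie X p = V p"
  by (simp add: lie_tensor_def)

lemma CCm: "module k (CC k A A d)" by (rule CC_module')

text \<open>Closure is a hypothesis so that the lemma serves both for reduced \<open>f\<close> and
  for \<nu>, which is not reduced and needs a different reason.\<close>

lemma br_lin_right:
  assumes f: "f \<in> carrier (CC k A A (-1))"
    and cl: "\<And>g. g \<in> carrier (C (-1)) \<Longrightarrow> br f g \<in> carrier (C (-2))"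
  shows "lin k (C (-1)) (C (-2)) (br f)"
proof -
  interpret C1: module k "C (-1)" by (rule Cm)
  note L = lin_add[OF CCm gerst_lin_right[OF k A f, where d = "-1"] gerst_lin_left[OF k A f, where e = "-1"]]
  have "lin k (C (-1)) (CC k A A (-2)) (\<lambda>g. gerst k A (-1) (-1) f g \<oplus>\<^bsub>CC k A A (-2)\<^esub> gerst k A (-1) (-1) g f)"
    using lin_comp[OF L incl_lin(1)] by simp
  from lin_cong[OF Cm this] have "lin k (C (-1)) (CC k A A (-2)) (br f)"
    using gbracket_odd[OF f CC_red_subset] by simp
  then show ?thesis using cl by (simp add: lin_def)
qed

text \<open>Symmetry of the bracket of two odd elements; linearity in the left argument is thereby
  reduced to the right one.\<close>

lemma br_comm: "f \<in> carrier (CC k A A (-1)) \<Longrightarrow> g \<in> carrier (CC k A A (-1)) \<Longrightarrow> br f g = br g f"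
proof -
  assume fg: "f \<in> carrier (CC k A A (-1))" "g \<in> carrier (CC k A A (-1))"
  interpret C2: module k "CC k A A (-2)" by (rule CCm)
  show ?thesis
    using gerst_mem[OF k A fg] gerst_mem[OF k A fg(2,1)] by (simp add: gbracket_odd fg C2.a_comm)
qed

lemma br_red_lin: "f \<in> carrier (C (-1)) \<Longrightarrow> lin k (C (-1)) (C (-2)) (br f)"
  by (rule br_lin_right[OF CC_red_subset gbracket_CC_red])

lemma br_red_lin_left: "g \<in> carrier (C (-1)) \<Longrightarrow> lin k (C (-1)) (C (-2)) (\<lambda>f. br f g)"
  by (rule lin_cong[OF Cm br_red_lin[of g]]) (auto intro: br_comm CC_red_subset)

lemma br_\<nu>_lin: "lin k (C (-1)) (C (-2)) (br \<nu>)"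
  by (rule br_lin_right[OF \<nu>C gbracket_unit_CC_red[OF \<nu>_su]])

abbreviation "D \<equiv> lie_tensor_diff k Lie X (-1)"

lemma D:
  shows "D \<in> mod_hom k (V (-1)) (V (-2))"
    and "f \<in> carrier (C (-1)) \<Longrightarrow> x \<in> carrier O.m \<Longrightarrow>
      D (tens k (C (-1)) O.m f x) = tens k (C (-2)) O.m (br \<nu> f) x"
  using tmap[OF Cm mm Cm mm br_\<nu>_lin lin_id] by (simp_all add: lie_tensor_diff_def)

abbreviation "Br \<equiv> lie_tensor_br k Lie X (-1) (-1)"

lemma m_mult_lin: "x \<in> carrier O.m \<Longrightarrow> lin k O.m O.m (\<lambda>x'. x \<otimes>\<^bsub>O.l\<^esub> x')"
  using linD[OF E.mult_lin[of x]] O.m_mem by (intro linI) (auto simp: O.m_mult)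

lemma m_mult_lin_left: "x' \<in> carrier O.m \<Longrightarrow> lin k O.m O.m (\<lambda>x. x \<otimes>\<^bsub>O.l\<^esub> x')"
  by (rule lin_cong[OF mm m_mult_lin[of x']]) (auto intro: E.L_m_comm O.m_mem)

text \<open>The bracket is described in curried form, as a linear map into a Hom module. It is built
  by lifting twice: \<open>T f x\<close> over the second argument, then \<open>T\<close> itself,
  bilinear in \<open>f\<close> and \<open>x\<close>, over the first. Uniqueness is used twice in the
  same way.\<close>

lemma Br:
  shows "Br \<in> mod_hom k (V (-1)) (hom_module k (V (-1)) (V (-2)))"
    and "f \<in> carrier (C (-1)) \<Longrightarrow> x \<in> carrier O.m \<Longrightarrow> f' \<in> carrier (C (-1)) \<Longrightarrow> x' \<in> carrier O.m \<Longrightarrow>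
      Br (tens k (C (-1)) O.m f x) (tens k (C (-1)) O.m f' x') =
      tens k (C (-2)) O.m (br f f') (x \<otimes>\<^bsub>O.l\<^esub> x')"
proof -
  let ?H = "hom_module k (V (-1)) (V (-2))"
  let ?t = "tens k (C (-1)) O.m" and ?t2 = "tens k (C (-2)) O.m"
  interpret V2: module k "V (-2)" by (rule Vm)
  interpret C2: module k "C (-2)" by (rule Cm)
  interpret m: module k O.m by (rule mm)
  interpret C1: module k "C (-1)" by (rule Cm)
  have H: "module k ?H" by (rule hom_module_module[OF Vm Vm])
  interpret H: module k ?H by (rule H)
  define T where "T f x = tmap k (C (-1)) O.m (C (-2)) O.m (br f) (\<lambda>x'. x \<otimes>\<^bsub>O.l\<^esub> x')" for f x
  have T: "T f x \<in> mod_hom k (V (-1)) (V (-2))"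
      "\<And>f' x'. f' \<in> carrier (C (-1)) \<Longrightarrow> x' \<in> carrier O.m \<Longrightarrow> T f x (?t f' x') = ?t2 (br f f') (x \<otimes>\<^bsub>O.l\<^esub> x')"
    if "f \<in> carrier (C (-1))" "x \<in> carrier O.m" for f x
    unfolding T_def using tmap[OF Cm mm Cm mm br_red_lin[OF that(1)] m_mult_lin[OF that(2)]] by blast+
  have tm: "?t f x \<in> carrier (V (-1))" if "f \<in> carrier (C (-1))" "x \<in> carrier O.m" for f x
    using that by (rule tens_mem[OF Cm mm])
  have bc: "br f f' \<in> carrier (C (-2))" if "f \<in> carrier (C (-1))" "f' \<in> carrier (C (-1))" for f f'
    using that by (rule gbracket_CC_red)
  note t2 = bilinD[OF bilin_tens[OF Cm[where d = "-2"] mm]]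
  have b: "bilin k (C (-1)) O.m ?H T"
  proof (rule bilinI)
    show "T f x \<in> carrier ?H" if "f \<in> carrier (C (-1))" "x \<in> carrier O.m" for f x
      using T(1)[OF that] by (simp add: hom_module_simps)
    show "T (f \<oplus>\<^bsub>C (-1)\<^esub> g) x = T f x \<oplus>\<^bsub>?H\<^esub> T g x"
      if a: "f \<in> carrier (C (-1))" "g \<in> carrier (C (-1))" "x \<in> carrier O.m" for f g x
    proof (rule tensor_hom_eqI[OF Cm mm Vm T(1)[OF C1.a_closed[OF a(1,2)] a(3)]])
      show "T f x \<oplus>\<^bsub>?H\<^esub> T g x \<in> mod_hom k (V (-1)) (V (-2))"
        using H.a_closed[unfolded hom_module_simps(1), OF T(1)[OF a(1,3)] T(1)[OF a(2,3)]] .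
      show "T (f \<oplus>\<^bsub>C (-1)\<^esub> g) x (?t f' x') = (T f x \<oplus>\<^bsub>?H\<^esub> T g x) (?t f' x')"
        if "f' \<in> carrier (C (-1))" "x' \<in> carrier O.m" for f' x'
        unfolding hom_module_simps restrict_apply'[OF tm[OF that]]
          T(2)[OF C1.a_closed[OF a(1,2)] a(3) that] T(2)[OF a(1,3) that] T(2)[OF a(2,3) that]
          linD(2)[OF br_red_lin_left[OF that(1)] a(1,2)]
        by (rule t2(2)[OF bc[OF a(1) that(1)] bc[OF a(2) that(1)] O.m_mult[OF a(3) that(2)]])
    qed
    show "T f (x \<oplus>\<^bsub>O.m\<^esub> z) = T f x \<oplus>\<^bsub>?H\<^esub> T f z"
      if a: "f \<in> carrier (C (-1))" "x \<in> carrier O.m" "z \<in> carrier O.m" for f x z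
    proof (rule tensor_hom_eqI[OF Cm mm Vm T(1)[OF a(1) m.a_closed[OF a(2,3)]]])
      show "T f x \<oplus>\<^bsub>?H\<^esub> T f z \<in> mod_hom k (V (-1)) (V (-2))"
        using H.a_closed[unfolded hom_module_simps(1), OF T(1)[OF a(1,2)] T(1)[OF a(1,3)]] .
      show "T f (x \<oplus>\<^bsub>O.m\<^esub> z) (?t f' x') = (T f x \<oplus>\<^bsub>?H\<^esub> T f z) (?t f' x')"
        if "f' \<in> carrier (C (-1))" "x' \<in> carrier O.m" for f' x'
        unfolding hom_module_simps restrict_apply'[OF tm[OF that]]
          T(2)[OF a(1) m.a_closed[OF a(2,3)] that] T(2)[OF a(1,2) that] T(2)[OF a(1,3) that]
          linD(2)[OF m_mult_lin_left[OF that(2)] a(2,3)]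
        by (rule t2(3)[OF bc[OF a(1) that(1)] O.m_mult[OF a(2) that(2)] O.m_mult[OF a(3) that(2)]])
    qed
    show "T (r \<odot>\<^bsub>C (-1)\<^esub> f) x = r \<odot>\<^bsub>?H\<^esub> T f x"
      if a: "r \<in> carrier k" "f \<in> carrier (C (-1))" "x \<in> carrier O.m" for r f x
    proof (rule tensor_hom_eqI[OF Cm mm Vm T(1)[OF C1.smult_closed[OF a(1,2)] a(3)]])
      show "r \<odot>\<^bsub>?H\<^esub> T f x \<in> mod_hom k (V (-1)) (V (-2))"
        using H.smult_closed[unfolded hom_module_simps(1), OF a(1) T(1)[OF a(2,3)]] .
      show "T (r \<odot>\<^bsub>C (-1)\<^esub> f) x (?t f' x') = (r \<odot>\<^bsub>?H\<^esub> T f x) (?t f' x')"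
        if "f' \<in> carrier (C (-1))" "x' \<in> carrier O.m" for f' x'
        unfolding hom_module_simps restrict_apply'[OF tm[OF that]]
          T(2)[OF C1.smult_closed[OF a(1,2)] a(3) that] T(2)[OF a(2,3) that]
          linD(3)[OF br_red_lin_left[OF that(1)] a(1,2)]
        by (rule t2(4)[OF a(1) bc[OF a(2) that(1)] O.m_mult[OF a(3) that(2)]])
    qed
    show "T f (r \<odot>\<^bsub>O.m\<^esub> x) = r \<odot>\<^bsub>?H\<^esub> T f x"
      if a: "r \<in> carrier k" "f \<in> carrier (C (-1))" "x \<in> carrier O.m" for r f x
    proof (rule tensor_hom_eqI[OF Cm mm Vm T(1)[OF a(2) m.smult_closed[OF a(1,3)]]])
      show "r \<odot>\<^bsub>?H\<^esub> T f x \<in> mod_hom k (V (-1)) (V (-2))"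
        using H.smult_closed[unfolded hom_module_simps(1), OF a(1) T(1)[OF a(2,3)]] .
      show "T f (r \<odot>\<^bsub>O.m\<^esub> x) (?t f' x') = (r \<odot>\<^bsub>?H\<^esub> T f x) (?t f' x')"
        if "f' \<in> carrier (C (-1))" "x' \<in> carrier O.m" for f' x'
        unfolding hom_module_simps restrict_apply'[OF tm[OF that]]
          T(2)[OF a(2) m.smult_closed[OF a(1,3)] that] T(2)[OF a(2,3) that]
          linD(3)[OF m_mult_lin_left[OF that(2)] a(1,3)]
        by (rule t2(5)[OF a(1) bc[OF a(2) that(1)] O.m_mult[OF a(3) that(2)]])
    qed
  qed
  let ?P = "\<lambda>b. b \<in> mod_hom k (V (-1)) ?H \<and>
      (\<forall>f\<in>carrier (C (-1)). \<forall>x\<in>carrier O.m. \<forall>f'\<in>carrier (C (-1)). \<forall>x'\<in>carrier O.m.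
        b (?t f x) (?t f' x') = ?t2 (br f f') (x \<otimes>\<^bsub>O.l\<^esub> x'))"
  note tl = tlift[OF Cm mm H b]
  have "\<exists>!b. ?P b"
  proof (rule ex1I)
    let ?b = "tlift k (C (-1)) O.m ?H T"
    show "?P ?b" using tl T(2) by simp
    show "b = ?b" if b: "?P b" for b
    proof (rule tensor_hom_eqI[OF Cm mm H conjunct1[OF b] tl(1)])
      fix f x assume fx: "f \<in> carrier (C (-1))" "x \<in> carrier O.m"
      have bm: "b (?t f x) \<in> mod_hom k (V (-1)) (V (-2))"
        using mod_hom_mem[OF conjunct1[OF b] tm[OF fx]] by (simp add: hom_module_simps)
      show "b (?t f x) = ?b (?t f x)"
        unfolding tl(2)[OF fx]
        by (rule tensor_hom_eqI[OF Cm mm Vm bm T(1)[OF fx]]) (use b fx T(2)[OF fx] in simp)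
    qed
  qed
  from theI'[OF this] have P: "?P Br" by (simp add: lie_tensor_br_def)
  then show "Br \<in> mod_hom k (V (-1)) ?H" by blast
  show "f \<in> carrier (C (-1)) \<Longrightarrow> x \<in> carrier O.m \<Longrightarrow> f' \<in> carrier (C (-1)) \<Longrightarrow> x' \<in> carrier O.m \<Longrightarrow>
      Br (?t f x) (?t f' x') = ?t2 (br f f') (x \<otimes>\<^bsub>O.l\<^esub> x')"
    using P by blast
qed

lemma Br_lin_right: "v \<in> carrier (V (-1)) \<Longrightarrow> lin k (V (-1)) (V (-2)) (Br v)"
  using mod_hom_mem[OF Br(1)] by (simp add: hom_module_simps mod_hom_lin)

lemma Br_lin_left: "v' \<in> carrier (V (-1)) \<Longrightarrow> lin k (V (-1)) (V (-2)) (\<lambda>v. Br v v')"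
proof (rule linI)
  assume v': "v' \<in> carrier (V (-1))"
  note B = mod_hom_add[OF Br(1)] mod_hom_smult[OF Br(1)]
  show "Br v v' \<in> carrier (V (-2))" if "v \<in> carrier (V (-1))" for v
    using linD(1)[OF Br_lin_right[OF that] v'] .
  show "Br (v \<oplus>\<^bsub>V (-1)\<^esub> w) v' = Br v v' \<oplus>\<^bsub>V (-2)\<^esub> Br w v'"
    if "v \<in> carrier (V (-1))" "w \<in> carrier (V (-1))" for v w
    using B(1)[OF that] v' by (simp add: hom_module_simps)
  show "Br (r \<odot>\<^bsub>V (-1)\<^esub> v) v' = r \<odot>\<^bsub>V (-2)\<^esub> Br v v'" if "r \<in> carrier k" "v \<in> carrier (V (-1))" for r v
    using B(2)[OF that] v' by (simp add: hom_module_simps)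
qed

section \<open>The deformation map and the Maurer--Cartan equation\<close>

definition inc :: "(('k, 'a, 'a) cochain \<times> 'l \<Rightarrow> 'k) set \<Rightarrow> (('k, 'a, 'a) cochain \<times> 'l \<Rightarrow> 'k) set" where
  "inc = tmap k (C (-1)) O.m (CC k A A (-1)) O.l (\<lambda>f. f) (\<lambda>x. x)"

lemma inc:
  shows "lin k (V (-1)) (tensor k (CC k A A (-1)) O.l) inc"
    and "f \<in> carrier (C (-1)) \<Longrightarrow> x \<in> carrier O.m \<Longrightarrow>
      inc (tens k (C (-1)) O.m f x) = tens k (CC k A A (-1)) O.l f x"
  unfolding inc_def using tmap[OF Cm mm CCm E.lk incl_lin] mod_hom_lin by blast+

definition Th :: "(('k, 'a, 'a) cochain \<times> 'l \<Rightarrow> 'k) set \<Rightarrow> ('l, ('a \<times> 'l \<Rightarrow> 'k) set, ('a \<times> 'l \<Rightarrow> 'k) set) cochain" where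
  "Th v = theta k A O.l (-1) (inc v)"

definition \<theta>\<nu> :: "('l, ('a \<times> 'l \<Rightarrow> 'k) set, ('a \<times> 'l \<Rightarrow> 'k) set) cochain" where
  "\<theta>\<nu> = E.theta1 (-1) \<nu> \<one>\<^bsub>O.l\<^esub>"

text \<open>The form of the deformation map used in the computations: \<open>theta\<close> is
  additive, and \<nu> is the sum of \<mu> and \<open>mu_su\<close>. The agreement with
  \<open>def_map\<close> is \<open>def_map_eq\<close>.\<close>

definition \<eta> :: "(('k, 'a, 'a) cochain \<times> 'l \<Rightarrow> 'k) set \<Rightarrow> ('l, ('a \<times> 'l \<Rightarrow> 'k) set, ('a \<times> 'l \<Rightarrow> 'k) set) cochain" where
  "\<eta> v = Th v \<oplus>\<^bsub>cl (-1)\<^esub> \<theta>\<nu>"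

abbreviation "rcl d \<equiv> res_scal O.l (cl d)"

lemma Th:
  shows "lin k (V (-1)) (rcl (-1)) Th"
    and "f \<in> carrier (C (-1)) \<Longrightarrow> x \<in> carrier O.m \<Longrightarrow> Th (tens k (C (-1)) O.m f x) = E.theta1 (-1) f x"
  using lin_comp[OF mod_hom_lin[OF E.theta(1)] inc(1)]
  by (simp_all add: Th_def[abs_def] inc(2) E.theta(2) CC_red_subset O.m_mem)

lemma Th_mem: "v \<in> carrier (V (-1)) \<Longrightarrow> Th v \<in> carrier (cl (-1))"
  using linD(1)[OF Th(1)] by simp

lemma \<theta>\<nu>_mem: "\<theta>\<nu> \<in> carrier (cl (-1))"
  unfolding \<theta>\<nu>_def by (rule E.theta1(1)[OF \<nu>C]) simp

lemma \<eta>_mem: "v \<in> carrier (V (-1)) \<Longrightarrow> \<eta> v \<in> carrier (cl (-1))"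
proof -
  interpret cl: module O.l "cl (-1)" by (rule E.CCl_module)
  show "v \<in> carrier (V (-1)) \<Longrightarrow> \<eta> v \<in> carrier (cl (-1))"
    unfolding \<eta>_def by (intro cl.a_closed Th_mem \<theta>\<nu>_mem)
qed

lemma ev_emb_res_lin:
  assumes "w \<in> wset (susp A)" "w \<noteq> []"
  shows "lin k (rcl d) (E.T (wdeg w + d - 1)) (\<lambda>F. ev O.l E.X F (E.emb w))"
  using lin_res_scal[OF O.l E.ev_emb_lin[OF assms]] by (simp add: E.lin_res_ext)

lemma ev_Th:
  assumes w: "w \<in> wset (susp A)" "w \<noteq> []" and v: "v \<in> carrier (V (-1))"
  shows "ev O.l E.X (Th v) (E.emb w) = K (-1) w v"
  by (rule tensor_lin_eqI[OF Cm mm E.T_module lin_comp[OF ev_emb_res_lin[OF w] Th(1)] K(1)[OF w] _ v])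
    (use E.theta1(2)[OF CC_red_subset O.m_mem w, where d = "-1"] in \<open>simp add: Th(2) K(2)[OF w] susp_def\<close>)

lemma ev_\<theta>\<nu>:
  assumes w: "w \<in> wset (susp A)" "w \<noteq> []"
  shows "ev O.l E.X \<theta>\<nu> (E.emb w) = E.tn (wdeg w + -1 - 1) (ev k A \<nu> w) \<one>\<^bsub>O.l\<^esub>"
  unfolding \<theta>\<nu>_def using E.theta1(2)[OF \<nu>C _ w] by (simp add: susp_def)

lemma ev_\<eta>:
  assumes w: "w \<in> wset (susp A)" "w \<noteq> []" and v: "v \<in> carrier (V (-1))"
  shows "ev O.l E.X (\<eta> v) (E.emb w) = K (-1) w v \<oplus>\<^bsub>E.T (wdeg w + -1 - 1)\<^esub> E.tn (wdeg w + -1 - 1) (ev k A \<nu> w) \<one>\<^bsub>O.l\<^esub>"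
  unfolding \<eta>_def
  using linD(2)[OF E.ev_emb_lin[OF w] Th_mem[OF v] \<theta>\<nu>_mem] by (simp only: E.ext_simps ev_Th[OF w v] ev_\<theta>\<nu>[OF w])

lemma gl_lin_left:
  assumes "F \<in> carrier (cl (-1))"
  shows "lin k (rcl (-1)) (rcl (-2)) (\<lambda>G. gl G F)"
  using lin_res_scal[OF O.l gerst_lin_left[OF E.lc E.ext_module assms, where e = "-1"]] by simp

lemma gl_lin_right:
  assumes "G \<in> carrier (cl (-1))"
  shows "lin k (rcl (-1)) (rcl (-2)) (\<lambda>F. gl G F)"
  using lin_res_scal[OF O.l gerst_lin_right[OF E.lc E.ext_module assms, where d = "-1"]] by simp

lemma gl_mem: "G \<in> carrier (cl (-1)) \<Longrightarrow> F \<in> carrier (cl (-1)) \<Longrightarrow> gl G F \<in> carrier (cl (-2))"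
  using gerst_mem[OF E.lc E.ext_module, where g = G and f = F and e = "-1" and d = "-1"] by simp

lemma one_l: "\<one>\<^bsub>O.l\<^esub> \<in> carrier O.l" by simp

text \<open>The mixed terms of the square make up the differential. Both sides are linear in
  \<open>v\<close>; on f \<otimes> x, \<open>ev_gerst_theta1\<close> turns the two terms into the
  two halves of the bracket of \<nu> with f, tensored with x.\<close>

lemma ev_gl_\<theta>\<nu>_Th:
  assumes w: "w \<in> wset (susp A)" "w \<noteq> []" and v: "v \<in> carrier (V (-1))"
  shows "ev O.l E.X (gl \<theta>\<nu> (Th v)) (E.emb w) \<oplus>\<^bsub>E.T (wdeg w + -2 - 1)\<^esub> ev O.l E.X (gl (Th v) \<theta>\<nu>) (E.emb w) = K (-2) w (D v)"
proof (rule tensor_lin_eqI[OF Cm mm E.T_module _ _ _ v])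
  note L1 = lin_comp[OF ev_emb_res_lin[OF w] lin_comp[OF gl_lin_right[OF \<theta>\<nu>_mem] Th(1)]]
  note L2 = lin_comp[OF ev_emb_res_lin[OF w] lin_comp[OF gl_lin_left[OF \<theta>\<nu>_mem] Th(1)]]
  show "lin k (V (-1)) (E.T (wdeg w + -2 - 1))
      (\<lambda>v. ev O.l E.X (gl \<theta>\<nu> (Th v)) (E.emb w) \<oplus>\<^bsub>E.T (wdeg w + -2 - 1)\<^esub> ev O.l E.X (gl (Th v) \<theta>\<nu>) (E.emb w))"
    by (rule lin_add[OF E.T_module L1 L2])
  show "lin k (V (-1)) (E.T (wdeg w + -2 - 1)) (\<lambda>v. K (-2) w (D v))"
    by (rule lin_comp[OF K(1)[OF w] mod_hom_lin[OF D(1)]])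
  fix f x assume f: "f \<in> carrier (C (-1))" and x: "x \<in> carrier O.m"
  note fC = CC_red_subset[OF f] and xl = O.m_mem[OF x]
  have gm: "gerst k A (-1) (-1) \<nu> f \<in> carrier (CC k A A (-2))" "gerst k A (-1) (-1) f \<nu> \<in> carrier (CC k A A (-2))"
    using gerst_mem[OF k A \<nu>C fC] gerst_mem[OF k A fC \<nu>C] by simp_all
  note evm = ev_mem[OF k A A gm(1) w] ev_mem[OF k A A gm(2) w]
  have br: "ev k A (br \<nu> f) w = ev k A (gerst k A (-1) (-1) \<nu> f) w \<oplus>\<^bsub>A (wdeg w - 3)\<^esub> ev k A (gerst k A (-1) (-1) f \<nu>) w"
    using linD(2)[OF ev_lin[OF k A A w] gm] by (simp add: gbracket_odd[OF \<nu>C fC] susp_def)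
  have one: "x \<otimes>\<^bsub>O.l\<^esub> \<one>\<^bsub>O.l\<^esub> = x" using xl E.L_m_comm[of x "\<one>\<^bsub>O.l\<^esub>"] by simp
  have "ev O.l E.X (gl \<theta>\<nu> (Th (tens k (C (-1)) O.m f x))) (E.emb w) = E.tn (wdeg w - 3) (ev k A (gerst k A (-1) (-1) \<nu> f) w) x"
    "ev O.l E.X (gl (Th (tens k (C (-1)) O.m f x)) \<theta>\<nu>) (E.emb w) = E.tn (wdeg w - 3) (ev k A (gerst k A (-1) (-1) f \<nu>) w) x"
    using E.ev_gerst_theta1[OF \<nu>C one_l fC xl w] E.ev_gerst_theta1[OF fC xl \<nu>C one_l w] xl one
    by (simp_all add: Th(2)[OF f x] \<theta>\<nu>_def susp_def)
  then show "ev O.l E.X (gl \<theta>\<nu> (Th (tens k (C (-1)) O.m f x))) (E.emb w) \<oplus>\<^bsub>E.T (wdeg w + -2 - 1)\<^esub>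
      ev O.l E.X (gl (Th (tens k (C (-1)) O.m f x)) \<theta>\<nu>) (E.emb w) = K (-2) w (D (tens k (C (-1)) O.m f x))"
    using K(2)[OF w gbracket_unit_CC_red[OF \<nu>_su f] x] evm xl
    by (simp add: D(2)[OF f x] br tens_add_l[OF A E.lk] susp_def)
qed

text \<open>Stated for two arguments although only \<open>v = v'\<close> is needed in the end: the
  square is not linear in \<open>v\<close>, whereas the symmetrised form is bilinear and can be
  checked on pure tensors in one argument after the other.\<close>

lemma ev_gl_Th_Th:
  assumes w: "w \<in> wset (susp A)" "w \<noteq> []" and v: "v \<in> carrier (V (-1))" and v': "v' \<in> carrier (V (-1))"
  shows "ev O.l E.X (gl (Th v) (Th v')) (E.emb w) \<oplus>\<^bsub>E.T (wdeg w + -2 - 1)\<^esub> ev O.l E.X (gl (Th v') (Th v)) (E.emb w) =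
    K (-2) w (Br v v')"
proof -
  let ?F = "\<lambda>v v'. ev O.l E.X (gl (Th v) (Th v')) (E.emb w) \<oplus>\<^bsub>E.T (wdeg w + -2 - 1)\<^esub> ev O.l E.X (gl (Th v') (Th v)) (E.emb w)"
  note L1 = lin_comp[OF ev_emb_res_lin[OF w] lin_comp[OF gl_lin_right[OF Th_mem] Th(1)]]
  note L2 = lin_comp[OF ev_emb_res_lin[OF w] lin_comp[OF gl_lin_left[OF Th_mem] Th(1)]]
  have Fl: "lin k (V (-1)) (E.T (wdeg w + -2 - 1)) (?F v)" if "v \<in> carrier (V (-1))" for v
    by (rule lin_add[OF E.T_module L1[OF that] L2[OF that]])
  have Fl': "lin k (V (-1)) (E.T (wdeg w + -2 - 1)) (\<lambda>v. ?F v v')" if "v' \<in> carrier (V (-1))" for v'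
    by (rule lin_add[OF E.T_module L2[OF that] L1[OF that]])
  have pure: "?F (tens k (C (-1)) O.m f x) (tens k (C (-1)) O.m f' x') =
      K (-2) w (Br (tens k (C (-1)) O.m f x) (tens k (C (-1)) O.m f' x'))"
    if f: "f \<in> carrier (C (-1))" and x: "x \<in> carrier O.m" and f': "f' \<in> carrier (C (-1))" and x': "x' \<in> carrier O.m" for f x f' x'
  proof -
    note fC = CC_red_subset[OF f] and xl = O.m_mem[OF x] and fC' = CC_red_subset[OF f'] and xl' = O.m_mem[OF x']
    have gm: "gerst k A (-1) (-1) f f' \<in> carrier (CC k A A (-2))" "gerst k A (-1) (-1) f' f \<in> carrier (CC k A A (-2))"
      using gerst_mem[OF k A fC fC'] gerst_mem[OF k A fC' fC] by simp_all
    note evm = ev_mem[OF k A A gm(1) w] ev_mem[OF k A A gm(2) w]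
    have br: "ev k A (br f f') w = ev k A (gerst k A (-1) (-1) f f') w \<oplus>\<^bsub>A (wdeg w - 3)\<^esub> ev k A (gerst k A (-1) (-1) f' f) w"
      using linD(2)[OF ev_lin[OF k A A w] gm] by (simp add: gbracket_odd[OF fC fC'] susp_def)
    have "ev O.l E.X (gl (Th (tens k (C (-1)) O.m f x)) (Th (tens k (C (-1)) O.m f' x'))) (E.emb w) =
          E.tn (wdeg w - 3) (ev k A (gerst k A (-1) (-1) f f') w) (x \<otimes>\<^bsub>O.l\<^esub> x')"
      "ev O.l E.X (gl (Th (tens k (C (-1)) O.m f' x')) (Th (tens k (C (-1)) O.m f x))) (E.emb w) =
          E.tn (wdeg w - 3) (ev k A (gerst k A (-1) (-1) f' f) w) (x \<otimes>\<^bsub>O.l\<^esub> x')"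
      using E.ev_gerst_theta1[OF fC xl fC' xl' w] E.ev_gerst_theta1[OF fC' xl' fC xl w] E.L_m_comm[OF xl' xl]
      by (simp_all add: Th(2)[OF f x] Th(2)[OF f' x'] susp_def)
    then show ?thesis
      using K(2)[OF w gbracket_CC_red[OF f f'] O.m_mult[OF x x']] evm O.m_mem[OF O.m_mult[OF x x']]
      by (simp add: Br(2)[OF f x f' x'] br tens_add_l[OF A E.lk] susp_def)
  qed
  have 1: "?F (tens k (C (-1)) O.m f x) v' = K (-2) w (Br (tens k (C (-1)) O.m f x) v')"
    if f: "f \<in> carrier (C (-1))" and x: "x \<in> carrier O.m" for f x
  proof -
    have t: "tens k (C (-1)) O.m f x \<in> carrier (V (-1))" using f x by (rule tens_mem[OF Cm mm])
    show ?thesis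
      by (rule tensor_lin_eqI[OF Cm mm E.T_module Fl[OF t] lin_comp[OF K(1)[OF w] Br_lin_right[OF t]] pure[OF f x] v'])
  qed
  show ?thesis
    by (rule tensor_lin_eqI[OF Cm mm E.T_module Fl'[OF v'] lin_comp[OF K(1)[OF w] Br_lin_left[OF v']] 1 v])
qed

lemma ev_gl_\<theta>\<nu>_\<theta>\<nu>:
  assumes w: "w \<in> wset (susp A)" "w \<noteq> []"
  shows "ev O.l E.X (gl \<theta>\<nu> \<theta>\<nu>) (E.emb w) = \<zero>\<^bsub>E.T (wdeg w + -2 - 1)\<^esub>"
proof -
  have "gerst k A (-1) (-1) \<nu> \<nu> = \<zero>\<^bsub>CC k A A (-2)\<^esub>" using \<nu>_inf by (simp add: A_infinity_def)
  then have "ev k A (gerst k A (-1) (-1) \<nu> \<nu>) w = \<zero>\<^bsub>A (wdeg w - 3)\<^esub>"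
    using lin_zero[OF CCm sA ev_lin[OF k A A w], of "-2"] by (simp add: susp_def)
  then show ?thesis
    using E.ev_gerst_theta1[OF \<nu>C one_l \<nu>C one_l w]
    by (simp add: \<theta>\<nu>_def susp_def tens_zero_l[OF A E.lk])
qed

abbreviation "half \<equiv> inv\<^bsub>k\<^esub> (\<one>\<^bsub>k\<^esub> \<oplus>\<^bsub>k\<^esub> \<one>\<^bsub>k\<^esub>)"

definition MC_expr :: "(('k, 'a, 'a) cochain \<times> 'l \<Rightarrow> 'k) set \<Rightarrow> (('k, 'a, 'a) cochain \<times> 'l \<Rightarrow> 'k) set" where
  "MC_expr v = D v \<oplus>\<^bsub>V (-2)\<^esub> (half \<odot>\<^bsub>V (-2)\<^esub> Br v v)"

lemma MC_iff_expr: "v \<in> MC k Lie X \<longleftrightarrow> v \<in> carrier (V (-1)) \<and> MC_expr v = \<zero>\<^bsub>V (-2)\<^esub>"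
  by (simp add: MC_def MC_expr_def)

context
  assumes two: "\<one>\<^bsub>k\<^esub> \<oplus>\<^bsub>k\<^esub> \<one>\<^bsub>k\<^esub> \<in> Units k"
begin

lemma half_mem: "half \<in> carrier k" and half_double: "half \<otimes>\<^bsub>k\<^esub> (\<one>\<^bsub>k\<^esub> \<oplus>\<^bsub>k\<^esub> \<one>\<^bsub>k\<^esub>) = \<one>\<^bsub>k\<^esub>"
proof -
  interpret k: cring k by (rule k)
  show "half \<in> carrier k" "half \<otimes>\<^bsub>k\<^esub> (\<one>\<^bsub>k\<^esub> \<oplus>\<^bsub>k\<^esub> \<one>\<^bsub>k\<^esub>) = \<one>\<^bsub>k\<^esub>" using two by simp_all
qed

lemma half_add:
  assumes "module k M" "x \<in> carrier M"
  shows "half \<odot>\<^bsub>M\<^esub> (x \<oplus>\<^bsub>M\<^esub> x) = x"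
proof -
  interpret M: module k M by fact
  have "half \<odot>\<^bsub>M\<^esub> (x \<oplus>\<^bsub>M\<^esub> x) = half \<odot>\<^bsub>M\<^esub> ((\<one>\<^bsub>k\<^esub> \<oplus>\<^bsub>k\<^esub> \<one>\<^bsub>k\<^esub>) \<odot>\<^bsub>M\<^esub> x)"
    using assms(2) by (simp add: M.smult_l_distr)
  also have "\<dots> = (half \<otimes>\<^bsub>k\<^esub> (\<one>\<^bsub>k\<^esub> \<oplus>\<^bsub>k\<^esub> \<one>\<^bsub>k\<^esub>)) \<odot>\<^bsub>M\<^esub> x"
    using assms(2) half_mem by (intro M.smult_assoc1[symmetric]) simp_all
  finally show ?thesis using assms(2) by (simp add: half_double)
qed

lemma MC_expr_mem: "v \<in> carrier (V (-1)) \<Longrightarrow> MC_expr v \<in> carrier (V (-2))"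
proof -
  interpret V2: module k "V (-2)" by (rule Vm)
  assume v: "v \<in> carrier (V (-1))"
  show ?thesis unfolding MC_expr_def
    by (intro V2.a_closed V2.smult_closed half_mem mod_hom_mem[OF D(1) v] linD(1)[OF Br_lin_right[OF v] v])
qed

lemma K_MC_expr:
  assumes w: "w \<in> wset (susp A)" "w \<noteq> []" and v: "v \<in> carrier (V (-1))"
  shows "K (-2) w (MC_expr v) = ev O.l E.X (gl (\<eta> v) (\<eta> v)) (E.emb w)"
proof -
  let ?T = "E.T (wdeg w + -2 - 1)"
  interpret T: module k "E.T (wdeg w - 3)" by (rule E.T_module)
  interpret V2: module k "V (-2)" by (rule Vm)
  note Kl = linD[OF K(1)[OF w, of "-2"]]
  note t = Th_mem[OF v]
  note gm = gl_mem[OF t t] gl_mem[OF t \<theta>\<nu>_mem] gl_mem[OF \<theta>\<nu>_mem t] gl_mem[OF \<theta>\<nu>_mem \<theta>\<nu>_mem]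
  define ee where "ee F = ev O.l E.X F (E.emb w)" for F :: "('l, ('a \<times> 'l \<Rightarrow> 'k) set, ('a \<times> 'l \<Rightarrow> 'k) set) cochain"
  have el: "lin k (rcl (-2)) ?T ee" unfolding ee_def by (rule ev_emb_res_lin[OF w])
  have em: "ee F \<in> carrier ?T" if "F \<in> carrier (cl (-2))" for F using linD(1)[OF el] that by simp
  have ea: "ee (F \<oplus>\<^bsub>cl (-2)\<^esub> G) = ee F \<oplus>\<^bsub>?T\<^esub> ee G" if "F \<in> carrier (cl (-2))" "G \<in> carrier (cl (-2))" for F G
    using linD(2)[OF el] that by simp
  have Brm: "Br v v \<in> carrier (V (-2))" by (rule linD(1)[OF Br_lin_right[OF v] v])
  have Dm: "D v \<in> carrier (V (-2))" by (rule mod_hom_mem[OF D(1) v])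
  have "K (-2) w (MC_expr v) = K (-2) w (D v) \<oplus>\<^bsub>?T\<^esub> half \<odot>\<^bsub>?T\<^esub> K (-2) w (Br v v)"
    unfolding MC_expr_def using Kl(2)[OF Dm V2.smult_closed[OF half_mem Brm]] Kl(3)[OF half_mem Brm] by simp
  also have "\<dots> = (ee (gl \<theta>\<nu> (Th v)) \<oplus>\<^bsub>?T\<^esub> ee (gl (Th v) \<theta>\<nu>)) \<oplus>\<^bsub>?T\<^esub> half \<odot>\<^bsub>?T\<^esub> (ee (gl (Th v) (Th v)) \<oplus>\<^bsub>?T\<^esub> ee (gl (Th v) (Th v)))"
    by (simp only: ee_def ev_gl_\<theta>\<nu>_Th[OF w v] ev_gl_Th_Th[OF w v v])
  \<comment> \<open>With equal arguments the symmetrised product is the square taken twice, which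
    the factor 1/2 undoes.\<close>
  also have "half \<odot>\<^bsub>?T\<^esub> (ee (gl (Th v) (Th v)) \<oplus>\<^bsub>?T\<^esub> ee (gl (Th v) (Th v))) = ee (gl (Th v) (Th v))"
    by (rule half_add[OF E.T_module em[OF gm(1)]])
  finally have 1: "K (-2) w (MC_expr v) = (ee (gl \<theta>\<nu> (Th v)) \<oplus>\<^bsub>?T\<^esub> ee (gl (Th v) \<theta>\<nu>)) \<oplus>\<^bsub>?T\<^esub> ee (gl (Th v) (Th v))" .
  have \<eta>m: "\<eta> v \<in> carrier (cl (-1))" by (rule \<eta>_mem[OF v])
  have "gl (\<eta> v) (\<eta> v) = gl (Th v) (\<eta> v) \<oplus>\<^bsub>cl (-2)\<^esub> gl \<theta>\<nu> (\<eta> v)"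
    using linD(2)[OF gl_lin_left[OF \<eta>m], of "Th v" \<theta>\<nu>] t \<theta>\<nu>_mem by (simp add: \<eta>_def)
  also have "gl (Th v) (\<eta> v) = gl (Th v) (Th v) \<oplus>\<^bsub>cl (-2)\<^esub> gl (Th v) \<theta>\<nu>"
    using linD(2)[OF gl_lin_right[OF t], of "Th v" \<theta>\<nu>] t \<theta>\<nu>_mem by (simp add: \<eta>_def)
  also have "gl \<theta>\<nu> (\<eta> v) = gl \<theta>\<nu> (Th v) \<oplus>\<^bsub>cl (-2)\<^esub> gl \<theta>\<nu> \<theta>\<nu>"
    using linD(2)[OF gl_lin_right[OF \<theta>\<nu>_mem], of "Th v" \<theta>\<nu>] t \<theta>\<nu>_mem by (simp add: \<eta>_def)
  finally have "ee (gl (\<eta> v) (\<eta> v)) = (ee (gl (Th v) (Th v)) \<oplus>\<^bsub>?T\<^esub> ee (gl (Th v) \<theta>\<nu>)) \<oplus>\<^bsub>?T\<^esub> (ee (gl \<theta>\<nu> (Th v)) \<oplus>\<^bsub>?T\<^esub> ee (gl \<theta>\<nu> \<theta>\<nu>))"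
  proof -
    interpret c: module O.l "cl (-2)" by (rule E.CCl_module)
    assume "gl (\<eta> v) (\<eta> v) = (gl (Th v) (Th v) \<oplus>\<^bsub>cl (-2)\<^esub> gl (Th v) \<theta>\<nu>) \<oplus>\<^bsub>cl (-2)\<^esub> (gl \<theta>\<nu> (Th v) \<oplus>\<^bsub>cl (-2)\<^esub> gl \<theta>\<nu> \<theta>\<nu>)"
    then show ?thesis using ea[OF c.a_closed[OF gm(1,2)] c.a_closed[OF gm(3,4)]] ea[OF gm(1,2)] ea[OF gm(3,4)] by simp
  qed
  also have "ee (gl \<theta>\<nu> \<theta>\<nu>) = \<zero>\<^bsub>?T\<^esub>" unfolding ee_def by (rule ev_gl_\<theta>\<nu>_\<theta>\<nu>[OF w])
  finally show ?thesis
    unfolding 1 ee_def[symmetric] using em[OF gm(1)] em[OF gm(2)] em[OF gm(3)] by (simp add: T.a_ac)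
qed

text \<open>By \<open>K_MC_expr\<close> both equations have the same evaluations on words a
  \<otimes> 1. From these, \<open>K_inj\<close> recovers the Maurer--Cartan equation and
  \<open>CC_ext_eqI\<close> the vanishing of the square.\<close>

lemma A_infinity_\<eta>_iff:
  assumes v: "v \<in> carrier (V (-1))"
  shows "A_infinity O.l E.X (\<eta> v) \<longleftrightarrow> MC_expr v = \<zero>\<^bsub>V (-2)\<^esub>"
proof -
  note g = gl_mem[OF \<eta>_mem[OF v] \<eta>_mem[OF v]]
  interpret c: module O.l "cl (-2)" by (rule E.CCl_module)
  have z: "ev O.l E.X \<zero>\<^bsub>cl (-2)\<^esub> (E.emb w) = \<zero>\<^bsub>E.T (wdeg w + -2 - 1)\<^esub>" if w: "w \<in> wset (susp A)" "w \<noteq> []" for w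
    using lin_zero[OF E.CCl_module E.ext_module E.ev_emb_lin[OF w]] by simp
  have "gl (\<eta> v) (\<eta> v) = \<zero>\<^bsub>cl (-2)\<^esub> \<longleftrightarrow> MC_expr v = \<zero>\<^bsub>V (-2)\<^esub>"
  proof
    assume "gl (\<eta> v) (\<eta> v) = \<zero>\<^bsub>cl (-2)\<^esub>"
    then show "MC_expr v = \<zero>\<^bsub>V (-2)\<^esub>"
      using z K_MC_expr[OF _ _ v] by (intro K_inj[OF MC_expr_mem[OF v]]) simp
  next
    assume "MC_expr v = \<zero>\<^bsub>V (-2)\<^esub>"
    then have "K (-2) w (MC_expr v) = \<zero>\<^bsub>E.T (wdeg w + -2 - 1)\<^esub>" if w: "w \<in> wset (susp A)" "w \<noteq> []" for w
      using lin_zero[OF Vm E.T_module K(1)[OF w]] by simp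
    then show "gl (\<eta> v) (\<eta> v) = \<zero>\<^bsub>cl (-2)\<^esub>"
      using z K_MC_expr[OF _ _ v] by (intro E.CC_ext_eqI[OF E.ext_module g c.zero_closed]) simp
  qed
  then show ?thesis using \<eta>_mem[OF v] by (simp add: A_infinity_def)
qed

end

section \<open>Strict unitality, reduction along the augmentation, and bijectivity\<close>

abbreviation "e1 \<equiv> tens k (A 0) O.l e \<one>\<^bsub>O.l\<^esub>"

lemma emb_e: "(1, e) \<in> set w \<Longrightarrow> (1, e1) \<in> set (E.emb w)"
  by (force simp: E.emb_def)

lemma K_unit:
  assumes w: "w \<in> wset (susp A)" "(1, e) \<in> set w" and v: "v \<in> carrier (V p)"
  shows "K p w v = \<zero>\<^bsub>E.T (wdeg w + p - 1)\<^esub>"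
proof -
  have ne: "w \<noteq> []" using w(2) by auto
  show ?thesis
  proof (rule tensor_lin_eqI[OF Cm mm E.T_module K(1)[OF w(1) ne] lin_const_zero[OF E.T_module] _ v])
    show "K p w (tens k (C p) O.m f x) = \<zero>\<^bsub>E.T (wdeg w + p - 1)\<^esub>" if "f \<in> carrier (C p)" "x \<in> carrier O.m" for f x
      using K(2)[OF w(1) ne that] CC_red_vanish[OF that(1) w] O.m_mem[OF that(2)]
      by (simp add: susp_def tens_zero_l[OF A E.lk])
  qed
qed

text \<open>Since \<nu> is strictly unital, its values on words with a letter \<open>e\<close> are
  the ones strict unitality prescribes, and tensoring them with 1 gives those required over l.
  Passing from letters a \<otimes> 1 to arbitrary letters is l-linearity.\<close>

lemma strictly_unital_iff_emb:
  assumes F: "F \<in> carrier (cl (-1))"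
  shows "strictly_unital O.l E.X e1 F \<longleftrightarrow>
    (\<forall>w\<in>wset (susp A). (1, e) \<in> set w \<longrightarrow> ev O.l E.X F (E.emb w) = E.tn (wdeg w - 2) (ev k A \<nu> w) \<one>\<^bsub>O.l\<^esub>)"
    (is "?L \<longleftrightarrow> ?R")
proof
  assume L: ?L
  show ?R
  proof (intro ballI impI)
    fix w assume w: "w \<in> wset (susp A)" "(1, e) \<in> set w"
    show "ev O.l E.X F (E.emb w) = E.tn (wdeg w - 2) (ev k A \<nu> w) \<one>\<^bsub>O.l\<^esub>"
    proof (cases "length w = 2")
      case False
      then show ?thesis
        using strictly_unital_other[OF L E.emb_wset[OF w(1)] emb_e[OF w(2)]] strictly_unital_other[OF \<nu>_su w]
        by (simp add: susp_def tens_zero_l[OF A E.lk])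
    next
      case True
      then obtain s t where st: "w = [s, t]" by (auto simp: length_Suc_conv numeral_2_eq_2)
      then consider j a where "w = [(1, e), (j, a)]" | j a where "w = [(j, a), (1, e)]"
        using w(2) by (cases s; cases t) auto
      then show ?thesis
      proof cases
        case 1
        then have a: "a \<in> carrier (A (j - 1))" using w(1) by (simp add: susp_def)
        have t: "E.tn (j - 1) a \<one>\<^bsub>O.l\<^esub> \<in> carrier (E.X (j - 1))" using a by (simp add: E.tn_mem)
        show ?thesis using strictly_unital_left[OF L t] strictly_unital_left[OF \<nu>_su a] 1 by simp
      next
        case 2
        then have a: "a \<in> carrier (A (j - 1))" using w(1) by (simp add: susp_def)
        have t: "E.tn (j - 1) a \<one>\<^bsub>O.l\<^esub> \<in> carrier (E.X (j - 1))" using a by (simp add: E.tn_mem)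
        have e1: "e1 \<in> carrier (E.X 0)" using e_mem by (simp add: E.tn_mem)
        have "ksign (E.X (j - 1)) (j - 1) (E.tn (j - 1) a \<one>\<^bsub>O.l\<^esub>) = E.tn (j - 1) (ksign (A (j - 1)) (j - 1) a) \<one>\<^bsub>O.l\<^esub>"
          unfolding E.ext_ksign by (rule lin_ksign[OF A E.T_module E.tn_lin[OF one_l] a, symmetric])
        then show ?thesis
          using strictly_unital_right[where A = E.X, OF E.lc E.ext_module e1 L t]
            strictly_unital_right[OF k A e_mem \<nu>_su a] 2 by simp
      qed
    qed
  qed
next
  assume R: ?R
  show ?L
    unfolding strictly_unital_def
  proof (intro conjI allI impI ballI)
    show "F \<in> carrier (cl (-1))" by (rule F)
  next
    fix i t assume "t \<in> carrier (E.X i)"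
    then have t: "t \<in> carrier (E.T i)" by simp
    have u: "[(1, e1)] \<in> wset (susp E.X)" using e_mem by (simp add: susp_def E.tn_mem)
    show "ev O.l E.X F [(1, e1), (i + 1, t)] = t"
      using t
    proof (induction rule: E.T_induct)
      case (tens a x)
      have "ev O.l E.X F [(1, e1), (i + 1, E.tn i a x)] = x \<odot>\<^bsub>E.X i\<^esub> ev O.l E.X F (E.emb [(1, e), (i + 1, a)])"
        using E.ev_slot_tens[OF F E.ext_module u, of "[]" a "i + 1" x] tens by (simp add: susp_def)
      also have "ev O.l E.X F (E.emb [(1, e), (i + 1, a)]) = E.tn i a \<one>\<^bsub>O.l\<^esub>"
        using R[rule_format, of "[(1, e), (i + 1, a)]"] tens e_mem strictly_unital_left[OF \<nu>_su, of a "i + 1"]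
        by (simp add: susp_def)
      finally show ?case using tens by (simp add: E.L_m_comm[of x])
    next
      case (add s t)
      then show ?case
        using linD(2)[OF ev_slot_lin[OF E.lc E.ext_module E.ext_module F u, of "[]" "i + 1"], of s t]
        by (simp add: susp_def)
    qed
    have "ev O.l E.X F [(i + 1, t), (1, e1)] = ksign (E.T i) i t"
      using t
    proof (induction rule: E.T_induct)
      case (tens a x)
      have ks: "ksign (A i) i a \<in> carrier (A i)" by (rule ksign_mem[OF A tens(1)])
      have "ev O.l E.X F [(i + 1, E.tn i a x), (1, e1)] = x \<odot>\<^bsub>E.X i\<^esub> ev O.l E.X F (E.emb [(i + 1, a), (1, e)])"
        using E.ev_slot_tens[OF F E.ext_module _ u, of "[]" a "i + 1" x] tens by (simp add: susp_def)
      also have "ev O.l E.X F (E.emb [(i + 1, a), (1, e)]) = E.tn i (ksign (A i) i a) \<one>\<^bsub>O.l\<^esub>"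
        using R[rule_format, of "[(i + 1, a), (1, e)]"] tens e_mem strictly_unital_right[OF k A e_mem \<nu>_su, of a "i + 1"]
        by (simp add: susp_def)
      also have "x \<odot>\<^bsub>E.X i\<^esub> \<dots> = E.tn i (ksign (A i) i a) x" using tens ks by (simp add: E.L_m_comm[of x])
      also have "\<dots> = ksign (E.T i) i (E.tn i a x)"
        by (rule lin_ksign[OF A E.T_module E.tn_lin[OF tens(2)] tens(1)])
      finally show ?case .
    next
      case (add s t)
      then show ?case
        using linD(2)[OF ev_slot_lin[OF E.lc E.ext_module E.ext_module F _ u, of "[]" "i + 1"], of s t]
          linD(2)[OF ksign_lin[OF E.T_module], of s i t i]
        by (simp add: susp_def)
    qed
    moreover have "ksign (E.T i) (i + i) t = t" by (simp add: ksign_def)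
    ultimately show "t = ksign (E.X i) i (ev O.l E.X F [(i + 1, t), (1, e1)])"
      using ksign_ksign[OF E.T_module t, of i i] by (simp add: E.ext_ksign)
  next
    fix n :: nat and m w assume n: "1 \<le> n" "n \<noteq> 2" and w: "w \<in> words (susp E.X) n m" "(1, e1) \<in> set w"
    have F': "mlin O.l (susp E.X) (\<lambda>m. susp E.X (m + -1)) n (ev O.l E.X F)"
      using cmlin_ev[OF E.lc E.ext_module E.ext_module F] n by (simp add: cmlin_def)
    have P: "module O.l (susp E.X (m + -1))" for m by (rule E.sX)
    have Z: "mlin O.l (susp E.X) (\<lambda>m. susp E.X (m + -1)) n (\<lambda>w. \<zero>\<^bsub>susp E.X (wdeg w + -1)\<^esub>)"
    proof (rule mlinI)
      show "\<zero>\<^bsub>susp E.X (wdeg w + - 1)\<^esub> \<in> carrier (susp E.X (wdeg w + - 1))" for w :: "(int \<times> ('a \<times> 'l \<Rightarrow> 'k) set) list"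
        using P by (simp add: module_def abelian_groupE(2))
      show "lin O.l (susp E.X i) (susp E.X (wdeg u + (i + wdeg v) + - 1))
        (\<lambda>x. \<zero>\<^bsub>susp E.X (wdeg (u @ (i, x) # v) + - 1)\<^esub>)" for u v :: "(int \<times> ('a \<times> 'l \<Rightarrow> 'k) set) list" and i
      proof -
        interpret S: module O.l "susp E.X (wdeg u + (i + wdeg v) + -1)" by (rule P)
        have "wdeg (u @ (i, x) # v) = wdeg u + (i + wdeg v)" for x by simp
        then show ?thesis by (intro linI) (simp_all only: S.zero_closed S.r_zero S.smult_r_null)
      qed
    qed
    \<comment> \<open>The comparison with the zero function is confined to words keeping the unit as
      an entry, by the choice of the set \<open>{(1, e)}\<close>; the hypothesis says nothing about
      \<open>F\<close> on other words.\<close>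
    have "ev O.l E.X F w = \<zero>\<^bsub>susp E.X (wdeg w + -1)\<^esub>"
    proof (rule E.mlin_emb_unique[OF F' Z P, of "{(1, e)}"])
      show "a \<in> carrier (susp A i)" if "(i, a) \<in> {(1, e)}" for i a using that e_mem by (simp add: susp_def)
      show "ev O.l E.X F (E.emb w) = \<zero>\<^bsub>susp E.X (wdeg (E.emb w) + - 1)\<^esub>"
        if w: "w \<in> wset (susp A)" "length w = n" "{(1, e)} = {} \<or> set w \<inter> {(1, e)} \<noteq> {}" for w
        using R[rule_format, OF w(1)] strictly_unital_other[OF \<nu>_su w(1)] w n
        by (simp add: susp_def tens_zero_l[OF A E.lk])
    qed (use w in \<open>auto simp: words_iff\<close>)
    then show "ev O.l E.X F w = \<zero>\<^bsub>susp E.X (m - 1)\<^esub>" using w by (simp add: words_iff)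
  qed
qed

lemma aug_map_contr: "aug_map k A X i = contr k (A i) O.l O.\<epsilon>"
  by (simp add: aug_map_def contr_def tlift_def)

lemma aug_map:
  shows "lin k (E.T i) (A i) (aug_map k A X i)"
    and "a \<in> carrier (A i) \<Longrightarrow> x \<in> carrier O.l \<Longrightarrow> aug_map k A X i (E.tn i a x) = O.\<epsilon> x \<odot>\<^bsub>A i\<^esub> a"
  unfolding aug_map_contr using contr[where M = "A i", OF A E.lk O.\<epsilon>_lin] mod_hom_lin by blast+

lemma aug_map_one: "a \<in> carrier (A i) \<Longrightarrow> aug_map k A X i (E.tn i a \<one>\<^bsub>O.l\<^esub>) = a"
proof -
  interpret Ai: module k "A i" by (rule A)
  show "a \<in> carrier (A i) \<Longrightarrow> aug_map k A X i (E.tn i a \<one>\<^bsub>O.l\<^esub>) = a"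
    by (simp add: aug_map(2) O.\<epsilon>_one)
qed

text \<open>The second factors lie in the augmentation ideal, which the augmentation kills. Hence
  adding such a term does not change the reduction to k.\<close>

lemma aug_map_K:
  assumes w: "w \<in> wset (susp A)" "w \<noteq> []" and v: "v \<in> carrier (V p)"
  shows "aug_map k A X (wdeg w + p - 1) (K p w v) = \<zero>\<^bsub>A (wdeg w + p - 1)\<^esub>"
proof (rule tensor_lin_eqI[OF Cm mm A lin_comp[OF aug_map(1) K(1)[OF w]] lin_const_zero[OF A] _ v])
  fix f x assume f: "f \<in> carrier (C p)" and x: "x \<in> carrier O.m"
  interpret Ai: module k "A (wdeg w + p - 1)" by (rule A)
  have "ev k A f w \<in> carrier (A (wdeg w + p - 1))" using linD(1)[OF ev_red_lin[OF w] f] .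
  then show "aug_map k A X (wdeg w + p - 1) (K p w (tens k (C p) O.m f x)) = \<zero>\<^bsub>A (wdeg w + p - 1)\<^esub>"
    using K(2)[OF w f x] aug_map(2) O.m_mem[OF x] x by (simp add: O.m_iff)
qed

abbreviation "redu N \<equiv> push k A (-1) (aug_map k A X) (restr k A O.l (-1) N)"

lemma redu:
  assumes "N \<in> carrier (cl (-1))"
  shows "redu N \<in> carrier (CC k A A (-1))"
    and "w \<in> wset (susp A) \<Longrightarrow> w \<noteq> [] \<Longrightarrow> ev k A (redu N) w = aug_map k A X (wdeg w + -1 - 1) (ev O.l E.X N (E.emb w))"
  using push[OF k A E.T_module A aug_map(1) E.restr(1)[OF assms]] E.restr(2)[OF assms] by simp_all

lemma redu_\<eta>:
  assumes v: "v \<in> carrier (V (-1))"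
  shows "redu (\<eta> v) = \<nu>"
proof (rule CC_eqI[OF k A A redu(1)[OF \<eta>_mem[OF v]] \<nu>C])
  fix w assume w: "w \<in> wset (susp A)" "w \<noteq> []"
  let ?i = "wdeg w + -1 - 1"
  interpret Ai: module k "A (wdeg w - 2)" by (rule A)
  have \<nu>w: "ev k A \<nu> w \<in> carrier (A ?i)" using ev_mem[OF k A A \<nu>C w] by (simp add: susp_def)
  have "ev k A (redu (\<eta> v)) w = aug_map k A X ?i (K (-1) w v \<oplus>\<^bsub>E.T ?i\<^esub> E.tn ?i (ev k A \<nu> w) \<one>\<^bsub>O.l\<^esub>)"
    using redu(2)[OF \<eta>_mem[OF v] w] ev_\<eta>[OF w v] by simp
  also have "\<dots> = aug_map k A X ?i (K (-1) w v) \<oplus>\<^bsub>A ?i\<^esub> aug_map k A X ?i (E.tn ?i (ev k A \<nu> w) \<one>\<^bsub>O.l\<^esub>)"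
    by (rule linD(2)[OF aug_map(1) linD(1)[OF K(1)[OF w] v] E.tn_mem[OF \<nu>w one_l]])
  also have "\<dots> = ev k A \<nu> w"
    using aug_map_K[OF w v] aug_map_one[OF \<nu>w] \<nu>w by simp
  finally show "ev k A (redu (\<eta> v)) w = ev k A \<nu> w" .
qed

lemma \<eta>_strictly_unital:
  assumes v: "v \<in> carrier (V (-1))"
  shows "strictly_unital O.l E.X e1 (\<eta> v)"
  unfolding strictly_unital_iff_emb[OF \<eta>_mem[OF v]]
proof (intro ballI impI)
  fix w assume w: "w \<in> wset (susp A)" "(1, e) \<in> set w"
  then have ne: "w \<noteq> []" by auto
  interpret T: module k "E.T (wdeg w - 2)" by (rule E.T_module)
  have "ev k A \<nu> w \<in> carrier (A (wdeg w - 2))" using ev_mem[OF k A A \<nu>C w(1) ne] by (simp add: susp_def)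
  then show "ev O.l E.X (\<eta> v) (E.emb w) = E.tn (wdeg w - 2) (ev k A \<nu> w) \<one>\<^bsub>O.l\<^esub>"
    using ev_\<eta>[OF w(1) ne v] K_unit[OF w v] by (simp add: E.tn_mem)
qed

lemma \<eta>_inj: "inj_on \<eta> (carrier (V (-1)))"
proof (rule inj_onI)
  fix v v' assume v: "v \<in> carrier (V (-1))" and v': "v' \<in> carrier (V (-1))" and eq: "\<eta> v = \<eta> v'"
  interpret V: module k "V (-1)" by (rule Vm)
  have "v \<ominus>\<^bsub>V (-1)\<^esub> v' = \<zero>\<^bsub>V (-1)\<^esub>"
  proof (rule K_inj)
    show "v \<ominus>\<^bsub>V (-1)\<^esub> v' \<in> carrier (V (-1))" using v v' by simp
    fix w assume w: "w \<in> wset (susp A)" "w \<noteq> []"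
    let ?i = "wdeg w + -1 - 1"
    interpret T: module k "E.T ?i" by (rule E.T_module)
    have \<nu>w: "ev k A \<nu> w \<in> carrier (A ?i)" using ev_mem[OF k A A \<nu>C w] by (simp add: susp_def)
    note m = linD(1)[OF K(1)[OF w] v] linD(1)[OF K(1)[OF w] v'] E.tn_mem[OF \<nu>w one_l]
    have "K (-1) w v = K (-1) w v'"
      using ev_\<eta>[OF w v] ev_\<eta>[OF w v'] eq T.add.right_cancel[OF m(3,1,2)] by simp
    then show "K (-1) w (v \<ominus>\<^bsub>V (-1)\<^esub> v') = \<zero>\<^bsub>E.T (wdeg w + -1 - 1)\<^esub>"
      using lin_minus[OF Vm E.T_module K(1)[OF w] v v'] module_minus_self_eq[OF E.T_module _ m(2)] by simp
  qed
  moreover have "v = (v \<ominus>\<^bsub>V (-1)\<^esub> v') \<oplus>\<^bsub>V (-1)\<^esub> v'"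
    using v v' by (simp add: V.minus_eq V.a_assoc V.l_neg)
  ultimately show "v = v'" using v' by simp
qed

text \<open>Contracting the values of \<open>N\<close> with the functionals of the dual basis gives
  cochains \<open>f b\<close>, and the sum of the f_b \<otimes> y_b is the preimage. They are
  reduced because on words with a letter \<open>e\<close> the value of \<open>N\<close> is a tensor
  with 1, which the functionals kill.\<close>

lemma \<eta>_surj:
  assumes su: "strictly_unital O.l E.X e1 N" and red: "redu N = \<nu>"
  shows "\<exists>v\<in>carrier (V (-1)). \<eta> v = N"
proof -
  have N: "N \<in> carrier (cl (-1))" using su by (simp add: strictly_unital_def)
  interpret V: module k "V (-1)" by (rule Vm)
  obtain B :: "'l set" and \<phi> y where B: "finite B" and \<phi>: "\<And>b. b \<in> B \<Longrightarrow> lin k O.l (self_alg k) (\<phi> b)"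
    and y: "\<And>b. b \<in> B \<Longrightarrow> y b \<in> carrier O.m" and \<phi>1: "\<And>b. b \<in> B \<Longrightarrow> \<phi> b \<one>\<^bsub>O.l\<^esub> = \<zero>\<^bsub>k\<^esub>"
    and ex: "\<And>x. x \<in> carrier O.l \<Longrightarrow> O.aug_part x = finsum O.l (\<lambda>b. \<phi> b x \<odot>\<^bsub>O.l\<^esub> y b) B"
    by (rule O.m_dual_basis) blast
  have yl: "y b \<in> carrier O.l" if "b \<in> B" for b using y[OF that] by (rule O.m_mem)
  define c where "c b i = contr k (A i) O.l (\<phi> b)" for b i
  have c: "lin k (E.T i) (A i) (c b i)"
    "\<And>a x. a \<in> carrier (A i) \<Longrightarrow> x \<in> carrier O.l \<Longrightarrow> c b i (E.tn i a x) = \<phi> b x \<odot>\<^bsub>A i\<^esub> a" if b: "b \<in> B" for b i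
    unfolding c_def using contr[where M = "A i", OF A E.lk \<phi>[OF b]] mod_hom_lin by blast+
  define f where "f b = push k A (-1) (c b) (restr k A O.l (-1) N)" for b
  have f: "f b \<in> carrier (CC k A A (-1))"
    "\<And>w. w \<in> wset (susp A) \<Longrightarrow> w \<noteq> [] \<Longrightarrow> ev k A (f b) w = c b (wdeg w - 2) (ev O.l E.X N (E.emb w))" if b: "b \<in> B" for b
    unfolding f_def using push[OF k A E.T_module A c(1)[OF b] E.restr(1)[OF N]] E.restr(2)[OF N] by simp_all
  have fC: "f b \<in> carrier (C (-1))" if b: "b \<in> B" for b
    unfolding CC_red_iff
  proof (intro conjI ballI impI f(1)[OF b])
    fix w assume w: "w \<in> wset (susp A)" "(1, e) \<in> set w"
    then have ne: "w \<noteq> []" by auto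
    interpret Ai: module k "A (wdeg w - 2)" by (rule A)
    have "ev k A \<nu> w \<in> carrier (A (wdeg w - 2))" using ev_mem[OF k A A \<nu>C w(1) ne] by (simp add: susp_def)
    then show "ev k A (f b) w = \<zero>\<^bsub>susp A (wdeg w + -1)\<^esub>"
      using f(2)[OF b w(1) ne] strictly_unital_iff_emb[OF N] su w c(2)[OF b] \<phi>1[OF b] by (simp add: susp_def)
  qed
  define v where "v = finsum (V (-1)) (\<lambda>b. tens k (C (-1)) O.m (f b) (y b)) B"
  have tm: "(\<lambda>b. tens k (C (-1)) O.m (f b) (y b)) \<in> B \<rightarrow> carrier (V (-1))"
    using fC y by (auto intro: tens_mem[OF Cm mm])
  have v: "v \<in> carrier (V (-1))" unfolding v_def by (rule V.finsum_closed[OF tm])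
  \<comment> \<open>The splitting of l into the augmentation ideal and the multiples of 1, tensored
    with A: the first part is expanded in the dual basis, the second is read off by the
    augmentation.\<close>
  have decomp: "t = finsum (E.T i) (\<lambda>b. E.tn i (c b i t) (y b)) B \<oplus>\<^bsub>E.T i\<^esub> E.tn i (aug_map k A X i t) \<one>\<^bsub>O.l\<^esub>"
    if t: "t \<in> carrier (E.T i)" for i t
  proof (rule tensor_lin_eqI[OF A E.lk E.T_module lin_id _ _ t])
    interpret Ti: module k "E.T i" by (rule E.T_module)
    show "lin k (E.T i) (E.T i) (\<lambda>t. finsum (E.T i) (\<lambda>b. E.tn i (c b i t) (y b)) B \<oplus>\<^bsub>E.T i\<^esub> E.tn i (aug_map k A X i t) \<one>\<^bsub>O.l\<^esub>)"
      by (intro lin_add[OF E.T_module] lin_finsum_fun[OF E.T_module E.T_module B]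
          lin_comp[OF E.tn_lin[OF yl] c(1)] lin_comp[OF E.tn_lin[OF one_l] aug_map(1)])
    fix a x assume a: "a \<in> carrier (A i)" and x: "x \<in> carrier O.l"
    have \<phi>m: "\<phi> b x \<in> carrier k" if "b \<in> B" for b using linD(1)[OF \<phi>[OF that] x] by simp
    note \<epsilon>m = O.\<epsilon>_mem[OF x]
    have g: "(\<lambda>b. \<phi> b x \<odot>\<^bsub>O.l\<^esub> y b) \<in> B \<rightarrow> carrier O.l" using \<phi>m yl by auto
    have "finsum (E.T i) (\<lambda>b. E.tn i (c b i (E.tn i a x)) (y b)) B = finsum (E.T i) (\<lambda>b. E.tn i a (\<phi> b x \<odot>\<^bsub>O.l\<^esub> y b)) B"
    proof (rule Ti.finsum_cong')
      show "(\<lambda>b. E.tn i a (\<phi> b x \<odot>\<^bsub>O.l\<^esub> y b)) \<in> B \<rightarrow> carrier (E.T i)"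
        using a funcset_mem[OF g] by (intro Pi_I E.tn_mem) auto
      show "E.tn i (c b i (E.tn i a x)) (y b) = E.tn i a (\<phi> b x \<odot>\<^bsub>O.l\<^esub> y b)" if b: "b \<in> B" for b
        using c(2)[OF b a x] \<phi>m[OF b] a yl[OF b] by (simp add: tens_smult_l[OF A E.lk] tens_smult_r[OF A E.lk])
    qed simp
    also have "\<dots> = E.tn i a (O.aug_part x)"
      unfolding ex[OF x] by (rule lin_finsum[OF E.lk E.T_module E.tn_lin_r[OF a] B g, symmetric])
    finally have 1: "finsum (E.T i) (\<lambda>b. E.tn i (c b i (E.tn i a x)) (y b)) B = E.tn i a (O.aug_part x)" .
    have 2: "E.tn i (aug_map k A X i (E.tn i a x)) \<one>\<^bsub>O.l\<^esub> = E.tn i a (O.\<epsilon> x \<odot>\<^bsub>O.l\<^esub> \<one>\<^bsub>O.l\<^esub>)"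
      using aug_map(2)[OF a x] a \<epsilon>m by (simp add: tens_smult_l[OF A E.lk] tens_smult_r[OF A E.lk])
    have "E.tn i a x = E.tn i a (O.aug_part x \<oplus>\<^bsub>O.l\<^esub> O.\<epsilon> x \<odot>\<^bsub>O.l\<^esub> \<one>\<^bsub>O.l\<^esub>)"
      using O.aug_part_decomp[OF x] by simp
    also have "\<dots> = E.tn i a (O.aug_part x) \<oplus>\<^bsub>E.T i\<^esub> E.tn i a (O.\<epsilon> x \<odot>\<^bsub>O.l\<^esub> \<one>\<^bsub>O.l\<^esub>)"
      using O.m_mem[OF linD(1)[OF O.aug_part_lin x]] \<epsilon>m by (intro tens_add_r[OF A E.lk a]) simp_all
    finally show "E.tn i a x = finsum (E.T i) (\<lambda>b. E.tn i (c b i (E.tn i a x)) (y b)) B \<oplus>\<^bsub>E.T i\<^esub>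
        E.tn i (aug_map k A X i (E.tn i a x)) \<one>\<^bsub>O.l\<^esub>" unfolding 1 2 .
  qed
  have "\<eta> v = N"
  proof (rule E.CC_ext_eqI[OF E.ext_module \<eta>_mem[OF v] N])
    fix w assume w: "w \<in> wset (susp A)" "w \<noteq> []"
    let ?t = "ev O.l E.X N (E.emb w)" and ?i = "wdeg w - 2"
    interpret Ti: module k "E.T ?i" by (rule E.T_module)
    have Kl: "lin k (V (-1)) (E.T ?i) (K (-1) w)" using K(1)[OF w, of "-1"] by simp
    have t: "?t \<in> carrier (E.T ?i)" using linD(1)[OF E.ev_emb_lin[OF w] N] by simp
    have "K (-1) w v = finsum (E.T ?i) (\<lambda>b. K (-1) w (tens k (C (-1)) O.m (f b) (y b))) B"
      unfolding v_def by (rule lin_finsum[OF Vm E.T_module Kl B tm])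
    also have "\<dots> = finsum (E.T ?i) (\<lambda>b. E.tn ?i (c b ?i ?t) (y b)) B"
    proof (rule Ti.finsum_cong')
      show "(\<lambda>b. E.tn ?i (c b ?i ?t) (y b)) \<in> B \<rightarrow> carrier (E.T ?i)"
        using linD(1)[OF c(1) t] yl by (auto simp: E.tn_mem)
      show "K (-1) w (tens k (C (-1)) O.m (f b) (y b)) = E.tn ?i (c b ?i ?t) (y b)" if b: "b \<in> B" for b
        using K(2)[OF w fC[OF b] y[OF b]] f(2)[OF b w] by simp
    qed simp
    finally have 1: "K (-1) w v = finsum (E.T ?i) (\<lambda>b. E.tn ?i (c b ?i ?t) (y b)) B" .
    \<comment> \<open>The component along 1 is fixed by the condition that \<open>N\<close> reduces
      to \<nu>; it is the term \<nu> \<otimes> 1 in \<eta>.\<close>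
    have 2: "aug_map k A X ?i ?t = ev k A \<nu> w" using redu(2)[OF N w] red by simp
    show "ev O.l E.X (\<eta> v) (E.emb w) = ?t"
      using ev_\<eta>[OF w v] decomp[OF t] 1 2 by simp
  qed
  then show ?thesis using v by blast
qed

lemma infDef_iff: "N \<in> infDef_su k A e \<nu> X \<longleftrightarrow> A_infinity O.l E.X N \<and> strictly_unital O.l E.X e1 N \<and> redu N = \<nu>"
  by (simp add: infDef_su_def)

text \<open>Before any equation is imposed, \<eta> is a bijection from all of \<open>V (-1)\<close>
  to the strictly unital cochains reducing to \<nu>. Maurer--Cartan elements are the ones whose
  image is an A-infinity structure.\<close>

lemma \<eta>_bij:
  assumes "\<one>\<^bsub>k\<^esub> \<oplus>\<^bsub>k\<^esub> \<one>\<^bsub>k\<^esub> \<in> Units k"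
  shows "bij_betw \<eta> (MC k Lie X) (infDef_su k A e \<nu> X)"
proof -
  have MC: "v \<in> MC k Lie X \<longleftrightarrow> v \<in> carrier (V (-1)) \<and> A_infinity O.l E.X (\<eta> v)" for v
    using A_infinity_\<eta>_iff[OF assms] by (auto simp: MC_iff_expr)
  have "inj_on \<eta> (MC k Lie X)" by (rule inj_on_subset[OF \<eta>_inj]) (auto simp: MC)
  moreover have "\<eta> ` MC k Lie X = infDef_su k A e \<nu> X"
  proof
    show "\<eta> ` MC k Lie X \<subseteq> infDef_su k A e \<nu> X"
      using \<eta>_strictly_unital redu_\<eta> by (auto simp: MC infDef_iff)
    show "infDef_su k A e \<nu> X \<subseteq> \<eta> ` MC k Lie X"
    proof
      fix N assume N: "N \<in> infDef_su k A e \<nu> X"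
      then obtain v where "v \<in> carrier (V (-1))" "\<eta> v = N"
        using \<eta>_surj unfolding infDef_iff by blast
      then show "N \<in> \<eta> ` MC k Lie X" using N by (auto simp: MC infDef_iff)
    qed
  qed
  ultimately show ?thesis by (simp add: bij_betw_def)
qed

lemma def_map_eq:
  assumes \<mu>: "\<mu> \<in> carrier (C (-1))" and \<nu>: "\<nu> = \<mu> \<oplus>\<^bsub>CC k A A (-1)\<^esub> mu_su k A e sp" and v: "v \<in> carrier (V (-1))"
  shows "def_map k A e sp \<mu> X v = \<eta> v"
proof -
  let ?C = "CC k A A (-1)"
  let ?T = "tensor k ?C O.l"
  interpret T: module k ?T by (rule tensor_module[OF CCm E.lk])
  note m = tens_mem[OF CCm E.lk CC_red_subset[OF \<mu>] one_l] tens_mem[OF CCm E.lk mu_su_mem one_l]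
  have i: "inc v \<in> carrier ?T" by (rule linD(1)[OF inc(1) v])
  have "def_map k A e sp \<mu> X v = theta k A O.l (-1) (inc v \<oplus>\<^bsub>?T\<^esub> tens k ?C O.l \<mu> \<one>\<^bsub>O.l\<^esub> \<oplus>\<^bsub>?T\<^esub> tens k ?C O.l (mu_su k A e sp) \<one>\<^bsub>O.l\<^esub>)"
    by (simp add: def_map_def Let_def inc_def)
  also have "inc v \<oplus>\<^bsub>?T\<^esub> tens k ?C O.l \<mu> \<one>\<^bsub>O.l\<^esub> \<oplus>\<^bsub>?T\<^esub> tens k ?C O.l (mu_su k A e sp) \<one>\<^bsub>O.l\<^esub> =
      inc v \<oplus>\<^bsub>?T\<^esub> tens k ?C O.l \<nu> \<one>\<^bsub>O.l\<^esub>"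
    unfolding \<nu> tens_add_l[OF CCm E.lk CC_red_subset[OF \<mu>] mu_su_mem one_l] by (rule T.a_assoc[OF i m])
  also have "theta k A O.l (-1) \<dots> = \<eta> v"
    using mod_hom_add[OF E.theta(1) i tens_mem[OF CCm E.lk \<nu>C one_l]] E.theta(2)[OF \<nu>C one_l]
    by (simp add: \<eta>_def Th_def \<theta>\<nu>_def)
  finally show ?thesis .
qed

end

section \<open>Functoriality\<close>

locale deform_hom = X: deform k A e sp X \<nu> + Y: deform k A e sp Y \<nu>
  for k :: "('k, 'z) ring_scheme" and A :: "int \<Rightarrow> ('k, 'a) module" and e :: 'a and sp :: "'a \<Rightarrow> 'k"
    and X :: "('k, 'l) aug" and \<nu> :: "('k, 'a, 'a) cochain" and Y :: "('k, 'l) aug" +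
  fixes \<phi> :: "'l \<Rightarrow> 'l"
  assumes \<phi>: "\<phi> \<in> aug_hom k X Y"
begin

lemma \<phi>_lin: "lin k X.O.l Y.O.l \<phi>"
  using \<phi> by (auto simp: aug_hom_def alg_hom_def intro: mod_hom_lin)

lemma \<phi>_mult: "x \<in> carrier X.O.l \<Longrightarrow> y \<in> carrier X.O.l \<Longrightarrow> \<phi> (x \<otimes>\<^bsub>X.O.l\<^esub> y) = \<phi> x \<otimes>\<^bsub>Y.O.l\<^esub> \<phi> y"
  and \<phi>_one: "\<phi> \<one>\<^bsub>X.O.l\<^esub> = \<one>\<^bsub>Y.O.l\<^esub>"
  and \<phi>_aug: "x \<in> carrier X.O.l \<Longrightarrow> Y.O.\<epsilon> (\<phi> x) = X.O.\<epsilon> x"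
  using \<phi> by (auto simp: aug_hom_def alg_hom_def ring_hom_def)

lemma \<phi>_lin_m: "lin k X.O.m Y.O.m \<phi>"
  using linD[OF \<phi>_lin] by (intro linI) (auto simp: X.O.m_iff Y.O.m_iff \<phi>_aug)

definition \<Phi> :: "int \<Rightarrow> (('k, 'a, 'a) cochain \<times> 'l \<Rightarrow> 'k) set \<Rightarrow> (('k, 'a, 'a) cochain \<times> 'l \<Rightarrow> 'k) set" where
  "\<Phi> p = tmap k (X.C p) X.O.m (X.C p) Y.O.m (\<lambda>f. f) \<phi>"

lemma \<Phi>:
  shows "lin k (X.V p) (Y.V p) (\<Phi> p)"
    and "f \<in> carrier (X.C p) \<Longrightarrow> x \<in> carrier X.O.m \<Longrightarrow>
      \<Phi> p (tens k (X.C p) X.O.m f x) = tens k (X.C p) Y.O.m f (\<phi> x)"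
  unfolding \<Phi>_def using tmap[OF X.Cm X.mm X.Cm Y.mm lin_id \<phi>_lin_m] mod_hom_lin by blast+

lemma MC_map_\<Phi>: "MC_map k X.Lie X Y \<phi> = \<Phi> (-1)"
  by (simp add: MC_map_def \<Phi>_def)

text \<open>The differential acts on the cochain factor and \<Phi> on the scalar factor, so they
  commute on pure tensors.\<close>

lemma \<Phi>_D: "v \<in> carrier (X.V (-1)) \<Longrightarrow> Y.D (\<Phi> (-1) v) = \<Phi> (-2) (X.D v)"
proof (rule tensor_lin_eqI[OF X.Cm X.mm Y.Vm lin_comp[OF mod_hom_lin[OF Y.D(1)] \<Phi>(1)]
      lin_comp[OF \<Phi>(1) mod_hom_lin[OF X.D(1)]]])
  fix f x assume f: "f \<in> carrier (X.C (-1))" and x: "x \<in> carrier X.O.m"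
  show "Y.D (\<Phi> (-1) (tens k (X.C (-1)) X.O.m f x)) = \<Phi> (-2) (X.D (tens k (X.C (-1)) X.O.m f x))"
    using \<Phi>(2) f x linD(1)[OF \<phi>_lin_m x] linD(1)[OF X.br_\<nu>_lin f] by (simp add: X.D(2) Y.D(2))
qed

lemma \<Phi>_Br:
  assumes v: "v \<in> carrier (X.V (-1))" and v': "v' \<in> carrier (X.V (-1))"
  shows "Y.Br (\<Phi> (-1) v) (\<Phi> (-1) v') = \<Phi> (-2) (X.Br v v')"
proof -
  note \<Phi>m = linD(1)[OF \<Phi>(1)]
  have 1: "Y.Br (\<Phi> (-1) (tens k (X.C (-1)) X.O.m f x)) (\<Phi> (-1) v') = \<Phi> (-2) (X.Br (tens k (X.C (-1)) X.O.m f x) v')"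
    if f: "f \<in> carrier (X.C (-1))" and x: "x \<in> carrier X.O.m" for f x
  proof -
    have t: "tens k (X.C (-1)) X.O.m f x \<in> carrier (X.V (-1))" using f x by (rule tens_mem[OF X.Cm X.mm])
    show ?thesis
    proof (rule tensor_lin_eqI[OF X.Cm X.mm Y.Vm lin_comp[OF Y.Br_lin_right[OF \<Phi>m[OF t]] \<Phi>(1)]
          lin_comp[OF \<Phi>(1) X.Br_lin_right[OF t]] _ v'])
      fix f' x' assume f': "f' \<in> carrier (X.C (-1))" and x': "x' \<in> carrier X.O.m"
      show "Y.Br (\<Phi> (-1) (tens k (X.C (-1)) X.O.m f x)) (\<Phi> (-1) (tens k (X.C (-1)) X.O.m f' x')) =
          \<Phi> (-2) (X.Br (tens k (X.C (-1)) X.O.m f x) (tens k (X.C (-1)) X.O.m f' x'))"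
        using X.Br(2)[OF f x f' x'] Y.Br(2)[OF f linD(1)[OF \<phi>_lin_m x] f' linD(1)[OF \<phi>_lin_m x']]
          \<Phi>(2)[OF f x] \<Phi>(2)[OF f' x'] \<Phi>(2)[OF X.gbracket_CC_red[OF f f'] X.O.m_mult[OF x x']]
        by (simp add: \<phi>_mult X.O.m_mem x x')
    qed
  qed
  show ?thesis
    by (rule tensor_lin_eqI[OF X.Cm X.mm Y.Vm lin_comp[OF Y.Br_lin_left[OF \<Phi>m[OF v']] \<Phi>(1)]
          lin_comp[OF \<Phi>(1) X.Br_lin_left[OF v']] 1 v])
qed

text \<open>The Maurer--Cartan expression is built from the differential, the bracket and the scalar
  1/2, all of which \<Phi> respects; for the bracket this uses that \<phi> is
  multiplicative.\<close>

lemma \<Phi>_MC: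
  assumes two: "\<one>\<^bsub>k\<^esub> \<oplus>\<^bsub>k\<^esub> \<one>\<^bsub>k\<^esub> \<in> Units k" and v: "v \<in> MC k X.Lie X"
  shows "\<Phi> (-1) v \<in> MC k X.Lie Y"
proof -
  interpret V: module k "X.V (-2)" by (rule X.Vm)
  have vV: "v \<in> carrier (X.V (-1))" and z: "X.MC_expr v = \<zero>\<^bsub>X.V (-2)\<^esub>"
    using v by (auto simp: X.MC_iff_expr)
  have b: "X.Br v v \<in> carrier (X.V (-2))" by (rule linD(1)[OF X.Br_lin_right[OF vV] vV])
  have "Y.MC_expr (\<Phi> (-1) v) = \<Phi> (-2) (X.MC_expr v)"
    unfolding X.MC_expr_def Y.MC_expr_def \<Phi>_D[OF vV] \<Phi>_Br[OF vV vV]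
    using linD(2)[OF \<Phi>(1) mod_hom_mem[OF X.D(1) vV] V.smult_closed[OF X.half_mem[OF two] b]]
      linD(3)[OF \<Phi>(1) X.half_mem[OF two] b] by simp
  then show ?thesis
    using z lin_zero[OF X.Vm Y.Vm \<Phi>(1)] linD(1)[OF \<Phi>(1) vV] by (simp add: Y.MC_iff_expr)
qed

definition \<chi> :: "int \<Rightarrow> ('a \<times> 'l \<Rightarrow> 'k) set \<Rightarrow> ('a \<times> 'l \<Rightarrow> 'k) set" where
  "\<chi> i = tmap k (A i) X.O.l (A i) Y.O.l (\<lambda>a. a) \<phi>"

lemma \<chi>:
  shows "lin k (X.E.T i) (Y.E.T i) (\<chi> i)"
    and "a \<in> carrier (A i) \<Longrightarrow> x \<in> carrier X.O.l \<Longrightarrow> \<chi> i (X.E.tn i a x) = Y.E.tn i a (\<phi> x)"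
  unfolding \<chi>_def using tmap[OF X.A X.E.lk X.A Y.E.lk lin_id \<phi>_lin] mod_hom_lin by blast+

lemma \<chi>_K:
  assumes w: "w \<in> wset (susp A)" "w \<noteq> []" and v: "v \<in> carrier (X.V p)"
  shows "\<chi> (wdeg w + p - 1) (X.K p w v) = Y.K p w (\<Phi> p v)"
proof (rule tensor_lin_eqI[OF X.Cm X.mm Y.E.T_module lin_comp[OF \<chi>(1) X.K(1)[OF w]]
      lin_comp[OF Y.K(1)[OF w] \<Phi>(1)] _ v])
  fix f x assume f: "f \<in> carrier (X.C p)" and x: "x \<in> carrier X.O.m"
  show "\<chi> (wdeg w + p - 1) (X.K p w (tens k (X.C p) X.O.m f x)) = Y.K p w (\<Phi> p (tens k (X.C p) X.O.m f x))"
    using X.K(2)[OF w f x] \<Phi>(2)[OF f x] Y.K(2)[OF w f linD(1)[OF \<phi>_lin_m x]]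
      \<chi>(2)[OF linD(1)[OF X.ev_red_lin[OF w] f] X.O.m_mem[OF x]] by simp
qed

text \<open>\<open>base_change\<close> is the solution of an equation between restrictions to words
  a \<otimes> 1. It is unique by \<open>CC_ext_eqI\<close>, and \<eta> of the transported element
  solves it because \<phi> fixes the term \<nu> \<otimes> 1. No base change of an arbitrary cochain
  has to be constructed.\<close>

lemma \<eta>_natural:
  assumes v: "v \<in> carrier (X.V (-1))"
  shows "Y.\<eta> (\<Phi> (-1) v) = base_change k A X Y \<phi> (X.\<eta> v)"
proof -
  have \<Phi>v: "\<Phi> (-1) v \<in> carrier (Y.V (-1))" by (rule linD(1)[OF \<Phi>(1) v])
  let ?p = "push k A (-1) \<chi> (restr k A X.O.l (-1) (X.\<eta> v))"
  note p = push[OF X.k X.A X.E.T_module Y.E.T_module \<chi>(1) X.E.restr(1)[OF X.\<eta>_mem[OF v]]]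
  have ev: "ev k A ?p w = ev Y.O.l Y.E.X (Y.\<eta> (\<Phi> (-1) v)) (Y.E.emb w)" if w: "w \<in> wset (susp A)" "w \<noteq> []" for w
  proof -
    let ?i = "wdeg w + -1 - 1"
    have \<nu>w: "ev k A \<nu> w \<in> carrier (A ?i)" using ev_mem[OF X.k X.A X.A X.\<nu>C w] by (simp add: susp_def)
    have "ev k A ?p w = \<chi> ?i (X.K (-1) w v \<oplus>\<^bsub>X.E.T ?i\<^esub> X.E.tn ?i (ev k A \<nu> w) \<one>\<^bsub>X.O.l\<^esub>)"
      using p(2)[OF w] X.E.restr(2)[OF X.\<eta>_mem[OF v] w] X.ev_\<eta>[OF w v] by simp
    also have "\<dots> = \<chi> ?i (X.K (-1) w v) \<oplus>\<^bsub>Y.E.T ?i\<^esub> \<chi> ?i (X.E.tn ?i (ev k A \<nu> w) \<one>\<^bsub>X.O.l\<^esub>)"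
      by (rule linD(2)[OF \<chi>(1) linD(1)[OF X.K(1)[OF w] v] X.E.tn_mem[OF \<nu>w X.one_l]])
    also have "\<dots> = ev Y.O.l Y.E.X (Y.\<eta> (\<Phi> (-1) v)) (Y.E.emb w)"
      unfolding Y.ev_\<eta>[OF w \<Phi>v] \<chi>_K[OF w v] \<chi>(2)[OF \<nu>w X.one_l] \<phi>_one ..
    finally show ?thesis .
  qed
  have "base_change k A X Y \<phi> (X.\<eta> v) = (THE N'. N' \<in> carrier (Y.cl (-1)) \<and> restr k A Y.O.l (-1) N' = ?p)"
    by (simp add: base_change_def \<chi>_def[abs_def])
  also have "\<dots> = Y.\<eta> (\<Phi> (-1) v)"
  proof (rule the_equality)
    note m = Y.\<eta>_mem[OF \<Phi>v]
    have "restr k A Y.O.l (-1) (Y.\<eta> (\<Phi> (-1) v)) = ?p"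
      by (rule CC_eqI[OF X.k X.A Y.E.T_module Y.E.restr(1)[OF m] p(1)]) (simp add: ev Y.E.restr(2)[OF m])
    then show "Y.\<eta> (\<Phi> (-1) v) \<in> carrier (Y.cl (-1)) \<and> restr k A Y.O.l (-1) (Y.\<eta> (\<Phi> (-1) v)) = ?p"
      using m by simp
    fix N' assume N': "N' \<in> carrier (Y.cl (-1)) \<and> restr k A Y.O.l (-1) N' = ?p"
    show "N' = Y.\<eta> (\<Phi> (-1) v)"
    proof (rule Y.E.CC_ext_eqI[OF Y.E.ext_module conjunct1[OF N'] m])
      fix w assume w: "w \<in> wset (susp A)" "w \<noteq> []"
      show "ev Y.O.l Y.E.X N' (Y.E.emb w) = ev Y.O.l Y.E.X (Y.\<eta> (\<Phi> (-1) v)) (Y.E.emb w)"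
        using Y.E.restr(2)[OF conjunct1[OF N'] w] N' ev[OF w] by simp
    qed
  qed
  finally show ?thesis ..
qed

end

lemma aug_hom_id: "algebra k (fst X) \<Longrightarrow> (\<lambda>x\<in>carrier (fst X). x) \<in> aug_hom k X X"
proof -
  assume "algebra k (fst X)"
  then interpret l: algebra k "fst X" .
  show ?thesis using mod_hom_id[OF l.module] by (auto simp: aug_hom_def alg_hom_def ring_hom_def)
qed

lemma aug_hom_compose:
  assumes "algebra k (fst X)" "\<phi> \<in> aug_hom k X Y" "\<psi> \<in> aug_hom k Y Z"
  shows "compose (carrier (fst X)) \<psi> \<phi> \<in> aug_hom k X Z"
proof -
  interpret l: algebra k "fst X" by fact
  have "\<phi> x \<in> carrier (fst Y)" if "x \<in> carrier (fst X)" for x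
    using assms(2) that by (auto simp: aug_hom_def alg_hom_def ring_hom_def)
  then show ?thesis
    using assms(2,3) mod_hom_compose[OF l.module, of \<psi> "fst Y" "fst Z" \<phi>]
    by (auto simp: aug_hom_def alg_hom_def ring_hom_def compose_def)
qed

theorem corollary4p20:
  fixes k :: "('k, 'z) ring_scheme" and A :: "int \<Rightarrow> ('k, 'a) module"
    and e :: 'a and sp :: "'a \<Rightarrow> 'k" and \<mu> \<nu> :: "('k, 'a, 'a) cochain"
  assumes "cring k"
    and "\<one>\<^bsub>k\<^esub> \<oplus>\<^bsub>k\<^esub> \<one>\<^bsub>k\<^esub> \<in> Units k"
    and "\<mu> \<in> carrier (CC_red k A e sp (-1))"
    and "\<nu> = \<mu> \<oplus>\<^bsub>CC k A A (-1)\<^esub> mu_su k A e sp"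
    and "A_infinity_split_unit k A e sp \<nu>"
  shows "controls k (red_Hochschild k A e sp \<nu>)
           (infDef_su k A e \<nu> :: ('k, 'l) aug \<Rightarrow> _) (base_change k A) \<and>
         functor_iso k
           (MC k (red_Hochschild k A e sp \<nu>) :: ('k, 'l) aug \<Rightarrow> _)
           (MC_map k (red_Hochschild k A e sp \<nu>))
           (infDef_su k A e \<nu>) (base_change k A)
           (def_map k A e sp \<mu>)"
proof -
  let ?L = "red_Hochschild k A e sp \<nu>"
  let ?\<eta> = "def_map k A e sp \<mu>"
  have df: "deform k A e sp X \<nu>" if "X \<in> aug_obj k" for X :: "('k, 'l) aug"
    using assms that unfolding A_infinity_split_unit_def
    by (intro deform.intro deform_axioms.intro split_unit.intro aug_alg.intro) auto
  have dh: "deform_hom k A e sp X \<nu> Y \<phi>" if "X \<in> aug_obj k" "Y \<in> aug_obj k" "\<phi> \<in> aug_hom k X Y"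
    for X Y :: "('k, 'l) aug" and \<phi>
    by (rule deform_hom.intro[OF df[OF that(1)] df[OF that(2)] deform_hom_axioms.intro[OF that(3)]])
  have alg: "algebra k (fst X)" if "X \<in> aug_obj k" for X :: "('k, 'l) aug"
    using that by (simp add: aug_obj_def)
  have eq: "?\<eta> X v = deform.\<eta> k A e sp X \<nu> v" if X: "X \<in> aug_obj k" and v: "v \<in> MC k ?L X" for X :: "('k, 'l) aug" and v
  proof -
    interpret X: deform k A e sp X \<nu> by (rule df[OF X])
    show ?thesis using v by (intro X.def_map_eq assms) (simp add: X.MC_iff_expr)
  qed
  have bij: "bij_betw (?\<eta> X) (MC k ?L X) (infDef_su k A e \<nu> X)" if X: "X \<in> aug_obj k" for X :: "('k, 'l) aug"
    using deform.\<eta>_bij[OF df[OF X] assms(2)] bij_betw_cong[of "MC k ?L X" "?\<eta> X"] eq[OF X] by blast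
  have mc: "MC_map k ?L X Y \<phi> v \<in> MC k ?L Y" and nat: "?\<eta> Y (MC_map k ?L X Y \<phi> v) = base_change k A X Y \<phi> (?\<eta> X v)"
    if XY: "X \<in> aug_obj k" "Y \<in> aug_obj k" "\<phi> \<in> aug_hom k X Y" and v: "v \<in> MC k ?L X"
    for X Y :: "('k, 'l) aug" and \<phi> v
  proof -
    interpret H: deform_hom k A e sp X \<nu> Y \<phi> by (rule dh[OF XY])
    show 1: "MC_map k ?L X Y \<phi> v \<in> MC k ?L Y" unfolding H.MC_map_\<Phi> by (rule H.\<Phi>_MC[OF assms(2) v])
    have "v \<in> carrier (H.X.V (-1))" using v by (simp add: H.X.MC_iff_expr)
    from H.\<eta>_natural[OF this] show "?\<eta> Y (MC_map k ?L X Y \<phi> v) = base_change k A X Y \<phi> (?\<eta> X v)"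
      using eq[OF XY(2) 1] eq[OF XY(1) v] by (simp add: H.MC_map_\<Phi>)
  qed
  have mc_id: "MC_map k ?L X X (\<lambda>x\<in>carrier (fst X). x) v = v" if X: "X \<in> aug_obj k" and v: "v \<in> MC k ?L X"
    for X :: "('k, 'l) aug" and v
  proof -
    interpret H: deform_hom k A e sp X \<nu> X "\<lambda>x\<in>carrier (fst X). x"
      by (rule dh[OF X X aug_hom_id[OF alg[OF X]]])
    have "v \<in> carrier (H.X.V (-1))" using v by (simp add: H.X.MC_iff_expr)
    \<comment> \<open>Both sides are linear in \<open>v\<close>, and on pure tensors only the
      identity on the augmentation ideal is involved, where the restricted identity of the algebra
      acts trivially.\<close>
    then show ?thesis unfolding H.MC_map_\<Phi>
      by (rule tensor_lin_eqI[OF H.X.Cm H.X.mm H.X.Vm H.\<Phi>(1) lin_id, rotated])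
        (simp add: H.\<Phi>(2) H.X.O.m_mem)
  qed
  have mc_comp: "MC_map k ?L X Z (compose (carrier (fst X)) \<psi> \<phi>) v = MC_map k ?L Y Z \<psi> (MC_map k ?L X Y \<phi> v)"
    if XYZ: "X \<in> aug_obj k" "Y \<in> aug_obj k" "Z \<in> aug_obj k" "\<phi> \<in> aug_hom k X Y" "\<psi> \<in> aug_hom k Y Z" and v: "v \<in> MC k ?L X"
    for X Y Z :: "('k, 'l) aug" and \<phi> \<psi> v
  proof -
    interpret F: deform_hom k A e sp X \<nu> Y \<phi> by (rule dh[OF XYZ(1,2,4)])
    interpret G: deform_hom k A e sp Y \<nu> Z \<psi> by (rule dh[OF XYZ(2,3,5)])
    interpret H: deform_hom k A e sp X \<nu> Z "compose (carrier (fst X)) \<psi> \<phi>"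
      by (rule dh[OF XYZ(1,3) aug_hom_compose[OF alg[OF XYZ(1)] XYZ(4,5)]])
    have "v \<in> carrier (F.X.V (-1))" using v by (simp add: F.X.MC_iff_expr)
    then show ?thesis unfolding H.MC_map_\<Phi> F.MC_map_\<Phi> G.MC_map_\<Phi>
    proof (rule tensor_lin_eqI[OF F.X.Cm F.X.mm G.Y.Vm H.\<Phi>(1) lin_comp[OF G.\<Phi>(1) F.\<Phi>(1)], rotated])
      fix f x assume fx: "f \<in> carrier (F.X.C (-1))" "x \<in> carrier F.X.O.m"
      show "H.\<Phi> (-1) (tens k (F.X.C (-1)) F.X.O.m f x) = G.\<Phi> (-1) (F.\<Phi> (-1) (tens k (F.X.C (-1)) F.X.O.m f x))"
        unfolding H.\<Phi>(2)[OF fx] F.\<Phi>(2)[OF fx] G.\<Phi>(2)[OF fx(1) linD(1)[OF F.\<phi>_lin_m fx(2)]]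
        using F.X.O.m_mem[OF fx(2)] by (simp add: compose_def)
    qed
  qed
  \<comment> \<open>Writing a deformation as the image of a Maurer--Cartan element turns, by
    \<open>nat\<close>, each law for \<open>base_change\<close> into the corresponding law for
    \<open>MC_map\<close>.\<close>
  have preimage: "\<exists>v\<in>MC k ?L X. N = ?\<eta> X v" if "X \<in> aug_obj k" "N \<in> infDef_su k A e \<nu> X" for X :: "('k, 'l) aug" and N
    using bij[OF that(1)] that(2) by (auto simp: bij_betw_def)
  have into: "?\<eta> X v \<in> infDef_su k A e \<nu> X" if "X \<in> aug_obj k" "v \<in> MC k ?L X" for X :: "('k, 'l) aug" and v
    using bij[OF that(1)] that(2) by (auto simp: bij_betw_def)
  have "set_functor k (MC k ?L :: ('k, 'l) aug \<Rightarrow> _) (MC_map k ?L)"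
    unfolding set_functor_def
  proof (intro conjI ballI funcsetI)
    fix X Y :: "('k, 'l) aug" and \<phi> v
    assume "X \<in> aug_obj k" "Y \<in> aug_obj k" "\<phi> \<in> aug_hom k X Y" "v \<in> MC k ?L X"
    then show "MC_map k ?L X Y \<phi> v \<in> MC k ?L Y" by (rule mc)
  next
    fix X :: "('k, 'l) aug" and v assume "X \<in> aug_obj k" "v \<in> MC k ?L X"
    then show "MC_map k ?L X X (\<lambda>x\<in>carrier (fst X). x) v = v" by (rule mc_id)
  next
    fix X Y Z :: "('k, 'l) aug" and \<phi> \<psi> v
    assume "X \<in> aug_obj k" "Y \<in> aug_obj k" "Z \<in> aug_obj k" "\<phi> \<in> aug_hom k X Y" "\<psi> \<in> aug_hom k Y Z" "v \<in> MC k ?L X"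
    then show "MC_map k ?L X Z (compose (carrier (fst X)) \<psi> \<phi>) v = MC_map k ?L Y Z \<psi> (MC_map k ?L X Y \<phi> v)"
      by (rule mc_comp)
  qed
  moreover have "set_functor k (infDef_su k A e \<nu> :: ('k, 'l) aug \<Rightarrow> _) (base_change k A)"
    unfolding set_functor_def
  proof (intro conjI ballI funcsetI)
    fix X Y :: "('k, 'l) aug" and \<phi> N
    assume XY: "X \<in> aug_obj k" "Y \<in> aug_obj k" "\<phi> \<in> aug_hom k X Y" and N: "N \<in> infDef_su k A e \<nu> X"
    obtain v where v: "v \<in> MC k ?L X" "N = ?\<eta> X v" using preimage[OF XY(1) N] by blast
    show "base_change k A X Y \<phi> N \<in> infDef_su k A e \<nu> Y"
      unfolding v(2) nat[OF XY v(1), symmetric] by (rule into[OF XY(2) mc[OF XY v(1)]])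
  next
    fix X :: "('k, 'l) aug" and N assume X: "X \<in> aug_obj k" and N: "N \<in> infDef_su k A e \<nu> X"
    obtain v where v: "v \<in> MC k ?L X" "N = ?\<eta> X v" using preimage[OF X N] by blast
    show "base_change k A X X (\<lambda>x\<in>carrier (fst X). x) N = N"
      unfolding v(2) nat[OF X X aug_hom_id[OF alg[OF X]] v(1), symmetric] mc_id[OF X v(1)] ..
  next
    fix X Y Z :: "('k, 'l) aug" and \<phi> \<psi> N
    assume XYZ: "X \<in> aug_obj k" "Y \<in> aug_obj k" "Z \<in> aug_obj k" "\<phi> \<in> aug_hom k X Y" "\<psi> \<in> aug_hom k Y Z"
      and N: "N \<in> infDef_su k A e \<nu> X"
    obtain v where v: "v \<in> MC k ?L X" "N = ?\<eta> X v" using preimage[OF XYZ(1) N] by blast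
    show "base_change k A X Z (compose (carrier (fst X)) \<psi> \<phi>) N = base_change k A Y Z \<psi> (base_change k A X Y \<phi> N)"
      unfolding v(2) nat[OF XYZ(1,3) aug_hom_compose[OF alg[OF XYZ(1)] XYZ(4,5)] v(1), symmetric]
        nat[OF XYZ(1,2,4) v(1), symmetric] nat[OF XYZ(2,3,5) mc[OF XYZ(1,2,4) v(1)], symmetric]
        mc_comp[OF XYZ v(1)] ..
  qed
  ultimately have "functor_iso k (MC k ?L :: ('k, 'l) aug \<Rightarrow> _) (MC_map k ?L) (infDef_su k A e \<nu>) (base_change k A) ?\<eta>"
    unfolding functor_iso_def by (intro conjI ballI bij nat)
  then show ?thesis unfolding controls_def by blast
qed

end
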